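(* Let $q\in L^2(0,1)$, $a\in[0,\frac{\pi}{2})$ and $n\ge0$. Then $$h_n^0(a)\le h_n(a),\qquad|\mu_n^{0,\pm}(a)|\le|\mu_n^\pm(a)|,\qquad|\sigma_n^0(a)|\ge|\sigma_n(a)|,$$ and, for all $\frac{\pi}{3}\le a\le a_1<\frac{\pi}{2}$, $$h_n(a)\le h_n(a_1),\qquad|\mu_n^\pm(a)|\le|\mu_n^\pm(a_1)|,\qquad|\sigma_n^0(a)|\ge|\sigma_n(a_1)|.$$ Here, for $n=0$, only the assertions about $\mu_0^+$ are meant (the quantities $h_n,\sigma_n,\mu_n^-$ are defined for $n\ge1$).
   Context: For $a\in[0,\frac{\pi}{2})$ put $c=\cos a>0$, $s=\sin a$, and let $q\in L^2(0,1)$ be real-valued. Let $\vartheta(x,\lambda),\varphi(x,\lambda)$ be the solutions of $-y''+q(x)y=\lambda y$ on $[0,1]$ with $\vartheta(0,\lambda)=\varphi'(0,\lambda)=1$, $\vartheta'(0,\lambda)=\varphi(0,\lambda)=0$. Put $$\Delta(\lambda)=\tfrac12(\varphi'(1,\lambda)+\vartheta(1,\lambda)),\quad \Delta_-(\lambda)=\tfrac12(\varphi'(1,\lambda)-\vartheta(1,\lambda)),\quad F=\frac{9\Delta^2-\Delta_-^2-5}{4},\quad \xi(\lambda)=\xi(\lambda,a)=\frac{F(\lambda)+s^2}{c}.$$ These are entire functions of $\lambda$. It is known that all zeros of $\xi^2-1$ are real; counted with multiplicity they are labelled $\lambda_0^+<\lambda_1^-\le\lambda_1^+<\lambda_2^-\le\lambda_2^+<\dots$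 (with $\lambda_n^\pm=\lambda_n^\pm(a)$), and $\xi(\lambda_n^\pm)=(-1)^n$. The bands are $\sigma_n(a)=[\lambda_{n-1}^+,\lambda_n^-]$, of length $|\sigma_n(a)|$, and the gaps are $\gamma_n=(\lambda_n^-,\lambda_n^+)$, $n\ge1$. Let $\lambda_1<\lambda_2<\dots$ be the zeros of $F'$ (equivalently of $\xi'$), $\lambda_n\in[\lambda_n^-,\lambda_n^+]$; the numbers $h_n(a)\ge0$, $n\ge1$, are defined by $\xi(\lambda_n,a)=(-1)^n\cosh h_n(a)$. The quasimomentum $k$ is the analytic function on $\mathbb{C}_+$ with $\xi(\lambda)=\cos k(\lambda)$. For $\lambda_0^+$, and for each $\lambda_n^\pm$ with $n\ge 1$ and $\gamma_n\neq\emptyset$, the effective mass $\mu_n^\pm=\mu_n^\pm(a)$ is defined by $$\lambda=\lambda_n^\pm+\frac{(k(\lambda)-\pi n)^2}{2\mu_n^\pm}(1+o(1))\quad\text{as }\lambda\to\lambda_n^\pm,$$ where a branch of $k$ with $k(\lambda)\to\pi n$ as $\lambda\to\lambda_n^\pm$ is taken; if $|\gamma_n|=0$, then $\mu_n^\pm=0$. The superscript $0$ in $h_n^0(a),\mu_n^{0,\pm}(a),\sigma_n^0(a)$ denotes the same quantities for $q=0$ (and the same $a$). *)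

theory Defs
  imports "HOL-Complex_Analysis.Complex_Analysis" "HOL-Library.Landau_Symbols"
begin

definition L2_potential :: "(real \<Rightarrow> real) \<Rightarrow> bool" where
  "L2_potential q \<longleftrightarrow>
     q \<in> borel_measurable (lebesgue_on {0<..<1}) \<and>
     integrable (lebesgue_on {0<..<1}) (\<lambda>x. (q x)\<^sup>2)"

text \<open>
  Solutions of $-y'' + q y = \lambda y$ on $[0,1]$ in the usual sense for a potential that is only
  square integrable: $y$ is differentiable with derivative \<open>y'\<close>, and \<open>y'\<close> is absolutely continuous
  with $y'' = (q - \lambda) y$ almost everywhere, i.e. \<open>y'\<close> is an indefinite integral of
  $(q - \lambda) y$.
\<close>

definition schrodinger_solution ::
    "(real \<Rightarrow> real) \<Rightarrow> complex \<Rightarrow> (real \<Rightarrow> complex) \<Rightarrow> (real \<Rightarrow> complex) \<Rightarrow> bool" where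
  "schrodinger_solution q l y y' \<longleftrightarrow>
     (\<forall>x\<in>{0..1}. (y has_vector_derivative y' x) (at x within {0..1})) \<and>
     (\<forall>x\<in>{0..1}. ((\<lambda>t. (complex_of_real (q t) - l) * y t) has_integral (y' x - y' 0)) {0..x})"

text \<open>
  The solution with $y(0) = u$, $y'(0) = v$, as the pair $(y, y')$. It is unique on $[0,1]$ only,
  since the values of the two functions outside $[0,1]$ are unconstrained; hence \<open>SOME\<close>.
\<close>

definition cauchy_solution ::
    "(real \<Rightarrow> real) \<Rightarrow> complex \<Rightarrow> complex \<Rightarrow> complex \<Rightarrow> (real \<Rightarrow> complex) \<times> (real \<Rightarrow> complex)" where
  "cauchy_solution q l u v =
     (SOME (y, y'). schrodinger_solution q l y y' \<and> y 0 = u \<and> y' 0 = v)"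

definition theta :: "(real \<Rightarrow> real) \<Rightarrow> real \<Rightarrow> complex \<Rightarrow> complex" where
  "theta q x l = fst (cauchy_solution q l 1 0) x"

definition phi :: "(real \<Rightarrow> real) \<Rightarrow> real \<Rightarrow> complex \<Rightarrow> complex" where
  "phi q x l = fst (cauchy_solution q l 0 1) x"

definition phi' :: "(real \<Rightarrow> real) \<Rightarrow> real \<Rightarrow> complex \<Rightarrow> complex" where
  "phi' q x l = snd (cauchy_solution q l 0 1) x"

definition Delta :: "(real \<Rightarrow> real) \<Rightarrow> complex \<Rightarrow> complex" where
  "Delta q l = (phi' q 1 l + theta q 1 l) / 2"

definition Delta_minus :: "(real \<Rightarrow> real) \<Rightarrow> complex \<Rightarrow> complex" where
  "Delta_minus q l = (phi' q 1 l - theta q 1 l) / 2"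

definition F :: "(real \<Rightarrow> real) \<Rightarrow> complex \<Rightarrow> complex" where
  "F q l = (9 * (Delta q l)\<^sup>2 - (Delta_minus q l)\<^sup>2 - 5) / 4"

definition xi :: "(real \<Rightarrow> real) \<Rightarrow> real \<Rightarrow> complex \<Rightarrow> complex" where
  "xi q a l = (F q l + complex_of_real ((sin a)\<^sup>2)) / complex_of_real (cos a)"

text \<open>
  The zeros of $\xi^2 - 1$ as a single sequence
  $e_0 < e_1 \le e_2 < e_3 \le e_4 < \dots$ in which every complex zero occurs as often as its
  multiplicity, so that $e_{2n} = \lambda_n^+$ and $e_{2n-1} = \lambda_n^-$. The order of vanishing
  is $0$ at points that are not zeros.
\<close>

definition is_edge_sequence :: "(real \<Rightarrow> real) \<Rightarrow> real \<Rightarrow> (nat \<Rightarrow> real) \<Rightarrow> bool" where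
  "is_edge_sequence q a e \<longleftrightarrow>
     (\<forall>n. e (2 * n) < e (2 * n + 1) \<and> e (2 * n + 1) \<le> e (2 * n + 2)) \<and>
     (\<forall>z. zorder (\<lambda>l. (xi q a l)\<^sup>2 - 1) z = int (card {k. complex_of_real (e k) = z}))"

definition edge_sequence :: "(real \<Rightarrow> real) \<Rightarrow> real \<Rightarrow> nat \<Rightarrow> real" where
  "edge_sequence q a = (THE e. is_edge_sequence q a e)"

definition lam_plus :: "(real \<Rightarrow> real) \<Rightarrow> real \<Rightarrow> nat \<Rightarrow> real" where
  "lam_plus q a n = edge_sequence q a (2 * n)"

text \<open>Meaningful for $n \ge 1$ only; likewise \<open>band_length\<close>, \<open>crit\<close>, \<open>height\<close> and \<open>mass_minus\<close>.\<close>

definition lam_minus :: "(real \<Rightarrow> real) \<Rightarrow> real \<Rightarrow> nat \<Rightarrow> real" where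
  "lam_minus q a n = edge_sequence q a (2 * n - 1)"

definition band_length :: "(real \<Rightarrow> real) \<Rightarrow> real \<Rightarrow> nat \<Rightarrow> real" where
  "band_length q a n = lam_minus q a n - lam_plus q a (n - 1)"

definition gap :: "(real \<Rightarrow> real) \<Rightarrow> real \<Rightarrow> nat \<Rightarrow> real set" where
  "gap q a n = {lam_minus q a n <..< lam_plus q a n}"

text \<open>The zeros $\lambda_1 < \lambda_2 < \dots$ of $F'$; the sequence below is indexed from $0$.\<close>

definition crit :: "(real \<Rightarrow> real) \<Rightarrow> nat \<Rightarrow> real" where
  "crit q n =
     (THE c :: nat \<Rightarrow> real. strict_mono c \<and>
        range (\<lambda>k. complex_of_real (c k)) = {z. deriv (F q) z = 0}) (n - 1)"

definition height :: "(real \<Rightarrow> real) \<Rightarrow> real \<Rightarrow> nat \<Rightarrow> real" where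
  "height q a n =
     (THE h. h \<ge> 0 \<and> xi q a (complex_of_real (crit q n)) = (-1) ^ n * complex_of_real (cosh h))"

abbreviation upper_half_plane :: "complex set" where
  "upper_half_plane \<equiv> {z. Im z > 0}"

text \<open>The quasimomentum is determined up to sign and addition of multiples of $2 \pi$.\<close>

definition is_quasimomentum :: "(real \<Rightarrow> real) \<Rightarrow> real \<Rightarrow> (complex \<Rightarrow> complex) \<Rightarrow> bool" where
  "is_quasimomentum q a k \<longleftrightarrow>
     k holomorphic_on upper_half_plane \<and> (\<forall>z\<in>upper_half_plane. xi q a z = cos (k z))"

text \<open>
  The expansion $\lambda = e + \frac{(k(\lambda) - \pi n)^2}{2 \mu} (1 + o(1))$ as $\lambda \to e$ in
  the upper half-plane, for a branch with $k(\lambda) \to \pi n$. It does not hold for \<open>\<mu> = 0\<close>,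
  where the right-hand side of the equivalence is identically zero.
\<close>

definition is_effective_mass :: "(real \<Rightarrow> real) \<Rightarrow> real \<Rightarrow> nat \<Rightarrow> real \<Rightarrow> real \<Rightarrow> bool" where
  "is_effective_mass q a n e \<mu> \<longleftrightarrow>
     (\<exists>k. is_quasimomentum q a k \<and>
        (k \<longlongrightarrow> complex_of_real (pi * n)) (at (complex_of_real e) within upper_half_plane) \<and>
        (\<lambda>l. l - complex_of_real e)
          \<sim>[at (complex_of_real e) within upper_half_plane]
        (\<lambda>l. (k l - complex_of_real (pi * n))\<^sup>2 / complex_of_real (2 * \<mu>)))"

definition mass_plus :: "(real \<Rightarrow> real) \<Rightarrow> real \<Rightarrow> nat \<Rightarrow> real" where
  "mass_plus q a n =
     (if n \<ge> 1 \<and> gap q a n = {} then 0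
      else (THE \<mu>. is_effective_mass q a n (lam_plus q a n) \<mu>))"

definition mass_minus :: "(real \<Rightarrow> real) \<Rightarrow> real \<Rightarrow> nat \<Rightarrow> real" where
  "mass_minus q a n =
     (if gap q a n = {} then 0
      else (THE \<mu>. is_effective_mass q a n (lam_minus q a n) \<mu>))"

end

(*
  Writing \<lambda> = z^2, the function G = (8 F + 1)/9 is cos 2z up to O(e^(2 |Im z|)/|z|), and F does not take
  values in [-5/4, 1] off the real line, because F(\<lambda>) in that range makes \<lambda> an eigenvalue of a
  self-adjoint operator on a finite graph. Laguerre's theorem, applied to F - f for f in [-5/4, 1],
  shows that F oscillates monotonically between critical values outside (-5/4, 1), which gives the
  band structure, and that F'/(F - f) is nonincreasing on the real line.

  Comparison with q = 0. Let w be the branch of arccos G on the upper half-plane with w - 2z -> 0.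
  Laguerre's theorem for the Chebyshev polynomials of G shows Re w' >= 0 and hence Re w >= 0, so w^2/4
  maps the upper half-plane to itself; since w^2/4 is asymptotic to \<lambda>, Schwarz and Pick give
  Im (w^2/4) >= Im \<lambda>. On each band f = w^2/4 is real with f' >= 1 and F = F0 o f, where F0 belongs
  to q = 0 and f maps band edges to band edges of q = 0. This compares the band lengths and the
  slopes of F at the edges; the modulus of an effective mass is |\<xi>'| at the edge. The critical values
  of F0 are -5/4 and 1, which compares the heights.

  For a >= pi/3, that is cos a <= 1/2, the bands shrink as a grows, and the slopes of F at the moving
  edges are controlled by the monotonicity of F'/(F + 5/4) and F'/(F - 1).
*)

theory Submission
  imports Defs "HOL-Real_Asymp.Real_Asymp"
begin

section \<open>Laguerre's inequality for entire functions with real zeros\<close>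

text \<open>The numbers -5/4 and 1 arise twice. With c = cos a the values of \<open>F\<close> at
  band edges are c^2 + c - 1 and c^2 - c - 1, which lie in [-5/4, 1] for every a; and 4 F + 5 is the
  square of some z = 1 + 2 cos \<alpha> in [0, 3] exactly when \<open>F\<close> lies there. The
  threshold cos a = 1/2 is the vertex of c^2 - c - 1: below it this edge value rises as c falls.

  In the variable \<lambda> the functions have order at most 1/2, so a Hadamard product would have
  no exponential factor. Instead of the infinite product, the zeros in a large disc are divided out,
  and the remaining factor is shown to have logarithmic derivative close to 0.

  The obstacle to the comparison is that \<open>w\<close> is controlled near infinity and on the
  bands, while no boundary values are constructed inside the gaps. Re w is therefore followed across
  a gap slightly above the real line, where it cannot leave an interval of length \<pi>; this tells
  which free band corresponds to a given band.\<close>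

lemma Borel_Caratheodory_deriv:
  fixes L :: "complex \<Rightarrow> complex"
  assumes hol: "L holomorphic_on ball c R" and R: "R > 0" and L0: "L c = 0"
    and bd: "\<And>z. z \<in> ball c R \<Longrightarrow> Re (L z) < K"
  shows "norm (deriv L c) \<le> 4 * K / R" "norm (deriv (deriv L) c) \<le> 16 * K / R\<^sup>2"
proof -
  have K: "K > 0" using bd[of c] R L0 by simp
  \<comment> \<open>Re L < K says that L is closer to 0 than to 2K, so this Moebius image of L maps
    the unit disc into itself and fixes 0: the Schwarz lemma applies.\<close>
  define f where "f = (\<lambda>u. L (c + of_real R * u) / (2 * of_real K - L (c + of_real R * u)))"
  have inb: "c + of_real R * u \<in> ball c R" if "norm u < 1" for u
    using that R by (auto simp: dist_norm norm_mult)
  have nz: "2 * of_real K - L z \<noteq> 0" if "z \<in> ball c R" for z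
  proof
    assume "2 * of_real K - L z = 0"
    hence "L z = of_real (2 * K)" by simp
    with bd[OF that] K show False by simp
  qed
  have fhol: "f holomorphic_on ball 0 1"
  proof -
    have "(\<lambda>u. L (c + of_real R * u)) holomorphic_on ball 0 1"
    proof -
      have "L \<circ> (\<lambda>u. c + of_real R * u) holomorphic_on ball 0 1"
        by (rule holomorphic_on_compose_gen[OF _ hol]) (use inb in \<open>auto intro!: holomorphic_intros\<close>)
      thus ?thesis by (simp add: o_def)
    qed
    thus ?thesis unfolding f_def
      by (intro holomorphic_intros) (use nz inb in auto)
  qed
  have lt1: "norm (L z / (2 * of_real K - L z)) < 1" if z: "z \<in> ball c R" for z
  proof -
    have "(norm (L z))\<^sup>2 < (norm (2 * of_real K - L z))\<^sup>2"
      using bd[OF z] K unfolding cmod_power2 by (simp add: power2_eq_square algebra_simps)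
    hence "norm (L z) < norm (2 * of_real K - L z)"
      by (rule power_less_imp_less_base) simp
    thus ?thesis using nz[OF z] by (simp add: norm_divide)
  qed
  have f0: "f 0 = 0" by (simp add: f_def L0)
  have fb: "norm (f u) < 1" if "norm u < 1" for u
    using lt1[OF inb[OF that]] by (simp add: f_def)
  have fle: "norm (f u) \<le> norm u" if "norm u < 1" for u
    by (rule Schwarz_Lemma(1)[OF fhol f0 fb that])
  have Lb: "norm (L z) \<le> 2 * K" if z: "norm (c - z) \<le> R / 2" for z
  proof -
    have zin: "z \<in> ball c R" using z R by (auto simp: dist_norm)
    define u where "u = (z - c) / of_real R"
    have zu: "z = c + of_real R * u" using R by (simp add: u_def)
    have nu: "norm u \<le> 1/2" using z R by (simp add: u_def norm_divide norm_minus_commute divide_simps)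
    have "norm (f u) \<le> 1/2" using fle[of u] nu by simp
    hence "norm (L z) \<le> (1/2) * norm (2 * of_real K - L z)"
      using nz[OF zin] by (simp add: f_def zu[symmetric] norm_divide divide_simps)
    also have "norm (2 * of_real K - L z) \<le> 2 * K + norm (L z)"
      using norm_triangle_ineq4[of "2 * of_real K" "L z"] K by (simp add: norm_mult)
    finally show ?thesis by simp
  qed
  have h2: "L holomorphic_on ball c (R/2)" using hol by (rule holomorphic_on_subset) (use R in auto)
  have c2: "continuous_on (cball c (R/2)) L"
    by (rule continuous_on_subset[OF holomorphic_on_imp_continuous_on[OF hol]]) (use R in auto)
  \<comment> \<open>Cauchy's estimate on the disc of radius R/2, where |L| is at most 2K; n = 1 and
    n = 2 give the constants 4 and 16.\<close>
  have *: "norm ((deriv ^^ n) L c) \<le> (fact n) * (2 * K) / (R/2)^n" for n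
    by (rule Cauchy_inequality[OF h2 c2]) (use R Lb in auto)
  show "norm (deriv L c) \<le> 4 * K / R" using *[of 1] R by (simp add: field_simps)
  show "norm (deriv (deriv L) c) \<le> 16 * K / R\<^sup>2" using *[of 2] R 
    by (simp add: field_simps numeral_2_eq_2)
qed

section \<open>Zeros of an entire function in a disc\<close>

text \<open>A list keeps multiple zeros as repeated entries, which suits dividing out one zero at a
  time.\<close>

definition root_poly :: "complex list \<Rightarrow> complex \<Rightarrow> complex" where
  "root_poly es z = (\<Prod>e\<leftarrow>es. z - e)"

lemma root_poly_simps [simp]:
  "root_poly [] z = 1" "root_poly (e # es) z = (z - e) * root_poly es z"
  by (simp_all add: root_poly_def)

lemma root_poly_eq_0_iff: "root_poly es z = 0 \<longleftrightarrow> z \<in> set es"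
  by (induction es) auto

lemma holomorphic_root_poly [holomorphic_intros]: "root_poly es holomorphic_on A"
proof (induction es)
  case Nil
  have "root_poly [] = (\<lambda>_. 1)" by auto
  then show ?case by simp
next
  case (Cons e es)
  have "root_poly (e # es) = (\<lambda>z. (z - e) * root_poly es z)" by auto
  then show ?case using Cons by (auto intro!: holomorphic_intros)
qed

lemma divide_entire_root:
  fixes h :: "complex \<Rightarrow> complex"
  assumes h: "h holomorphic_on UNIV" and z: "h e = 0"
  obtains k where "k holomorphic_on UNIV" "\<And>w. h w = (w - e) * k w"
proof
  let ?k = "\<lambda>w. if w = e then deriv h e else h w / (w - e)"
  show "?k holomorphic_on UNIV"
    using pole_theorem_open_0[OF h, of e] by (simp add: z)
  show "h w = (w - e) * ?k w" for w using z by simp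
qed
lemma norm_root_poly_le:
  assumes "\<And>e. e \<in> set es \<Longrightarrow> norm (z - e) \<le> r"
  shows "norm (root_poly es z) \<le> r ^ length es"
  using assms
proof (induction es)
  case (Cons e es)
  have "norm (z - e) * norm (root_poly es z) \<le> r * r ^ length es"
  proof (rule mult_mono)
    show "norm (z - e) \<le> r" using Cons.prems by simp
    thus "0 \<le> r" using norm_ge_zero order_trans by blast
  qed (use Cons in auto)
  thus ?case by (simp add: norm_mult)
qed simp

lemma norm_root_poly_ge:
  assumes "\<And>e. e \<in> set es \<Longrightarrow> r \<le> norm (z - e)" "r \<ge> 0"
  shows "r ^ length es \<le> norm (root_poly es z)"
  using assms
proof (induction es)
  case (Cons e es)
  have "r * r ^ length es \<le> norm (z - e) * norm (root_poly es z)"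
    using Cons by (intro mult_mono) auto
  thus ?case by (simp add: norm_mult)
qed simp

text \<open>On the circle of radius 3R about c each factor z - e has modulus at least 2R, while at c
  it has modulus at most R. The maximum principle for the quotient \<open>h\<close> therefore gains
  a factor 2 per zero, as in Jensen's formula; the second bound limits the number of zeros in the
  disc.\<close>

lemma divided_entire_bounds:
  fixes g h :: "complex \<Rightarrow> complex"
  assumes h: "h holomorphic_on UNIV" and gh: "\<And>w. g w = root_poly es w * h w"
    and es: "set es \<subseteq> ball c R" and R: "R > 0"
    and M: "\<And>w. norm (w - c) \<le> 3 * R \<Longrightarrow> norm (g w) \<le> M" and gc: "g c \<noteq> 0"
    and w: "norm (w - c) \<le> 3 * R"
  shows "2 ^ length es * norm (h w) \<le> M / norm (g c) * norm (h c)"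
    and "2 ^ length es \<le> M / norm (g c)"
proof -
  let ?n = "length es"
  have hb: "norm (h w) \<le> M / (2 * R) ^ ?n" if w: "norm (w - c) \<le> 3 * R" for w
  proof (rule maximum_modulus_frontier[of h "cball c (3*R)"])
    show "h holomorphic_on interior (cball c (3 * R))" using h holomorphic_on_subset by blast
    show "continuous_on (closure (cball c (3 * R))) h"
      using h holomorphic_on_imp_continuous_on continuous_on_subset by blast
    show "bounded (cball c (3 * R))" by simp
    show "w \<in> cball c (3*R)" using w by (simp add: dist_norm norm_minus_commute)
    show "norm (h z) \<le> M / (2 * R) ^ ?n" if "z \<in> frontier (cball c (3 * R))" for z
    proof -
      have z: "norm (z - c) = 3 * R" using that R by (simp add: dist_norm norm_minus_commute)
      have "(2 * R) ^ ?n \<le> norm (root_poly es z)"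
      proof (rule norm_root_poly_ge)
        show "2 * R \<le> norm (z - e)" if "e \<in> set es" for e
        proof -
          have "norm (e - c) \<le> R" using that es by (force simp: dist_norm norm_minus_commute)
          thus ?thesis using z norm_triangle_ineq[of "z - e" "e - c"] by simp
        qed
      qed (use R in simp)
      hence "(2 * R) ^ ?n * norm (h z) \<le> norm (g z)"
        unfolding gh norm_mult by (intro mult_right_mono) auto
      also have "\<dots> \<le> M" using M z by simp
      finally show ?thesis using R by (simp add: field_simps)
    qed
  qed
  have gle: "norm (g c) \<le> R ^ ?n * norm (h c)"
    unfolding gh norm_mult
    by (intro mult_right_mono norm_root_poly_le) (use es in \<open>auto simp: dist_norm dest!: subsetD\<close>)
  have M0: "0 \<le> M" using M[OF w] norm_ge_zero order_trans by blast
  have "2 ^ ?n * norm (h w) * norm (g c) \<le> 2 ^ ?n * (M / (2 * R) ^ ?n) * (R ^ ?n * norm (h c))"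
    by (intro mult_mono hb w gle) (use M0 R in auto)
  also have "\<dots> = M * norm (h c)" using R by (simp add: power_mult_distrib)
  finally show "2 ^ ?n * norm (h w) \<le> M / norm (g c) * norm (h c)"
    using gc by (simp add: field_simps)
  have "2 ^ ?n * norm (g c) \<le> 2 ^ ?n * (R ^ ?n * (M / (2 * R) ^ ?n))"
    by (intro mult_left_mono order_trans[OF gle] hb) (use R in auto)
  also have "\<dots> = M" using R by (simp add: power_mult_distrib)
  finally show "2 ^ ?n \<le> M / norm (g c)" using gc by (simp add: field_simps)
qed

text \<open>The list has maximal length among all lists of zeros in the disc that divide
  \<open>g\<close>; the previous estimate bounds these lengths, and a zero of the quotient would
  lengthen the list.\<close>

lemma divide_out_roots:
  fixes g :: "complex \<Rightarrow> complex"
  assumes g: "g holomorphic_on UNIV" and R: "R > 0"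
    and M: "\<And>w. norm (w - c) \<le> 3 * R \<Longrightarrow> norm (g w) \<le> M" and gc: "g c \<noteq> 0"
  obtains es h where "h holomorphic_on UNIV" "\<And>w. g w = root_poly es w * h w"
    "set es \<subseteq> ball c R" "\<And>w. w \<in> ball c R \<Longrightarrow> h w \<noteq> 0"
    "\<And>w. w \<in> ball c R \<Longrightarrow> norm (h w) \<le> M / norm (g c) * norm (h c)"
proof -
  define P where "P = (\<lambda>n es h. h holomorphic_on UNIV \<and> (\<forall>w. g w = root_poly es w * h w) \<and>
      set es \<subseteq> ball c R \<and> length es = n)"
  obtain N :: nat where N: "M / norm (g c) < 2 ^ N"
    using real_arch_pow[of 2 "M / norm (g c)"] by auto
  have bound: "n \<le> N" if "P n es h" for n es h
  proof -
    have "2 ^ length es \<le> M / norm (g c)"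
      using that R divided_entire_bounds(2)[of h g es c R M c] M gc by (auto simp: P_def)
    hence "(2::real) ^ length es < 2 ^ N" using N by linarith
    thus ?thesis using that by (auto simp: P_def)
  qed
  have "P 0 [] g" using g by (simp add: P_def)
  hence "\<exists>n. (\<exists>es h. P n es h)" by blast
  then obtain n where n: "\<exists>es h. P n es h" and mx: "\<And>m. \<exists>es h. P m es h \<Longrightarrow> m \<le> n"
    using GreatestI_nat[of "\<lambda>n. \<exists>es h. P n es h" 0 N] Greatest_le_nat[of "\<lambda>n. \<exists>es h. P n es h" _ N]
      bound \<open>P 0 [] g\<close> by metis
  obtain es h where es: "P n es h" using n by blast
  have nz: "h w \<noteq> 0" if w: "w \<in> ball c R" for w
  proof
    assume hw: "h w = 0"
    have "h holomorphic_on UNIV" using es by (simp add: P_def)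
    then obtain k where "k holomorphic_on UNIV" "\<And>v. h v = (v - w) * k v"
      using divide_entire_root[of h w] hw by blast
    hence "P (Suc n) (w # es) k" using es w by (simp add: P_def mult_ac)
    hence "Suc n \<le> n" using mx by blast
    thus False by simp
  qed
  show ?thesis
  proof (rule that)
    fix w assume w: "w \<in> ball c R"
    have "1 * norm (h w) \<le> 2 ^ length es * norm (h w)" by (intro mult_right_mono) auto
    also have "\<dots> \<le> M / norm (g c) * norm (h c)"
      by (rule divided_entire_bounds(1)) (use es R M gc w in \<open>auto simp: P_def dist_norm norm_minus_commute\<close>)
    finally show "norm (h w) \<le> M / norm (g c) * norm (h c)" by simp
  qed (use es nz in \<open>auto simp: P_def\<close>)
qed

lemma deriv_root_poly:
  assumes "z \<notin> set es"
  shows "(root_poly es has_field_derivative root_poly es z * (\<Sum>e\<leftarrow>es. 1 / (z - e))) (at z)"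
  using assms
proof (induction es)
  case Nil
  have "root_poly [] = (\<lambda>_. 1)" by auto
  then show ?case by simp
next
  case (Cons e es)
  have "root_poly (e # es) = (\<lambda>z. (z - e) * root_poly es z)" by auto
  moreover have "((\<lambda>z. (z - e) * root_poly es z) has_field_derivative
      (1 * root_poly es z + root_poly es z * (\<Sum>e\<leftarrow>es. 1 / (z - e)) * (z - e))) (at z)"
    by (rule DERIV_mult) (use Cons in \<open>auto intro!: derivative_eq_intros\<close>)
  moreover have "1 * root_poly es z + root_poly es z * (\<Sum>e\<leftarrow>es. 1 / (z - e)) * (z - e) =
     root_poly (e # es) z * (\<Sum>e\<leftarrow>e # es. 1 / (z - e))"
    using Cons.prems by (simp add: field_simps)
  ultimately show ?case by simp
qed

lemma deriv_sum_list_inverse: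
  assumes "z \<notin> set es"
  shows "((\<lambda>z. \<Sum>e\<leftarrow>es. 1 / (z - e)) has_field_derivative - (\<Sum>e\<leftarrow>es. 1 / (z - e)\<^sup>2)) (at (z :: complex))"
  using assms
proof (induction es)
  case (Cons e es)
  have "((\<lambda>z. 1 / (z - e)) has_field_derivative - (1 / (z - e)\<^sup>2)) (at z)"
    using Cons.prems by (auto intro!: derivative_eq_intros simp: power2_eq_square field_simps)
  from DERIV_add[OF this Cons.IH] Cons.prems show ?case by (simp add: o_def)
qed simp

section \<open>Logarithmic derivatives as sums over zeros\<close>

definition logderiv :: "(complex \<Rightarrow> complex) \<Rightarrow> complex \<Rightarrow> complex" where
  "logderiv g z = deriv g z / g z"

lemma logderiv_split_roots:
  fixes g h :: "complex \<Rightarrow> complex"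
  assumes h: "h holomorphic_on UNIV" and gh: "\<And>w. g w = root_poly es w * h w" and gz: "g z \<noteq> 0"
  shows "logderiv g z = (\<Sum>e\<leftarrow>es. 1 / (z - e)) + logderiv h z"
proof -
  have z: "z \<notin> set es" "h z \<noteq> 0" using gz gh[of z] by (auto simp: root_poly_eq_0_iff)
  have dh: "(h has_field_derivative deriv h z) (at z)"
    using h holomorphic_derivI by blast
  have "((\<lambda>w. root_poly es w * h w) has_field_derivative
     root_poly es z * (\<Sum>e\<leftarrow>es. 1 / (z - e)) * h z + deriv h z * root_poly es z) (at z)"
    by (rule DERIV_mult[OF deriv_root_poly[OF z(1)] dh])
  moreover have "(\<lambda>w. root_poly es w * h w) = g" using gh by auto
  ultimately have "deriv g z = root_poly es z * (\<Sum>e\<leftarrow>es. 1 / (z - e)) * h z + deriv h z * root_poly es z"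
    using DERIV_imp_deriv by metis
  thus ?thesis using z gz by (simp add: logderiv_def gh field_simps root_poly_eq_0_iff)
qed

text \<open>Once the zeros in a disc of radius R are divided out, the quotient has a logarithm there
  whose real part, normalised at c, is O(sqrt R); Borel and Caratheodory then bound its first
  derivative by O(1/sqrt R) and its second by less. The point \<open>e1\<close> is at the caller's
  disposal: if it is a zero, its term yields strict inequalities.\<close>

theorem logderiv_zero_sum:
  fixes g :: "complex \<Rightarrow> complex"
  assumes g: "g holomorphic_on UNIV"
    and growth: "\<And>z. norm (g z) \<le> C * exp (C * sqrt (norm z))"
    and gc: "g c \<noteq> 0" and eps: "\<epsilon> > 0"
  obtains es where "\<And>e. e \<in> set es \<Longrightarrow> g e = 0" "g e1 = 0 \<Longrightarrow> e1 \<in> set es"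
    "norm (logderiv g c - (\<Sum>e\<leftarrow>es. 1 / (c - e))) \<le> \<epsilon>"
    "norm (deriv (logderiv g) c + (\<Sum>e\<leftarrow>es. 1 / (c - e)\<^sup>2)) \<le> \<epsilon>"
proof -
  have "0 < norm (g c)" using gc by simp
  also have "\<dots> \<le> C * exp (C * sqrt (norm c))" by (rule growth)
  finally have C: "C > 0" by (simp add: zero_less_mult_iff)
  define M where "M = (\<lambda>R. C * exp (C * sqrt (norm c + 3 * R)))"
  \<comment> \<open>The summand 1 turns the bound ln (M R / |g c|) for the real part into a strict
    one.\<close>
  define K where "K = (\<lambda>R. 1 + ln (M R / norm (g c)))"
  have K_eq: "K R = 1 + ln (C / norm (g c)) + C * sqrt (norm c + 3 * R)" for R
    using C gc by (simp add: K_def M_def ln_mult ln_div)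
  have "((\<lambda>R. (1 + ln (C / norm (g c))) / R + C * sqrt (norm c / R / R + 3 / R)) \<longlongrightarrow> 0) at_top"
    by real_asymp
  moreover have "eventually (\<lambda>R. (1 + ln (C / norm (g c))) / R + C * sqrt (norm c / R / R + 3 / R) = K R / R) at_top"
    using eventually_gt_at_top[of 0]
  proof eventually_elim
    case (elim R)
    have "sqrt (norm c / R / R + 3 / R) = sqrt ((norm c + 3 * R) / R\<^sup>2)"
      using elim by (intro arg_cong[where f = sqrt]) (simp add: field_simps power2_eq_square)
    also have "\<dots> = sqrt (norm c + 3 * R) / R" using elim by (simp add: real_sqrt_divide)
    finally show ?case by (simp add: K_eq add_divide_distrib)
  qed
  ultimately have lim: "((\<lambda>R. K R / R) \<longlongrightarrow> 0) at_top" by (rule Lim_transform_eventually)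
  have "eventually (\<lambda>R. K R / R < \<epsilon> / 16) at_top"
    using order_tendstoD(2)[OF lim, of "\<epsilon> / 16"] eps by simp
  moreover have "eventually (\<lambda>R. R > 1 \<and> R > norm (c - e1)) at_top"
    by (intro eventually_conj eventually_gt_at_top)
  ultimately have "eventually (\<lambda>R. K R / R < \<epsilon> / 16 \<and> R > 1 \<and> R > norm (c - e1)) at_top"
    by (rule eventually_conj)
  then obtain R where KR: "K R / R < \<epsilon> / 16" and R: "R > 1" "R > norm (c - e1)"
    using eventually_happens trivial_limit_at_top_linorder by blast
  have Mb: "norm (g w) \<le> M R" if "norm (w - c) \<le> 3 * R" for w
  proof -
    have "norm w \<le> norm c + 3 * R" using that norm_triangle_ineq[of c "w - c"] by simp
    thus ?thesis unfolding M_def using C by (intro order_trans[OF growth] mult_left_mono) auto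
  qed
  obtain es h where h: "h holomorphic_on UNIV" and gh: "\<And>w. g w = root_poly es w * h w"
    and es: "set es \<subseteq> ball c R" and hnz: "\<And>w. w \<in> ball c R \<Longrightarrow> h w \<noteq> 0"
    and hb: "\<And>w. w \<in> ball c R \<Longrightarrow> norm (h w) \<le> M R / norm (g c) * norm (h c)"
  proof (rule divide_out_roots[OF g _ Mb gc, of R])
    show "R > 0" using R by simp
  qed (use that in blast)+
  have hc: "h c \<noteq> 0" using gc gh by auto
  obtain l where l: "l holomorphic_on ball c R" and el: "\<And>w. w \<in> ball c R \<Longrightarrow> exp (l w) = h w"
    using holomorphic_logarithm_exists[of "ball c R" h c] h hnz R holomorphic_on_subset
    by (metis UNIV_I centre_in_ball convex_ball dual_order.strict_trans open_ball subsetI zero_less_one)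
  define L where "L = (\<lambda>w. l w - l c)"
  have Lhol: "L holomorphic_on ball c R" unfolding L_def by (intro holomorphic_intros l)
  have LRe: "Re (L w) < K R" if w: "w \<in> ball c R" for w
  proof -
    have "exp (Re (L w)) = norm (h w) / norm (h c)"
      using R by (simp add: L_def el[OF w, symmetric] el[of c, symmetric] exp_diff norm_divide)
    also have "\<dots> \<le> M R / norm (g c)" using hb[OF w] hc by (simp add: field_simps)
    finally have "exp (Re (L w)) \<le> M R / norm (g c)" .
    hence "Re (L w) \<le> ln (M R / norm (g c))"
      by (metis exp_gt_zero exp_le_cancel_iff exp_ln order_less_le_trans)
    thus ?thesis by (simp add: K_def)
  qed
  have dL: "deriv L w = logderiv h w" if w: "w \<in> ball c R" for w
  proof -
    have dl: "(l has_field_derivative deriv l w) (at w)"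
      using l w holomorphic_derivI open_ball by blast
    have "((\<lambda>w. exp (l w)) has_field_derivative exp (l w) * deriv l w) (at w)"
      using dl by (auto intro!: derivative_eq_intros)
    hence "(h has_field_derivative exp (l w) * deriv l w) (at w)"
      by (rule has_field_derivative_transform_within_open[OF _ open_ball w]) (use el in auto)
    hence "deriv h w = h w * deriv l w" using el[OF w] DERIV_imp_deriv by metis
    moreover have "deriv L w = deriv l w"
      using dl by (intro DERIV_imp_deriv) (auto simp: L_def intro!: derivative_eq_intros)
    ultimately show ?thesis using hnz[OF w] by (simp add: logderiv_def)
  qed
  have cR: "c \<in> ball c R" using R by simp
  have K0: "0 \<le> K R" using LRe[OF cR] by (simp add: L_def)
  note BC = Borel_Caratheodory_deriv[OF Lhol _ _ LRe]
  have "norm (deriv L c) \<le> 4 * K R / R" using BC(1) R by (simp add: L_def)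
  also have "\<dots> = 4 * (K R / R)" by simp
  also have "\<dots> \<le> 16 * (K R / R)" using K0 R by (intro mult_right_mono) auto
  also have "\<dots> \<le> \<epsilon>" using KR by linarith
  finally have 1: "norm (logderiv h c) \<le> \<epsilon>" by (simp add: dL[OF cR])
  have dd: "deriv (deriv L) c = deriv (logderiv h) c"
  proof (rule deriv_cong_ev)
    show "eventually (\<lambda>w. deriv L w = logderiv h w) (nhds c)"
      using eventually_nhds_in_open[OF open_ball cR] by eventually_elim (rule dL)
  qed simp
  have "norm (deriv (deriv L) c) \<le> 16 * K R / R\<^sup>2" using BC(2) R by (simp add: L_def)
  also have "\<dots> = 16 * (K R / R) * (1 / R)" by (simp add: power2_eq_square)
  also have "\<dots> \<le> \<epsilon> * 1"
  proof (rule mult_mono)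
    show "16 * (K R / R) \<le> \<epsilon>" using KR by linarith
  qed (use R eps in auto)
  finally have 2: "norm (deriv (logderiv h) c) \<le> \<epsilon>" by (simp add: dd)
  have ces: "c \<notin> set es" using gc gh[of c] by (auto simp: root_poly_eq_0_iff)
  have ev: "eventually (\<lambda>w. logderiv g w = (\<Sum>e\<leftarrow>es. 1 / (w - e)) + logderiv h w) (nhds c)"
  proof -
    have "open (g -` (- {0}))" 
      using g holomorphic_on_imp_continuous_on by (intro open_vimage) auto
    hence "eventually (\<lambda>w. w \<in> g -` (- {0})) (nhds c)"
      using gc by (intro eventually_nhds_in_open) auto
    thus ?thesis by eventually_elim (intro logderiv_split_roots[OF h gh], auto)
  qed
  have "(logderiv h has_field_derivative deriv (logderiv h) c) (at c)"
  proof -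
    have "logderiv h holomorphic_on ball c R"
      unfolding logderiv_def using hnz h by (intro holomorphic_intros) (auto intro: holomorphic_on_subset)
    thus ?thesis using cR holomorphic_derivI open_ball by blast
  qed
  from DERIV_add[OF deriv_sum_list_inverse[OF ces] this]
  have "deriv (\<lambda>w. (\<Sum>e\<leftarrow>es. 1 / (w - e)) + logderiv h w) c = - (\<Sum>e\<leftarrow>es. 1 / (c - e)\<^sup>2) + deriv (logderiv h) c"
    by (rule DERIV_imp_deriv)
  hence dg: "deriv (logderiv g) c = - (\<Sum>e\<leftarrow>es. 1 / (c - e)\<^sup>2) + deriv (logderiv h) c"
    using deriv_cong_ev[OF ev refl] by simp
  show ?thesis
  proof (rule that[of es])
    show "g e = 0" if "e \<in> set es" for e using that gh root_poly_eq_0_iff by simp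
    show "e1 \<in> set es" if "g e1 = 0"
    proof -
      have "e1 \<in> ball c R" using R by (simp add: dist_norm)
      thus ?thesis using that gh[of e1] hnz root_poly_eq_0_iff by auto
    qed
    show "norm (logderiv g c - (\<Sum>e\<leftarrow>es. 1 / (c - e))) \<le> \<epsilon>"
      using 1 logderiv_split_roots[OF h gh gc] by simp
    show "norm (deriv (logderiv g) c + (\<Sum>e\<leftarrow>es. 1 / (c - e)\<^sup>2)) \<le> \<epsilon>"
      using 2 dg by simp
  qed
qed

context
  fixes g :: "complex \<Rightarrow> complex" and C :: real
  assumes g: "g holomorphic_on UNIV"
    and growth: "\<And>z. norm (g z) \<le> C * exp (C * sqrt (norm z))"
    and real_zeros: "\<And>z. g z = 0 \<Longrightarrow> Im z = 0"
begin

text \<open>Each term 1/(c - e) with e real has negative imaginary part. For strictness the term of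
  one zero is kept as a bound that does not depend on \<epsilon>.\<close>

lemma Im_logderiv_le:
  assumes c: "Im c > 0"
  shows "Im (logderiv g c) \<le> 0" "g e1 = 0 \<Longrightarrow> Im (logderiv g c) < 0"
proof -
  have gc: "g c \<noteq> 0" using c real_zeros by force
  have tm: "Im (1 / (c - e)) < 0" if "g e = 0" for e
  proof -
    have e: "Im e = 0" using that real_zeros by simp
    have "(cmod (c - e))\<^sup>2 > 0" using c e by auto
    moreover have "Im (1 / (c - e)) = - Im c / (cmod (c - e))\<^sup>2"
      using e by (simp add: Im_divide cmod_power2)
    ultimately show ?thesis using c by (simp add: divide_neg_pos)
  qed
  have sum: "Im (\<Sum>e\<leftarrow>es. 1 / (c - e)) \<le> 0" if "\<And>e. e \<in> set es \<Longrightarrow> g e = 0" for es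
    using that
  proof (induction es)
    case (Cons e es)
    have "Im (1 / (c - e)) \<le> 0" using tm[of e] Cons.prems by simp
    thus ?case using Cons by (simp del: one_divide_eq_0_iff)
  qed simp
  have sum1: "Im (\<Sum>e\<leftarrow>es. 1 / (c - e)) \<le> Im (1 / (c - e1))" 
    if "\<And>e. e \<in> set es \<Longrightarrow> g e = 0" "e1 \<in> set es" for es
    using that
  proof (induction es)
    case (Cons e es)
    show ?case
    proof (cases "e = e1")
      case True
      thus ?thesis using sum[of es] Cons.prems by simp
    next
      case False
      hence "Im (\<Sum>e\<leftarrow>es. 1 / (c - e)) \<le> Im (1 / (c - e1))" using Cons by simp
      moreover have "Im (1 / (c - e)) \<le> 0" using tm[of e] Cons.prems by simp
      ultimately show ?thesis by simp
    qed
  qed simp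
  have key: "\<exists>es. (\<forall>e\<in>set es. g e = 0) \<and> (g e1 = 0 \<longrightarrow> e1 \<in> set es) \<and>
      Im (logderiv g c) \<le> \<epsilon> + Im (\<Sum>e\<leftarrow>es. 1 / (c - e))" if eps: "\<epsilon> > 0" for \<epsilon> e1
  proof -
    obtain es where es: "\<And>e. e \<in> set es \<Longrightarrow> g e = 0" "g e1 = 0 \<Longrightarrow> e1 \<in> set es"
      "norm (logderiv g c - (\<Sum>e\<leftarrow>es. 1 / (c - e))) \<le> \<epsilon>"
      using logderiv_zero_sum[OF g growth gc eps] by blast
    have "Im (logderiv g c - (\<Sum>e\<leftarrow>es. 1 / (c - e))) \<le> \<epsilon>"
      using es(3) abs_Im_le_cmod[of "logderiv g c - (\<Sum>e\<leftarrow>es. 1 / (c - e))"] by linarith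
    thus ?thesis using es by (intro exI[of _ es]) (auto simp: algebra_simps)
  qed
  show "Im (logderiv g c) \<le> 0"
  proof (rule field_le_epsilon)
    fix \<epsilon> :: real assume "\<epsilon> > 0"
    from key[OF this] obtain es where "\<forall>e\<in>set es. g e = 0"
      "Im (logderiv g c) \<le> \<epsilon> + Im (\<Sum>e\<leftarrow>es. 1 / (c - e))" by blast
    thus "Im (logderiv g c) \<le> 0 + \<epsilon>" using sum[of es] by auto
  qed
  show "Im (logderiv g c) < 0" if e1: "g e1 = 0"
  proof -
    have "Im (logderiv g c) \<le> Im (1 / (c - e1))"
    proof (rule field_le_epsilon)
      fix \<epsilon> :: real assume "\<epsilon> > 0"
      from key[OF this, of e1] e1 obtain es where "\<forall>e\<in>set es. g e = 0" "e1 \<in> set es"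
        "Im (logderiv g c) \<le> \<epsilon> + Im (\<Sum>e\<leftarrow>es. 1 / (c - e))" by blast
      thus "Im (logderiv g c) \<le> Im (1 / (c - e1)) + \<epsilon>" using sum1[of es] by auto
    qed
    thus ?thesis using tm[OF e1] by linarith
  qed
qed

text \<open>The derivative of the sum over zeros consists of the terms -1/(x - e)^2 with e real;
  this is Laguerre's inequality g'' g <= g'^2 in logarithmic form.\<close>

lemma deriv_logderiv_real_neg:
  assumes x: "g (of_real x) \<noteq> 0"
  shows "Re (deriv (logderiv g) (of_real x)) \<le> 0" "g e1 = 0 \<Longrightarrow> Re (deriv (logderiv g) (of_real x)) < 0"
proof -
  let ?c = "complex_of_real x"
  have tm: "Re (1 / (?c - e)\<^sup>2) = 1 / (x - Re e)\<^sup>2" "x \<noteq> Re e" if "g e = 0" for e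
  proof -
    have e: "e = of_real (Re e)" using that real_zeros by (simp add: complex_eq_iff)
    have "1 / (?c - e)\<^sup>2 = of_real (1 / (x - Re e)\<^sup>2)" by (subst e) simp
    thus "Re (1 / (?c - e)\<^sup>2) = 1 / (x - Re e)\<^sup>2" by (metis Re_complex_of_real)
    show "x \<noteq> Re e" using x e that by auto
  qed
  have sum: "0 \<le> Re (\<Sum>e\<leftarrow>es. 1 / (?c - e)\<^sup>2)" if "\<And>e. e \<in> set es \<Longrightarrow> g e = 0" for es
    using that
  proof (induction es)
    case (Cons e es)
    have "Re (1 / (?c - e)\<^sup>2) \<ge> 0" using tm[of e] Cons.prems by simp
    thus ?case using Cons by simp
  qed simp
  have key: "\<exists>es. (\<forall>e\<in>set es. g e = 0) \<and> (g e1 = 0 \<longrightarrow> e1 \<in> set es) \<and>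
      Re (deriv (logderiv g) ?c) \<le> \<epsilon> - Re (\<Sum>e\<leftarrow>es. 1 / (?c - e)\<^sup>2)" if eps: "\<epsilon> > 0" for \<epsilon> e1
  proof -
    obtain es where es: "\<And>e. e \<in> set es \<Longrightarrow> g e = 0" "g e1 = 0 \<Longrightarrow> e1 \<in> set es"
      "norm (deriv (logderiv g) ?c + (\<Sum>e\<leftarrow>es. 1 / (?c - e)\<^sup>2)) \<le> \<epsilon>"
      using logderiv_zero_sum[OF g growth x eps] by blast
    have "Re (deriv (logderiv g) ?c + (\<Sum>e\<leftarrow>es. 1 / (?c - e)\<^sup>2)) \<le> \<epsilon>"
      using es(3) complex_Re_le_cmod order_trans by blast
    thus ?thesis using es by (intro exI[of _ es]) (auto simp: algebra_simps)
  qed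
  show "Re (deriv (logderiv g) ?c) \<le> 0"
  proof (rule field_le_epsilon)
    fix \<epsilon> :: real assume "\<epsilon> > 0"
    from key[OF this] obtain es where "\<forall>e\<in>set es. g e = 0"
      "Re (deriv (logderiv g) ?c) \<le> \<epsilon> - Re (\<Sum>e\<leftarrow>es. 1 / (?c - e)\<^sup>2)" by blast
    thus "Re (deriv (logderiv g) ?c) \<le> 0 + \<epsilon>" using sum[of es] by auto
  qed
  assume e1: "g e1 = 0"
  have sum1: "1 / (x - Re e1)\<^sup>2 \<le> Re (\<Sum>e\<leftarrow>es. 1 / (?c - e)\<^sup>2)" 
    if "\<And>e. e \<in> set es \<Longrightarrow> g e = 0" "e1 \<in> set es" for es
    using that
  proof (induction es)
    case (Cons e es)
    have nn: "Re (1 / (?c - e)\<^sup>2) \<ge> 0" using tm[of e] Cons.prems by simp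
    show ?case
    proof (cases "e = e1")
      case True
      thus ?thesis using sum[of es] Cons.prems tm(1)[OF e1] by simp
    next
      case False
      thus ?thesis using Cons nn by simp
    qed
  qed simp
  have "Re (deriv (logderiv g) ?c) \<le> - (1 / (x - Re e1)\<^sup>2)"
  proof (rule field_le_epsilon)
    fix \<epsilon> :: real assume eps: "\<epsilon> > 0"
    from key[OF this, of e1] e1 obtain es where "\<forall>e\<in>set es. g e = 0" "e1 \<in> set es"
      "Re (deriv (logderiv g) ?c) \<le> \<epsilon> - Re (\<Sum>e\<leftarrow>es. 1 / (?c - e)\<^sup>2)" by blast
    thus "Re (deriv (logderiv g) ?c) \<le> - (1 / (x - Re e1)\<^sup>2) + \<epsilon>" using sum1[of es] by auto
  qed
  moreover have "1 / (x - Re e1)\<^sup>2 > 0" using tm(2)[OF e1] by simp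
  ultimately show "Re (deriv (logderiv g) ?c) < 0" by linarith
qed

end

section \<open>The Schrodinger equation with an integrable potential\<close>

text \<open>Summing over a fine equal partition telescopes both sides and leaves \<epsilon> (H b - H
  0). This takes the place of a vanishing derivative for functions that are differentiable only
  almost everywhere.\<close>

lemma eq_if_increments_small:
  fixes E :: "real \<Rightarrow> complex" and H :: "real \<Rightarrow> real"
  assumes b: "0 \<le> b"
    and small: "\<And>\<epsilon>. \<epsilon> > 0 \<Longrightarrow> \<exists>\<delta>>0. \<forall>x y. 0 \<le> x \<and> x \<le> y \<and> y \<le> b \<and> y - x < \<delta> \<longrightarrow>
        norm (E y - E x) \<le> \<epsilon> * (H y - H x)"
  shows "E b = E 0"
proof -
  have "norm (E b - E 0) \<le> 0 + \<epsilon> * \<bar>H b - H 0\<bar>" if eps: "\<epsilon> > 0" for \<epsilon>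
  proof -
    obtain \<delta> where \<delta>: "\<delta> > 0" and d: "\<And>x y. 0 \<le> x \<Longrightarrow> x \<le> y \<Longrightarrow> y \<le> b \<Longrightarrow> y - x < \<delta> \<Longrightarrow>
        norm (E y - E x) \<le> \<epsilon> * (H y - H x)" using small[OF eps] by blast
    obtain N :: nat where "b / \<delta> < N" using reals_Archimedean2 by blast
    moreover have "0 \<le> b / \<delta>" using \<delta> b by simp
    ultimately have "real N > 0" by linarith
    hence N: "N > 0" "b / N < \<delta>" using \<open>b / \<delta> < N\<close> \<delta> by (simp_all add: pos_divide_less_eq mult.commute)
    define p where "p = (\<lambda>i::nat. b * i / N)"
    have "norm (E (p i) - E 0) \<le> \<epsilon> * (H (p i) - H 0)" if "i \<le> N" for i
      using that
    proof (induction i)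
      case 0
      then show ?case by (simp add: p_def)
    next
      case (Suc i)
      have "norm (E (p (Suc i)) - E (p i)) \<le> \<epsilon> * (H (p (Suc i)) - H (p i))"
      proof (rule d)
        show "0 \<le> p i" "p i \<le> p (Suc i)" using b N by (auto simp: p_def divide_right_mono mult_left_mono)
        show "p (Suc i) \<le> b"
          using b N Suc.prems mult_left_mono[of "real (Suc i)" "real N" b] by (simp add: p_def field_simps)
        show "p (Suc i) - p i < \<delta>" using N by (simp add: p_def field_simps)
      qed
      moreover have "norm (E (p i) - E 0) \<le> \<epsilon> * (H (p i) - H 0)" using Suc by simp
      moreover have "norm (E (p (Suc i)) - E 0) \<le> norm (E (p (Suc i)) - E (p i)) + norm (E (p i) - E 0)"
        using norm_triangle_ineq[of "E (p (Suc i)) - E (p i)" "E (p i) - E 0"] by simp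
      ultimately show ?case by (simp add: algebra_simps)
    qed
    from this[of N] N have "norm (E b - E 0) \<le> \<epsilon> * (H b - H 0)" by (simp add: p_def)
    also have "\<dots> \<le> \<epsilon> * \<bar>H b - H 0\<bar>" using eps by (intro mult_left_mono) auto
    finally show ?thesis by simp
  qed
  note * = this
  have "norm (E b - E 0) \<le> 0"
  proof (rule field_le_epsilon)
    fix e :: real assume e: "e > 0"
    have "norm (E b - E 0) \<le> (e / (1 + \<bar>H b - H 0\<bar>)) * \<bar>H b - H 0\<bar>"
      using *[of "e / (1 + \<bar>H b - H 0\<bar>)"] e by simp
    also have "\<dots> \<le> e" using e by (simp add: field_simps)
    finally show "norm (E b - E 0) \<le> 0 + e" by simp
  qed
  thus ?thesis by simp
qed

lemma absolutely_integrable_mult_continuous: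
  fixes g y :: "real \<Rightarrow> complex"
  assumes g: "g absolutely_integrable_on {a..b}" and y: "continuous_on {a..b} y"
  shows "(\<lambda>t. g t * y t) absolutely_integrable_on {a..b}"
proof -
  have "(\<lambda>t. y t * g t) absolutely_integrable_on {a..b}"
  proof (rule absolutely_integrable_bounded_measurable_product[where h = times])
    show "bilinear (times :: complex \<Rightarrow> complex \<Rightarrow> complex)"
      by (simp add: bilinear_conv_bounded_bilinear bounded_bilinear_mult)
    show "y \<in> borel_measurable (lebesgue_on {a..b})"
      using y by (intro continuous_imp_measurable_on_sets_lebesgue) auto
    show "bounded (y ` {a..b})" using y by (intro compact_imp_bounded compact_continuous_image) auto
  qed (use g in auto)
  thus ?thesis by (simp add: mult.commute)
qed

lemma absolutely_integrable_imp_integrable: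
  "f absolutely_integrable_on S \<Longrightarrow> f integrable_on (S :: real set)" for f :: "real \<Rightarrow> complex"
  by (simp add: absolutely_integrable_on_def)

text \<open>\<open>V\<close> is only absolutely continuous, so the product rule may fail at
  individual points. Instead, V y minus the integral, as a function \<open>E\<close> of the upper
  limit, is shown to have negligible increments.\<close>

lemma integration_by_parts_indefinite:
  fixes y y' h V :: "real \<Rightarrow> complex"
  assumes b: "0 \<le> b" and h: "h absolutely_integrable_on {0..b}"
    and V: "\<And>x. x \<in> {0..b} \<Longrightarrow> V x = V 0 + integral {0..x} h"
    and y: "\<And>x. x \<in> {0..b} \<Longrightarrow> (y has_vector_derivative y' x) (at x within {0..b})"
    and y': "continuous_on {0..b} y'"
  shows "((\<lambda>t. h t * y t + V t * y' t) has_integral (V b * y b - V 0 * y 0)) {0..b}"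
proof -
  have hi: "h integrable_on {0..b}" by (rule absolutely_integrable_imp_integrable[OF h])
  have yc: "continuous_on {0..b} y"
    using y by (meson continuous_on_eq_continuous_within has_vector_derivative_continuous)
  have Vc: "continuous_on {0..b} V"
  proof -
    have "continuous_on {0..b} (\<lambda>x. V 0 + integral {0..x} h)"
      by (intro continuous_intros indefinite_integral_continuous_1 hi)
    thus ?thesis by (rule continuous_on_eq) (rule V[symmetric])
  qed
  have i1: "(\<lambda>t. h t * y t) integrable_on {0..b}"
    by (rule absolutely_integrable_imp_integrable[OF absolutely_integrable_mult_continuous[OF h yc]])
  have i2: "(\<lambda>t. V t * y' t) integrable_on {0..b}"
    by (intro integrable_continuous_real continuous_intros Vc y')
  have hn: "(\<lambda>t. norm (h t)) integrable_on {0..b}" using h by (simp add: absolutely_integrable_on_def)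
  have yn: "(\<lambda>t. norm (y' t)) integrable_on {0..b}"
    by (intro integrable_continuous_real continuous_intros y')
  let ?f = "\<lambda>t. h t * y t + V t * y' t"
  have fi: "?f integrable_on {0..b}" by (intro integrable_add i1 i2)
  define E where "E = (\<lambda>x. V x * y x - integral {0..x} ?f)"
  define H where "H = (\<lambda>x. integral {0..x} (\<lambda>t. norm (h t) + norm (y' t)))"
  have HI: "(\<lambda>t. norm (h t) + norm (y' t)) integrable_on {0..b}" by (intro integrable_add hn yn)
  have uc: "uniformly_continuous_on {0..b} y" "uniformly_continuous_on {0..b} V"
    using yc Vc by (auto intro: compact_uniformly_continuous)
  have "E b = E 0"
  proof (rule eq_if_increments_small[OF b])
    fix \<epsilon> :: real assume eps: "\<epsilon> > 0"
    obtain d1 where d1: "d1 > 0" "\<And>s t. s \<in> {0..b} \<Longrightarrow> t \<in> {0..b} \<Longrightarrow> dist t s < d1 \<Longrightarrow> dist (y t) (y s) < \<epsilon>"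
      using uc(1) eps unfolding uniformly_continuous_on_def by blast
    obtain d2 where d2: "d2 > 0" "\<And>s t. s \<in> {0..b} \<Longrightarrow> t \<in> {0..b} \<Longrightarrow> dist t s < d2 \<Longrightarrow> dist (V t) (V s) < \<epsilon>"
      using uc(2) eps unfolding uniformly_continuous_on_def by blast
    have "norm (E x2 - E x1) \<le> \<epsilon> * (H x2 - H x1)"
      if x: "0 \<le> x1" "x1 \<le> x2" "x2 \<le> b" "x2 - x1 < min d1 d2" for x1 x2
    proof -
      have sub: "{x1..x2} \<subseteq> {0..b}" "{0..x2} \<subseteq> {0..b}" "{x1..x2} \<subseteq> {0..x2}" using x by auto
      note int = integrable_on_subinterval[OF _ sub(1)]
      have spl: "integral {0..x2} f - integral {0..x1} f = integral {x1..x2} f"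
        if "f integrable_on {0..b}" for f :: "real \<Rightarrow> 'a::banach"
        using Henstock_Kurzweil_Integration.integral_combine[of 0 x1 x2 f] x 
          integrable_on_subinterval[OF that sub(2)] by (simp add: algebra_simps)
      have Vd: "V x2 - V x1 = integral {x1..x2} h"
        using spl[OF hi] V[of x1] V[of x2] x by simp
      have yd: "y x2 - y x1 = integral {x1..x2} y'"
      proof -
        have "(y' has_integral y x2 - y x1) {x1..x2}"
          by (rule fundamental_theorem_of_calculus[OF x(2)])
            (use sub(1) y has_vector_derivative_within_subset in blast)
        thus ?thesis by (simp add: integral_unique)
      qed
      have j1: "(\<lambda>t. h t * (y x2 - y t)) integrable_on {x1..x2}"
        by (rule int, rule absolutely_integrable_imp_integrable, rule absolutely_integrable_mult_continuous[OF h])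
          (intro continuous_intros yc)
      have j2: "(\<lambda>t. (V x1 - V t) * y' t) integrable_on {x1..x2}"
        by (rule int, intro integrable_continuous_real continuous_intros Vc y')
      \<comment> \<open>This integral is the increment of \<open>E\<close>; on a short interval its
        factors y x2 - y t and V x1 - V t are at most \<epsilon> in modulus by uniform
        continuity.\<close>
      have "integral {x1..x2} (\<lambda>t. h t * (y x2 - y t) + (V x1 - V t) * y' t)
          = integral {x1..x2} (\<lambda>t. (h t * y x2 + V x1 * y' t) - ?f t)"
        by (intro arg_cong[where f = "integral _"] ext) (simp add: algebra_simps)
      also have "\<dots> = integral {x1..x2} (\<lambda>t. h t * y x2 + V x1 * y' t) - integral {x1..x2} ?f"
        by (intro Henstock_Kurzweil_Integration.integral_diff int[OF fi] integrable_add integrable_on_mult_left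
             integrable_on_mult_right int[OF hi] int[OF integrable_continuous_real[OF y']])
      also have "integral {x1..x2} (\<lambda>t. h t * y x2 + V x1 * y' t)
          = integral {x1..x2} h * y x2 + V x1 * integral {x1..x2} y'"
        by (subst Henstock_Kurzweil_Integration.integral_add)
           (auto intro!: integrable_on_mult_left integrable_on_mult_right
              int[OF hi] int[OF integrable_continuous_real[OF y']])
      also have "\<dots> - integral {x1..x2} ?f = E x2 - E x1"
        unfolding E_def Vd[symmetric] yd[symmetric] spl[OF fi, symmetric] by (simp add: algebra_simps)
      finally have Eq: "E x2 - E x1 = integral {x1..x2} (\<lambda>t. h t * (y x2 - y t) + (V x1 - V t) * y' t)" by simp
      have "norm (E x2 - E x1) \<le> integral {x1..x2} (\<lambda>t. \<epsilon> * (norm (h t) + norm (y' t)))"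
        unfolding Eq
      proof (rule Henstock_Kurzweil_Integration.integral_norm_bound_integral)
        show "(\<lambda>t. h t * (y x2 - y t) + (V x1 - V t) * y' t) integrable_on {x1..x2}"
          by (intro integrable_add j1 j2)
        show "(\<lambda>t. \<epsilon> * (norm (h t) + norm (y' t))) integrable_on {x1..x2}"
          by (intro integrable_on_mult_right int HI)
        fix t assume t: "t \<in> {x1..x2}"
        have "norm (y x2 - y t) \<le> \<epsilon>"
          using d1(2)[of t x2] t x by (auto simp: dist_norm)
        moreover have "norm (V x1 - V t) \<le> \<epsilon>"
          using d2(2)[of t x1] t x by (auto simp: dist_norm)
        ultimately have "norm (h t * (y x2 - y t)) + norm ((V x1 - V t) * y' t) \<le> norm (h t) * \<epsilon> + \<epsilon> * norm (y' t)"
          unfolding norm_mult by (intro add_mono mult_left_mono mult_right_mono) auto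
        thus "norm (h t * (y x2 - y t) + (V x1 - V t) * y' t) \<le> \<epsilon> * (norm (h t) + norm (y' t))"
          using norm_triangle_ineq[of "h t * (y x2 - y t)" "(V x1 - V t) * y' t"]
          by (simp add: algebra_simps)
      qed
      also have "\<dots> = \<epsilon> * (H x2 - H x1)" unfolding H_def spl[OF HI] by simp
      finally show ?thesis .
    qed
    thus "\<exists>\<delta>>0. \<forall>x y. 0 \<le> x \<and> x \<le> y \<and> y \<le> b \<and> y - x < \<delta> \<longrightarrow> norm (E y - E x) \<le> \<epsilon> * (H y - H x)"
      using d1 d2 by (intro exI[of _ "min d1 d2"]) auto
  qed
  hence "integral {0..b} ?f = V b * y b - V 0 * y 0" by (simp add: E_def algebra_simps)
  thus ?thesis using fi by (simp add: has_integral_iff)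
qed

section \<open>Bounds and uniqueness for the Volterra equation\<close>

context
  fixes g :: "real \<Rightarrow> complex" and Q :: real
  assumes g: "g absolutely_integrable_on {0..1}"
    and Q: "integral {0..1} (\<lambda>t. norm (g t)) \<le> Q"
begin

lemma Q_nonneg: "0 \<le> Q"
  using Q integral_nonneg[of "\<lambda>t. norm (g t)" "{0..1}"] g
  by (simp add: absolutely_integrable_on_def)

lemma indefinite_mult_bound:
  assumes w: "continuous_on {0..1} w" and x: "x \<in> {0..1}"
    and bd: "\<And>t. t \<in> {0..x} \<Longrightarrow> norm (w t) \<le> B"
  shows "norm (integral {0..x} (\<lambda>t. g t * w t)) \<le> Q * B"
proof -
  have sub: "{0..x} \<subseteq> {0..1}" using x by auto
  have B0: "0 \<le> B" using order_trans[OF norm_ge_zero bd[of 0]] x by simp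
  have gn: "(\<lambda>t. norm (g t)) integrable_on {0..1}" using g by (simp add: absolutely_integrable_on_def)
  have "norm (integral {0..x} (\<lambda>t. g t * w t)) \<le> integral {0..x} (\<lambda>t. norm (g t) * B)"
  proof (rule Henstock_Kurzweil_Integration.integral_norm_bound_integral)
    show "(\<lambda>t. g t * w t) integrable_on {0..x}"
      using absolutely_integrable_mult_continuous[OF g w] absolutely_integrable_on_def
        integrable_on_subinterval[OF _ sub] by blast
    show "(\<lambda>t. norm (g t) * B) integrable_on {0..x}"
      by (intro integrable_on_mult_left integrable_on_subinterval[OF gn sub])
  qed (use bd in \<open>auto simp: norm_mult intro!: mult_left_mono\<close>)
  also have "\<dots> = integral {0..x} (\<lambda>t. norm (g t)) * B" by simp
  also have "\<dots> \<le> Q * B"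
    by (intro mult_right_mono B0 order_trans[OF integral_subset_le Q])
      (use sub gn integrable_on_subinterval[OF gn sub] in auto)
  finally show ?thesis .
qed

lemma continuous_indefinite_mult:
  assumes w: "continuous_on {0..1} w"
  shows "continuous_on {0..1} (\<lambda>x. integral {0..x} (\<lambda>t. g t * w t))"
  using absolutely_integrable_mult_continuous[OF g w]
  by (intro indefinite_integral_continuous_1) (simp add: absolutely_integrable_on_def)

text \<open>The inner integral costs a factor Q, the outer one turns t^n into x^(n+1)/(n+1): one
  Volterra step replaces (Q x)^n/n! by the next term of the exponential series.\<close>

lemma double_integral_bound:
  assumes w: "continuous_on {0..1} w" and M: "0 \<le> M"
    and bd: "\<And>x. x \<in> {0..1} \<Longrightarrow> norm (w x) \<le> M * (Q * x) ^ n / fact n" and x: "x \<in> {0..1}"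
  shows "norm (integral {0..x} (\<lambda>t. g t * w t)) \<le> M * Q * (Q * x) ^ n / fact n"
    and "norm (integral {0..x} (\<lambda>s. integral {0..s} (\<lambda>t. g t * w t))) \<le> M * (Q * x) ^ Suc n / fact (Suc n)"
proof -
  have 1: "norm (integral {0..x} (\<lambda>t. g t * w t)) \<le> M * Q * (Q * x) ^ n / fact n"
    if x: "x \<in> {0..1}" for x
  proof -
    have "norm (integral {0..x} (\<lambda>t. g t * w t)) \<le> Q * (M * (Q * x) ^ n / fact n)"
    proof (rule indefinite_mult_bound[OF w x])
      fix t assume t: "t \<in> {0..x}"
      have "M * (Q * t) ^ n / fact n \<le> M * (Q * x) ^ n / fact n"
        using t x M Q_nonneg by (intro divide_right_mono mult_left_mono power_mono) auto
      thus "norm (w t) \<le> M * (Q * x) ^ n / fact n" using bd[of t] t x by auto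
    qed
    thus ?thesis by (simp add: mult_ac)
  qed
  show "norm (integral {0..x} (\<lambda>t. g t * w t)) \<le> M * Q * (Q * x) ^ n / fact n" by (rule 1[OF x])
  have x01: "0 \<le> x" "x \<le> 1" using x by auto
  let ?V = "\<lambda>s. integral {0..s} (\<lambda>t. g t * w t)"
  have "norm (integral {0..x} ?V) \<le> integral {0..x} (\<lambda>t. M * Q ^ Suc n / fact n * t ^ n)"
  proof (rule Henstock_Kurzweil_Integration.integral_norm_bound_integral)
    show "?V integrable_on {0..x}"
      by (rule integrable_continuous_real, rule continuous_on_subset[OF continuous_indefinite_mult[OF w]])
        (use x in auto)
    show "(\<lambda>t. M * Q ^ Suc n / fact n * t ^ n) integrable_on {0..x}"
      by (intro integrable_continuous_real continuous_intros)
    show "norm (?V t) \<le> M * Q ^ Suc n / fact n * t ^ n" if "t \<in> {0..x}" for t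
      using 1[of t] that x by (simp add: power_mult_distrib mult_ac)
  qed
  also have "\<dots> = M * Q ^ Suc n / fact n * (x ^ Suc n / Suc n)"
  proof -
    have "((\<lambda>t. t ^ n) has_integral (x ^ Suc n / Suc n - 0 ^ Suc n / Suc n)) {0..x}"
      by (rule fundamental_theorem_of_calculus[OF x01(1)])
        (auto simp: has_real_derivative_iff_has_vector_derivative[symmetric] divide_simps simp del: power_Suc
           intro!: derivative_eq_intros)
    thus ?thesis by (simp add: integral_unique)
  qed
  also have "\<dots> = M * (Q * x) ^ Suc n / fact (Suc n)" by (simp add: power_mult_distrib field_simps)
  finally show "norm (integral {0..x} ?V) \<le> M * (Q * x) ^ Suc n / fact (Suc n)" .
qed

text \<open>A solution is its own image under every power of the Volterra operator, hence bounded by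
  M (Q x)^n/n! for all n.\<close>

lemma volterra_unique:
  assumes y: "\<And>x. x \<in> {0..1} \<Longrightarrow> (y has_vector_derivative V x) (at x within {0..1})"
    and V: "\<And>x. x \<in> {0..1} \<Longrightarrow> V x = integral {0..x} (\<lambda>t. g t * y t)" and y0: "y 0 = 0"
    and x: "x \<in> {0..1}"
  shows "y x = 0" "V x = 0"
proof -
  have yc: "continuous_on {0..1} y"
    using y by (meson continuous_on_eq_continuous_within has_vector_derivative_continuous)
  have "bounded (y ` {0..1})" using yc by (intro compact_imp_bounded compact_continuous_image) auto
  then obtain M where M: "M > 0" "\<And>x. x \<in> {0..1} \<Longrightarrow> norm (y x) \<le> M"
    by (auto simp: bounded_pos)
  have yV: "y x = integral {0..x} (\<lambda>s. integral {0..s} (\<lambda>t. g t * y t))" if x: "x \<in> {0..1}" for x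
  proof -
    have "(V has_integral (y x - y 0)) {0..x}"
    proof (rule fundamental_theorem_of_calculus)
      show "(y has_vector_derivative V t) (at t within {0..x})" if "t \<in> {0..x}" for t
        using has_vector_derivative_within_subset[OF y[of t], of "{0..x}"] that x by auto
    qed (use x in simp)
    hence "y x = integral {0..x} V" using y0 by (simp add: integral_unique)
    also have "\<dots> = integral {0..x} (\<lambda>s. integral {0..s} (\<lambda>t. g t * y t))"
      by (rule Henstock_Kurzweil_Integration.integral_cong) (use x V in auto)
    finally show ?thesis .
  qed
  have bd: "\<And>x. x \<in> {0..1} \<Longrightarrow> norm (y x) \<le> M * (Q * x) ^ n / fact n" for n
  proof (induction n)
    case 0
    then show ?case using M by auto
  next
    case (Suc n)
    show ?case using double_integral_bound(2)[OF yc _ Suc.IH Suc.prems] M yV[OF Suc.prems] by simp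
  qed
  have y_eq: "y x = 0" if x: "x \<in> {0..1}" for x
  proof -
    have "(\<lambda>n. M * ((Q * x) ^ n / fact n)) \<longlonglongrightarrow> M * 0"
      using summable_LIMSEQ_zero[OF summable_exp[of "Q * x"]]
      by (intro tendsto_intros) (simp add: field_simps)
    hence "norm (y x) \<le> M * 0"
      by (rule LIMSEQ_le_const) (use bd[OF x] in auto)
    thus ?thesis by simp
  qed
  show "y x = 0" by (rule y_eq[OF x])
  have "V x = integral {0..x} (\<lambda>t. 0)" unfolding V[OF x]
    by (rule Henstock_Kurzweil_Integration.integral_cong) (use x y_eq in auto)
  thus "V x = 0" by simp
qed

end

section \<open>The Neumann series of the Cauchy problem\<close>

text \<open>The pairs are the terms of the Neumann series, not its partial sums; the second
  component is the derivative of the first, so that both series are controlled together.\<close>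

primrec picard :: "(real \<Rightarrow> complex) \<Rightarrow> complex \<Rightarrow> complex \<Rightarrow> nat \<Rightarrow> (real \<Rightarrow> complex) \<times> (real \<Rightarrow> complex)" where
  "picard g u v 0 = ((\<lambda>x. u + v * of_real x), (\<lambda>x. v))"
| "picard g u v (Suc n) =
     ((\<lambda>x. integral {0..x} (\<lambda>s. integral {0..s} (\<lambda>t. g t * fst (picard g u v n) t))),
      (\<lambda>s. integral {0..s} (\<lambda>t. g t * fst (picard g u v n) t)))"

text \<open>The derivative of the n-th term is an integral against term n - 1, hence the shifted
  index and the extra factor Q; adding both bounds gives one majorant for both components.\<close>

definition picard_majorant :: "complex \<Rightarrow> complex \<Rightarrow> real \<Rightarrow> nat \<Rightarrow> real" where
  "picard_majorant u v Q n =
     (norm u + norm v) * (Q ^ n / fact n + (case n of 0 \<Rightarrow> 1 | Suc m \<Rightarrow> Q * (Q ^ m / fact m)))"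

definition picard_y :: "(real \<Rightarrow> complex) \<Rightarrow> complex \<Rightarrow> complex \<Rightarrow> real \<Rightarrow> complex" where
  "picard_y g u v x = (\<Sum>n. fst (picard g u v n) x)"

definition picard_v :: "(real \<Rightarrow> complex) \<Rightarrow> complex \<Rightarrow> complex \<Rightarrow> real \<Rightarrow> complex" where
  "picard_v g u v x = (\<Sum>n. snd (picard g u v n) x)"

context
  fixes g :: "real \<Rightarrow> complex" and u v :: complex and Q :: real
  assumes g: "g absolutely_integrable_on {0..1}"
    and Q: "integral {0..1} (\<lambda>t. norm (g t)) \<le> Q"
begin

abbreviation "py n \<equiv> fst (picard g u v n)"
abbreviation "pv n \<equiv> snd (picard g u v n)"

lemma picard_continuous: "continuous_on {0..1} (py n)" "continuous_on {0..1} (pv n)"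
proof -
  have "continuous_on {0..1} (py n) \<and> continuous_on {0..1} (pv n)"
  proof (induction n)
    case 0
    then show ?case by (auto intro!: continuous_intros)
  next
    case (Suc n)
    have "continuous_on {0..1} (pv (Suc n))" using continuous_indefinite_mult[OF g Q] Suc by simp
    moreover from this have "continuous_on {0..1} (py (Suc n))"
      using indefinite_integral_continuous_1[OF integrable_continuous_real] by simp
    ultimately show ?case by blast
  qed
  thus "continuous_on {0..1} (py n)" "continuous_on {0..1} (pv n)" by auto
qed

lemma picard_bound:
  assumes "x \<in> {0..1}"
  shows "norm (py n x) \<le> (norm u + norm v) * (Q * x) ^ n / fact n"
    and "norm (pv (Suc n) x) \<le> (norm u + norm v) * Q * (Q * x) ^ n / fact n"
proof -
  have main: "\<And>x. x \<in> {0..1} \<Longrightarrow> norm (py n x) \<le> (norm u + norm v) * (Q * x) ^ n / fact n" for n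
  proof (induction n)
    case 0
    have "norm (v * of_real x) \<le> norm v" using 0 mult_left_mono[of "\<bar>x\<bar>" 1 "norm v"] by (auto simp: norm_mult)
    hence "norm (u + v * of_real x) \<le> norm u + norm v"
      using norm_triangle_ineq[of u "v * of_real x"] by linarith
    then show ?case by simp
  next
    case (Suc n)
    show ?case
      using double_integral_bound(2)[OF g Q picard_continuous(1) _ Suc.IH Suc.prems] by simp
  qed
  show "norm (py n x) \<le> (norm u + norm v) * (Q * x) ^ n / fact n" by (rule main[OF assms])
  show "norm (pv (Suc n) x) \<le> (norm u + norm v) * Q * (Q * x) ^ n / fact n"
    using double_integral_bound(1)[OF g Q picard_continuous(1) _ main assms] by simp
qed

lemma summable_picard_majorant: "summable (picard_majorant u v Q)"
proof -
  have e: "summable (\<lambda>n. Q ^ n / fact n)" using summable_exp[of Q] by (simp add: field_simps)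
  have "summable (\<lambda>n. case n of 0 \<Rightarrow> 1 | Suc m \<Rightarrow> Q * (Q ^ m / fact m))"
    by (subst summable_Suc_iff[symmetric]) (use summable_mult[OF e, of Q] in simp)
  with e show ?thesis unfolding picard_majorant_def by (intro summable_mult summable_add)
qed

lemma picard_le_majorant:
  assumes x: "x \<in> {0..1}"
  shows "norm (py n x) \<le> picard_majorant u v Q n" "norm (pv n x) \<le> picard_majorant u v Q n"
proof -
  have Q0: "Q \<ge> 0" by (rule Q_nonneg[OF g Q])
  have p: "(Q * x) ^ m \<le> Q ^ m" for m
    using x Q0 mult_left_mono[of x 1 Q] by (intro power_mono) auto
  have p1: "(norm u + norm v) * (Q * x) ^ m / fact m \<le> (norm u + norm v) * (Q ^ m / fact m)" for m
    using mult_left_mono[OF p, of "norm u + norm v" m] by (simp add: divide_right_mono)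
  have nn: "0 \<le> (norm u + norm v) * (case n of 0 \<Rightarrow> 1 | Suc m \<Rightarrow> Q * (Q ^ m / fact m))" for n
    using Q0 by (auto split: nat.splits)
  have nn': "0 \<le> (norm u + norm v) * (Q ^ n / fact n)" using Q0 by simp
  show "norm (py n x) \<le> picard_majorant u v Q n"
    using picard_bound(1)[OF x, of n] p1[of n] nn[of n] unfolding picard_majorant_def ring_distribs
    by linarith
  show "norm (pv n x) \<le> picard_majorant u v Q n"
  proof (cases n)
    case 0
    then show ?thesis by (simp add: picard_majorant_def)
  next
    case (Suc m)
    have "norm (pv n x) \<le> Q * ((norm u + norm v) * (Q * x) ^ m / fact m)"
      using picard_bound(2)[OF x, of m] Suc by (simp add: mult_ac)
    also have "\<dots> \<le> Q * ((norm u + norm v) * (Q ^ m / fact m))" by (rule mult_left_mono[OF p1 Q0])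
    finally show ?thesis using nn' Suc unfolding picard_majorant_def ring_distribs by (simp add: mult_ac)
  qed
qed

lemma picard_limits:
  "uniform_limit {0..1} (\<lambda>N x. \<Sum>n<N. py n x) (picard_y g u v) sequentially"
  "uniform_limit {0..1} (\<lambda>N x. \<Sum>n<N. pv n x) (picard_v g u v) sequentially"
  unfolding picard_y_def[abs_def] picard_v_def[abs_def]
  by (rule Weierstrass_m_test[OF _ summable_picard_majorant], erule picard_le_majorant)+

lemma picard_sum_continuous: "continuous_on {0..1} (picard_y g u v)" "continuous_on {0..1} (picard_v g u v)"
  by (rule uniform_limit_theorem[OF _ picard_limits(1)] uniform_limit_theorem[OF _ picard_limits(2)],
      auto intro!: continuous_on_sum picard_continuous always_eventually)+

lemma picard_sum_v:
  assumes x: "x \<in> {0..1}"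
  shows "picard_v g u v x = v + integral {0..x} (\<lambda>t. g t * picard_y g u v t)"
proof -
  have sub: "{0..x} \<subseteq> {0..1}" using x by auto
  have gint: "(\<lambda>t. g t * w t) integrable_on {0..x}" if "continuous_on {0..1} w" for w
    using integrable_on_subinterval[OF _ sub]
      absolutely_integrable_imp_integrable[OF absolutely_integrable_mult_continuous[OF g that]] by blast
  have Sc: "continuous_on {0..1} (\<lambda>t. \<Sum>n<N. py n t)" for N by (intro continuous_on_sum picard_continuous)
  have eq: "(\<Sum>n<Suc N. pv n x) = v + integral {0..x} (\<lambda>t. g t * (\<Sum>n<N. py n t))" for N
  proof -
    have "(\<Sum>n<Suc N. pv n x) = v + (\<Sum>n<N. integral {0..x} (\<lambda>t. g t * py n t))"
      by (subst sum.lessThan_Suc_shift) simp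
    also have "(\<Sum>n<N. integral {0..x} (\<lambda>t. g t * py n t)) = integral {0..x} (\<lambda>t. \<Sum>n<N. g t * py n t)"
      by (rule Henstock_Kurzweil_Integration.integral_sum[symmetric]) (auto intro: gint picard_continuous)
    finally show ?thesis by (simp add: sum_distrib_left)
  qed
  have "(\<lambda>N. integral {0..x} (\<lambda>t. g t * (\<Sum>n<N. py n t))) \<longlonglongrightarrow> integral {0..x} (\<lambda>t. g t * picard_y g u v t)"
  proof (rule LIMSEQ_I)
    fix e :: real assume e: "e > 0"
    have Q0: "Q \<ge> 0" by (rule Q_nonneg[OF g Q])
    \<comment> \<open>With partial sums uniformly within e/(Q + 1) of the limit, the integrals
      against \<open>g\<close> differ by at most Q e/(Q + 1) < e.\<close>
    have "eventually (\<lambda>N. \<forall>t\<in>{0..1}. dist (\<Sum>n<N. py n t) (picard_y g u v t) < e / (Q + 1)) sequentially"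
      using picard_limits(1) e Q0 unfolding uniform_limit_iff by (auto dest!: spec[of _ "e / (Q + 1)"])
    then obtain N0 where N0: "\<And>N t. N \<ge> N0 \<Longrightarrow> t \<in> {0..1} \<Longrightarrow> norm ((\<Sum>n<N. py n t) - picard_y g u v t) < e / (Q + 1)"
      unfolding eventually_sequentially dist_norm by blast
    show "\<exists>no. \<forall>n\<ge>no. norm (integral {0..x} (\<lambda>t. g t * (\<Sum>n<n. py n t)) - integral {0..x} (\<lambda>t. g t * picard_y g u v t)) < e"
    proof (intro exI allI impI)
      fix N assume N: "N \<ge> N0"
      have "norm (integral {0..x} (\<lambda>t. g t * ((\<Sum>n<N. py n t) - picard_y g u v t))) \<le> Q * (e / (Q + 1))"
      proof (rule indefinite_mult_bound[OF g Q _ x])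
        show "norm ((\<Sum>n<N. py n t) - picard_y g u v t) \<le> e / (Q + 1)" if "t \<in> {0..x}" for t
          using N0[OF N, of t] that sub by auto
      qed (intro continuous_intros Sc picard_sum_continuous)
      also have "\<dots> < e" using e Q0 by (simp add: field_simps)
      finally show "norm (integral {0..x} (\<lambda>t. g t * (\<Sum>n<N. py n t)) - integral {0..x} (\<lambda>t. g t * picard_y g u v t)) < e"
        by (simp add: right_diff_distrib Henstock_Kurzweil_Integration.integral_diff gint Sc picard_sum_continuous)
    qed
  qed
  hence "(\<lambda>N. \<Sum>n<Suc N. pv n x) \<longlonglongrightarrow> v + integral {0..x} (\<lambda>t. g t * picard_y g u v t)"
    unfolding eq by (intro tendsto_intros)
  moreover have "(\<lambda>N. \<Sum>n<Suc N. pv n x) \<longlonglongrightarrow> picard_v g u v x"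
    using tendsto_uniform_limitI[OF picard_limits(2) x] by (rule LIMSEQ_Suc)
  ultimately show ?thesis by (rule LIMSEQ_unique[symmetric])
qed

lemma picard_sum_y:
  assumes x: "x \<in> {0..1}"
  shows "picard_y g u v x = u + integral {0..x} (picard_v g u v)"
proof -
  have sub: "{0..x} \<subseteq> {0..1}" using x by auto
  have int: "w integrable_on {0..x}" if "continuous_on {0..1} w" for w :: "real \<Rightarrow> complex"
    using integrable_continuous_real continuous_on_subset[OF that sub] by blast
  have eq: "(\<Sum>n<Suc N. py n x) = u + integral {0..x} (\<lambda>t. \<Sum>n<Suc N. pv n t)" for N
  proof -
    have "integral {0..x} (\<lambda>t. \<Sum>n<Suc N. pv n t) = (\<Sum>n<Suc N. integral {0..x} (pv n))"
      by (rule Henstock_Kurzweil_Integration.integral_sum) (auto simp only: finite_lessThan intro!: int picard_continuous)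
    also have "\<dots> = of_real x * v + (\<Sum>n<N. integral {0..x} (pv (Suc n)))"
      using x by (subst sum.lessThan_Suc_shift) (simp add: scaleR_conv_of_real)
    finally show ?thesis by (subst sum.lessThan_Suc_shift) (simp add: mult.commute add.assoc)
  qed
  have "uniform_limit {0..x} (\<lambda>N t. \<Sum>n<Suc N. pv n t) (picard_v g u v) sequentially"
    using uniform_limit_on_subset[OF picard_limits(2) sub] 
    by (rule filterlim_compose[OF _ filterlim_Suc])
  moreover have "continuous_on {0..x} (\<lambda>t. \<Sum>n<Suc N. pv n t)" for N
    by (intro continuous_on_sum continuous_on_subset[OF picard_continuous(2) sub])
  ultimately obtain I J where "\<And>N. ((\<lambda>t. \<Sum>n<Suc N. pv n t) has_integral I N) {0..x}"
      "(picard_v g u v has_integral J) {0..x}" "I \<longlonglongrightarrow> J"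
    using uniform_limit_integral trivial_limit_sequentially by blast
  then have "(\<lambda>N. integral {0..x} (\<lambda>t. \<Sum>n<Suc N. pv n t)) \<longlonglongrightarrow> integral {0..x} (picard_v g u v)"
  proof -
    assume I: "\<And>N. ((\<lambda>t. \<Sum>n<Suc N. pv n t) has_integral I N) {0..x}"
      and J: "(picard_v g u v has_integral J) {0..x}" and lim: "I \<longlonglongrightarrow> J"
    have "I = (\<lambda>N. integral {0..x} (\<lambda>t. \<Sum>n<Suc N. pv n t))"
      using integral_unique[OF I] by auto
    with lim integral_unique[OF J] show ?thesis by simp
  qed
  hence "(\<lambda>N. \<Sum>n<Suc N. py n x) \<longlonglongrightarrow> u + integral {0..x} (picard_v g u v)"
    unfolding eq by (intro tendsto_intros)
  moreover have "(\<lambda>N. \<Sum>n<Suc N. py n x) \<longlonglongrightarrow> picard_y g u v x"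
    using tendsto_uniform_limitI[OF picard_limits(1) x] by (rule LIMSEQ_Suc)
  ultimately show ?thesis by (rule LIMSEQ_unique[symmetric])
qed

lemma picard_has_derivative:
  assumes x: "x \<in> {0..1}"
  shows "(picard_y g u v has_vector_derivative picard_v g u v x) (at x within {0..1})"
proof -
  have "((\<lambda>x. u + integral {0..x} (picard_v g u v)) has_vector_derivative (0 + picard_v g u v x)) (at x within {0..1})"
    by (intro derivative_intros integral_has_vector_derivative picard_sum_continuous x)
  from has_vector_derivative_transform[OF x _ this, of "picard_y g u v"] show ?thesis
    by (simp add: picard_sum_y)
qed

end

section \<open>Solutions of the Schrodinger equation and their identities\<close>

text \<open>The unit interval has finite measure, so square integrable functions on it are
  integrable; the two end points form a null set.\<close>

lemma L2_potential_absolutely_integrable: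
  assumes "L2_potential q"
  shows "(\<lambda>t. complex_of_real (q t)) absolutely_integrable_on {0..1}"
proof -
  have m: "q \<in> borel_measurable (lebesgue_on {0<..<1})" and i: "integrable (lebesgue_on {0<..<1}) (\<lambda>x. (q x)\<^sup>2)"
    using assms by (auto simp: L2_potential_def)
  interpret finite_measure "lebesgue_on {0<..<1::real}"
    by (rule finite_measure_lebesgue_on) auto
  have "integrable (lebesgue_on {0<..<1}) q" by (rule square_integrable_imp_integrable[OF m i])
  hence "integrable (lebesgue_on {0<..<1}) (norm \<circ> q)" by (simp add: o_def)
  with m have "q absolutely_integrable_on {0<..<1}"
    by (subst absolutely_integrable_measurable) auto
  hence "q absolutely_integrable_on {0..1}"
  proof (rule absolutely_integrable_spike_set)
    have "{x \<in> {0..1} - {0<..<1}. q x \<noteq> 0} \<subseteq> {0, 1}" by auto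
    thus "negligible {x \<in> {0..1} - {0<..<1}. q x \<noteq> 0}" 
      by (rule negligible_subset[rotated]) simp
    show "negligible {x \<in> {0<..<1} - {0..1}. q x \<noteq> 0}" by (rule negligible_subset[of "{}"]) auto
  qed
  from absolutely_integrable_linear[OF this bounded_linear_of_real] show ?thesis by (simp add: o_def)
qed

locale potential =
  fixes q :: "real \<Rightarrow> real"
  assumes q_int: "(\<lambda>t. complex_of_real (q t)) absolutely_integrable_on {0..1}"
begin

definition q_norm :: real where "q_norm = integral {0..1} (\<lambda>t. norm (complex_of_real (q t)))"

lemma coeff_int: "(\<lambda>t. complex_of_real (q t) - l) absolutely_integrable_on {0..1}"
  by (rule set_integral_diff(1)[OF q_int]) (rule absolutely_integrable_continuous_real, simp)

lemma q_norm_int: "(\<lambda>t. norm (complex_of_real (q t))) integrable_on {0..1}"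
  using q_int unfolding absolutely_integrable_on_def by blast

lemma coeff_norm: "integral {0..1} (\<lambda>t. norm (complex_of_real (q t) - l)) \<le> q_norm + norm l"
proof -
  have "integral {0..1} (\<lambda>t. norm (complex_of_real (q t) - l)) \<le> integral {0..1} (\<lambda>t. norm (complex_of_real (q t)) + norm l)"
  proof (rule integral_le)
    show "(\<lambda>t. norm (complex_of_real (q t) - l)) integrable_on {0..1}"
      using coeff_int[of l] unfolding absolutely_integrable_on_def by blast
    show "(\<lambda>t. norm (complex_of_real (q t)) + norm l) integrable_on {0..1}"
      by (intro integrable_add q_norm_int) auto
  qed (rule norm_triangle_ineq4)
  also have "\<dots> = q_norm + norm l" unfolding q_norm_def
    using Henstock_Kurzweil_Integration.integral_add[OF q_norm_int integrable_const_ivl[of "norm l" 0 1]]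
    by simp
  finally show ?thesis .
qed

lemma q_norm_nonneg: "q_norm \<ge> 0"
  unfolding q_norm_def by (rule integral_nonneg[OF q_norm_int]) simp

definition sol :: "complex \<Rightarrow> complex \<Rightarrow> complex \<Rightarrow> real \<Rightarrow> complex" where
  "sol l u v = picard_y (\<lambda>t. complex_of_real (q t) - l) u v"

definition sol' :: "complex \<Rightarrow> complex \<Rightarrow> complex \<Rightarrow> real \<Rightarrow> complex" where
  "sol' l u v = picard_v (\<lambda>t. complex_of_real (q t) - l) u v"

lemma sol_0: "sol l u v 0 = u" "sol' l u v 0 = v"
  using picard_sum_y[OF coeff_int coeff_norm, of 0] picard_sum_v[OF coeff_int coeff_norm, of 0]
  by (simp_all add: sol_def sol'_def)

lemma sol_solves: "schrodinger_solution q l (sol l u v) (sol' l u v)"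
proof -
  have "((\<lambda>t. (complex_of_real (q t) - l) * sol l u v t) has_integral (sol' l u v x - sol' l u v 0)) {0..x}"
    if x: "x \<in> {0..1}" for x
  proof -
    have "(\<lambda>t. (complex_of_real (q t) - l) * sol l u v t) integrable_on {0..1}"
      unfolding sol_def
      by (intro absolutely_integrable_imp_integrable absolutely_integrable_mult_continuous coeff_int
           picard_sum_continuous[OF coeff_int coeff_norm])
    hence "(\<lambda>t. (complex_of_real (q t) - l) * sol l u v t) integrable_on {0..x}"
      by (rule integrable_on_subinterval) (use x in auto)
    thus ?thesis unfolding sol_0
      using picard_sum_v[OF coeff_int coeff_norm x, of l u v]
      by (simp add: has_integral_iff sol_def sol'_def)
  qed
  moreover have "(sol l u v has_vector_derivative sol' l u v x) (at x within {0..1})" if "x \<in> {0..1}" for x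
    unfolding sol_def sol'_def by (rule picard_has_derivative[OF coeff_int coeff_norm that])
  ultimately show ?thesis by (simp add: schrodinger_solution_def)
qed

lemma solution_unique:
  assumes "schrodinger_solution q l y1 y1'" "schrodinger_solution q l y2 y2'"
    and "y1 0 = y2 0" "y1' 0 = y2' 0" and x: "x \<in> {0..1}"
  shows "y1 x = y2 x" "y1' x = y2' x"
proof -
  have d: "((\<lambda>x. y1 x - y2 x) has_vector_derivative (y1' x - y2' x)) (at x within {0..1})" if "x \<in> {0..1}" for x
    using assms that unfolding schrodinger_solution_def by (intro derivative_intros) auto
  have i: "y1' x - y2' x = integral {0..x} (\<lambda>t. (complex_of_real (q t) - l) * (y1 t - y2 t))" if "x \<in> {0..1}" for x
  proof -
    have "((\<lambda>t. (complex_of_real (q t) - l) * y1 t - (complex_of_real (q t) - l) * y2 t)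
       has_integral ((y1' x - y1' 0) - (y2' x - y2' 0))) {0..x}"
      using assms that unfolding schrodinger_solution_def by (intro has_integral_diff) auto
    thus ?thesis using assms by (simp add: integral_unique right_diff_distrib)
  qed
  note vu = volterra_unique[OF coeff_int coeff_norm d i _ x]
  show "y1 x = y2 x" using vu(1) assms by simp
  show "y1' x = y2' x" using vu(2) assms by simp
qed

text \<open>The \<open>SOME\<close> in the definition picks an unspecified pair of functions, but
  uniqueness pins down its values on [0,1].\<close>

lemma cauchy_solution_eq:
  assumes x: "x \<in> {0..1}"
  shows "fst (cauchy_solution q l u v) x = sol l u v x" "snd (cauchy_solution q l u v) x = sol' l u v x"
proof -
  let ?P = "\<lambda>p. case p of (y, y') \<Rightarrow> schrodinger_solution q l y y' \<and> y 0 = u \<and> y' 0 = v"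
  have "?P (sol l u v, sol' l u v)" using sol_solves sol_0 by simp
  hence "?P (cauchy_solution q l u v)" unfolding cauchy_solution_def by (rule someI)
  hence "schrodinger_solution q l (fst (cauchy_solution q l u v)) (snd (cauchy_solution q l u v))"
    "fst (cauchy_solution q l u v) 0 = u" "snd (cauchy_solution q l u v) 0 = v"
    by (auto simp: case_prod_unfold)
  from solution_unique[OF this(1) sol_solves _ _ x, of u v] this(2,3)
  show "fst (cauchy_solution q l u v) x = sol l u v x" "snd (cauchy_solution q l u v) x = sol' l u v x"
    by (auto simp: sol_0)
qed

lemma solution_eq_sol:
  assumes "schrodinger_solution q l y y'" and "x \<in> {0..1}"
  shows "y x = sol l (y 0) (y' 0) x" "y' x = sol' l (y 0) (y' 0) x"
  using solution_unique[OF assms(1) sol_solves _ _ assms(2)] by (simp_all add: sol_0)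

lemma solution_lincomb:
  assumes "schrodinger_solution q l y1 y1'" "schrodinger_solution q l y2 y2'"
  shows "schrodinger_solution q l (\<lambda>x. a * y1 x + b * y2 x) (\<lambda>x. a * y1' x + b * y2' x)"
  unfolding schrodinger_solution_def
proof (intro conjI ballI)
  fix x :: real assume x: "x \<in> {0..1}"
  show "((\<lambda>x. a * y1 x + b * y2 x) has_vector_derivative a * y1' x + b * y2' x) (at x within {0..1})"
    using assms x unfolding schrodinger_solution_def by (intro derivative_intros) auto
  have "((\<lambda>t. a * ((complex_of_real (q t) - l) * y1 t) + b * ((complex_of_real (q t) - l) * y2 t))
    has_integral (a * (y1' x - y1' 0) + b * (y2' x - y2' 0))) {0..x}"
    using assms x unfolding schrodinger_solution_def
    by (intro has_integral_add has_integral_mult_right) auto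
  thus "((\<lambda>t. (complex_of_real (q t) - l) * (a * y1 t + b * y2 t)) has_integral
     a * y1' x + b * y2' x - (a * y1' 0 + b * y2' 0)) {0..x}"
    by (simp add: algebra_simps)
qed

lemma sol_lincomb:
  assumes "x \<in> {0..1}"
  shows "sol l u v x = u * sol l 1 0 x + v * sol l 0 1 x" "sol' l u v x = u * sol' l 1 0 x + v * sol' l 0 1 x"
  using solution_eq_sol[OF solution_lincomb[OF sol_solves[of l 1 0] sol_solves[of l 0 1], of u v] assms]
  by (simp_all add: sol_0)

lemma sol_cnj:
  assumes x: "x \<in> {0..1}"
  shows "sol (cnj l) (cnj u) (cnj v) x = cnj (sol l u v x)" "sol' (cnj l) (cnj u) (cnj v) x = cnj (sol' l u v x)"
proof -
  have "schrodinger_solution q (cnj l) (\<lambda>x. cnj (sol l u v x)) (\<lambda>x. cnj (sol' l u v x))"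
    unfolding schrodinger_solution_def
  proof (intro conjI ballI)
    fix x :: real assume x: "x \<in> {0..1}"
    show "((\<lambda>x. cnj (sol l u v x)) has_vector_derivative cnj (sol' l u v x)) (at x within {0..1})"
      using bounded_linear.has_vector_derivative[OF bounded_linear_cnj] sol_solves x
      unfolding schrodinger_solution_def by blast
    have "((\<lambda>t. (complex_of_real (q t) - l) * sol l u v t) has_integral (sol' l u v x - sol' l u v 0)) {0..x}"
      using sol_solves x unfolding schrodinger_solution_def by blast
    from has_integral_linear[OF this bounded_linear_cnj]
    show "((\<lambda>t. (complex_of_real (q t) - cnj l) * cnj (sol l u v t)) has_integral
         cnj (sol' l u v x) - cnj (sol' l u v 0)) {0..x}"
      by (simp add: o_def)
  qed
  from solution_eq_sol[OF this x] show "sol (cnj l) (cnj u) (cnj v) x = cnj (sol l u v x)"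
    "sol' (cnj l) (cnj u) (cnj v) x = cnj (sol' l u v x)" by (simp_all add: sol_0)
qed

lemma sol_continuous: "continuous_on {0..1} (sol l u v)" "continuous_on {0..1} (sol' l u v)"
  unfolding sol_def sol'_def by (rule picard_sum_continuous[OF coeff_int coeff_norm])+

lemma sol_ibp:
  assumes b: "0 \<le> b" "b \<le> 1"
    and w: "\<And>x. x \<in> {0..b} \<Longrightarrow> (w has_vector_derivative w' x) (at x within {0..b})"
    and w': "continuous_on {0..b} w'"
  shows "((\<lambda>t. (complex_of_real (q t) - l) * sol l u v t * w t + sol' l u v t * w' t) has_integral
     (sol' l u v b * w b - v * w 0)) {0..b}"
proof -
  have sub: "{0..b} \<subseteq> {0..1}" using b by auto
  have h: "(\<lambda>t. (complex_of_real (q t) - l) * sol l u v t) absolutely_integrable_on {0..b}"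
    using absolutely_integrable_on_subinterval[OF absolutely_integrable_mult_continuous[OF coeff_int sol_continuous(1)] sub] .
  have V: "sol' l u v x = sol' l u v 0 + integral {0..x} (\<lambda>t. (complex_of_real (q t) - l) * sol l u v t)"
    if "x \<in> {0..b}" for x
  proof -
    have "x \<in> {0..1}" using that b by auto
    hence "((\<lambda>t. (complex_of_real (q t) - l) * sol l u v t) has_integral (sol' l u v x - sol' l u v 0)) {0..x}"
      using sol_solves unfolding schrodinger_solution_def by blast
    thus ?thesis by (simp add: integral_unique)
  qed
  show ?thesis using integration_by_parts_indefinite[OF b(1) h V w w'] by (simp add: sol_0)
qed

lemma sol_vector_derivative:
  assumes "0 \<le> b" "b \<le> 1" "x \<in> {0..b}"
  shows "(sol l u v has_vector_derivative sol' l u v x) (at x within {0..b})"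
proof -
  have "(sol l u v has_vector_derivative sol' l u v x) (at x within {0..1})"
    using sol_solves assms unfolding schrodinger_solution_def by auto
  thus ?thesis by (rule has_vector_derivative_within_subset) (use assms in auto)
qed

text \<open>Integration by parts with the roles of the two solutions exchanged evaluates one and the
  same integral twice.\<close>

lemma wronskian: "sol l 1 0 1 * sol' l 0 1 1 - sol l 0 1 1 * sol' l 1 0 1 = 1"
proof -
  have "((\<lambda>t. (complex_of_real (q t) - l) * sol l 0 1 t * sol l 1 0 t + sol' l 0 1 t * sol' l 1 0 t) has_integral
     (sol' l 0 1 1 * sol l 1 0 1 - 1 * sol l 1 0 0)) {0..1}"
    by (rule sol_ibp) (auto intro: sol_vector_derivative sol_continuous)
  moreover have "((\<lambda>t. (complex_of_real (q t) - l) * sol l 1 0 t * sol l 0 1 t + sol' l 1 0 t * sol' l 0 1 t) has_integral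
     (sol' l 1 0 1 * sol l 0 1 1 - 0 * sol l 0 1 0)) {0..1}"
    by (rule sol_ibp) (auto intro: sol_vector_derivative sol_continuous)
  hence "((\<lambda>t. (complex_of_real (q t) - l) * sol l 0 1 t * sol l 1 0 t + sol' l 0 1 t * sol' l 1 0 t) has_integral
     (sol' l 1 0 1 * sol l 0 1 1 - 0 * sol l 0 1 0)) {0..1}"
    by (rule has_integral_eq[rotated]) simp
  ultimately have "sol' l 0 1 1 * sol l 1 0 1 - 1 * sol l 1 0 0 = sol' l 1 0 1 * sol l 0 1 1 - 0 * sol l 0 1 0"
    by (rule has_integral_unique)
  thus ?thesis by (simp add: sol_0 algebra_simps)
qed

text \<open>Green's identity for y and its conjugate: as \<open>q\<close> is real, the only nonreal
  part of the integrand comes from -l |y|^2.\<close>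

lemma sol_energy:
  "Im (sol' l u v 1 * cnj (sol l u v 1)) - Im (v * cnj u) =
     - Im l * integral {0..1} (\<lambda>t. (norm (sol l u v t))\<^sup>2)"
proof -
  have "((\<lambda>t. (complex_of_real (q t) - l) * sol l u v t * cnj (sol l u v t) + sol' l u v t * cnj (sol' l u v t)) has_integral
     (sol' l u v 1 * cnj (sol l u v 1) - v * cnj (sol l u v 0))) {0..1}"
  proof (rule sol_ibp)
    fix x :: real assume "x \<in> {0..1}"
    show "((\<lambda>x. cnj (sol l u v x)) has_vector_derivative cnj (sol' l u v x)) (at x within {0..1})"
      by (rule bounded_linear.has_vector_derivative[OF bounded_linear_cnj])
        (rule sol_vector_derivative, use \<open>x \<in> {0..1}\<close> in auto)
  qed (auto intro!: continuous_intros sol_continuous)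
  from has_integral_linear[OF this bounded_linear_Im]
  have "((\<lambda>t. - Im l * (norm (sol l u v t))\<^sup>2) has_integral
     Im (sol' l u v 1 * cnj (sol l u v 1) - v * cnj (sol l u v 0))) {0..1}"
    unfolding o_def
  proof (rule has_integral_eq[rotated])
    fix t
    have "(complex_of_real (q t) - l) * sol l u v t * cnj (sol l u v t) + sol' l u v t * cnj (sol' l u v t)
      = (complex_of_real (q t) - l) * of_real ((norm (sol l u v t))\<^sup>2) + of_real ((norm (sol' l u v t))\<^sup>2)"
      by (simp only: complex_norm_square mult.assoc)
    thus "Im ((complex_of_real (q t) - l) * sol l u v t * cnj (sol l u v t) + sol' l u v t * cnj (sol' l u v t)) =
      - Im l * (norm (sol l u v t))\<^sup>2"
      by (simp only: plus_complex.sel times_complex.sel minus_complex.sel Im_complex_of_real Re_complex_of_real) simp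
  qed
  from integral_unique[OF this, symmetric]
  have "Im (sol' l u v 1 * cnj (sol l u v 1) - v * cnj (sol l u v 0)) = 
     integral {0..1} (\<lambda>t. - Im l * (norm (sol l u v t))\<^sup>2)" .
  also have "\<dots> = - Im l * integral {0..1} (\<lambda>t. (norm (sol l u v t))\<^sup>2)" 
    by (rule integral_mult_right)
  finally show ?thesis by (simp only: sol_0 minus_complex.sel)
qed

end

section \<open>Analyticity in the spectral parameter\<close>

context potential
begin

text \<open>The potential enters as q - l, and each integration acts on the coefficients of the
  powers of l separately. Analyticity of the Neumann terms in l then needs no differentiation under
  an integral sign.\<close>

lemma picard_polynomial:
  "\<exists>c. (\<forall>j. continuous_on {0..1} (c j)) \<and>
     (\<forall>l. \<forall>x\<in>{0..1}. fst (picard (\<lambda>t. complex_of_real (q t) - l) u v n) x = (\<Sum>j\<le>n. l ^ j * c j x))"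
  "\<exists>c. (\<forall>j. continuous_on {0..1} (c j)) \<and>
     (\<forall>l. \<forall>x\<in>{0..1}. snd (picard (\<lambda>t. complex_of_real (q t) - l) u v n) x = (\<Sum>j\<le>n. l ^ j * c j x))"
proof -
  let ?Y = "\<lambda>l n. fst (picard (\<lambda>t. complex_of_real (q t) - l) u v n)"
  let ?V = "\<lambda>l n. snd (picard (\<lambda>t. complex_of_real (q t) - l) u v n)"
  define PY where "PY = (\<lambda>n. \<exists>c :: nat \<Rightarrow> real \<Rightarrow> complex. (\<forall>j. continuous_on {0..1} (c j)) \<and> (\<forall>l. \<forall>x\<in>{0..1}. ?Y l n x = (\<Sum>j\<le>n. l ^ j * c j x)))"
  define PV where "PV = (\<lambda>n. \<exists>c :: nat \<Rightarrow> real \<Rightarrow> complex. (\<forall>j. continuous_on {0..1} (c j)) \<and> (\<forall>l. \<forall>x\<in>{0..1}. ?V l n x = (\<Sum>j\<le>n. l ^ j * c j x)))"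
  have step_V: "PV (Suc n)" if PYn: "PY n" for n
  proof -
    obtain c :: "nat \<Rightarrow> real \<Rightarrow> complex" where c: "\<And>j. continuous_on {0..1} (c j)"
      "\<And>l x. x \<in> {0..1} \<Longrightarrow> ?Y l n x = (\<Sum>j\<le>n. l ^ j * c j x)"
      using PYn unfolding PY_def by blast
    \<comment> \<open>The coefficient of l^j in (q - l) times the sum of the l^j c_j, namely q c_j -
      c_(j-1), with absent coefficients read as 0.\<close>
    define e where "e = (\<lambda>j t. (if j \<le> n then complex_of_real (q t) * c j t else 0) - (if 1 \<le> j then c (j - 1) t else 0))"
    have e1: "(\<lambda>t. if j \<le> n then complex_of_real (q t) * c j t else 0) integrable_on {0..1}" for j
      by (cases "j \<le> n")
        (auto intro!: absolutely_integrable_imp_integrable absolutely_integrable_mult_continuous q_int c)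
    have e2: "(\<lambda>t. if 1 \<le> j then c (j - 1) t else 0) integrable_on {0..1}" for j
      by (cases "1 \<le> j") (auto intro!: integrable_continuous_real c)
    have ei: "e j integrable_on {0..1}" for j
      unfolding e_def by (intro integrable_diff e1 e2)
    have poly: "(complex_of_real (q t) - l) * ?Y l n t = (\<Sum>j\<le>Suc n. l ^ j * e j t)" if "t \<in> {0..1}" for l t
    proof -
      have "(\<Sum>j\<le>Suc n. l ^ j * e j t) = (\<Sum>j\<le>Suc n. l ^ j * (if j \<le> n then complex_of_real (q t) * c j t else 0))
        - (\<Sum>j\<le>Suc n. l ^ j * (if 1 \<le> j then c (j - 1) t else 0))"
        by (simp add: e_def right_diff_distrib sum_subtractf)
      also have "(\<Sum>j\<le>Suc n. l ^ j * (if j \<le> n then complex_of_real (q t) * c j t else 0)) =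
         (\<Sum>j\<le>n. l ^ j * (complex_of_real (q t) * c j t))" by simp
      also have "(\<Sum>j\<le>Suc n. l ^ j * (if 1 \<le> j then c (j - 1) t else 0)) = (\<Sum>j\<le>n. l ^ Suc j * c j t)"
        by (subst sum.atMost_Suc_shift) simp
      finally show ?thesis
        unfolding c(2)[OF that] sum_distrib_left sum_subtractf[symmetric]
        by (simp add: algebra_simps)
    qed
    have "?V l (Suc n) x = (\<Sum>j\<le>Suc n. l ^ j * integral {0..x} (e j))" if x: "x \<in> {0..1}" for l x
    proof -
      have sub: "{0..x} \<subseteq> {0..1}" using x by auto
      have "?V l (Suc n) x = integral {0..x} (\<lambda>t. \<Sum>j\<le>Suc n. l ^ j * e j t)"
        unfolding picard.simps snd_conv
        by (rule Henstock_Kurzweil_Integration.integral_cong) (use poly x in auto)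
      also have "\<dots> = (\<Sum>j\<le>Suc n. integral {0..x} (\<lambda>t. l ^ j * e j t))"
        by (rule Henstock_Kurzweil_Integration.integral_sum)
          (auto intro!: integrable_on_mult_right integrable_on_subinterval[OF ei sub])
      finally show ?thesis by simp
    qed
    moreover have "continuous_on {0..1} (\<lambda>x. integral {0..x} (e j))" for j
      by (intro indefinite_integral_continuous_1 ei)
    ultimately show "PV (Suc n)" unfolding PV_def
      by (intro exI[of _ "\<lambda>j x. integral {0..x} (e j)"]) auto
  qed
  have step_Y: "PY (Suc n)" if PVn: "PV (Suc n)" for n
  proof -
    obtain c :: "nat \<Rightarrow> real \<Rightarrow> complex" where c: "\<And>j. continuous_on {0..1} (c j)"
      "\<And>l x. x \<in> {0..1} \<Longrightarrow> ?V l (Suc n) x = (\<Sum>j\<le>Suc n. l ^ j * c j x)"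
      using PVn unfolding PV_def by blast
    have ci: "c j integrable_on {0..1}" for j by (intro integrable_continuous_real c)
    have "?Y l (Suc n) x = (\<Sum>j\<le>Suc n. l ^ j * integral {0..x} (c j))" if x: "x \<in> {0..1}" for l x
    proof -
      have sub: "{0..x} \<subseteq> {0..1}" using x by auto
      have "?Y l (Suc n) x = integral {0..x} (?V l (Suc n))" by simp
      also have "\<dots> = integral {0..x} (\<lambda>t. \<Sum>j\<le>Suc n. l ^ j * c j t)"
        by (rule Henstock_Kurzweil_Integration.integral_cong, rule c(2)) (use x in auto)
      also have "\<dots> = (\<Sum>j\<le>Suc n. integral {0..x} (\<lambda>t. l ^ j * c j t))"
        by (rule Henstock_Kurzweil_Integration.integral_sum)
          (auto intro!: integrable_on_mult_right integrable_on_subinterval[OF ci sub])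
      finally show ?thesis by simp
    qed
    moreover have "continuous_on {0..1} (\<lambda>x. integral {0..x} (c j))" for j
      by (intro indefinite_integral_continuous_1 ci)
    ultimately show "PY (Suc n)" unfolding PY_def
      by (intro exI[of _ "\<lambda>j x. integral {0..x} (c j)"]) auto
  qed
  have PV0: "PV 0" unfolding PV_def by (intro exI[of _ "\<lambda>_ _. v"]) auto
  have PY: "PY n" for n
  proof (induction n)
    case 0
    show ?case unfolding PY_def by (intro exI[of _ "\<lambda>_ x. u + v * of_real x"]) (auto intro!: continuous_intros)
  next
    case (Suc n)
    then show ?case using step_V step_Y by blast
  qed
  moreover have PV: "PV n" for n using PV0 PY step_V by (cases n) auto
  ultimately show "\<exists>c. (\<forall>j. continuous_on {0..1} (c j)) \<and> (\<forall>l. \<forall>x\<in>{0..1}. ?Y l n x = (\<Sum>j\<le>n. l ^ j * c j x))"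
    "\<exists>c. (\<forall>j. continuous_on {0..1} (c j)) \<and> (\<forall>l. \<forall>x\<in>{0..1}. ?V l n x = (\<Sum>j\<le>n. l ^ j * c j x))"
    unfolding PY_def PV_def by blast+
qed

lemma picard_holomorphic:
  assumes x: "x \<in> {0..1}"
  shows "(\<lambda>l. fst (picard (\<lambda>t. complex_of_real (q t) - l) u v n) x) holomorphic_on UNIV"
    and "(\<lambda>l. snd (picard (\<lambda>t. complex_of_real (q t) - l) u v n) x) holomorphic_on UNIV"
proof -
  obtain c where "\<And>l. fst (picard (\<lambda>t. complex_of_real (q t) - l) u v n) x = (\<Sum>j\<le>n. l ^ j * c j x)"
    using picard_polynomial(1)[of u v n] x by blast
  thus "(\<lambda>l. fst (picard (\<lambda>t. complex_of_real (q t) - l) u v n) x) holomorphic_on UNIV"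
    by (simp add: holomorphic_intros)
  obtain c where "\<And>l. snd (picard (\<lambda>t. complex_of_real (q t) - l) u v n) x = (\<Sum>j\<le>n. l ^ j * c j x)"
    using picard_polynomial(2)[of u v n] x by blast
  thus "(\<lambda>l. snd (picard (\<lambda>t. complex_of_real (q t) - l) u v n) x) holomorphic_on UNIV"
    by (simp add: holomorphic_intros)
qed

lemma sol_holomorphic:
  assumes x: "x \<in> {0..1}"
  shows "(\<lambda>l. sol l u v x) holomorphic_on UNIV" "(\<lambda>l. sol' l u v x) holomorphic_on UNIV"
proof -
  \<comment> \<open>One bound serves the whole disc of radius 1 about \<open>l0\<close>, so the
    Neumann series converges uniformly in l there.\<close>
  have Q: "integral {0..1} (\<lambda>t. norm (complex_of_real (q t) - l)) \<le> q_norm + norm l0 + 1"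
    if "l \<in> cball l0 1" for l l0
    using coeff_norm[of l] norm_triangle_ineq2[of l l0] that by (simp add: dist_norm norm_minus_commute)
  have lim: "uniform_limit (cball l0 1) (\<lambda>N l. \<Sum>n<N. fst (picard (\<lambda>t. complex_of_real (q t) - l) u v n) x) (\<lambda>l. sol l u v x) sequentially"
    "uniform_limit (cball l0 1) (\<lambda>N l. \<Sum>n<N. snd (picard (\<lambda>t. complex_of_real (q t) - l) u v n) x) (\<lambda>l. sol' l u v x) sequentially"
    for l0
    unfolding sol_def sol'_def picard_y_def picard_v_def
    by (rule Weierstrass_m_test[OF _ summable_picard_majorant[OF coeff_int Q[of l0 l0]]],
        rule picard_le_majorant[OF coeff_int Q x], assumption, simp)+
  show "(\<lambda>l. sol l u v x) holomorphic_on UNIV"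
    by (rule holomorphic_uniform_sequence[of _ "\<lambda>N l. \<Sum>n<N. fst (picard (\<lambda>t. complex_of_real (q t) - l) u v n) x"])
      (use lim(1) in \<open>auto intro!: holomorphic_on_sum picard_holomorphic x exI[of _ 1]\<close>)
  show "(\<lambda>l. sol' l u v x) holomorphic_on UNIV"
    by (rule holomorphic_uniform_sequence[of _ "\<lambda>N l. \<Sum>n<N. snd (picard (\<lambda>t. complex_of_real (q t) - l) u v n) x"])
      (use lim(2) in \<open>auto intro!: holomorphic_on_sum picard_holomorphic x exI[of _ 1]\<close>)
qed

end

section \<open>Asymptotics for a large spectral parameter\<close>

lemma norm_sin_cos_le_exp_Im: "norm (sin z) \<le> exp \<bar>Im z\<bar>" "norm (cos z) \<le> exp \<bar>Im z\<bar>"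
proof -
  have e: "norm (exp (\<i> * z)) \<le> exp \<bar>Im z\<bar>" "norm (exp (- (\<i> * z))) \<le> exp \<bar>Im z\<bar>" by auto
  have "norm (exp (\<i> * z) - exp (- (\<i> * z))) \<le> 2 * exp \<bar>Im z\<bar>"
    using norm_triangle_ineq4[of "exp (\<i> * z)" "exp (- (\<i> * z))"] e by linarith
  thus "norm (sin z) \<le> exp \<bar>Im z\<bar>" by (simp add: sin_exp_eq norm_divide norm_mult)
  have "norm (exp (\<i> * z) + exp (- (\<i> * z))) \<le> 2 * exp \<bar>Im z\<bar>"
    using norm_triangle_ineq[of "exp (\<i> * z)" "exp (- (\<i> * z))"] e by linarith
  thus "norm (cos z) \<le> exp \<bar>Im z\<bar>" by (simp add: cos_exp_eq norm_divide)
qed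

context potential
begin

text \<open>Variation of constants with \<lambda> = z^2: integrate by parts against sin (z (x - t))
  or cos (z (x - t)) and combine with the integrated derivative of y times the other function; the
  terms with z^2 y cancel.\<close>

lemma duhamel:
  assumes x: "0 \<le> x" "x \<le> 1"
  shows "((\<lambda>t. complex_of_real (q t) * sol (z\<^sup>2) u v t * sin (z * of_real (x - t))) has_integral
          (z * sol (z\<^sup>2) u v x - z * u * cos (z * of_real x) - v * sin (z * of_real x))) {0..x}"
    and "((\<lambda>t. complex_of_real (q t) * sol (z\<^sup>2) u v t * cos (z * of_real (x - t))) has_integral
          (sol' (z\<^sup>2) u v x + z * u * sin (z * of_real x) - v * cos (z * of_real x))) {0..x}"
proof -
  let ?y = "sol (z\<^sup>2) u v" and ?y' = "sol' (z\<^sup>2) u v"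
  have ds: "((\<lambda>t. sin (z * of_real (x - t))) has_vector_derivative - (z * cos (z * of_real (x - t)))) (at t within {0..x})" for t
    by (rule has_vector_derivative_at_within) 
       (auto intro!: derivative_eq_intros has_vector_derivative_real_field simp: mult_ac)
  have dc: "((\<lambda>t. cos (z * of_real (x - t))) has_vector_derivative (z * sin (z * of_real (x - t)))) (at t within {0..x})" for t
    by (rule has_vector_derivative_at_within) 
       (auto intro!: derivative_eq_intros has_vector_derivative_real_field simp: mult_ac)
  have cs: "continuous_on {0..x} (\<lambda>t. - (z * cos (z * of_real (x - t))))" "continuous_on {0..x} (\<lambda>t. z * sin (z * of_real (x - t)))"
    by (intro continuous_intros)+
  note dy = sol_vector_derivative[OF x]
  have 1: "((\<lambda>t. ?y' t * cos (z * of_real (x - t)) + ?y t * (z * sin (z * of_real (x - t)))) has_integral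
      (?y x * cos (z * of_real (x - x)) - ?y 0 * cos (z * of_real (x - 0)))) {0..x}"
    by (rule fundamental_theorem_of_calculus[OF x(1)])
      (use has_vector_derivative_mult[OF dy dc] in \<open>simp add: add.commute\<close>)
  have 2: "((\<lambda>t. ?y' t * sin (z * of_real (x - t)) + ?y t * - (z * cos (z * of_real (x - t)))) has_integral
      (?y x * sin (z * of_real (x - x)) - ?y 0 * sin (z * of_real (x - 0)))) {0..x}"
    by (rule fundamental_theorem_of_calculus[OF x(1)])
      (use has_vector_derivative_mult[OF dy ds] in \<open>simp add: add.commute\<close>)
  have "((\<lambda>t. ((complex_of_real (q t) - z\<^sup>2) * ?y t * sin (z * of_real (x - t)) + ?y' t * - (z * cos (z * of_real (x - t)))) +
      z * (?y' t * cos (z * of_real (x - t)) + ?y t * (z * sin (z * of_real (x - t))))) has_integral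
      ((?y' x * sin (z * of_real (x - x)) - v * sin (z * of_real (x - 0))) +
       z * (?y x * cos (z * of_real (x - x)) - ?y 0 * cos (z * of_real (x - 0))))) {0..x}"
    by (intro has_integral_add has_integral_mult_right sol_ibp x ds cs 1)
  thus "((\<lambda>t. complex_of_real (q t) * ?y t * sin (z * of_real (x - t))) has_integral
          (z * ?y x - z * u * cos (z * of_real x) - v * sin (z * of_real x))) {0..x}"
    by (simp add: sol_0 algebra_simps power2_eq_square)
  have "((\<lambda>t. ((complex_of_real (q t) - z\<^sup>2) * ?y t * cos (z * of_real (x - t)) + ?y' t * (z * sin (z * of_real (x - t)))) -
      z * (?y' t * sin (z * of_real (x - t)) + ?y t * - (z * cos (z * of_real (x - t))))) has_integral
      ((?y' x * cos (z * of_real (x - x)) - v * cos (z * of_real (x - 0))) -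
       z * (?y x * sin (z * of_real (x - x)) - ?y 0 * sin (z * of_real (x - 0))))) {0..x}"
    by (intro has_integral_diff has_integral_mult_right sol_ibp x dc cs 2)
  thus "((\<lambda>t. complex_of_real (q t) * ?y t * cos (z * of_real (x - t))) has_integral
          (?y' x + z * u * sin (z * of_real x) - v * cos (z * of_real x))) {0..x}"
    by (simp add: sol_0 algebra_simps power2_eq_square)
qed

lemma q_integral_bound:
  assumes x: "0 \<le> x" "x \<le> 1"
    and int: "((\<lambda>t. complex_of_real (q t) * y t * w t) has_integral I) {0..x}"
    and bd: "\<And>t. t \<in> {0..x} \<Longrightarrow> norm (y t * w t) \<le> B"
  shows "norm I \<le> q_norm * B"
proof -
  have B0: "0 \<le> B" using order_trans[OF norm_ge_zero bd[of 0]] x by simp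
  have sub: "{0..x} \<subseteq> {0..1}" using x by auto
  have qi: "(\<lambda>t. norm (complex_of_real (q t))) integrable_on {0..x}"
    by (rule integrable_on_subinterval[OF q_norm_int sub])
  have "norm I \<le> integral {0..x} (\<lambda>t. norm (complex_of_real (q t)) * B)"
    unfolding integral_unique[OF int, symmetric]
  proof (rule Henstock_Kurzweil_Integration.integral_norm_bound_integral)
    show "(\<lambda>t. complex_of_real (q t) * y t * w t) integrable_on {0..x}"
      using int by (rule has_integral_integrable)
    show "(\<lambda>t. norm (complex_of_real (q t)) * B) integrable_on {0..x}"
      by (intro integrable_on_mult_left qi)
    show "norm (complex_of_real (q t) * y t * w t) \<le> norm (complex_of_real (q t)) * B" if "t \<in> {0..x}" for t
      using mult_left_mono[OF bd[OF that], of "norm (complex_of_real (q t))"] by (simp only: mult.assoc norm_mult norm_ge_zero)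
  qed
  also have "\<dots> = integral {0..x} (\<lambda>t. norm (complex_of_real (q t))) * B" by (rule integral_mult_left)
  also have "\<dots> \<le> q_norm * B" unfolding q_norm_def
    by (intro mult_right_mono B0 integral_subset_le sub qi q_norm_int) auto
  finally show ?thesis .
qed

text \<open>At a maximum point x of |y| e^(-|Im z| x), with maximum m, the integral in Duhamel's
  formula is at most q_norm m e^(|Im z| x), since the exponentials of t and x - t multiply to that
  of x. As |z| >= 2 q_norm, half of |z| m absorbs it.\<close>

lemma sol_large_bound:
  assumes z: "norm z \<ge> 2 * q_norm" "z \<noteq> 0"
  obtains m where "m \<le> 2 * norm u + 2 * norm v / norm z"
    "\<And>x. x \<in> {0..1} \<Longrightarrow> norm (sol (z\<^sup>2) u v x) \<le> m * exp (\<bar>Im z\<bar> * x)" "m \<ge> 0"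
proof -
  let ?k = "\<bar>Im z\<bar>"
  let ?f = "\<lambda>x. norm (sol (z\<^sup>2) u v x) * exp (- (?k * x))"
  have "continuous_on {0..1} ?f" by (intro continuous_intros sol_continuous)
  then obtain x where x: "x \<in> {0..1}" and mx: "\<And>t. t \<in> {0..1} \<Longrightarrow> ?f t \<le> ?f x"
    using continuous_attains_sup[of "{0..1}" ?f] by auto
  define m where "m = ?f x"
  have m: "norm (sol (z\<^sup>2) u v t) \<le> m * exp (?k * t)" if "t \<in> {0..1}" for t
    using mx[OF that] by (simp add: m_def exp_minus field_simps)
  have m0: "m \<ge> 0" by (simp add: m_def)
  have Im_eq: "\<bar>Im (z * of_real s)\<bar> = ?k * s" if "s \<ge> 0" for s using that by (simp add: abs_mult)
  have I: "norm (z * sol (z\<^sup>2) u v x - z * u * cos (z * of_real x) - v * sin (z * of_real x)) \<le> q_norm * (m * exp (?k * x))"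
  proof (rule q_integral_bound[OF _ _ duhamel(1)])
    fix t assume t: "t \<in> {0..x}"
    have "norm (sol (z\<^sup>2) u v t * sin (z * of_real (x - t))) \<le> (m * exp (?k * t)) * exp (?k * (x - t))"
      unfolding norm_mult using t x m0 norm_sin_cos_le_exp_Im(1)[of "z * of_real (x - t)"] Im_eq[of "x - t"]
      by (intro mult_mono m) auto
    also have "\<dots> = m * exp (?k * x)" by (simp add: algebra_simps flip: exp_add)
    finally show "norm (sol (z\<^sup>2) u v t * sin (z * of_real (x - t))) \<le> m * exp (?k * x)" .
  qed (use x in auto)
  have "norm z * norm (sol (z\<^sup>2) u v x) \<le> norm (z * sol (z\<^sup>2) u v x - z * u * cos (z * of_real x) - v * sin (z * of_real x))
      + norm (z * u * cos (z * of_real x)) + norm (v * sin (z * of_real x))"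
    unfolding norm_mult[symmetric] by norm
  also have "\<dots> \<le> q_norm * (m * exp (?k * x)) + norm z * norm u * exp (?k * x) + norm v * exp (?k * x)"
    using norm_sin_cos_le_exp_Im[of "z * of_real x"] Im_eq[of x] x
    by (intro add_mono I) (auto simp: norm_mult mult.assoc intro!: mult_left_mono)
  finally have "norm z * norm (sol (z\<^sup>2) u v x) \<le> (q_norm * m + norm z * norm u + norm v) * exp (?k * x)"
    by (simp add: algebra_simps)
  moreover have "norm (sol (z\<^sup>2) u v x) = m * exp (?k * x)" by (simp add: m_def exp_minus)
  ultimately have "norm z * m \<le> q_norm * m + norm z * norm u + norm v" by simp
  moreover have "q_norm * m \<le> norm z / 2 * m" using z m0 by (intro mult_right_mono) auto
  ultimately have "norm z * m / 2 \<le> norm z * norm u + norm v" by (simp add: algebra_simps)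
  hence "m \<le> 2 * norm u + 2 * norm v / norm z" using z by (simp add: field_simps)
  with m m0 show ?thesis using that by blast
qed

lemma diagonal_asymptotics:
  assumes z: "norm z \<ge> 2 * q_norm" "z \<noteq> 0"
  shows "norm (sol (z\<^sup>2) 1 0 1 - cos z) \<le> 2 * q_norm * exp \<bar>Im z\<bar> / norm z"
    and "norm (sol' (z\<^sup>2) 0 1 1 - cos z) \<le> 2 * q_norm * exp \<bar>Im z\<bar> / norm z"
proof -
  let ?k = "\<bar>Im z\<bar>"
  have Im_eq: "\<bar>Im (z * of_real s)\<bar> = ?k * s" if "s \<ge> 0" for s using that by (simp add: abs_mult)
  have bd: "norm (w t * f (z * of_real (1 - t))) \<le> m * exp ?k"
    if "f = sin \<or> f = cos" "\<And>x. x \<in> {0..1} \<Longrightarrow> norm (w x) \<le> m * exp (?k * x)" "t \<in> {0..1}" "m \<ge> 0" for w f m t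
  proof -
    have f: "norm (f w) \<le> exp \<bar>Im w\<bar>" for w using that(1) norm_sin_cos_le_exp_Im by blast
    have "norm (w t * f (z * of_real (1 - t))) \<le> (m * exp (?k * t)) * exp (?k * (1 - t))"
      unfolding norm_mult using f[of "z * of_real (1 - t)"] Im_eq[of "1 - t"] that
      by (intro mult_mono) auto
    also have "\<dots> = m * exp ?k" by (simp add: algebra_simps flip: exp_add)
    finally show ?thesis .
  qed
  obtain m where m: "m \<le> 2" "\<And>x. x \<in> {0..1} \<Longrightarrow> norm (sol (z\<^sup>2) 1 0 x) \<le> m * exp (\<bar>Im z\<bar> * x)" "m \<ge> 0"
    using sol_large_bound[OF z, of 1 0] by auto
  have "norm (z * sol (z\<^sup>2) 1 0 1 - z * 1 * cos (z * of_real 1) - 0 * sin (z * of_real 1)) \<le> q_norm * (m * exp ?k)"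
    by (rule q_integral_bound[OF _ _ duhamel(1)]) (use bd[of sin "sol (z\<^sup>2) 1 0" m] m in auto)
  also have "\<dots> \<le> q_norm * (2 * exp ?k)" using m q_norm_nonneg by (intro mult_left_mono mult_right_mono) auto
  also have "z * sol (z\<^sup>2) 1 0 1 - z * 1 * cos (z * of_real 1) - 0 * sin (z * of_real 1) = z * (sol (z\<^sup>2) 1 0 1 - cos z)"
    by (simp add: right_diff_distrib)
  finally have "norm z * norm (sol (z\<^sup>2) 1 0 1 - cos z) \<le> 2 * q_norm * exp ?k"
    by (simp only: norm_mult mult_ac)
  thus "norm (sol (z\<^sup>2) 1 0 1 - cos z) \<le> 2 * q_norm * exp \<bar>Im z\<bar> / norm z"
    using z by (simp add: pos_le_divide_eq mult.commute)
  obtain m where m: "m \<le> 2 / norm z" "\<And>x. x \<in> {0..1} \<Longrightarrow> norm (sol (z\<^sup>2) 0 1 x) \<le> m * exp (\<bar>Im z\<bar> * x)" "m \<ge> 0"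
    using sol_large_bound[OF z, of 0 1] by auto
  have "norm (sol' (z\<^sup>2) 0 1 1 + z * 0 * sin (z * of_real 1) - 1 * cos (z * of_real 1)) \<le> q_norm * (m * exp ?k)"
    by (rule q_integral_bound[OF _ _ duhamel(2)]) (use bd[of cos "sol (z\<^sup>2) 0 1" m] m in auto)
  also have "\<dots> \<le> q_norm * (2 / norm z * exp ?k)" using m q_norm_nonneg by (intro mult_left_mono mult_right_mono) auto
  finally show "norm (sol' (z\<^sup>2) 0 1 1 - cos z) \<le> 2 * q_norm * exp \<bar>Im z\<bar> / norm z"
    by (simp add: mult_ac)
qed

end

section \<open>The function F and the Kirchhoff problem on the graph\<close>

context potential
begin

definition "edge_A l = sol l 1 0 1"
definition "edge_B l = sol l 0 1 1"
definition "edge_C l = sol' l 1 0 1"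
definition "edge_D l = sol' l 0 1 1"

lemmas edge_defs = edge_A_def edge_B_def edge_C_def edge_D_def

text \<open>9 \<Delta>^2 - \<Delta>_-^2 is a difference of squares with the factors 3 \<Delta> -
  \<Delta>_- = 2A + D and 3 \<Delta> + \<Delta>_- = A + 2D.\<close>

lemma F_factorization: "F q l = ((2 * edge_A l + edge_D l) * (edge_A l + 2 * edge_D l) - 5) / 4"
  by (simp add: F_def Delta_def Delta_minus_def theta_def phi'_def cauchy_solution_eq edge_defs
       power2_eq_square field_simps)

lemma F_holomorphic: "F q holomorphic_on UNIV"
  unfolding F_factorization[abs_def] edge_defs by (intro holomorphic_intros sol_holomorphic) auto

lemma F_cnj: "F q (cnj l) = cnj (F q l)"
  using sol_cnj[of 1 l 1 0] sol_cnj[of 1 l 0 1] by (simp add: F_factorization edge_defs)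

lemma edge_det: "edge_A l * edge_D l - edge_B l * edge_C l = 1"
  using wronskian[of l] by (simp add: edge_defs)

lemma sol_zero_if_energy_zero:
  assumes "integral {0..1} (\<lambda>t. (norm (sol l u v t))\<^sup>2) = 0" "x \<in> {0..1}"
  shows "sol l u v x = 0"
proof -
  have c: "continuous_on {0..1} (\<lambda>t. (norm (sol l u v t))\<^sup>2)" by (intro continuous_intros sol_continuous)
  have "\<forall>x\<in>{0..1}. (norm (sol l u v x))\<^sup>2 = 0"
    using integral_eq_0_iff[OF c] assms(1) by simp
  thus ?thesis using assms(2) by simp
qed

lemma sol_nontrivial:
  assumes "\<And>x. x \<in> {0..1} \<Longrightarrow> sol l u v x = 0"
  shows "u = 0" "v = 0"
proof -
  show "u = 0" using assms[of 0] by (simp add: sol_0)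
  have v: "sol' l u v x = v" if x: "x \<in> {0..1}" for x
  proof -
    have "((\<lambda>t. (complex_of_real (q t) - l) * sol l u v t) has_integral (sol' l u v x - sol' l u v 0)) {0..x}"
      using sol_solves x unfolding schrodinger_solution_def by blast
    moreover have "((\<lambda>t. (complex_of_real (q t) - l) * sol l u v t) has_integral 0) {0..x}"
      by (rule has_integral_eq[OF _ has_integral_0]) (use assms x in auto)
    ultimately have "sol' l u v x - sol' l u v 0 = 0" by (rule has_integral_unique)
    thus ?thesis by (simp add: sol_0)
  qed
  have "(sol' l u v has_integral (sol l u v 1 - sol l u v 0)) {0..1}"
    by (rule fundamental_theorem_of_calculus) (auto intro: sol_vector_derivative)
  moreover have "(sol' l u v has_integral v) {0..1}"
    by (rule has_integral_eq[of _ "\<lambda>_. v"]) (use v has_integral_const_real[of v 0 1] in auto)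
  ultimately have "sol l u v 1 - sol l u v 0 = v" by (rule has_integral_unique)
  thus "v = 0" using assms[of 0] assms[of 1] by simp
qed

lemma energy_nonneg: "0 \<le> integral {0..1} (\<lambda>t. (norm (sol l u v t))\<^sup>2)"
  by (intro integral_nonneg integrable_continuous_real continuous_intros sol_continuous) auto

text \<open>A zero of \<open>edge_B\<close> is a Dirichlet eigenvalue, and the energy identity
  excludes a nonreal one.\<close>

lemma edge_B_nonzero:
  assumes "Im l \<noteq> 0"
  shows "edge_B l \<noteq> 0"
proof
  assume "edge_B l = 0"
  hence "Im l * integral {0..1} (\<lambda>t. (norm (sol l 0 1 t))\<^sup>2) = 0"
    using sol_energy[of l 0 1] by (simp add: edge_B_def)
  hence "sol l 0 1 x = 0" if "x \<in> {0..1}" for x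
    using assms sol_zero_if_energy_zero that by (metis mult_eq_0_iff)
  from sol_nontrivial(2)[OF this] show False by simp
qed

text \<open>
  The boundary form of the solution on one edge of the graph with the values \<open>u\<close> and \<open>w\<close> at the end
  points.
\<close>

definition edge_form :: "complex \<Rightarrow> complex \<Rightarrow> complex \<Rightarrow> complex" where
  "edge_form l u w =
     ((edge_D l * w - u) * cnj w - (w - edge_A l * u) * cnj u) / edge_B l"

text \<open>\<open>v\<close> is the initial slope of the solution y with end values u and w. The
  form is then the boundary term y'(1) cnj (y 1) - y'(0) cnj (y 0) of the energy identity, and
  \<open>N\<close> is the integral of |y|^2.\<close>

lemma edge_form_Im:
  assumes l: "Im l \<noteq> 0"
  obtains N where "Im (edge_form l u w) = - Im l * N" "N \<ge> 0" "N = 0 \<Longrightarrow> u = 0 \<and> w = 0"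
proof -
  note B = edge_B_nonzero[OF l]
  define v where "v = (w - edge_A l * u) / edge_B l"
  have y1: "sol l u v 1 = w"
    using B sol_lincomb(1)[of 1 l u v] by (simp add: v_def edge_A_def[symmetric] edge_B_def[symmetric])
  have "sol' l u v 1 = u * edge_C l + v * edge_D l"
    using sol_lincomb(2)[of 1 l u v] by (simp add: edge_defs)
  hence "edge_B l * sol' l u v 1 = u * (edge_B l * edge_C l) + (w - edge_A l * u) * edge_D l"
    using B by (simp add: v_def field_simps)
  also have "edge_B l * edge_C l = edge_A l * edge_D l - 1" using edge_det[of l] by (simp add: algebra_simps)
  finally have "edge_B l * sol' l u v 1 = edge_D l * w - u" by (simp add: algebra_simps)
  hence y2: "sol' l u v 1 = (edge_D l * w - u) / edge_B l" using B by (simp add: field_simps)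
  have "edge_form l u w = sol' l u v 1 * cnj (sol l u v 1) - v * cnj u"
    unfolding edge_form_def y1 y2 by (simp add: v_def diff_divide_distrib left_diff_distrib)
  hence "Im (edge_form l u w) = - Im l * integral {0..1} (\<lambda>t. (norm (sol l u v t))\<^sup>2)"
    using sol_energy[of l u v] by simp
  moreover have "u = 0 \<and> w = 0" if "integral {0..1} (\<lambda>t. (norm (sol l u v t))\<^sup>2) = 0"
    using sol_zero_if_energy_zero[OF that, of 0] sol_zero_if_energy_zero[OF that, of 1] y1 by (simp add: sol_0)
  ultimately show ?thesis using that energy_nonneg by blast
qed

text \<open>
  If $4 F(\lambda) + 5 = z^2$ with $z = 1 + 2 \cos \alpha \in [0,3]$, the vertex values \<open>u\<close>, \<open>w\<close> below
  satisfy the Kirchhoff conditions of a degree three graph with Bloch phases $1, e^{\pm i \alpha}$, so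
  that \<open>\<lambda>\<close> is an eigenvalue of a self-adjoint operator.
\<close>

lemma F_nonreal:
  assumes l: "Im l \<noteq> 0" and f: "f \<in> {-5/4..1}"
  shows "F q l \<noteq> of_real f"
proof
  assume Ff: "F q l = of_real f"
  define z where "z = sqrt (4 * f + 5)"
  have z0: "0 \<le> z" using f by (simp add: z_def)
  have zz: "z * z = 4 * f + 5" using f by (simp add: z_def)
  have z3: "z \<le> 3" using f by (auto simp: z_def intro!: real_le_lsqrt)
  define \<alpha> where "\<alpha> = arccos ((z - 1) / 2)"
  define \<epsilon> where "\<epsilon> = cis \<alpha>"
  have "cos \<alpha> = (z - 1) / 2" unfolding \<alpha>_def by (rule cos_arccos) (use z0 z3 in auto)
  hence eps: "1 + \<epsilon> + cnj \<epsilon> = of_real z" by (simp add: \<epsilon>_def complex_eq_iff)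
  have eps1: "\<epsilon> * cnj \<epsilon> = 1" by (simp add: \<epsilon>_def cis_cnj cis_mult)
  hence eps0: "\<epsilon> \<noteq> 0" by auto
  let ?A = "edge_A l" and ?B = "edge_B l" and ?D = "edge_D l"
  have det: "(2 * ?A + ?D) * (?A + 2 * ?D) = of_real z * of_real z"
  proof -
    have "(2 * ?A + ?D) * (?A + 2 * ?D) = of_real (4 * f + 5)"
      using Ff by (simp add: F_factorization divide_eq_eq diff_eq_eq)
    thus ?thesis by (simp only: zz[symmetric] of_real_mult)
  qed
  \<comment> \<open>A homogeneous linear system whose determinant (2A + D)(A + 2D) - z^2 vanishes;
    the case distinction supplies a nonzero solution.\<close>
  obtain u w where uw: "(2 * ?A + ?D) * u = of_real z * w" "(?A + 2 * ?D) * w = of_real z * u" "u \<noteq> 0 \<or> w \<noteq> 0"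
  proof (cases "z = 0 \<and> 2 * ?A + ?D = 0")
    case True
    thus ?thesis using that[of 1 0] by simp
  next
    case False
    thus ?thesis using that[of "of_real z" "2 * ?A + ?D"] det by (auto simp: mult_ac)
  qed
  obtain N1 where N1: "Im (edge_form l w u) = - Im l * N1" "N1 \<ge> 0" "N1 = 0 \<Longrightarrow> w = 0 \<and> u = 0"
    using edge_form_Im[OF l, of w u] by blast
  obtain N2 where N2: "Im (edge_form l u (\<epsilon> * w)) = - Im l * N2" "N2 \<ge> 0"
    using edge_form_Im[OF l, of u "\<epsilon> * w"] by blast
  obtain N3 where N3: "Im (edge_form l u (cnj \<epsilon> * w)) = - Im l * N3" "N3 \<ge> 0"
    using edge_form_Im[OF l, of u "cnj \<epsilon> * w"] by blast
  have form: "edge_form l u w * ?B = (?D * w - u) * cnj w - (w - ?A * u) * cnj u" for u w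
    using edge_B_nonzero[OF l] by (simp add: edge_form_def)
  \<comment> \<open>The three edges at a vertex: one runs from w to u, two run from u to w with
    phases \<epsilon> and cnj \<epsilon>. As |\<epsilon>| = 1, the phases drop out of the diagonal
    terms and contribute 1 + \<epsilon> + cnj \<epsilon> = z to the mixed ones.\<close>
  have "(edge_form l w u + edge_form l u (\<epsilon> * w) + edge_form l u (cnj \<epsilon> * w)) * ?B =
     (2 * ?A + ?D) * u * cnj u + (?A + ?D * (\<epsilon> * cnj \<epsilon>) + ?D * (\<epsilon> * cnj \<epsilon>)) * w * cnj w
      - (1 + \<epsilon> + cnj \<epsilon>) * (w * cnj u + u * cnj w)"
    unfolding distrib_right[of _ _ ?B] form by (simp add: algebra_simps)
  also have "\<dots> = ((2 * ?A + ?D) * u) * cnj u + ((?A + 2 * ?D) * w) * cnj w - of_real z * (w * cnj u + u * cnj w)"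
    unfolding eps eps1 by (simp add: algebra_simps)
  also have "\<dots> = 0" unfolding uw(1,2) by (simp add: algebra_simps)
  finally have "edge_form l w u + edge_form l u (\<epsilon> * w) + edge_form l u (cnj \<epsilon> * w) = 0"
    using edge_B_nonzero[OF l] by simp
  hence "Im (edge_form l w u) + Im (edge_form l u (\<epsilon> * w)) + Im (edge_form l u (cnj \<epsilon> * w)) = 0"
    by (simp flip: plus_complex.sel)
  hence "Im l * (N1 + N2 + N3) = 0" unfolding N1(1) N2(1) N3(1) by (simp add: algebra_simps)
  \<comment> \<open>All three energies are nonnegative, so that of the first edge is 0, which forces
    u = w = 0.\<close>
  hence "N1 + N2 + N3 = 0" using l by simp
  with N1(2) N2(2) N3(2) have "N1 = 0" by linarith
  with N1(3) uw(3) show False by blast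
qed

text \<open>The deviations \<alpha> and \<delta> of the diagonal entries from cos z, of relative
  size e, enter linearly with a factor cos z and quadratically. As e <= 1, e^2 is at most e, and 2/9
  (18 + 9) e = 6 e gives the constant 12 q_norm/|z|.\<close>

lemma F_asymptotics:
  assumes z: "norm z \<ge> 2 * q_norm + 1"
  shows "norm ((8 * F q (z\<^sup>2) + 1) / 9 - cos (2 * z)) \<le> 12 * q_norm * exp (2 * \<bar>Im z\<bar>) / norm z"
proof -
  have z': "norm z \<ge> 2 * q_norm" "z \<noteq> 0" using z q_norm_nonneg by auto
  define e where "e = 2 * q_norm / norm z"
  let ?k = "exp \<bar>Im z\<bar>"
  define \<alpha> \<delta> where "\<alpha> = edge_A (z\<^sup>2) - cos z" and "\<delta> = edge_D (z\<^sup>2) - cos z"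
  have e: "e \<le> 1" "e \<ge> 0" using z' q_norm_nonneg by (auto simp: e_def divide_le_eq_1)
  have a: "norm \<alpha> \<le> e * ?k" "norm \<delta> \<le> e * ?k"
    using diagonal_asymptotics[OF z'] by (simp_all add: \<alpha>_def \<delta>_def edge_defs e_def)
  have "(8 * F q (z\<^sup>2) + 1) / 9 - cos (2 * z) = 2 / 9 * (9 * (cos z * (\<alpha> + \<delta>)) + (2 * \<alpha> + \<delta>) * (\<alpha> + 2 * \<delta>))"
  proof -
    have A: "edge_A (z\<^sup>2) = cos z + \<alpha>" "edge_D (z\<^sup>2) = cos z + \<delta>" by (simp_all add: \<alpha>_def \<delta>_def)
    show ?thesis unfolding F_factorization A cos_double_cos by (simp add: field_simps power2_eq_square)
  qed
  also have "norm \<dots> \<le> 2 / 9 * (9 * (?k * (e * ?k + e * ?k)) + (2 * (e * ?k) + e * ?k) * (e * ?k + 2 * (e * ?k)))"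
    unfolding norm_mult
  proof (intro mult_mono order_trans[OF norm_triangle_ineq] add_mono)
    show "norm (9 * (cos z * (\<alpha> + \<delta>))) \<le> 9 * (?k * (e * ?k + e * ?k))"
      unfolding norm_mult using e
      by (intro mult_mono order_trans[OF norm_triangle_ineq] add_mono a norm_sin_cos_le_exp_Im) auto
    show "norm ((2 * \<alpha> + \<delta>) * (\<alpha> + 2 * \<delta>)) \<le> (2 * (e * ?k) + e * ?k) * (e * ?k + 2 * (e * ?k))"
      unfolding norm_mult using e a
      by (intro mult_mono order_trans[OF norm_triangle_ineq] add_mono a) (auto simp: norm_mult)
  qed (use e in auto)
  also have "\<dots> = 2 / 9 * (18 * e + 9 * (e * e)) * (?k * ?k)" by (simp add: algebra_simps)
  also have "\<dots> \<le> 2 / 9 * (18 * e + 9 * e) * (?k * ?k)"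
    using e mult_left_mono[OF e(1) e(2)] by (intro mult_right_mono mult_left_mono) auto
  also have "\<dots> = 12 * q_norm * exp (2 * \<bar>Im z\<bar>) / norm z" by (simp add: e_def exp_add[symmetric] mult_ac)
  finally show ?thesis .
qed

end

section \<open>The zero potential\<close>

lemma potential_zero: "potential (\<lambda>_. 0)" by unfold_locales (simp add: absolutely_integrable_on_def)

text \<open>Here the error constant of the asymptotic estimate is 0, so the estimate is an identity
  for |z| >= 1; analytic continuation extends it to all z.\<close>

lemma F_zero_potential: "F (\<lambda>_. 0) (z\<^sup>2) = (9 * cos (2 * z) - 1) / 8"
proof -
  interpret potential "\<lambda>_. 0" by (rule potential_zero)
  have q0: "q_norm = 0" by (simp add: q_norm_def)
  have *: "F (\<lambda>_. 0) (z\<^sup>2) = (9 * cos (2 * z) - 1) / 8" if "norm z \<ge> 1" for z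
    using F_asymptotics[of z] that q0 by (simp add: field_simps)
  have "F (\<lambda>_. 0) (z\<^sup>2) - (9 * cos (2 * z) - 1) / 8 = 0"
  proof (rule analytic_continuation_open[of "- cball 0 1" UNIV "\<lambda>z. F (\<lambda>_. 0) (z\<^sup>2) - (9 * cos (2 * z) - 1) / 8" "\<lambda>_. 0"])
    show "- cball 0 1 \<noteq> ({} :: complex set)"
    proof -
      have "(2::complex) \<in> - cball 0 1" by simp
      thus ?thesis by blast
    qed
    have "F (\<lambda>_. 0) \<circ> (\<lambda>z. z\<^sup>2) holomorphic_on UNIV"
      by (rule holomorphic_on_compose_gen[OF _ F_holomorphic]) (auto intro!: holomorphic_intros)
    thus "(\<lambda>z. F (\<lambda>_. 0) (z\<^sup>2) - (9 * cos (2 * z) - 1) / 8) holomorphic_on UNIV"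
      unfolding o_def by (intro holomorphic_intros) auto
  qed (use * in \<open>auto intro!: holomorphic_intros\<close>)
  thus ?thesis by simp
qed

section \<open>Critical points and intervals of monotonicity\<close>

lemma Re_has_real_derivative:
  assumes "(g has_field_derivative g') (at (complex_of_real x))"
  shows "((\<lambda>x. Re (g (complex_of_real x))) has_real_derivative Re g') (at x)"
proof -
  have "((\<lambda>x. g (complex_of_real x)) has_vector_derivative g') (at x)"
    using has_vector_derivative_real_field[OF assms] by simp
  from bounded_linear.has_vector_derivative[OF bounded_linear_Re this]
  show ?thesis by (simp add: has_real_derivative_iff_has_vector_derivative)
qed

text \<open>The element c n has exactly n smaller elements in the range, so the range determines the
  index.\<close>

lemma strict_mono_nat_range_unique:
  fixes c d :: "nat \<Rightarrow> real"
  assumes c: "strict_mono c" and d: "strict_mono d" and r: "range c = range d"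
  shows "c = d"
proof
  fix n
  have rank: "card {w \<in> range c. w < c n} = n" if c: "strict_mono c" for c :: "nat \<Rightarrow> real" and n
  proof -
    have "{w \<in> range c. w < c n} = c ` {..<n}" using strict_mono_less[OF c] by auto
    moreover have "inj_on c {..<n}" using strict_mono_imp_inj_on[OF c] inj_on_subset by blast
    ultimately show ?thesis by (simp add: card_image)
  qed
  obtain m where m: "c n = d m" using r by (metis rangeE rangeI)
  hence "n = m" using rank[OF c, of n] rank[OF d, of m] r by simp
  thus "c n = d n" using m by simp
qed

text \<open>The enumeration is the inverse of the rank, the number of smaller elements. No rank is
  skipped: an element of positive rank has a predecessor, the maximum of a finite set, whose rank is
  one less.\<close>

lemma strict_mono_enumeration_exists:
  fixes Z :: "real set"
  assumes fin: "\<And>y. finite {z \<in> Z. z \<le> y}" and unb: "\<And>y. \<exists>z\<in>Z. y < z"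
  obtains c :: "nat \<Rightarrow> real" where "strict_mono c" "range c = Z"
proof -
  define rk where "rk = (\<lambda>z. card {w \<in> Z. w < z})"
  have fin': "finite {w \<in> Z. w < z}" for z by (rule finite_subset[OF _ fin[of z]]) auto
  have mono: "rk z < rk z'" if "z < z'" "z \<in> Z" for z z'
    unfolding rk_def by (rule psubset_card_mono[OF fin']) (use that in auto)
  have down: "n \<in> rk ` Z" if "n < rk z" "z \<in> Z" for n z
    using that
  proof (induction "rk z" arbitrary: z)
    case 0
    then show ?case by simp
  next
    case (Suc m)
    let ?S = "{w \<in> Z. w < z}"
    have ne: "?S \<noteq> {}" using Suc.hyps(2) unfolding rk_def by (metis card.empty nat.distinct(1))
    define w where "w = Max ?S"
    have w: "w \<in> Z" "w < z" "\<And>v. v \<in> Z \<Longrightarrow> v < z \<Longrightarrow> v \<le> w"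
      using Max_in[OF fin' ne] Max_ge[OF fin'] by (auto simp: w_def)
    have "?S = insert w {v \<in> Z. v < w}" using w by force
    hence "rk z = Suc (rk w)" using fin'[of w] by (simp add: rk_def)
    thus ?case using Suc w by (cases "n = m") auto
  qed
  have inj: "inj_on rk Z"
    by (rule inj_onI) (metis linorder_neqE mono nat_neq_iff)
  have "infinite Z"
  proof
    assume f: "finite Z"
    obtain z where "z \<in> Z" "Max (insert 0 Z) < z" using unb by blast
    thus False using Max_ge[of "insert 0 Z" z] f by auto
  qed
  hence "infinite (rk ` Z)" using inj finite_imageD by blast
  hence surj: "n \<in> rk ` Z" for n
    using down by (metis imageE infinite_nat_iff_unbounded)
  define c where "c = inv_into Z rk"
  have c: "c n \<in> Z" "rk (c n) = n" for n
    using surj[of n] by (auto simp: c_def inv_into_into f_inv_into_f)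
  have "strict_mono c"
  proof (rule strict_monoI)
    fix m n :: nat assume "m < n"
    thus "c m < c n" using mono[of "c n" "c m"] c by (metis linorder_neqE not_less_iff_gr_or_eq)
  qed
  moreover have "range c = Z"
  proof
    show "Z \<subseteq> range c"
    proof
      fix z assume "z \<in> Z"
      hence "c (rk z) = z" using inv_into_f_f[OF inj] by (simp add: c_def)
      thus "z \<in> range c" by (metis rangeI)
    qed
  qed (use c in auto)
  ultimately show ?thesis using that by blast
qed

section \<open>Entire functions of cosine type with real level sets\<close>

text \<open>These four properties are all that is used about \<open>F\<close> for a general
  potential. They hold for q and for 0 alike, so every result below is available for both and the
  comparison can be made between two instances.\<close>

locale band_function =
  fixes \<Phi> :: "complex \<Rightarrow> complex"
  assumes hol: "\<Phi> holomorphic_on UNIV"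
    and cnj: "\<And>l. \<Phi> (cnj l) = cnj (\<Phi> l)"
    and nonreal: "\<And>l f. Im l \<noteq> 0 \<Longrightarrow> f \<in> {-5/4..1} \<Longrightarrow> \<Phi> l \<noteq> of_real f"
    and asym: "\<exists>C R. \<forall>z. R \<le> norm z \<longrightarrow>
      norm ((8 * \<Phi> (z\<^sup>2) + 1) / 9 - cos (2 * z)) \<le> C * exp (2 * \<bar>Im z\<bar>) / norm z"
begin

definition "\<phi> x = Re (\<Phi> (complex_of_real x))"
definition "d\<phi> x = Re (deriv \<Phi> (complex_of_real x))"
definition "dd\<phi> x = Re (deriv (deriv \<Phi>) (complex_of_real x))"

lemma deriv_hol: "deriv \<Phi> holomorphic_on UNIV"
  using hol holomorphic_deriv by blast

lemma has_deriv: "(\<Phi> has_field_derivative deriv \<Phi> l) (at l)"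
  "(deriv \<Phi> has_field_derivative deriv (deriv \<Phi>) l) (at l)"
  using hol deriv_hol holomorphic_derivI by blast+

lemma deriv_cnj: "deriv \<Phi> (cnj l) = cnj (deriv \<Phi> l)"
proof -
  have e: "cnj \<circ> \<Phi> \<circ> cnj = \<Phi>" by (auto simp: cnj)
  have "(\<Phi> has_field_derivative cnj (deriv \<Phi> l)) (at (cnj l))"
    using has_field_derivative_cnj_cnj[of \<Phi> "deriv \<Phi> l" "cnj l"] has_deriv(1)[of l] unfolding e by simp
  thus ?thesis by (rule DERIV_imp_deriv)
qed

lemma deriv_deriv_cnj: "deriv (deriv \<Phi>) (cnj l) = cnj (deriv (deriv \<Phi>) l)"
proof -
  have e: "cnj \<circ> deriv \<Phi> \<circ> cnj = deriv \<Phi>" by (auto simp: deriv_cnj)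
  have "(deriv \<Phi> has_field_derivative cnj (deriv (deriv \<Phi>) l)) (at (cnj l))"
    using has_field_derivative_cnj_cnj[of "deriv \<Phi>" "deriv (deriv \<Phi>) l" "cnj l"] has_deriv(2)[of l] unfolding e by simp
  thus ?thesis by (rule DERIV_imp_deriv)
qed

lemma on_reals: "\<Phi> (of_real x) = of_real (\<phi> x)" "deriv \<Phi> (of_real x) = of_real (d\<phi> x)"
  "deriv (deriv \<Phi>) (of_real x) = of_real (dd\<phi> x)"
  using cnj[of "of_real x"] deriv_cnj[of "of_real x"] deriv_deriv_cnj[of "of_real x"]
  by (auto simp: \<phi>_def d\<phi>_def dd\<phi>_def complex_eq_iff)

lemma \<phi>_deriv: "(\<phi> has_real_derivative d\<phi> x) (at x)" "(d\<phi> has_real_derivative dd\<phi> x) (at x)"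
  unfolding \<phi>_def[abs_def] d\<phi>_def[abs_def] dd\<phi>_def
  by (rule Re_has_real_derivative has_deriv)+

lemma \<phi>_continuous: "continuous_on S \<phi>" "continuous_on S d\<phi>"
  using \<phi>_deriv by (meson DERIV_continuous_on DERIV_subset top_greatest)+

text \<open>In z = sqrt \<lambda> the bound is exponential of type 2, so the order in \<lambda> is
  at most 1/2. A single constant serves as factor and in the exponent, which is the form expected by
  the expansion over zeros.\<close>

lemma growth: "\<exists>C. \<forall>l. norm (\<Phi> l - of_real f) \<le> C * exp (C * sqrt (norm l))"
proof -
  obtain C R where CR: "\<And>z. R \<le> norm z \<Longrightarrow>
      norm ((8 * \<Phi> (z\<^sup>2) + 1) / 9 - cos (2 * z)) \<le> C * exp (2 * \<bar>Im z\<bar>) / norm z"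
    using asym by blast
  define R' where "R' = max R 1"
  have "bounded (\<Phi> ` cball 0 (R'\<^sup>2))"
    by (intro compact_imp_bounded compact_continuous_image holomorphic_on_imp_continuous_on
        holomorphic_on_subset[OF hol]) auto
  then obtain M where M: "\<And>l. norm l \<le> R'\<^sup>2 \<Longrightarrow> norm (\<Phi> l) \<le> M"
    by (meson bounded_iff imageI mem_cball_0)
  define K where "K = 2 + \<bar>M\<bar> + 2 * (\<bar>C\<bar> + 1) + \<bar>f\<bar>"
  have K: "K \<ge> 2" by (simp add: K_def)
  have "norm (\<Phi> l - of_real f) \<le> K * exp (K * sqrt (norm l))" for l
  proof -
    have e1: "1 \<le> exp (K * sqrt (norm l))" using K by simp
    have "norm (\<Phi> l) \<le> (K - \<bar>f\<bar>) * exp (K * sqrt (norm l))"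
    proof (cases "norm l \<le> R'\<^sup>2")
      case True
      have "norm (\<Phi> l) \<le> (K - \<bar>f\<bar>) * 1" using M[OF True] by (simp add: K_def)
      also have "\<dots> \<le> (K - \<bar>f\<bar>) * exp (K * sqrt (norm l))"
        by (rule mult_left_mono[OF e1]) (simp add: K_def)
      finally show ?thesis .
    next
      case False
      define z where "z = csqrt l"
      have l: "l = z\<^sup>2" by (simp add: z_def)
      have nz: "norm z = sqrt (norm l)" by (simp add: z_def)
      have z: "R' < norm z" using False real_less_rsqrt[of R' "norm l"] by (simp add: nz)
      let ?e = "exp (2 * norm z)"
      have im: "exp (2 * \<bar>Im z\<bar>) \<le> ?e" by (simp add: abs_Im_le_cmod)
      have "norm (cos (2 * z)) \<le> ?e"
      proof -
        have "norm (cos (2 * z)) \<le> (norm (exp (\<i> * (2 * z))) + norm (exp (- (\<i> * (2 * z))))) / 2"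
          unfolding cos_exp_eq norm_divide using norm_triangle_ineq[of "exp (\<i> * (2 * z))" "exp (- (\<i> * (2 * z)))"]
          by simp
        also have "\<dots> \<le> (?e + ?e) / 2"
          using abs_Im_le_cmod[of z] by (intro divide_right_mono add_mono) auto
        finally show ?thesis by simp
      qed
      moreover have "C * exp (2 * \<bar>Im z\<bar>) / norm z \<le> \<bar>C\<bar> * ?e"
      proof -
        have "C * exp (2 * \<bar>Im z\<bar>) / norm z \<le> \<bar>C\<bar> * ?e / 1"
          using z im by (intro frac_le mult_mono) (auto simp: R'_def)
        thus ?thesis by simp
      qed
      moreover have "norm ((8 * \<Phi> l + 1) / 9 - cos (2 * z)) \<le> C * exp (2 * \<bar>Im z\<bar>) / norm z"
        using CR[of z] z by (simp add: l R'_def)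
      ultimately have "norm ((8 * \<Phi> l + 1) / 9) \<le> (\<bar>C\<bar> + 1) * ?e"
        using norm_triangle_ineq[of "(8 * \<Phi> l + 1) / 9 - cos (2 * z)" "cos (2 * z)"]
        by (simp add: algebra_simps)
      hence "norm (8 * \<Phi> l + 1) \<le> 9 * ((\<bar>C\<bar> + 1) * ?e)" by (simp add: norm_divide)
      moreover have "8 * norm (\<Phi> l) \<le> norm (8 * \<Phi> l + 1) + 1"
        using norm_triangle_ineq4[of "8 * \<Phi> l + 1" 1] by (simp add: norm_mult)
      moreover have "1 \<le> (\<bar>C\<bar> + 1) * ?e" using mult_mono[of 1 "\<bar>C\<bar> + 1" 1 ?e] by simp
      ultimately have "norm (\<Phi> l) \<le> 2 * ((\<bar>C\<bar> + 1) * ?e)" by linarith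
      also have "\<dots> = 2 * (\<bar>C\<bar> + 1) * ?e" by simp
      also have "\<dots> \<le> (K - \<bar>f\<bar>) * exp (K * sqrt (norm l))"
        using K by (intro mult_mono) (auto simp: K_def nz mult_right_mono)
      finally show ?thesis .
    qed
    moreover have "\<bar>f\<bar> \<le> \<bar>f\<bar> * exp (K * sqrt (norm l))" using mult_left_mono[OF e1, of "\<bar>f\<bar>"] by simp
    ultimately show ?thesis using norm_triangle_ineq4[of "\<Phi> l" "of_real f"] by (simp add: algebra_simps)
  qed
  thus ?thesis by blast
qed

text \<open>At \<lambda> = -s^2, that is z = i s, the leading term cos 2z is cosh 2s, and the error
  is smaller by a factor of order 1/s.\<close>

lemma \<phi>_at_bot: "filterlim \<phi> at_top at_bot"
proof -
  obtain C R where CR: "\<And>z. R \<le> norm z \<Longrightarrow>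
      norm ((8 * \<Phi> (z\<^sup>2) + 1) / 9 - cos (2 * z)) \<le> C * exp (2 * \<bar>Im z\<bar>) / norm z"
    using asym by blast
  have lb: "9 / 8 * (exp (2 * s) / 2 - C * exp (2 * s) / s) - 1 / 8 \<le> \<phi> (- s\<^sup>2)" if s: "s > 0" "s \<ge> R" for s
  proof -
    let ?z = "\<i> * of_real s"
    have z2: "?z\<^sup>2 = of_real (- s\<^sup>2)" by (simp add: power_mult_distrib)
    have ce: "cos (2 * ?z) = of_real ((exp (2 * s) + exp (- 2 * s)) / 2)"
    proof -
      have "\<i> * (2 * ?z) = of_real (- 2 * s)" "- (\<i> * (2 * ?z)) = of_real (2 * s)"
        by (simp_all add: complex_eq_iff)
      thus ?thesis unfolding cos_exp_eq by (simp only: exp_of_real) simp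
    qed
    have "(8 * \<Phi> (?z\<^sup>2) + 1) / 9 - cos (2 * ?z) = of_real ((8 * \<phi> (- s\<^sup>2) + 1) / 9 - (exp (2 * s) + exp (- 2 * s)) / 2)"
      unfolding z2 on_reals(1) ce by simp
    moreover have "norm ((8 * \<Phi> (?z\<^sup>2) + 1) / 9 - cos (2 * ?z)) \<le> C * exp (2 * \<bar>Im ?z\<bar>) / norm ?z"
      by (rule CR) (use s in \<open>simp add: norm_mult\<close>)
    ultimately have "\<bar>(8 * \<phi> (- s\<^sup>2) + 1) / 9 - (exp (2 * s) + exp (- 2 * s)) / 2\<bar> \<le> C * exp (2 * s) / s"
      using s by (simp only: norm_of_real) (simp add: norm_mult)
    hence "(exp (2 * s) + exp (- 2 * s)) / 2 - (8 * \<phi> (- s\<^sup>2) + 1) / 9 \<le> C * exp (2 * s) / s"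
      by (simp only: abs_le_iff minus_diff_eq)
    moreover have "e / 2 - D \<le> p" if "(e + e') / 2 - p \<le> D" "0 < e'" for e e' p D :: real
      using that by (simp add: field_simps)
    ultimately have "exp (2 * s) / 2 - C * exp (2 * s) / s \<le> (8 * \<phi> (- s\<^sup>2) + 1) / 9"
      using exp_gt_zero by blast
    moreover have "9 / 8 * A - 1 / 8 \<le> p" if "A \<le> (8 * p + 1) / 9" for A p :: real
      using that by (simp add: field_simps)
    ultimately show ?thesis by blast
  qed
  have "filterlim (\<lambda>x. 9 / 8 * (exp (2 * sqrt (- x)) / 2 - C * exp (2 * sqrt (- x)) / sqrt (- x)) - 1 / 8) at_top at_bot"
    by real_asymp
  moreover have "eventually (\<lambda>x. 9 / 8 * (exp (2 * sqrt (- x)) / 2 - C * exp (2 * sqrt (- x)) / sqrt (- x)) - 1 / 8 \<le> \<phi> x) at_bot"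
    using eventually_le_at_bot[of "- (max R 1)\<^sup>2"]
  proof eventually_elim
    case (elim x)
    have "sqrt (- x) \<ge> max R 1" using elim by (intro real_le_rsqrt) auto
    moreover have "- (sqrt (- x))\<^sup>2 = x"
    proof -
      have "0 \<le> (max R 1)\<^sup>2" by simp
      hence "x \<le> 0" using elim by linarith
      thus ?thesis by simp
    qed
    ultimately show ?case using lb[of "sqrt (- x)"] by simp
  qed
  ultimately show ?thesis by (rule filterlim_at_top_mono)
qed

lemma \<phi>_at_bot_exists: "\<exists>x\<le>y. \<phi> x > M"
proof -
  have "eventually (\<lambda>x. \<phi> x > M \<and> x \<le> y) at_bot"
    using \<phi>_at_bot by (intro eventually_conj eventually_le_at_bot) (simp add: filterlim_at_top_dense)
  thus ?thesis using eventually_happens trivial_limit_at_bot_linorder by blast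
qed

text \<open>At z = \<pi> N and z = \<pi> (N + 1/2) the leading term is 1 and -1. The error only
  tends to 0, so at these points the values 1 and -5/4 are approached but perhaps not
  reached.\<close>

lemma \<phi>_oscillates:
  assumes "\<epsilon> > 0"
  shows "\<exists>x>y. \<phi> x > 1 - \<epsilon>" "\<exists>x>y. \<phi> x < -5/4 + \<epsilon>"
proof -
  obtain C R where CR: "\<And>z. R \<le> norm z \<Longrightarrow>
      norm ((8 * \<Phi> (z\<^sup>2) + 1) / 9 - cos (2 * z)) \<le> C * exp (2 * \<bar>Im z\<bar>) / norm z"
    using asym by blast
  have lb: "\<bar>(8 * \<phi> (s\<^sup>2) + 1) / 9 - cos (2 * s)\<bar> \<le> C / s" if s: "s > 0" "s \<ge> R" for s
  proof -
    have "cos (2 * complex_of_real s) = of_real (cos (2 * s))" by (simp add: cos_of_real[symmetric])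
    hence "norm (complex_of_real ((8 * \<phi> (s\<^sup>2) + 1) / 9 - cos (2 * s))) \<le> C / s"
      using CR[of "of_real s"] s on_reals(1)[of "s\<^sup>2"] by simp
    thus ?thesis by (simp only: norm_of_real)
  qed
  obtain N :: nat where N: "max (max R 1) (max (sqrt \<bar>y\<bar> + 1) (2 * \<bar>C\<bar> / \<epsilon>)) < N" using reals_Archimedean2 by blast
  define s where "s = (\<lambda>t. pi * (real N + t))"
  have s: "s t > 0" "s t \<ge> R" "(s t)\<^sup>2 > y" "\<bar>C / s t\<bar> < \<epsilon> / 2" if t: "t \<ge> 0" for t
  proof -
    have "1 * real N \<le> pi * (real N + t)" using t pi_gt3 by (intro mult_mono) auto
    hence sN: "real N \<le> s t" by (simp add: s_def)
    thus "s t > 0" "s t \<ge> R" using N by auto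
    have "sqrt \<bar>y\<bar> < s t" using sN N by linarith
    hence "(sqrt \<bar>y\<bar>)\<^sup>2 < (s t)\<^sup>2" by (intro power_strict_mono) auto
    thus "(s t)\<^sup>2 > y" by simp
    have "2 * \<bar>C\<bar> / \<epsilon> < s t" using sN N by linarith
    hence "2 * \<bar>C\<bar> < \<epsilon> * s t" using assms by (simp add: divide_less_eq mult.commute)
    hence "\<bar>C\<bar> < \<epsilon> / 2 * s t" by linarith
    thus "\<bar>C / s t\<bar> < \<epsilon> / 2" using \<open>s t > 0\<close> by (simp add: abs_div divide_less_eq)
  qed
  have c1: "cos (2 * s 0) = 1"
    using cos_2npi[of N] by (simp add: s_def mult_ac)
  have c2: "cos (2 * s (1/2)) = -1"
    using cos_npi[of "2 * N + 1"] by (simp add: s_def algebra_simps)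
  have "\<bar>(8 * \<phi> ((s 0)\<^sup>2) + 1) / 9 - 1\<bar> < \<epsilon> / 2" 
    using lb[OF s(1,2), of 0] s(4)[of 0] abs_ge_self[of "C / s 0"] unfolding c1 by linarith
  hence "\<phi> ((s 0)\<^sup>2) > 1 - \<epsilon>" using assms unfolding abs_less_iff by (auto simp: field_simps)
  thus "\<exists>x>y. \<phi> x > 1 - \<epsilon>" using s(3)[of 0] by auto
  have "\<bar>(8 * \<phi> ((s (1/2))\<^sup>2) + 1) / 9 + 1\<bar> < \<epsilon> / 2" 
    using lb[OF s(1,2), of "1/2"] s(4)[of "1/2"] abs_ge_self[of "C / s (1/2)"]
    unfolding c2 diff_minus_eq_add by linarith
  hence "\<phi> ((s (1/2))\<^sup>2) < - 5/4 + \<epsilon>" using assms unfolding abs_less_iff by (auto simp: field_simps)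
  thus "\<exists>x>y. \<phi> x < -5/4 + \<epsilon>" using s(3)[of "1/2"] by auto
qed

text \<open>Coming from +\<infinity> on the left, \<phi> descends to values as close to -5/4 as
  desired. The level -5/4 itself is left out since \<phi> is only known to come near it; hence the
  condition -5/4 < f in the strict form of Laguerre's inequality.\<close>

lemma value_exists:
  assumes "-5/4 < f"  "f \<le> 1"
  obtains x where "\<phi> x = f"
proof -
  obtain y where y: "\<phi> y < f" using \<phi>_oscillates(2)[of "f + 5/4" 0] assms by auto
  obtain x where x: "x \<le> y" "\<phi> x > f" using \<phi>_at_bot_exists by blast
  have "\<exists>t\<ge>x. t \<le> y \<and> \<phi> t = f"
    by (rule IVT2') (use x y \<phi>_continuous in auto)
  thus ?thesis using that by blast
qed

lemma shifted:
  "(\<lambda>l. \<Phi> l - of_real f) holomorphic_on UNIV"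
  "deriv (\<lambda>l. \<Phi> l - of_real f) = deriv \<Phi>"
  "f \<in> {-5/4..1} \<Longrightarrow> \<Phi> l - of_real f = 0 \<Longrightarrow> Im l = 0"
proof -
  show "(\<lambda>l. \<Phi> l - of_real f) holomorphic_on UNIV" by (intro holomorphic_intros hol)
  show "deriv (\<lambda>l. \<Phi> l - of_real f) = deriv \<Phi>"
  proof
    fix l
    have "((\<lambda>l. \<Phi> l - of_real f) has_field_derivative deriv \<Phi> l - 0) (at l)"
      by (intro DERIV_diff has_deriv(1)) auto
    from DERIV_imp_deriv[OF this] show "deriv (\<lambda>l. \<Phi> l - of_real f) l = deriv \<Phi> l" by simp
  qed
  show "f \<in> {-5/4..1} \<Longrightarrow> \<Phi> l - of_real f = 0 \<Longrightarrow> Im l = 0" using nonreal[of l f] by auto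
qed

lemma laguerre:
  assumes f: "f \<in> {-5/4..1}" and x: "\<phi> x \<noteq> f"
  shows "dd\<phi> x * (\<phi> x - f) \<le> (d\<phi> x)\<^sup>2" "-5/4 < f \<Longrightarrow> dd\<phi> x * (\<phi> x - f) < (d\<phi> x)\<^sup>2"
proof -
  let ?g = "\<lambda>l. \<Phi> l - of_real f"
  obtain C where C: "\<And>l. norm (?g l) \<le> C * exp (C * sqrt (norm l))" using growth[of f] by blast
  have gx: "?g (of_real x) \<noteq> 0" using x by (simp add: on_reals)
  have dg: "(?g has_field_derivative deriv \<Phi> (of_real x)) (at (of_real x))"
    using holomorphic_derivI[OF shifted(1) open_UNIV, of "of_real x" f] by (simp add: shifted(2))
  have "(logderiv ?g has_field_derivative
     (deriv (deriv \<Phi>) (of_real x) * ?g (of_real x) - deriv \<Phi> (of_real x) * deriv \<Phi> (of_real x)) /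
     (?g (of_real x) * ?g (of_real x))) (at (of_real x))"
    unfolding logderiv_def[abs_def] shifted(2) by (rule DERIV_divide[OF has_deriv(2) dg gx])
  hence "deriv (logderiv ?g) (of_real x) = (deriv (deriv \<Phi>) (of_real x) * ?g (of_real x) - deriv \<Phi> (of_real x) * deriv \<Phi> (of_real x)) /
     (?g (of_real x) * ?g (of_real x))"
    by (rule DERIV_imp_deriv)
  also have "\<dots> = of_real ((dd\<phi> x * (\<phi> x - f) - (d\<phi> x)\<^sup>2) / (\<phi> x - f)\<^sup>2)"
    by (simp add: on_reals power2_eq_square)
  finally have "deriv (logderiv ?g) (of_real x) = of_real ((dd\<phi> x * (\<phi> x - f) - (d\<phi> x)\<^sup>2) / (\<phi> x - f)\<^sup>2)" .
  hence *: "Re (deriv (logderiv ?g) (of_real x)) = (dd\<phi> x * (\<phi> x - f) - (d\<phi> x)\<^sup>2) / (\<phi> x - f)\<^sup>2"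
    by (simp only: Re_complex_of_real)
  have pos: "(\<phi> x - f)\<^sup>2 > 0" using x by simp
  note D = deriv_logderiv_real_neg[OF shifted(1) C shifted(3)[OF f] gx]
  from D(1) pos show "dd\<phi> x * (\<phi> x - f) \<le> (d\<phi> x)\<^sup>2"
    unfolding * by (simp add: divide_le_0_iff)
  assume "-5/4 < f"
  then obtain y where "\<phi> y = f" using value_exists[of f] f by auto
  hence "?g (of_real y) = 0" by (simp add: on_reals)
  from D(2)[OF _ this] pos show "dd\<phi> x * (\<phi> x - f) < (d\<phi> x)\<^sup>2"
    unfolding * by (simp add: divide_less_0_iff)
qed

text \<open>All zeros of \<Phi> are real and there is one, so the logarithmic derivative has
  strictly negative imaginary part above the real line and \<Phi>' has no zero there; conjugation
  treats the lower half-plane.\<close>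

lemma crit_real:
  assumes "deriv \<Phi> l = 0"
  shows "Im l = 0"
proof -
  have f: "(0::real) \<in> {-5/4..1}" by simp
  obtain C where C: "\<And>l. norm (\<Phi> l - of_real 0) \<le> C * exp (C * sqrt (norm l))" using growth[of 0] by blast
  obtain y where y: "\<phi> y = 0" using value_exists[of 0] by auto
  have pos: "deriv \<Phi> w \<noteq> 0" if w: "Im w > 0" for w
  proof -
    have "Im (logderiv (\<lambda>l. \<Phi> l - of_real 0) w) < 0"
      by (rule Im_logderiv_le(2)[OF shifted(1) C shifted(3)[OF f] w, of "of_real y"]) (use y in \<open>auto simp: on_reals\<close>)
    thus ?thesis by (auto simp: logderiv_def shifted(2))
  qed
  show ?thesis using pos[of l] pos[of "cnj l"] assms deriv_cnj[of l] by fastforce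
qed

text \<open>At a critical point strict Laguerre reads \<phi>'' (\<phi> - f) < 0 for every level f in
  (-5/4, 1] other than the critical value. Levels on both sides of this value would give \<phi>''
  opposite signs.\<close>

lemma crit_value: 
  assumes "d\<phi> c = 0"
  shows "\<phi> c \<ge> 1 \<or> \<phi> c \<le> -5/4" "dd\<phi> c \<noteq> 0"
proof -
  have L: "dd\<phi> c * (\<phi> c - f) < 0" if "-5/4 < f" "f \<le> 1" "\<phi> c \<noteq> f" for f
    using laguerre(2)[of f c] that assms by simp
  show "\<phi> c \<ge> 1 \<or> \<phi> c \<le> -5/4"
  proof (rule ccontr)
    assume "\<not> (\<phi> c \<ge> 1 \<or> \<phi> c \<le> -5/4)"
    hence *: "-5/4 < \<phi> c" "\<phi> c < 1" by auto
    have "dd\<phi> c * (\<phi> c - 1) < 0" using L[of 1] * by simp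
    hence "dd\<phi> c > 0" using * by (auto simp: mult_less_0_iff)
    \<comment> \<open>The midpoint of -5/4 and the critical value serves as a level below the
      latter.\<close>
    moreover have "dd\<phi> c * (\<phi> c - (\<phi> c - 5/4) / 2) < 0" using L[of "(\<phi> c - 5/4) / 2"] * by (simp add: field_simps)
    hence "dd\<phi> c < 0" using * by (auto simp: mult_less_0_iff)
    ultimately show False by simp
  qed
  \<comment> \<open>At least one of the admissible levels 0 and 1/2 differs from the critical
    value.\<close>
  show "dd\<phi> c \<noteq> 0" using L[of 0] L[of "1/2"] by (cases "\<phi> c = 0") auto
qed

lemma logslope_decreasing:
  assumes "x < y" "\<And>t. x \<le> t \<Longrightarrow> t \<le> y \<Longrightarrow> \<phi> t \<noteq> 0"
  shows "d\<phi> y / \<phi> y < d\<phi> x / \<phi> x"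
proof (rule DERIV_neg_imp_decreasing[OF assms(1)])
  fix t assume t: "x \<le> t" "t \<le> y"
  have nz: "\<phi> t \<noteq> 0" using assms t by auto
  have "((\<lambda>t. d\<phi> t / \<phi> t) has_real_derivative (dd\<phi> t * \<phi> t - d\<phi> t * d\<phi> t) / (\<phi> t * \<phi> t)) (at t)"
    by (rule DERIV_divide[OF \<phi>_deriv(2) \<phi>_deriv(1) nz])
  moreover have "dd\<phi> t * \<phi> t < (d\<phi> t)\<^sup>2" using laguerre(2)[of 0 t] nz by simp
  hence "(dd\<phi> t * \<phi> t - d\<phi> t * d\<phi> t) / (\<phi> t * \<phi> t) < 0" using nz 
    by (intro divide_neg_pos) (auto simp: power2_eq_square zero_less_mult_iff)
  ultimately show "\<exists>s. ((\<lambda>t. d\<phi> t / \<phi> t) has_real_derivative s) (at t) \<and> s < 0" by blast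
qed

text \<open>Without a zero of \<phi> in between, \<phi>'/\<phi> would be strictly decreasing and yet
  0 at both ends.\<close>

lemma no_two_crits:
  assumes "x < y" "d\<phi> x = 0" "d\<phi> y = 0"
  obtains t where "x \<le> t" "t \<le> y" "\<phi> t = 0"
  using logslope_decreasing[OF assms(1)] assms by fastforce

lemma interior_extremum_crit:
  assumes "x < t" "t < y" "\<phi> t < \<phi> x \<and> \<phi> t < \<phi> y \<or> \<phi> x < \<phi> t \<and> \<phi> y < \<phi> t"
  obtains c where "x < c" "c < y" "d\<phi> c = 0"
proof -
  have main: "\<exists>c>x. c < y \<and> d\<phi> c = 0" if s: "s = 1 \<or> s = -1" and lt: "s * \<phi> t < s * \<phi> x" "s * \<phi> t < s * \<phi> y" for s
  proof -
    have "continuous_on {x..y} (\<lambda>u. s * \<phi> u)" by (intro continuous_intros \<phi>_continuous)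
    then obtain c where c: "c \<in> {x..y}" "\<And>u. u \<in> {x..y} \<Longrightarrow> s * \<phi> c \<le> s * \<phi> u"
      using continuous_attains_inf[of "{x..y}" "\<lambda>u. s * \<phi> u"] assms by auto
    have "c \<noteq> x" "c \<noteq> y" using c(2)[of t] lt assms by auto
    hence xy: "x < c" "c < y" using c by auto
    have "((\<lambda>u. s * \<phi> u) has_real_derivative s * d\<phi> c) (at c)" by (intro DERIV_cmult \<phi>_deriv)
    hence "s * d\<phi> c = 0"
      by (rule DERIV_local_min[where d = "min (c - x) (y - c)"]) (use xy c in \<open>auto simp: abs_less_iff\<close>)
    thus ?thesis using s xy by auto
  qed
  show ?thesis using main[of 1] main[of "-1"] assms(3) that by auto
qed

definition "crits = {c. d\<phi> c = 0}"

text \<open>Far to the left \<phi> > 0. A critical point there would make \<phi>' positive to its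
  left, since \<phi>'/\<phi> decreases, against the growth of \<phi> towards -\<infinity>. So only a
  compact piece of the line matters, where the nonconstant entire function \<Phi>' has finitely many
  zeros.\<close>

lemma crits_finite: "finite {c \<in> crits. c \<le> y}"
proof -
  obtain x0 where x0: "\<And>x. x \<le> x0 \<Longrightarrow> \<phi> x > 0"
    using \<phi>_at_bot by (auto simp: filterlim_at_top_dense eventually_at_bot_linorder)
  have low: "c > x0" if c: "c \<in> crits" for c
  proof (rule ccontr)
    assume "\<not> c > x0"
    hence cx: "c \<le> x0" by simp
    obtain x where x: "x \<le> c" "\<phi> x > \<phi> c" using \<phi>_at_bot_exists by blast
    hence xc: "x < c" by (cases "x = c") auto
    have "\<phi> x < \<phi> c"
    proof (rule DERIV_pos_imp_increasing_open[OF xc])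
      fix t assume t: "x < t" "t < c"
      have "d\<phi> c / \<phi> c < d\<phi> t / \<phi> t"
      proof (rule logslope_decreasing[OF t(2)])
        show "\<phi> t' \<noteq> 0" if "t \<le> t'" "t' \<le> c" for t' using x0[of t'] cx that by simp
      qed
      moreover have "\<phi> t > 0" using x0[of t] t cx by simp
      ultimately have "d\<phi> t > 0" using c by (simp add: crits_def zero_less_divide_iff)
      thus "\<exists>s. (\<phi> has_real_derivative s) (at t) \<and> s > 0" using \<phi>_deriv by blast
    qed (rule \<phi>_continuous)
    thus False using x by simp
  qed
  have nc: "\<not> deriv \<Phi> constant_on UNIV"
  proof
    assume "deriv \<Phi> constant_on UNIV"
    then obtain k where "\<And>l. deriv \<Phi> l = k" by (auto simp: constant_on_def)
    hence k: "d\<phi> x = Re k" for x by (simp add: d\<phi>_def)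
    have "d\<phi> = (\<lambda>_. Re k)" using k by auto
    hence "(d\<phi> has_real_derivative 0) (at 0)" by simp
    hence "dd\<phi> 0 = 0" using \<phi>_deriv(2) DERIV_unique by blast
    \<comment> \<open>The signs +, -, + of \<phi> produce a critical point, so a constant derivative
      would be 0; its derivative vanishes as well, which is impossible at a critical point.\<close>
    moreover have "Re k = 0"
    proof -
      obtain y where y: "\<phi> y < 0" "y > 0" using \<phi>_oscillates(2)[of "1/2" 0] by force
      obtain z where z: "\<phi> z > 0" "z > y" using \<phi>_oscillates(1)[of "1/2" y] by force
      obtain w where w: "\<phi> w > 0" "w \<le> 0" using \<phi>_at_bot_exists[of 0 0] by force
      have "w < y" "\<phi> y < \<phi> w" "\<phi> y < \<phi> z" using w y z by linarith+
      then obtain c where "d\<phi> c = 0" using interior_extremum_crit[of w y z] z by blast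
      thus ?thesis using k by simp
    qed
    hence "d\<phi> 0 = 0" using k by simp
    ultimately show False using crit_value(2) by blast
  qed
  have "finite {l \<in> cball 0 (\<bar>x0\<bar> + \<bar>y\<bar>). deriv \<Phi> l = 0}"
    by (rule holomorphic_compact_finite_zeros[OF deriv_hol _ _ _ _ nc]) auto
  hence "finite (Re ` {l \<in> cball 0 (\<bar>x0\<bar> + \<bar>y\<bar>). deriv \<Phi> l = 0})" by (rule finite_imageI)
  moreover have "{c \<in> crits. c \<le> y} \<subseteq> Re ` {l \<in> cball 0 (\<bar>x0\<bar> + \<bar>y\<bar>). deriv \<Phi> l = 0}"
  proof
    fix c assume c: "c \<in> {c \<in> crits. c \<le> y}"
    hence "c > x0" "c \<le> y" using low by auto
    hence "complex_of_real c \<in> {l \<in> cball 0 (\<bar>x0\<bar> + \<bar>y\<bar>). deriv \<Phi> l = 0}"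
      using c by (auto simp: crits_def on_reals)
    thus "c \<in> Re ` {l \<in> cball 0 (\<bar>x0\<bar> + \<bar>y\<bar>). deriv \<Phi> l = 0}" by force
  qed
  ultimately show ?thesis using finite_subset by blast
qed

lemma crits_unbounded: "\<exists>c\<in>crits. y < c"
proof -
  obtain p where p: "p > y" "\<phi> p > 0" using \<phi>_oscillates(1)[of 1 y] by auto
  obtain r where r: "r > p" "\<phi> r < 0" using \<phi>_oscillates(2)[of 1 p] by force
  obtain s where s: "s > r" "\<phi> s > 0" using \<phi>_oscillates(1)[of 1 r] by auto
  have "\<phi> r < \<phi> p" "\<phi> r < \<phi> s" using p r s by linarith+
  then obtain c where "p < c" "d\<phi> c = 0" using interior_extremum_crit[of p r s] r s by blast
  hence "c \<in> crits" "y < c" using p by (auto simp: crits_def)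
  thus ?thesis by blast
qed

end

text \<open>At the first index where two such sequences differ, the smaller of the two values is
  taken strictly more often by the sequence that has it there.\<close>

lemma monotone_sequence_unique:
  fixes e e' :: "nat \<Rightarrow> real"
  assumes e: "mono e" "\<And>z. finite {k. e k = z}" and e': "mono e'" "\<And>z. finite {k. e' k = z}"
    and card: "\<And>z. card {k. e k = z} = card {k. e' k = z}"
  shows "e = e'"
proof
  fix n
  have aux: False if e: "mono e" "\<And>z. finite {k. e k = z}" and e': "mono e'"
    and card: "\<And>z. card {k. e k = z} = card {k. e' k = z}"
    and eq: "\<And>k. k < n \<Longrightarrow> e k = e' k" and lt: "e n < e' n" for e e' :: "nat \<Rightarrow> real" and n
  proof -
    have "{k. e' k = e n} \<subset> {k. e k = e n}"
    proof
      show "{k. e' k = e n} \<subseteq> {k. e k = e n}"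
      proof
        fix k assume k: "k \<in> {k. e' k = e n}"
        hence "k < n" using lt monoD[OF e', of n k] by (cases "k < n") auto
        thus "k \<in> {k. e k = e n}" using eq k by simp
      qed
      show "{k. e' k = e n} \<noteq> {k. e k = e n}" using lt by (metis (mono_tags, lifting) less_irrefl mem_Collect_eq)
    qed
    from psubset_card_mono[OF e(2) this] card show False by simp
  qed
  show "e n = e' n"
  proof (induction n rule: less_induct)
    case (less n)
    have "\<not> e n < e' n" using aux[OF e e'(1) card less.IH] by blast
    moreover have "\<not> e' n < e n" using aux[OF e' e(1) card[symmetric] less.IH[symmetric]] by blast
    ultimately show ?case by simp
  qed
qed

section \<open>Enumeration of the critical points and the intervals between them\<close>

context band_function
begin

lemma no_left_crit:
  assumes "\<And>t. t \<le> c \<Longrightarrow> \<phi> t > 0"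
  shows "d\<phi> c \<noteq> 0"
proof
  assume c: "d\<phi> c = 0"
  obtain x where x: "x \<le> c" "\<phi> x > \<phi> c" using \<phi>_at_bot_exists by blast
  hence xc: "x < c" by (cases "x = c") auto
  have "\<phi> x < \<phi> c"
  proof (rule DERIV_pos_imp_increasing_open[OF xc])
    fix t assume t: "x < t" "t < c"
    have "d\<phi> c / \<phi> c < d\<phi> t / \<phi> t"
    proof (rule logslope_decreasing[OF t(2)])
      show "\<phi> t' \<noteq> 0" if "t \<le> t'" "t' \<le> c" for t' using assms[of t'] that by simp
    qed
    moreover have "\<phi> t > 0" using assms[of t] t by simp
    ultimately have "d\<phi> t > 0" using c by (simp add: zero_less_divide_iff)
    thus "\<exists>s. (\<phi> has_real_derivative s) (at t) \<and> s > 0" using \<phi>_deriv by blast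
  qed (rule \<phi>_continuous)
  thus False using x by simp
qed

text \<open>Counting starts at 0: \<open>cs n\<close> is the critical point \<lambda>_(n+1).\<close>

definition "cs = (SOME c :: nat \<Rightarrow> real. strict_mono c \<and> range c = crits)"

lemma cs: "strict_mono cs" "range cs = crits"
proof -
  obtain c :: "nat \<Rightarrow> real" where "strict_mono c" "range c = crits"
    by (rule strict_mono_enumeration_exists[OF crits_finite crits_unbounded])
  hence "strict_mono c \<and> range c = crits" by blast
  from someI[of "\<lambda>c :: nat \<Rightarrow> real. strict_mono c \<and> range c = crits", OF this]
  show "strict_mono cs" "range cs = crits" unfolding cs_def by blast+
qed

lemma cs_crit: "d\<phi> (cs n) = 0"
proof -
  have "cs n \<in> crits" unfolding cs(2)[symmetric] by simp
  thus ?thesis by (simp add: crits_def)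
qed

lemma crit_cases:
  assumes "d\<phi> c = 0"
  obtains n where "c = cs n"
proof -
  have "c \<in> range cs" unfolding cs(2) using assms by (simp add: crits_def)
  thus ?thesis using that by blast
qed

lemma cs_less_iff: "cs m < cs n \<longleftrightarrow> m < n"
  by (rule strict_mono_less[OF cs(1)])

lemma no_crit_between: "cs n < c \<Longrightarrow> c < cs (Suc n) \<Longrightarrow> d\<phi> c \<noteq> 0"
  by (rule notI, erule crit_cases) (simp add: cs_less_iff)

lemma no_crit_before: "c < cs 0 \<Longrightarrow> d\<phi> c \<noteq> 0"
  by (rule notI, erule crit_cases) (simp add: cs_less_iff)

text \<open>If the first critical value were at least 1, \<phi> would be positive all the way from
  -\<infinity>, and then its end is not critical. Between consecutive critical points \<phi> has a
  zero but no further critical point, so the two critical values have opposite signs.\<close>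

lemma cs_value: "if even n then \<phi> (cs n) \<le> -5/4 else \<phi> (cs n) \<ge> 1"
proof (induction n)
  case 0
  have "\<not> \<phi> (cs 0) \<ge> 1"
  proof
    assume ge: "\<phi> (cs 0) \<ge> 1"
    have "\<phi> t > 0" if "t \<le> cs 0" for t
    proof (rule ccontr)
      assume neg: "\<not> \<phi> t > 0"
      hence tc: "t < cs 0" using that ge by (cases "t = cs 0") auto
      obtain x where x: "x \<le> t" "\<phi> x > 0" using \<phi>_at_bot_exists by blast
      hence "x < t" "\<phi> t < \<phi> x" "\<phi> t < \<phi> (cs 0)" using neg ge by (cases "x = t", auto)
      then obtain c where "c < cs 0" "d\<phi> c = 0" using interior_extremum_crit[of x t "cs 0"] tc by blast
      thus False using no_crit_before by blast
    qed
    thus False using no_left_crit cs_crit by blast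
  qed
  thus ?case using crit_value(1)[OF cs_crit[of 0]] by simp
next
  case (Suc n)
  have lt: "cs n < cs (Suc n)" by (simp add: cs_less_iff)
  obtain t where t: "cs n \<le> t" "t \<le> cs (Suc n)" "\<phi> t = 0"
    using no_two_crits[OF lt cs_crit cs_crit] by blast
  have ne: "t \<noteq> cs n" "t \<noteq> cs (Suc n)" 
    using crit_value(1)[OF cs_crit[of n]] crit_value(1)[OF cs_crit[of "Suc n"]] t(3) by auto
  have t': "cs n < t" "t < cs (Suc n)" using t ne by auto
  have "\<not> (\<phi> t < \<phi> (cs n) \<and> \<phi> t < \<phi> (cs (Suc n)) \<or> \<phi> (cs n) < \<phi> t \<and> \<phi> (cs (Suc n)) < \<phi> t)"
    using interior_extremum_crit[OF t'] no_crit_between by metis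
  hence "\<not> (\<phi> (cs n) > 0 \<and> \<phi> (cs (Suc n)) > 0)" "\<not> (\<phi> (cs n) < 0 \<and> \<phi> (cs (Suc n)) < 0)"
    using t(3) by auto
  thus ?case using Suc crit_value(1)[OF cs_crit[of "Suc n"]] by (auto split: if_splits)
qed

text \<open>The \<open>n\<close>-th interval of monotonicity of \<open>\<phi>\<close> contains the band $\sigma_{n+1}$.\<close>

definition seg :: "nat \<Rightarrow> real set" where
  "seg n = (case n of 0 \<Rightarrow> {..cs 0} | Suc m \<Rightarrow> {cs m..cs (Suc m)})"

lemma seg_simps: "seg 0 = {..cs 0}" "seg (Suc m) = {cs m..cs (Suc m)}"
  by (simp_all add: seg_def)

lemma cs_in_seg: "cs n \<in> seg n" "cs n \<in> seg (Suc n)"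
proof -
  have le: "cs m \<le> cs (Suc m)" for m using cs_less_iff[of m "Suc m"] by simp
  show "cs n \<in> seg n" using le by (cases n) (simp_all add: seg_simps)
  show "cs n \<in> seg (Suc n)" using le by (simp add: seg_simps)
qed

lemma seg_le: "x \<in> seg n \<Longrightarrow> x \<le> cs n"
  by (cases n) (auto simp: seg_simps)

lemma seg_ge: "x \<in> seg (Suc n) \<Longrightarrow> cs n \<le> x"
  by (auto simp: seg_simps)

lemma seg_convex: "x \<in> seg n \<Longrightarrow> y \<in> seg n \<Longrightarrow> x \<le> t \<Longrightarrow> t \<le> y \<Longrightarrow> t \<in> seg n"
  by (cases n) (auto simp: seg_simps)

lemma monotone_without_crit:
  assumes "\<And>t. a < t \<Longrightarrow> t < b \<Longrightarrow> d\<phi> t \<noteq> 0"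
  shows "(\<forall>x y. a \<le> x \<and> x < y \<and> y \<le> b \<longrightarrow> \<phi> x < \<phi> y) \<or> (\<forall>x y. a \<le> x \<and> x < y \<and> y \<le> b \<longrightarrow> \<phi> y < \<phi> x)"
proof -
  have "(\<forall>t. a < t \<and> t < b \<longrightarrow> d\<phi> t > 0) \<or> (\<forall>t. a < t \<and> t < b \<longrightarrow> d\<phi> t < 0)"
  proof (rule ccontr)
    assume "\<not> ?thesis"
    then obtain s t where s: "a < s" "s < b" "\<not> d\<phi> s > 0" and t: "a < t" "t < b" "\<not> d\<phi> t < 0"
      by blast
    hence st: "d\<phi> s < 0" "d\<phi> t > 0" using assms[of s] assms[of t] by auto
    have "\<exists>u\<ge>min s t. u \<le> max s t \<and> d\<phi> u = 0"
    proof (cases "s \<le> t")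
      case True
      thus ?thesis using IVT'[of "d\<phi>" s 0 t] st \<phi>_continuous(2) by auto
    next
      case False
      thus ?thesis using IVT2'[of "d\<phi>" s 0 t] st \<phi>_continuous(2) by auto
    qed
    then obtain u where "min s t \<le> u" "u \<le> max s t" "d\<phi> u = 0" by blast
    moreover from this have "a < u" "u < b" using s t by (auto simp: min_def max_def split: if_splits)
    ultimately show False using assms by blast
  qed
  thus ?thesis
  proof
    assume *: "\<forall>t. a < t \<and> t < b \<longrightarrow> d\<phi> t > 0"
    have "\<phi> x < \<phi> y" if xy: "a \<le> x" "x < y" "y \<le> b" for x y
    proof (rule DERIV_pos_imp_increasing_open[OF xy(2)])
      show "\<exists>s. (\<phi> has_real_derivative s) (at t) \<and> s > 0" if "x < t" "t < y" for t
        using * xy that \<phi>_deriv(1)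
        by (intro exI[of _ "d\<phi> t"]) auto
    qed (rule \<phi>_continuous)
    thus ?thesis by blast
  next
    assume *: "\<forall>t. a < t \<and> t < b \<longrightarrow> d\<phi> t < 0"
    have "\<phi> y < \<phi> x" if xy: "a \<le> x" "x < y" "y \<le> b" for x y
    proof (rule DERIV_neg_imp_decreasing_open[OF xy(2)])
      show "\<exists>s. (\<phi> has_real_derivative s) (at t) \<and> s < 0" if "x < t" "t < y" for t
        using * xy that \<phi>_deriv(1)
        by (intro exI[of _ "d\<phi> t"]) auto
    qed (rule \<phi>_continuous)
    thus ?thesis by blast
  qed
qed

text \<open>The direction on an interval free of interior critical points is read off from the
  values at its ends; it alternates, and the sign (-1)^n makes it a decrease on every
  \<open>seg n\<close>.\<close>

lemma seg_strict:
  assumes x: "x \<in> seg n" and y: "y \<in> seg n" and xy: "x < y"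
  shows "(-1) ^ n * \<phi> y < (-1) ^ n * \<phi> x"
proof (cases n)
  case 0
  \<comment> \<open>The first interval has no left end; a point left of x with a value above that at
    \<open>cs 0\<close> decides the direction instead.\<close>
  obtain w where w: "w \<le> x" "\<phi> w > \<phi> (cs 0)" using \<phi>_at_bot_exists by blast
  have "w < cs 0" using w x y xy 0 by (auto simp: seg_simps)
  hence "\<forall>x y. w \<le> x \<and> x < y \<and> y \<le> cs 0 \<longrightarrow> \<phi> y < \<phi> x"
  proof -
    have "(\<forall>x y. w \<le> x \<and> x < y \<and> y \<le> cs 0 \<longrightarrow> \<phi> x < \<phi> y) \<or> (\<forall>x y. w \<le> x \<and> x < y \<and> y \<le> cs 0 \<longrightarrow> \<phi> y < \<phi> x)"
      by (rule monotone_without_crit) (rule no_crit_before)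
    thus ?thesis using w \<open>w < cs 0\<close> by (meson order.refl order_less_asym)
  qed
  thus ?thesis using w x y xy 0 by (auto simp: seg_simps)
next
  case (Suc m)
  have lt: "cs m < cs (Suc m)" by (simp add: cs_less_iff)
  have "(if even n then \<phi> (cs m) \<ge> 1 \<and> \<phi> (cs n) \<le> -5/4 else \<phi> (cs m) \<le> -5/4 \<and> \<phi> (cs n) \<ge> 1)"
    using cs_value[of m] cs_value[of n] Suc by auto
  hence v: "(if even n then \<phi> (cs m) > \<phi> (cs n) else \<phi> (cs m) < \<phi> (cs n))" by (auto split: if_splits)
  from monotone_without_crit[of "cs m" "cs (Suc m)", OF no_crit_between]
  have "(if even n then \<phi> y < \<phi> x else \<phi> x < \<phi> y)"
  proof
    assume *: "\<forall>x y. cs m \<le> x \<and> x < y \<and> y \<le> cs (Suc m) \<longrightarrow> \<phi> x < \<phi> y"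
    hence "\<phi> (cs m) < \<phi> (cs n)" using lt Suc by auto
    hence "odd n" using v by (auto split: if_splits)
    thus ?thesis using * x y xy Suc by (auto simp: seg_simps)
  next
    assume *: "\<forall>x y. cs m \<le> x \<and> x < y \<and> y \<le> cs (Suc m) \<longrightarrow> \<phi> y < \<phi> x"
    hence "\<phi> (cs n) < \<phi> (cs m)" using lt Suc by auto
    hence "even n" using v by (auto split: if_splits)
    thus ?thesis using * x y xy Suc by (auto simp: seg_simps)
  qed
  thus ?thesis by (cases "even n") auto
qed

lemma seg_inj: "x \<in> seg n \<Longrightarrow> y \<in> seg n \<Longrightarrow> \<phi> x = \<phi> y \<Longrightarrow> x = y"
  using seg_strict[of x n y] seg_strict[of y n x] by (cases x y rule: linorder_cases) auto

lemma seg_value_exists: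
  assumes v: "v \<in> {-5/4..1}"
  shows "\<exists>x\<in>seg n. \<phi> x = v"
proof (cases n)
  case 0
  obtain w where w: "w \<le> cs 0" "\<phi> w > 1" using \<phi>_at_bot_exists by blast
  have "\<exists>x\<ge>w. x \<le> cs 0 \<and> \<phi> x = v"
    by (rule IVT2') (use w v cs_value[of 0] \<phi>_continuous in auto)
  thus ?thesis using 0 by (auto simp: seg_simps)
next
  case (Suc m)
  have lt: "cs m \<le> cs (Suc m)" using cs_less_iff[of m "Suc m"] by simp
  have "\<exists>x\<ge>cs m. x \<le> cs (Suc m) \<and> \<phi> x = v"
  proof (cases "even m")
    case True
    show ?thesis by (rule IVT') (use True v cs_value[of m] cs_value[of "Suc m"] lt \<phi>_continuous in auto)
  next
    case False
    show ?thesis by (rule IVT2') (use False v cs_value[of m] cs_value[of "Suc m"] lt \<phi>_continuous in auto)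
  qed
  thus ?thesis using Suc by (auto simp: seg_simps)
qed

definition "pt n v = (THE x. x \<in> seg n \<and> \<phi> x = v)"

lemma pt:
  assumes "v \<in> {-5/4..1}"
  shows "pt n v \<in> seg n" "\<phi> (pt n v) = v"
proof -
  have "\<exists>!x. x \<in> seg n \<and> \<phi> x = v"
    using seg_value_exists[OF assms, of n] seg_inj by metis
  from theI'[OF this] show "pt n v \<in> seg n" "\<phi> (pt n v) = v" by (auto simp: pt_def)
qed

lemma pt_eq: "x \<in> seg n \<Longrightarrow> \<phi> x = v \<Longrightarrow> pt n v = x"
  unfolding pt_def by (rule the_equality) (auto intro: seg_inj)

lemma pt_less:
  assumes "v \<in> {-5/4..1}" "v' \<in> {-5/4..1}" "(-1) ^ n * v < (-1) ^ n * v'"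
  shows "pt n v' < pt n v"
proof (rule ccontr)
  note p = pt[OF assms(1), of n] pt[OF assms(2), of n]
  assume "\<not> pt n v' < pt n v"
  hence "pt n v < pt n v' \<or> pt n v = pt n v'" by auto
  thus False
  proof
    assume "pt n v < pt n v'"
    from seg_strict[OF p(1) p(3) this] show False using assms(3) p(2,4) by simp
  next
    assume "pt n v = pt n v'"
    hence "v = v'" using p(2,4) by metis
    thus False using assms(3) by simp
  qed
qed

lemma seg_cover: "\<exists>n. x \<in> seg n"
proof -
  have ex: "\<exists>n. x \<le> cs n"
  proof -
    obtain c where "c \<in> crits" "x < c" using crits_unbounded by blast
    moreover from this obtain n where "c = cs n" unfolding cs(2)[symmetric] by blast
    ultimately show ?thesis by (intro exI[of _ n]) simp
  qed
  define n where "n = (LEAST n. x \<le> cs n)"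
  have n: "x \<le> cs n" "\<And>m. m < n \<Longrightarrow> \<not> x \<le> cs m"
    using LeastI_ex[OF ex] not_less_Least unfolding n_def by blast+
  hence "x \<in> seg n" by (cases n) (force simp: seg_simps)+
  thus ?thesis by blast
qed

lemma seg_overlap:
  assumes "x \<in> seg m" "x \<in> seg n" "m < n"
  shows "n = Suc m" "x = cs m"
proof -
  obtain n' where n': "n = Suc n'" "m \<le> n'" using assms(3) by (cases n) auto
  have "x \<le> cs m" "cs n' \<le> x" using assms n' seg_le seg_ge by auto
  moreover have "cs m \<le> cs n'" using n' strict_mono_less_eq[OF cs(1)] by simp
  ultimately have "cs n' = cs m" "x = cs m" by auto
  thus "x = cs m" "n = Suc m" using n' strict_mono_eq[OF cs(1)] by auto
qed

end

section \<open>Band edges and heights\<close>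

lemma zorder_from_derivs:
  fixes X :: "complex \<Rightarrow> complex"
  assumes X: "X holomorphic_on UNIV"
  shows "X z \<noteq> 0 \<Longrightarrow> zorder X z = 0"
    and "X z = 0 \<Longrightarrow> deriv X z \<noteq> 0 \<Longrightarrow> zorder X z = 1"
    and "X z = 0 \<Longrightarrow> deriv X z = 0 \<Longrightarrow> deriv (deriv X) z \<noteq> 0 \<Longrightarrow> zorder X z = 2"
proof -
  have *: "zorder X z = int n" if "\<And>i. i < n \<Longrightarrow> (deriv ^^ i) X z = 0" "(deriv ^^ n) X z \<noteq> 0" for n
    by (rule zorder_zero_eqI[OF X]) (use that in auto)
  show "X z \<noteq> 0 \<Longrightarrow> zorder X z = 0" using *[of 0] by simp
  show "X z = 0 \<Longrightarrow> deriv X z \<noteq> 0 \<Longrightarrow> zorder X z = 1" using *[of 1] by simp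
  assume z: "X z = 0" "deriv X z = 0" "deriv (deriv X) z \<noteq> 0"
  have "(deriv ^^ i) X z = 0" if "i < 2" for i
    using that z by (cases i) auto
  with *[of 2] z(3) show "zorder X z = 2" by (simp add: numeral_2_eq_2)
qed

text \<open>The value of \<xi> at the k-th zero of \<xi>^2 - 1: index 2n stands for \<lambda>_n^+,
  with (-1)^n, and 2n + 1 for \<lambda>_(n+1)^-, with (-1)^(n+1). These two bound the band
  \<sigma>_(n+1) in \<open>seg n\<close>, so k div 2 is the number of the interval.\<close>

definition edge_sign :: "nat \<Rightarrow> real" where
  "edge_sign k = (if even k then (-1) ^ (k div 2) else - ((-1) ^ (k div 2)))"

lemma edge_sign_simps:
  "edge_sign (2 * n) = (-1) ^ n" "edge_sign (2 * n + 1) = - ((-1) ^ n)" 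
  "edge_sign (Suc (2 * n)) = - ((-1) ^ n)" "edge_sign (2 * n + 2) = - ((-1) ^ n)"
  "edge_sign (Suc (Suc (2 * n))) = - ((-1) ^ n)"
  by (simp_all add: edge_sign_def)

lemma edge_sign_cases: "edge_sign k = 1 \<or> edge_sign k = -1"
  by (cases "even (k div 2)") (auto simp: edge_sign_def)

lemma edge_sign_inj: "k div 2 = m div 2 \<Longrightarrow> edge_sign k = edge_sign m \<Longrightarrow> k = m"
proof -
  assume h: "k div 2 = m div 2" "edge_sign k = edge_sign m"
  have "(-1::real) ^ (m div 2) \<noteq> 0" by simp
  hence "even k \<longleftrightarrow> even m" using h by (auto simp: edge_sign_def split: if_splits)
  thus "k = m" using h by (metis even_iff_mod_2_eq_zero div_mult_mod_eq odd_iff_mod_2_eq_one)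
qed

text \<open>The value of \<open>F\<close> at the \<open>k\<close>-th zero of $\xi^2 - 1$.\<close>

definition edge_value :: "real \<Rightarrow> nat \<Rightarrow> real" where
  "edge_value a k = edge_sign k * cos a - (sin a)\<^sup>2"

text \<open>With c = cos a the value is (c + 1/2)^2 - 5/4 or (c - 1/2)^2 - 5/4, where 0 < c <=
  1.\<close>

lemma edge_value_range:
  assumes "0 < cos a" "\<sigma> = 1 \<or> \<sigma> = (-1::real)"
  shows "\<sigma> * cos a - (sin a)\<^sup>2 \<in> {-5/4..1}"
proof -
  have "(cos a - 1/2)\<^sup>2 \<ge> 0" "(cos a + 1/2)\<^sup>2 \<ge> 0" by simp_all
  moreover have "(cos a)\<^sup>2 \<le> 1" "cos a \<le> 1" by (simp_all add: abs_square_le_1)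
  ultimately show ?thesis using assms cos_le_one[of a] unfolding sin_squared_eq
    by (elim disjE) (auto simp: power2_eq_square algebra_simps intro: order_trans[OF add_mono])
qed

context band_function
begin

definition "\<xi> a l = (\<Phi> l + complex_of_real ((sin a)\<^sup>2)) / complex_of_real (cos a)"

definition "edge a k = pt (k div 2) (edge_value a k)"

lemma \<xi>_of_real: "\<xi> a (of_real x) = of_real ((\<phi> x + (sin a)\<^sup>2) / cos a)"
  by (simp add: \<xi>_def on_reals)

lemma \<xi>_hol: "\<xi> a holomorphic_on UNIV"
  unfolding \<xi>_def[abs_def] divide_inverse by (intro holomorphic_intros hol)

lemma \<xi>_deriv: "(\<xi> a has_field_derivative deriv \<Phi> l / of_real (cos a)) (at l)"
proof -
  have "((\<lambda>l. \<Phi> l + complex_of_real ((sin a)\<^sup>2)) has_field_derivative deriv \<Phi> l) (at l)"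
    using DERIV_add[OF has_deriv(1)[of l] DERIV_const] by simp
  thus ?thesis unfolding \<xi>_def[abs_def] by (rule DERIV_cdivide)
qed

lemma \<xi>_sq_deriv:
  "deriv (\<lambda>l. (\<xi> a l)\<^sup>2 - 1) = (\<lambda>l. 2 * \<xi> a l * deriv \<Phi> l / of_real (cos a))"
  "deriv (deriv (\<lambda>l. (\<xi> a l)\<^sup>2 - 1)) l =
     2 * (deriv \<Phi> l / of_real (cos a))\<^sup>2 + 2 * \<xi> a l * deriv (deriv \<Phi>) l / of_real (cos a)"
proof -
  show 1: "deriv (\<lambda>l. (\<xi> a l)\<^sup>2 - 1) = (\<lambda>l. 2 * \<xi> a l * deriv \<Phi> l / of_real (cos a))"
    by (intro ext DERIV_imp_deriv) (auto intro!: derivative_eq_intros \<xi>_deriv)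
  show "deriv (deriv (\<lambda>l. (\<xi> a l)\<^sup>2 - 1)) l =
     2 * (deriv \<Phi> l / of_real (cos a))\<^sup>2 + 2 * \<xi> a l * deriv (deriv \<Phi>) l / of_real (cos a)"
    unfolding 1 divide_inverse
    by (rule DERIV_imp_deriv)
      (auto intro!: derivative_eq_intros \<xi>_deriv has_deriv(2) simp: power2_eq_square divide_inverse algebra_simps)
qed

context
  fixes a :: real
  assumes c: "0 < cos a"
begin

lemma edge: "edge a k \<in> seg (k div 2)" "\<phi> (edge a k) = edge_value a k"
  using pt[OF edge_value_range[OF c edge_sign_cases[of k]]] by (simp_all add: edge_def edge_value_def)

lemma edge_less: "edge a (2 * n) < edge a (2 * n + 1)"
proof -
  have "(-1::real) ^ n * (-1) ^ n = 1" by (simp flip: power_mult_distrib)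
  hence "(-1) ^ n * edge_value a (2 * n + 1) < (-1) ^ n * edge_value a (2 * n)"
    using c by (simp add: edge_value_def edge_sign_simps right_diff_distrib mult.assoc[symmetric])
  from pt_less[OF _ _ this] show ?thesis
    using edge_value_range[OF c edge_sign_cases] by (simp add: edge_def edge_value_def)
qed

lemma edge_le_crit: "edge a (2 * n + 1) \<le> cs n" "cs n \<le> edge a (2 * n + 2)"
  using seg_le[OF edge(1)[of "2 * n + 1"]] seg_ge[of "edge a (2 * n + 2)" n] edge(1)[of "2 * n + 2"] by auto

lemma edge_order: "edge a (2 * n) < edge a (2 * n + 1) \<and> edge a (2 * n + 1) \<le> edge a (2 * n + 2)"
  using edge_less edge_le_crit order_trans by blast

lemma edge_eqI:
  assumes "x \<in> seg n" "\<phi> x = edge_value a k" "k div 2 = n"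
  shows "edge a k = x"
  unfolding edge_def assms(3) by (rule pt_eq[OF assms(1,2)])

lemma edge_value_inj: "edge_value a k = edge_value a m \<Longrightarrow> edge_sign k = edge_sign m"
  using c by (simp add: edge_value_def)

text \<open>A noncritical point lies in only one interval, and within it the sign \<sigma> decides
  between the indices 2n and 2n + 1.\<close>

lemma edge_set_simple:
  assumes x: "\<phi> x = \<sigma> * cos a - (sin a)\<^sup>2" "\<sigma> = 1 \<or> \<sigma> = -1" and d: "d\<phi> x \<noteq> 0"
  shows "\<exists>k. {k. edge a k = x} = {k}"
proof -
  obtain n where n: "x \<in> seg n" using seg_cover by blast
  obtain k where k: "k div 2 = n" "edge_sign k = \<sigma>"
  proof (cases "\<sigma> = (-1) ^ n")
    case True
    thus ?thesis using that[of "2 * n"] by (simp add: edge_sign_simps)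
  next
    case False
    hence "\<sigma> = - ((-1) ^ n)" using x(2) by (cases "even n") auto
    thus ?thesis using that[of "2 * n + 1"] by (simp add: edge_sign_simps)
  qed
  have ek: "edge a k = x" by (rule edge_eqI[OF n _ k(1)]) (simp add: edge_value_def k x)
  have "m = k" if m: "edge a m = x" for m
  proof -
    have xm: "x \<in> seg (m div 2)" using edge(1)[of m] m by simp
    have "m div 2 = n"
    proof (rule ccontr)
      assume "m div 2 \<noteq> n"
      then consider "m div 2 < n" | "n < m div 2" by linarith
      thus False
      proof cases
        case 1
        from seg_overlap(2)[OF xm n 1] d cs_crit[of "m div 2"] show False by metis
      next
        case 2
        from seg_overlap(2)[OF n xm 2] d cs_crit[of n] show False by metis
      qed
    qed
    moreover have "edge_value a m = edge_value a k"
      using edge(2)[of m] edge(2)[of k] unfolding ek m by (rule trans[OF sym])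
    hence "edge_sign m = edge_sign k" by (rule edge_value_inj)
    ultimately show "m = k" using edge_sign_inj[of m k] k(1) by simp
  qed
  note uniq = this
  have "{k. edge a k = x} = {k}"
  proof (intro equalityI subsetI)
    fix m assume "m \<in> {k. edge a k = x}"
    thus "m \<in> {k}" using uniq[of m] by simp
  next
    fix m assume "m \<in> {k}"
    thus "m \<in> {k. edge a k = x}" using ek by simp
  qed
  thus ?thesis by (rule exI)
qed

text \<open>This is the closed gap: an edge at a critical point is the right end of one band and the
  left end of the next.\<close>

lemma edge_set_crit:
  assumes x: "\<phi> (cs n) = \<sigma> * cos a - (sin a)\<^sup>2" "\<sigma> = 1 \<or> \<sigma> = -1"
  shows "{k. edge a k = cs n} = {2 * n + 1, 2 * n + 2}"
proof -
  have s: "(sin a)\<^sup>2 = 1 - (cos a)\<^sup>2" by (simp add: sin_squared_eq)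
  have cc: "(cos a)\<^sup>2 \<le> cos a" "(cos a)\<^sup>2 > 0" using c mult_left_mono[of "cos a" 1 "cos a"] by (auto simp: power2_eq_square)
  \<comment> \<open>The other sign is impossible: for even n the critical value is at most -5/4
    while c^2 + c - 1 > -1, and for odd n it is at least 1 while c^2 - c - 1 <= -1.\<close>
  have \<sigma>: "\<sigma> = - ((-1) ^ n)"
  proof (cases "even n")
    case True
    hence \<phi>: "\<phi> (cs n) \<le> -5/4" using cs_value[of n] by simp
    have "\<sigma> \<noteq> 1"
    proof
      assume \<sigma>: "\<sigma> = 1"
      show False using x(1)[unfolded s \<sigma>] \<phi> cc c by linarith
    qed
    thus ?thesis using x(2) True by simp
  next
    case False
    hence \<phi>: "\<phi> (cs n) \<ge> 1" using cs_value[of n] by simp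
    have "\<sigma> \<noteq> -1"
    proof
      assume \<sigma>: "\<sigma> = -1"
      show False using x(1)[unfolded s \<sigma>] \<phi> cc c by linarith
    qed
    thus ?thesis using x(2) False by simp
  qed
  have v: "\<phi> (cs n) = edge_value a (2 * n + 1)" "\<phi> (cs n) = edge_value a (2 * n + 2)"
    using x(1) \<sigma> by (simp_all add: edge_value_def edge_sign_simps)
  have e: "edge a (2 * n + 1) = cs n" "edge a (2 * n + 2) = cs n"
    by (rule edge_eqI[OF cs_in_seg(1) v(1)], simp) (rule edge_eqI[OF cs_in_seg(2) v(2)], simp)
  have "k = 2 * n + 1 \<or> k = 2 * n + 2" if k: "edge a k = cs n" for k
  proof -
    have xk: "cs n \<in> seg (k div 2)" using edge(1)[of k] k by simp
    have "k div 2 = n \<or> k div 2 = Suc n"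
    proof (rule ccontr)
      assume ne: "\<not> (k div 2 = n \<or> k div 2 = Suc n)"
      then consider "k div 2 < n" | "n < k div 2" by linarith
      thus False
      proof cases
        case 1
        have "cs n = cs (k div 2)" by (rule seg_overlap(2)[OF xk cs_in_seg(1) 1])
        hence "n = k div 2" using strict_mono_eq[OF cs(1)] by blast
        thus False using 1 by linarith
      next
        case 2
        from seg_overlap(1)[OF cs_in_seg(1) xk 2] ne show False by simp
      qed
    qed
    moreover have "edge_sign k = edge_sign (2 * n + 1)" "edge_sign k = edge_sign (2 * n + 2)"
    proof -
      have "edge_value a k = \<phi> (cs n)" using edge(2)[of k] k by simp
      thus "edge_sign k = edge_sign (2 * n + 1)" "edge_sign k = edge_sign (2 * n + 2)"
        using v by (intro edge_value_inj; metis)+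
    qed
    ultimately show ?thesis using edge_sign_inj[of k "2 * n + 1"] edge_sign_inj[of k "2 * n + 2"] by fastforce
  qed
  thus ?thesis using e by auto
qed

lemma \<xi>_zero_cases:
  assumes "(\<xi> a l)\<^sup>2 = 1"
  obtains x \<sigma> where "l = of_real x" "\<sigma> = 1 \<or> \<sigma> = -1" "\<phi> x = \<sigma> * cos a - (sin a)\<^sup>2"
proof -
  have "\<xi> a l = 1 \<or> \<xi> a l = -1" using assms by (simp add: power2_eq_1_iff)
  then obtain \<sigma> :: real where \<sigma>: "\<sigma> = 1 \<or> \<sigma> = -1" "\<xi> a l = of_real \<sigma>"
    by (elim disjE) (use that[of 1] that[of "-1"] in auto)
  hence P: "\<Phi> l = of_real (\<sigma> * cos a - (sin a)\<^sup>2)"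
    using c by (simp add: \<xi>_def field_simps)
  hence "Im l = 0" using nonreal[of l, OF _ edge_value_range[OF c \<sigma>(1)]] by blast
  hence l: "l = of_real (Re l)" by (simp add: complex_eq_iff)
  have "of_real (\<phi> (Re l)) = complex_of_real (\<sigma> * cos a - (sin a)\<^sup>2)"
    using P on_reals(1)[of "Re l"] l by metis
  hence "\<phi> (Re l) = \<sigma> * cos a - (sin a)\<^sup>2" by (simp only: of_real_eq_iff)
  thus ?thesis using that l \<sigma> by blast
qed

lemma \<xi>_edge: "\<xi> a (of_real (edge a k)) = of_real (edge_sign k)"
  using c by (simp add: \<xi>_of_real edge edge_value_def)

text \<open>At a noncritical zero the first derivative of \<xi>^2 - 1 does not vanish, and there is
  one index; at a critical one \<phi>'' \<noteq> 0 makes the zero double, and there are two.\<close>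

lemma zorder_edge: "zorder (\<lambda>l. (\<xi> a l)\<^sup>2 - 1) z = int (card {k. complex_of_real (edge a k) = z})"
proof -
  let ?X = "\<lambda>l. (\<xi> a l)\<^sup>2 - 1"
  have X: "?X holomorphic_on UNIV" by (intro holomorphic_intros \<xi>_hol)
  show ?thesis
  proof (cases "(\<xi> a z)\<^sup>2 = 1")
    case False
    have "{k. complex_of_real (edge a k) = z} = {}"
      using False \<xi>_edge edge_sign_cases by (auto simp: power2_eq_1_iff) (metis of_real_1 of_real_minus)
    moreover have "zorder ?X z = 0" by (rule zorder_from_derivs(1)[OF X]) (use False in simp)
    ultimately show ?thesis by simp
  next
    case True
    then obtain x \<sigma> where x: "z = of_real x" and \<sigma>: "\<sigma> = 1 \<or> \<sigma> = -1" and v: "\<phi> x = \<sigma> * cos a - (sin a)\<^sup>2"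
      by (rule \<xi>_zero_cases)
    have \<xi>z: "\<xi> a z \<noteq> 0" using True by auto
    have K: "{k. complex_of_real (edge a k) = z} = {k. edge a k = x}" using x by simp
    show ?thesis
    proof (cases "d\<phi> x = 0")
      case False
      obtain k where "{k. edge a k = x} = {k}" using edge_set_simple[OF v \<sigma> False] by blast
      moreover have "zorder ?X z = 1"
      proof (rule zorder_from_derivs(2)[OF X])
        have "deriv \<Phi> z \<noteq> 0" using False by (simp add: x on_reals)
        thus "deriv ?X z \<noteq> 0" unfolding \<xi>_sq_deriv(1) using \<xi>z c by simp
      qed (use True in simp)
      ultimately show ?thesis unfolding K by simp
    next
      case d: True
      then obtain n where n: "x = cs n" using crit_cases by blast
      have "{k. edge a k = x} = {2 * n + 1, 2 * n + 2}" using edge_set_crit[of n \<sigma>] v \<sigma> n by simp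
      hence "card {k. edge a k = x} = 2" by simp
      moreover have "zorder ?X z = 2"
      proof (rule zorder_from_derivs(3)[OF X])
        have d': "deriv \<Phi> z = 0" using d by (simp add: x on_reals)
        show "deriv ?X z = 0" unfolding \<xi>_sq_deriv(1) d' by simp
        have "deriv (deriv \<Phi>) z \<noteq> 0" using crit_value(2)[OF d] by (simp add: x on_reals)
        thus "deriv (deriv ?X) z \<noteq> 0" unfolding \<xi>_sq_deriv(2) d' using \<xi>z c by simp
      qed (use True in simp)
      ultimately show ?thesis unfolding K by simp
    qed
  qed
qed

text \<open>The ordering makes the sequence nondecreasing with e k < e (k + 2), so each value occurs
  finitely often; such a sequence is determined by its multiplicities.\<close>

lemma edge_sequence_unique:
  assumes ord: "\<And>n. e (2 * n) < e (2 * n + 1) \<and> e (2 * n + 1) \<le> e (2 * n + 2)"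
    and z: "\<And>z. zorder (\<lambda>l. (\<xi> a l)\<^sup>2 - 1) z = int (card {k. complex_of_real (e k) = z})"
  shows "e = edge a"
proof -
  have fin: "mono e" "finite {k. e k = x}" if ord: "\<And>n. e (2 * n) < e (2 * n + 1) \<and> e (2 * n + 1) \<le> e (2 * n + 2)"
    for e :: "nat \<Rightarrow> real" and x
  proof -
    have step: "e k \<le> e (Suc k)" for k
    proof (cases "even k")
      case True
      then obtain n where "k = 2 * n" by blast
      thus ?thesis using ord[of n] by simp
    next
      case False
      then obtain n where "k = 2 * n + 1" by (elim oddE)
      thus ?thesis using ord[of n] by simp
    qed
    thus m: "mono e" by (simp add: mono_iff_le_Suc)
    have step2: "e k < e (k + 2)" for k
    proof (cases "even k")
      case True
      then obtain n where "k = 2 * n" by blast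
      thus ?thesis using ord[of n] by simp
    next
      case False
      then obtain n where "k = 2 * n + 1" by (elim oddE)
      thus ?thesis using ord[of n] ord[of "Suc n"] by simp
    qed
    show "finite {k. e k = x}"
    proof (cases "{k. e k = x} = {}")
      case False
      then obtain k where k: "e k = x" by blast
      have "{k. e k = x} \<subseteq> {..<k + 2}"
      proof
        fix j assume j: "j \<in> {k. e k = x}"
        show "j \<in> {..<k + 2}"
        proof (rule ccontr)
          assume "j \<notin> {..<k + 2}"
          hence "e (k + 2) \<le> e j" using m by (intro monoD[OF m]) auto
          thus False using step2[of k] j k by simp
        qed
      qed
      thus ?thesis using finite_subset by blast
    qed simp
  qed
  have card: "card {k. e k = x} = card {k. edge a k = x}" for x
    using z[of "of_real x"] zorder_edge[of "of_real x"] by simp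
  show ?thesis
    by (rule monotone_sequence_unique[OF fin(1)[OF ord] fin(2)[OF ord] fin(1)[OF edge_order] fin(2)[OF edge_order] card])
qed

text \<open>This is h_(n+1), since \<open>cs n\<close> is \<lambda>_(n+1); hence the exponent
  \<open>Suc n\<close>.\<close>

definition crit_height :: "nat \<Rightarrow> real" where
  "crit_height n = arcosh ((-1) ^ Suc n * (\<phi> (cs n) + (sin a)\<^sup>2) / cos a)"

text \<open>For even n the critical value is at most -5/4 and the claim reduces to (cos a - 1/2)^2
  >= 0; for odd n the critical value is at least 1.\<close>

lemma crit_height_arg: "1 \<le> (-1) ^ Suc n * (\<phi> (cs n) + (sin a)\<^sup>2) / cos a"
proof -
  have s: "(sin a)\<^sup>2 = 1 - (cos a)\<^sup>2" by (simp add: sin_squared_eq)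
  have cc: "cos a \<le> 1" by simp
  have c2: "(cos a)\<^sup>2 \<le> 1" by (simp add: abs_square_le_1)
  have "cos a \<le> (-1) ^ Suc n * (\<phi> (cs n) + (sin a)\<^sup>2)"
  proof (cases "even n")
    case True
    have "\<phi> (cs n) \<le> -5/4" using cs_value[of n] True by simp
    moreover have "0 \<le> (cos a - 1/2)\<^sup>2" by simp
    ultimately show ?thesis using True unfolding s by (simp add: power2_eq_square algebra_simps)
  next
    case False
    have "\<phi> (cs n) \<ge> 1" using cs_value[of n] False by simp
    moreover have e: "(-1::real) ^ Suc n = 1" using False by simp
    ultimately show ?thesis using c2 cc unfolding s e mult_1 by linarith
  qed
  thus ?thesis using c by (simp only: le_divide_eq_1_pos)
qed

lemma crit_height_unique:
  "(THE h. h \<ge> 0 \<and> \<xi> a (of_real (cs n)) = (-1) ^ Suc n * complex_of_real (cosh h)) = crit_height n"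
proof (rule the_equality)
  let ?H = "(-1) ^ Suc n * (\<phi> (cs n) + (sin a)\<^sup>2) / cos a"
  have sq: "(-1::real) ^ Suc n * (-1) ^ Suc n = 1" by (cases "even n") simp_all
  have eq: "\<xi> a (of_real (cs n)) = (-1) ^ Suc n * complex_of_real ?H"
  proof -
    have "(\<phi> (cs n) + (sin a)\<^sup>2) / cos a = (-1) ^ Suc n * ?H"
      by (simp only: times_divide_eq_right mult.assoc[symmetric] sq mult_1)
    hence "\<xi> a (of_real (cs n)) = complex_of_real ((-1) ^ Suc n * ?H)" unfolding \<xi>_of_real by (simp only:)
    thus ?thesis by (simp only: of_real_mult of_real_power of_real_minus of_real_1)
  qed
  show "crit_height n \<ge> 0 \<and> \<xi> a (of_real (cs n)) = (-1) ^ Suc n * complex_of_real (cosh (crit_height n))"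
    unfolding eq crit_height_def cosh_arcosh_real[OF crit_height_arg]
    using arcosh_nonneg_real[OF crit_height_arg] by blast
  fix h assume h: "h \<ge> 0 \<and> \<xi> a (of_real (cs n)) = (-1) ^ Suc n * complex_of_real (cosh h)"
  have "(-1::complex) ^ Suc n \<noteq> 0" by simp
  moreover have "(-1) ^ Suc n * complex_of_real ?H = (-1) ^ Suc n * complex_of_real (cosh h)"
    using h unfolding eq by blast
  ultimately have "complex_of_real ?H = complex_of_real (cosh h)" by (simp only: mult_cancel_left) blast
  hence "?H = cosh h" by (simp only: of_real_eq_iff)
  thus "h = crit_height n" unfolding crit_height_def using h arcosh_cosh_real[of h] by (simp only:)
qed

end

end

section \<open>The comparison map $w^2/4$\<close>

abbreviation (input) "\<H> \<equiv> {l :: complex. Im l > 0}"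

lemma convex_upper: "convex \<H>" "open \<H>" "connected \<H>"
  using convex_halfspace_Im_gt[of 0] open_halfspace_Im_gt[of 0] convex_connected by auto

lemma exp_i_eq_1_imp_const:
  fixes d :: "complex \<Rightarrow> complex"
  assumes S: "connected S" and d: "continuous_on S d" and e: "\<And>s. s \<in> S \<Longrightarrow> exp (\<i> * d s) = 1"
  shows "\<exists>n::int. \<forall>s\<in>S. d s = of_real (2 * pi * n)"
proof (cases "S = {}")
  case False
  have val: "\<exists>n::int. d s = of_real (2 * pi * n)" if s: "s \<in> S" for s
  proof -
    obtain n :: int where "Re (\<i> * d s) = 0" "Im (\<i> * d s) = of_int (2 * n) * pi"
      using e[OF s] exp_eq_1[of "\<i> * d s"] by blast
    hence "d s = of_real (2 * pi * n)" by (simp add: complex_eq_iff)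
    thus ?thesis by blast
  qed
  have "d constant_on S"
  proof (rule continuous_discrete_range_constant[OF S d])
    fix x assume x: "x \<in> S"
    show "\<exists>e>0. \<forall>y. y \<in> S \<and> d y \<noteq> d x \<longrightarrow> e \<le> norm (d y - d x)"
    proof (intro exI[of _ "2 * pi"] conjI allI impI)
      fix y assume y: "y \<in> S \<and> d y \<noteq> d x"
      obtain m n :: int where mn: "d y = of_real (2 * pi * m)" "d x = of_real (2 * pi * n)"
        using val x y by meson
      hence "m \<noteq> n" using y by auto
      hence "1 \<le> \<bar>m - n\<bar>" by linarith
      hence "2 * pi * 1 \<le> 2 * pi * of_int \<bar>m - n\<bar>" by (intro mult_left_mono) (simp_all only: of_int_1_le_iff, simp)
      also have "\<dots> = norm (complex_of_real (2 * pi * (real_of_int m - real_of_int n)))"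
        unfolding norm_of_real by (simp add: abs_mult)
      also have "\<dots> = norm (d y - d x)" unfolding mn by (simp add: right_diff_distrib)
      finally show "2 * pi \<le> norm (d y - d x)" by simp
    qed simp
  qed
  then obtain k where k: "\<And>s. s \<in> S \<Longrightarrow> d s = k" by (auto simp: constant_on_def)
  obtain s where "s \<in> S" using False by blast
  with val k show ?thesis by metis
qed simp

text \<open>Equal cosines make the quotient of the sines a continuous function with values 1 and -1,
  hence a constant \<sigma> on a connected set; then e^(i (u - \<sigma> v)) = 1, and the difference
  is a constant multiple of 2 \<pi>.\<close>

lemma cos_branch_unique:
  fixes u v :: "complex \<Rightarrow> complex"
  assumes S: "connected S" and u: "continuous_on S u" and v: "continuous_on S v"
    and eq: "\<And>s. s \<in> S \<Longrightarrow> cos (u s) = cos (v s)"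
    and ne: "\<And>s. s \<in> S \<Longrightarrow> cos (v s) \<noteq> 1 \<and> cos (v s) \<noteq> -1"
  obtains \<sigma> :: complex and n :: int where "\<sigma> = 1 \<or> \<sigma> = -1" "\<And>s. s \<in> S \<Longrightarrow> u s = \<sigma> * v s + of_real (2 * pi * n)"
proof -
  define \<rho> where "\<rho> = (\<lambda>s. sin (u s) / sin (v s))"
  have nz: "sin (v s) \<noteq> 0" if s: "s \<in> S" for s
  proof
    assume "sin (v s) = 0"
    hence "(cos (v s))\<^sup>2 = 1" using sin_cos_squared_add[of "v s"] by simp
    thus False using ne[OF s] by (simp add: power2_eq_1_iff)
  qed
  have \<rho>: "\<rho> s = 1 \<or> \<rho> s = -1" if s: "s \<in> S" for s
  proof -
    have "(sin (u s))\<^sup>2 = (sin (v s))\<^sup>2" using eq[OF s] by (simp add: sin_squared_eq)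
    thus ?thesis unfolding power2_eq_iff \<rho>_def using nz[OF s] by auto
  qed
  have "\<rho> constant_on S"
  proof (rule continuous_finite_range_constant[OF S])
    show "continuous_on S \<rho>" unfolding \<rho>_def by (intro continuous_intros u v) (use nz in auto)
    show "finite (\<rho> ` S)" by (rule finite_subset[of _ "{1, -1}"]) (use \<rho> in auto)
  qed
  then obtain \<sigma>' where \<sigma>': "\<And>s. s \<in> S \<Longrightarrow> \<rho> s = \<sigma>'" by (auto simp: constant_on_def)
  obtain \<sigma> where \<sigma>: "\<sigma> = 1 \<or> \<sigma> = -1" "\<And>s. s \<in> S \<Longrightarrow> \<rho> s = \<sigma>"
  proof (cases "S = {}")
    case True
    thus ?thesis using that[of 1] by simp
  next
    case False
    thus ?thesis using that[of \<sigma>'] \<sigma>' \<rho> by force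
  qed
  have "exp (\<i> * (u s - \<sigma> * v s)) = 1" if s: "s \<in> S" for s
  proof -
    have su: "sin (u s) = \<sigma> * sin (v s)" using \<sigma>(2)[OF s] nz[OF s] by (simp add: \<rho>_def field_simps)
    have "exp (\<i> * (\<sigma> * v s)) = cos (\<sigma> * v s) + \<i> * sin (\<sigma> * v s)" by (rule exp_Euler)
    also have "\<dots> = cos (u s) + \<i> * sin (u s)" using \<sigma>(1) su eq[OF s] by auto
    also have "\<dots> = exp (\<i> * u s)" by (rule exp_Euler[symmetric])
    finally show ?thesis by (simp add: right_diff_distrib exp_diff)
  qed
  moreover have "continuous_on S (\<lambda>s. u s - \<sigma> * v s)" by (intro continuous_intros u v)
  ultimately obtain n :: int where "\<And>s. s \<in> S \<Longrightarrow> u s - \<sigma> * v s = of_real (2 * pi * n)"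
    using exp_i_eq_1_imp_const[OF S, of "\<lambda>s. u s - \<sigma> * v s"] by blast
  hence "u s = \<sigma> * v s + of_real (2 * pi * n)" if "s \<in> S" for s using that by (simp add: algebra_simps)
  thus ?thesis using that \<sigma>(1) by blast
qed

section \<open>Chebyshev polynomials\<close>

fun chebyshev :: "nat \<Rightarrow> complex \<Rightarrow> complex" where
  "chebyshev 0 x = 1"
| "chebyshev (Suc 0) x = x"
| "chebyshev (Suc (Suc n)) x = 2 * x * chebyshev (Suc n) x - chebyshev n x"

lemma chebyshev_cos: "chebyshev n (cos w) = cos (of_nat n * w)"
proof (induction n "cos w" rule: chebyshev.induct)
  case (3 n)
  have "cos (of_nat (Suc n) * w + w) + cos (of_nat (Suc n) * w - w) = 2 * cos w * cos (of_nat (Suc n) * w)"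
    by (simp add: cos_add cos_diff)
  moreover have "of_nat (Suc n) * w + w = of_nat (Suc (Suc n)) * w" "of_nat (Suc n) * w - w = of_nat n * w"
    by (simp_all add: algebra_simps)
  ultimately show ?case using 3 by (simp add: algebra_simps)
qed simp_all

lemma chebyshev_holomorphic: "chebyshev n holomorphic_on A"
proof (induction n rule: less_induct)
  case (less n)
  consider "n = 0" | "n = Suc 0" | m where "n = Suc (Suc m)" by (metis not0_implies_Suc)
  thus ?case
  proof cases
    case 1
    have "chebyshev 0 = (\<lambda>_. 1)" by auto
    thus ?thesis using 1 by simp
  next
    case 2
    have "chebyshev (Suc 0) = (\<lambda>x. x)" by auto
    thus ?thesis using 2 by simp
  next
    case 3
    have "chebyshev n = (\<lambda>x. 2 * x * chebyshev (Suc m) x - chebyshev m x)" using 3 by auto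
    moreover have "\<dots> holomorphic_on A" using less.IH[of m] less.IH[of "Suc m"] 3 by (intro holomorphic_intros) auto
    ultimately show ?thesis by simp
  qed
qed

lemma chebyshev_bound: "norm (chebyshev n x) \<le> (1 + 2 * norm x) ^ n"
proof (induction n x rule: chebyshev.induct)
  case (3 n x)
  have "norm (chebyshev (Suc (Suc n)) x) \<le> 2 * norm x * norm (chebyshev (Suc n) x) + norm (chebyshev n x)"
    using norm_triangle_ineq4[of "2 * x * chebyshev (Suc n) x" "chebyshev n x"] by (simp add: norm_mult)
  also have "\<dots> \<le> 2 * norm x * (1 + 2 * norm x) ^ Suc n + (1 + 2 * norm x) ^ n"
    using 3 by (intro add_mono mult_left_mono) auto
  also have "\<dots> = (2 * norm x * (1 + 2 * norm x) + 1) * (1 + 2 * norm x) ^ n" by (simp add: algebra_simps)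
  also have "\<dots> \<le> ((1 + 2 * norm x) * (1 + 2 * norm x)) * (1 + 2 * norm x) ^ n"
    by (intro mult_right_mono) (auto simp: algebra_simps)
  finally show ?case by (simp add: mult_ac)
qed auto

text \<open>cos (n Arccos x) = 0 forces Arccos x to be real. Composed with a function that avoids
  [-1, 1] off the real line, the polynomial therefore has only real zeros.\<close>

lemma chebyshev_zero:
  assumes "chebyshev n x = 0"
  shows "\<exists>t::real. t \<in> {-1..1} \<and> x = of_real t"
proof -
  have "cos (of_nat n * Arccos x) = 0" using assms chebyshev_cos[of n "Arccos x"] by simp
  then obtain k :: int where k: "of_nat n * Arccos x = complex_of_real (k * pi) + of_real pi / 2"
    unfolding cos_eq_0 by blast
  have n: "n \<noteq> 0" using assms by (cases n) auto
  have "Arccos x = of_real ((k * pi + pi / 2) / n)" using k n by (simp add: field_simps)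
  hence "x = of_real (cos ((k * pi + pi / 2) / n))" using cos_Arccos[of x] by (metis cos_of_real)
  thus ?thesis by (intro exI[of _ "cos ((k * pi + pi / 2) / n)"]) auto
qed

section \<open>The Schwarz-Pick inequality and the square root on the upper half-plane\<close>

text \<open>Cayley maps at z and f z transport the Schwarz lemma. The identity |x - cnj y|^2 = |x -
  y|^2 + 4 Im x Im y then removes the conjugates and leaves a form without quotients, suited to
  letting z tend to infinity.\<close>

lemma Schwarz_Pick_upper:
  assumes f: "f holomorphic_on \<H>" and im: "\<And>l. Im l > 0 \<Longrightarrow> Im (f l) > 0"
    and z: "Im z > 0" and l: "Im l > 0"
  shows "(norm (f l - f z))\<^sup>2 * (Im l * Im z) \<le> (norm (l - z))\<^sup>2 * (Im (f l) * Im (f z))"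
proof -
  \<comment> \<open>An inverse Cayley map: it takes the unit disc to the upper half-plane and 0 to
    z.\<close>
  define L where "L = (\<lambda>\<zeta>. (z - cnj z * \<zeta>) / (1 - \<zeta>))"
  define g where "g = (\<lambda>\<zeta>. (f (L \<zeta>) - f z) / (f (L \<zeta>) - cnj (f z)))"
  have sq: "(norm (x - cnj y))\<^sup>2 = (norm (x - y))\<^sup>2 + 4 * (Im x * Im y)" for x y
    unfolding cmod_power2 by (simp add: power2_eq_square algebra_simps)
  have one: "1 - \<zeta> \<noteq> 0" if "norm \<zeta> < 1" for \<zeta> :: complex using that by auto
  have L_im: "Im (L \<zeta>) > 0" if n: "norm \<zeta> < 1" for \<zeta>
  proof -
    have "L \<zeta> * of_real ((norm (1 - \<zeta>))\<^sup>2) = (z - cnj z * \<zeta>) * cnj (1 - \<zeta>)"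
      using one[OF n] by (simp only: complex_norm_square L_def) simp
    moreover have "Im (x * complex_of_real r) = Im x * r" for x r by simp
    ultimately have "Im (L \<zeta>) * (norm (1 - \<zeta>))\<^sup>2 = Im ((z - cnj z * \<zeta>) * cnj (1 - \<zeta>))"
      by metis
    also have "\<dots> = Im z * (1 - (norm \<zeta>)\<^sup>2)" unfolding cmod_power2 by (simp add: power2_eq_square algebra_simps)
    also have "\<dots> > 0" using z n by (simp add: power_less_one_iff abs_square_less_1)
    finally show ?thesis by (simp add: zero_less_mult_iff)
  qed
  have ne: "x - cnj y \<noteq> 0" if "Im x > 0" "Im y > 0" for x y
  proof
    assume "x - cnj y = 0"
    hence "Im (x - cnj y) = 0" by simp
    thus False using that by simp
  qed
  have lt: "norm ((x - y) / (x - cnj y)) < 1" if "Im x > 0" "Im y > 0" for x y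
  proof -
    have "(norm (x - y))\<^sup>2 < (norm (x - cnj y))\<^sup>2" using that by (simp add: sq)
    hence "norm (x - y) < norm (x - cnj y)" by (rule power_less_imp_less_base) simp
    thus ?thesis using ne[OF that] by (simp add: norm_divide)
  qed
  have ghol: "g holomorphic_on ball 0 1"
  proof -
    have Lh: "L holomorphic_on ball 0 1" unfolding L_def by (intro holomorphic_intros) auto
    have "f \<circ> L holomorphic_on ball 0 1"
      by (rule holomorphic_on_compose_gen[OF Lh f]) (use L_im in auto)
    thus ?thesis unfolding g_def o_def
      by (intro holomorphic_intros) (use ne im L_im z in auto)
  qed
  have g0: "g 0 = 0" by (simp add: g_def L_def)
  have gb: "norm (g \<zeta>) < 1" if "norm \<zeta> < 1" for \<zeta>
    unfolding g_def by (rule lt) (use im L_im that z in auto)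
  define \<zeta> where "\<zeta> = (l - z) / (l - cnj z)"
  have n\<zeta>: "norm \<zeta> < 1" unfolding \<zeta>_def by (rule lt[OF l z])
  have L\<zeta>: "L \<zeta> = l"
  proof -
    have nn: "l - cnj z \<noteq> 0" by (rule ne[OF l z])
    have "z - cnj z \<noteq> 0" using ne[OF z z] .
    have "1 - \<zeta> = (z - cnj z) / (l - cnj z)" using nn by (simp add: \<zeta>_def field_simps)
    moreover have "z - cnj z * \<zeta> = l * (z - cnj z) / (l - cnj z)" using nn by (simp add: \<zeta>_def field_simps)
    ultimately show ?thesis using nn \<open>z - cnj z \<noteq> 0\<close> by (simp add: L_def)
  qed
  have "norm (g \<zeta>) \<le> norm \<zeta>" by (rule Schwarz_Lemma(1)[OF ghol g0 gb n\<zeta>])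
  then have "norm (f l - f z) * norm (l - cnj z) \<le> norm (l - z) * norm (f l - cnj (f z))"
  proof -
    assume le: "norm (g \<zeta>) \<le> norm \<zeta>"
    have "norm (g \<zeta>) = norm (f l - f z) / norm (f l - cnj (f z))" by (simp only: g_def L\<zeta> norm_divide)
    moreover have "norm \<zeta> = norm (l - z) / norm (l - cnj z)" by (simp only: \<zeta>_def norm_divide)
    moreover have "a * d \<le> c * b" if "a / b \<le> c / d" "b > 0" "d > 0" for a b c d :: real
      using that by (simp add: field_simps)
    ultimately show ?thesis using le ne[OF l z] ne[OF im[OF l] im[OF z]] by (metis zero_less_norm_iff)
  qed
  hence "(norm (f l - f z) * norm (l - cnj z))\<^sup>2 \<le> (norm (l - z) * norm (f l - cnj (f z)))\<^sup>2"
    by (rule power_mono) simp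
  thus ?thesis unfolding power_mult_distrib sq by (simp add: algebra_simps)
qed

lemma csqrt_upper:
  assumes "Im l > 0"
  shows "Re (csqrt l) > 0" "Im (csqrt l) > 0" "- Re l \<le> (Im (csqrt l))\<^sup>2" "2 * Re (csqrt l) * Im (csqrt l) = Im l"
proof -
  have lt: "\<bar>Re l\<bar> < norm l"
  proof -
    have "(Re l)\<^sup>2 < (norm l)\<^sup>2" using assms by (simp add: cmod_power2)
    thus ?thesis using power2_less_imp_less[of "\<bar>Re l\<bar>" "norm l"] by simp
  qed
  show "Re (csqrt l) > 0" using lt by simp
  show "Im (csqrt l) > 0" using lt assms by simp
  have sq: "csqrt l * csqrt l = l" by (metis power2_csqrt power2_eq_square)
  have "Re l = (Re (csqrt l))\<^sup>2 - (Im (csqrt l))\<^sup>2" 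
    using arg_cong[OF sq, of Re] by (simp only: times_complex.sel power2_eq_square)
  thus "- Re l \<le> (Im (csqrt l))\<^sup>2" using zero_le_power2[of "Re (csqrt l)"] by linarith
  have "Im l = Re (csqrt l) * Im (csqrt l) + Im (csqrt l) * Re (csqrt l)"
    using arg_cong[OF sq, of Im] by (simp only: times_complex.sel)
  thus "2 * Re (csqrt l) * Im (csqrt l) = Im l" by (simp only: mult.commute mult_2 mult.assoc)
qed

lemma csqrt_holomorphic_upper: "csqrt holomorphic_on \<H>"
  by (auto intro!: holomorphic_intros simp: complex_nonpos_Reals_iff)

declare csqrt.sel [simp del]

section \<open>The branch of arccos G and its bounds\<close>

context band_function
begin

text \<open>The affine change of values takes [-5/4, 1] to [-1, 1] and makes the function for q = 0
  equal to cos 2z.\<close>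

definition "G l = (8 * \<Phi> l + 1) / 9"
definition "g x = (8 * \<phi> x + 1) / 9"

lemma G_hol: "G holomorphic_on UNIV"
  unfolding G_def[abs_def] by (intro holomorphic_intros hol) auto

lemma G_of_real: "G (of_real x) = of_real (g x)"
  by (simp add: G_def g_def on_reals)

lemma G_nonreal:
  assumes "Im l \<noteq> 0" "t \<in> {-1..1}"
  shows "G l \<noteq> of_real t"
proof
  assume "G l = of_real t"
  hence "\<Phi> l = of_real ((9 * t - 1) / 8)" by (simp add: G_def field_simps)
  moreover have "(9 * t - 1) / 8 \<in> {-5/4..1}" using assms(2) by auto
  ultimately show False using nonreal[OF assms(1)] by blast
qed

lemma G_ne_pm1: "Im l \<noteq> 0 \<Longrightarrow> G l \<noteq> 1 \<and> G l \<noteq> -1"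
  using G_nonreal[of l 1] G_nonreal[of l "-1"] by simp

text \<open>A polynomial of degree n in G still has order at most 1/2, with a constant depending on
  n; the Laguerre argument can be applied for each n separately.\<close>

lemma chebyshev_G_growth: "\<exists>C. \<forall>l. norm (chebyshev n (G l)) \<le> C * exp (C * sqrt (norm l))"
proof -
  obtain C where C: "\<And>l. norm (\<Phi> l - of_real 0) \<le> C * exp (C * sqrt (norm l))" using growth[of 0] by blast
  have C0: "0 \<le> C" using order_trans[OF norm_ge_zero C[of 0]] by simp
  define K where "K = 2 + 2 * C"
  have b: "1 + 2 * norm (G l) \<le> K * exp (C * sqrt (norm l))" for l
  proof -
    let ?e = "exp (C * sqrt (norm l))"
    have e1: "1 \<le> ?e" using C0 by simp
    have "norm (G l) = norm (8 * \<Phi> l + 1) / 9" by (simp add: G_def norm_divide)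
    also have "\<dots> \<le> (8 * norm (\<Phi> l) + 1) / 9"
      using norm_triangle_ineq[of "8 * \<Phi> l" 1] by (simp add: norm_mult)
    also have "\<dots> \<le> norm (\<Phi> l) + 1 / 2"
    proof -
      have "(8 * N + 1) / 9 \<le> N + 1 / 2" if "0 \<le> N" for N :: real using that by (simp add: field_simps)
      thus ?thesis using norm_ge_zero by blast
    qed
    finally have "1 + 2 * norm (G l) \<le> 2 + 2 * (C * ?e)" using C[of l] by simp
    also have "\<dots> \<le> 2 * ?e + 2 * (C * ?e)" using e1 by simp
    finally show ?thesis by (simp add: K_def algebra_simps)
  qed
  define D where "D = max (K ^ n) (n * C)"
  have D0: "0 \<le> D" using C0 by (simp add: D_def K_def le_max_iff_disj)
  have "norm (chebyshev n (G l)) \<le> D * exp (D * sqrt (norm l))" for l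
  proof -
    have "norm (chebyshev n (G l)) \<le> (1 + 2 * norm (G l)) ^ n" by (rule chebyshev_bound)
    also have "\<dots> \<le> (K * exp (C * sqrt (norm l))) ^ n" by (rule power_mono[OF b]) simp
    also have "\<dots> = K ^ n * exp ((n * C) * sqrt (norm l))"
      by (simp add: power_mult_distrib exp_of_nat_mult[symmetric] mult.assoc)
    also have "\<dots> \<le> D * exp (D * sqrt (norm l))"
      using C0 D0 by (intro mult_mono) (auto simp: D_def K_def mult_right_mono)
    finally show ?thesis .
  qed
  thus ?thesis by blast
qed

text \<open>The asymptotics are required only where Im sqrt \<lambda> is large. There the error of G
  is small relative to cos 2z, and with Im w > 0 this singles out the branch.\<close>

definition is_branch :: "(complex \<Rightarrow> complex) \<Rightarrow> bool" where
  "is_branch w \<longleftrightarrow> w holomorphic_on \<H> \<and> (\<forall>l. Im l > 0 \<longrightarrow> cos (w l) = G l \<and> Im (w l) > 0) \<and>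
     (\<forall>\<epsilon>>0. \<exists>M. \<forall>l. Im l > 0 \<and> M \<le> Im (csqrt l) \<longrightarrow> norm (w l - 2 * csqrt l) \<le> \<epsilon>)"

text \<open>Multiplying 2 cos w = 2 G by e^(2iz), with z = sqrt \<lambda>, expresses e^(i (2z - w))
  - 1 by three terms, which are small by the error estimate for G, by |e^(4iz)| = e^(-4 Im z) and by
  Im w > 0. The estimate is pointwise in w, so it applies before a branch is fixed.\<close>

lemma branch_asymptotics:
  assumes \<epsilon>: "\<epsilon> > 0"
  shows "\<exists>M>0. \<forall>l w. Im l > 0 \<and> M \<le> Im (csqrt l) \<and> cos w = G l \<and> Im w > 0 \<longrightarrow>
            norm (exp (\<i> * (2 * csqrt l - w)) - 1) < \<epsilon>"
proof -
  obtain C R where CR: "\<And>z. R \<le> norm z \<Longrightarrow> norm (G (z\<^sup>2) - cos (2 * z)) \<le> C * exp (2 * \<bar>Im z\<bar>) / norm z"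
    using asym unfolding G_def by blast
  have "((\<lambda>s::real. 2 * \<bar>C\<bar> / s + exp (- 4 * s) + exp (- 2 * s)) \<longlongrightarrow> 0) at_top" by real_asymp
  hence "eventually (\<lambda>s. 2 * \<bar>C\<bar> / s + exp (- 4 * s) + exp (- 2 * s) < \<epsilon>) at_top"
    using order_tendstoD(2) \<epsilon> by blast
  then obtain M0 where M0: "\<And>s. s \<ge> M0 \<Longrightarrow> 2 * \<bar>C\<bar> / s + exp (- 4 * s) + exp (- 2 * s) < \<epsilon>"
    by (auto simp: eventually_at_top_linorder)
  have "norm (exp (\<i> * (2 * csqrt l - w)) - 1) < \<epsilon>"
    if l: "Im l > 0" and M: "max 1 (max M0 R) \<le> Im (csqrt l)" and w: "cos w = G l" "Im w > 0" for l w
  proof -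
    define z where "z = csqrt l"
    define s where "s = Im z"
    have s: "s \<ge> 1" "s \<ge> M0" "s \<ge> R" using M by (auto simp: s_def z_def)
    have zs: "s \<le> norm z" using abs_Im_le_cmod[of z] by (simp add: s_def)
    have lz: "l = z\<^sup>2" by (simp add: z_def)
    define r where "r = G l - cos (2 * z)"
    have r: "norm r \<le> \<bar>C\<bar> * exp (2 * s) / s"
    proof -
      have "norm r \<le> C * exp (2 * \<bar>Im z\<bar>) / norm z" unfolding r_def lz by (rule CR) (use s zs in linarith)
      also have "\<dots> \<le> \<bar>C\<bar> * exp (2 * s) / s" using s zs by (intro frac_le mult_mono) (auto simp: s_def)
      finally show ?thesis .
    qed
    have ne: "norm (exp (2 * \<i> * z)) = exp (- 2 * s)" by (simp add: s_def)
    have dbl: "2 * cos x = exp (\<i> * x) + exp (- (\<i> * x))" for x :: complex by (simp add: cos_exp_eq)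
    have "exp (2 * \<i> * z) * (2 * cos w) = exp (\<i> * (2 * z - w)) + exp (\<i> * (2 * z + w))"
      unfolding dbl by (simp add: distrib_left exp_add[symmetric] algebra_simps)
    moreover have "exp (2 * \<i> * z) * (2 * cos (2 * z)) = 1 + exp (4 * \<i> * z)"
      unfolding dbl by (simp add: distrib_left exp_add[symmetric] algebra_simps)
    ultimately have "exp (\<i> * (2 * z - w)) - 1 = 2 * exp (2 * \<i> * z) * r + exp (4 * \<i> * z) - exp (\<i> * (2 * z + w))"
      unfolding w r_def by (simp add: algebra_simps)
    hence "norm (exp (\<i> * (2 * z - w)) - 1) \<le> norm (2 * exp (2 * \<i> * z) * r) + norm (exp (4 * \<i> * z)) + norm (exp (\<i> * (2 * z + w)))"
      using norm_triangle_ineq4[of "2 * exp (2 * \<i> * z) * r + exp (4 * \<i> * z)" "exp (\<i> * (2 * z + w))"]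
        norm_triangle_ineq[of "2 * exp (2 * \<i> * z) * r" "exp (4 * \<i> * z)"] by (simp only:)
    also have "norm (2 * exp (2 * \<i> * z) * r) \<le> 2 * (exp (- 2 * s) * (\<bar>C\<bar> * exp (2 * s) / s))"
      unfolding norm_mult ne using mult_left_mono[OF r, of "exp (- 2 * s)"] by simp
    also have "exp (- 2 * s) * (\<bar>C\<bar> * exp (2 * s) / s) = \<bar>C\<bar> / s" by (simp add: exp_minus)
    also have "norm (exp (4 * \<i> * z)) = exp (- 4 * s)" by (simp add: s_def)
    also have "norm (exp (\<i> * (2 * z + w))) \<le> exp (- 2 * s)" using w(2) by (simp add: s_def)
    finally show ?thesis using M0[OF s(2)] by (simp add: z_def)
  qed
  thus ?thesis by (intro exI[of _ "max 1 (max M0 R)"]) auto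
qed

text \<open>For any holomorphic arccos of G, Im w has no zero because G avoids [-1, 1]; a change of
  sign makes it positive. In the far region 2z - w is close to a multiple of 2 \<pi>, which is
  constant by connectedness and can be removed.\<close>

lemma branch_exists: "\<exists>w. is_branch w"
proof -
  have contr: "contractible \<H>" by (rule convex_imp_contractible[OF convex_upper(1)])
  obtain w0 where w0: "w0 holomorphic_on \<H>" "\<And>l. Im l > 0 \<Longrightarrow> G l = cos (w0 l)"
  proof (rule contractible_imp_holomorphic_arccos[OF holomorphic_on_subset[OF G_hol] contr])
    show "G z \<noteq> 1 \<and> G z \<noteq> -1" if "z \<in> \<H>" for z using G_ne_pm1[of z] that by simp
  qed auto
  have im0: "Im (w0 l) \<noteq> 0" if l: "Im l > 0" for l
  proof
    assume "Im (w0 l) = 0"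
    hence "w0 l = of_real (Re (w0 l))" by (simp add: complex_eq_iff)
    hence "G l = of_real (cos (Re (w0 l)))" using w0(2)[OF l] by (metis cos_of_real)
    thus False using G_nonreal[of l "cos (Re (w0 l))"] l by auto
  qed
  have "connected ((\<lambda>l. Im (w0 l)) ` \<H>)"
    by (intro connected_continuous_image convex_upper continuous_intros holomorphic_on_imp_continuous_on w0)
  hence "(\<forall>l\<in>\<H>. Im (w0 l) > 0) \<or> (\<forall>l\<in>\<H>. Im (w0 l) < 0)"
  proof -
    assume conn: "connected ((\<lambda>l. Im (w0 l)) ` \<H>)"
    show ?thesis
    proof (rule ccontr)
      assume "\<not> ?thesis"
      then obtain x y where xy: "x \<in> \<H>" "y \<in> \<H>" "\<not> Im (w0 x) > 0" "\<not> Im (w0 y) < 0" by blast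
      hence "Im (w0 x) \<le> 0" "0 \<le> Im (w0 y)" by auto
      hence "0 \<in> (\<lambda>l. Im (w0 l)) ` \<H>" using connectedD_interval[OF conn] xy by blast
      thus False using im0 by force
    qed
  qed
  then obtain w1 where w1: "w1 holomorphic_on \<H>" "\<And>l. Im l > 0 \<Longrightarrow> cos (w1 l) = G l" "\<And>l. Im l > 0 \<Longrightarrow> Im (w1 l) > 0"
  proof
    assume "\<forall>l\<in>\<H>. Im (w0 l) > 0"
    thus ?thesis using that[of w0] w0 by simp
  next
    assume "\<forall>l\<in>\<H>. Im (w0 l) < 0"
    thus ?thesis using that[of "\<lambda>l. - w0 l"] w0 by (simp add: holomorphic_on_minus)
  qed
  have half: "(1 / 4 :: real) > 0" by simp
  obtain M where M: "M > 0" and bM: "\<And>l. Im l > 0 \<Longrightarrow> M \<le> Im (csqrt l) \<Longrightarrow> norm (exp (\<i> * (2 * csqrt l - w1 l)) - 1) < 1 / 4"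
    using branch_asymptotics[OF half] w1 by blast
  define U where "U = {l. Im l > 0 \<and> M \<le> Im (csqrt l)}"
  have UH: "U \<subseteq> \<H>" by (auto simp: U_def)
  \<comment> \<open>The far region is the image under squaring of a convex part of the first
    quadrant.\<close>
  have Uconn: "connected U"
  proof -
    define V where "V = {z. Re z > 0} \<inter> {z. Im z \<ge> M}"
    have "convex V" unfolding V_def by (intro convex_Int convex_halfspace_Re_gt convex_halfspace_Im_ge)
    hence "connected ((\<lambda>z. z\<^sup>2) ` V)" by (intro connected_continuous_image convex_connected continuous_intros)
    moreover have "(\<lambda>z. z\<^sup>2) ` V = U"
    proof (intro equalityI subsetI)
      fix l assume "l \<in> (\<lambda>z. z\<^sup>2) ` V"
      then obtain z where z: "l = z\<^sup>2" "Re z > 0" "Im z \<ge> M" by (auto simp: V_def)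
      have "csqrt l = z" unfolding z(1) by (rule csqrt_square) (use z in auto)
      moreover have "Im l > 0" using z M by (simp add: power2_eq_square)
      ultimately show "l \<in> U" using z by (simp add: U_def)
    next
      fix l assume l: "l \<in> U"
      have "l = (csqrt l)\<^sup>2" by simp
      moreover have "csqrt l \<in> V" using l csqrt_upper(1)[of l] by (simp add: U_def V_def)
      ultimately show "l \<in> (\<lambda>z. z\<^sup>2) ` V" by (rule image_eqI)
    qed
    ultimately show ?thesis by simp
  qed
  \<comment> \<open>E stays within 1/4 of 1, so its principal logarithm is continuous; it measures
    the deviation of 2z - w from the lattice of multiples of 2 \<pi>.\<close>
  define E where "E = (\<lambda>l. exp (\<i> * (2 * csqrt l - w1 l)))"
  have Ecl: "norm (E l - 1) < 1 / 4" if "l \<in> U" for l using bM that by (simp add: E_def U_def)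
  have Enn: "E l \<notin> \<real>\<^sub>\<le>\<^sub>0" if l: "l \<in> U" for l
  proof
    assume "E l \<in> \<real>\<^sub>\<le>\<^sub>0"
    hence "Re (E l) \<le> 0" by (simp add: complex_nonpos_Reals_iff)
    moreover have "\<bar>Re (E l - 1)\<bar> < 1 / 4" using Ecl[OF l] abs_Re_le_cmod order_le_less_trans by blast
    ultimately show False by simp
  qed
  have csc: "continuous_on U csqrt" "continuous_on U w1"
    using csqrt_holomorphic_upper w1(1) UH holomorphic_on_imp_continuous_on continuous_on_subset by blast+
  have Ec: "continuous_on U E" unfolding E_def by (intro continuous_intros csc)
  have "exp (\<i> * ((2 * csqrt l - w1 l) + \<i> * Ln (E l))) = 1" if l: "l \<in> U" for l
  proof -
    have "E l \<noteq> 0" using Enn[OF l] by auto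
    hence "exp (Ln (E l)) = E l" by (rule exp_Ln)
    moreover have "\<i> * ((2 * csqrt l - w1 l) + \<i> * Ln (E l)) = \<i> * (2 * csqrt l - w1 l) - Ln (E l)"
      by (simp add: algebra_simps)
    ultimately show ?thesis using \<open>E l \<noteq> 0\<close> by (simp add: exp_diff) (simp add: E_def)
  qed
  moreover have "continuous_on U (\<lambda>l. (2 * csqrt l - w1 l) + \<i> * Ln (E l))"
    using Enn by (intro continuous_intros csc Ec) auto
  ultimately obtain n :: int where n: "\<And>l. l \<in> U \<Longrightarrow> (2 * csqrt l - w1 l) + \<i> * Ln (E l) = of_real (2 * pi * n)"
    using exp_i_eq_1_imp_const[OF Uconn] by blast
  define w where "w = (\<lambda>l. w1 l + of_real (2 * pi * n))"
  have wc: "cos (w l) = cos (w1 l)" for l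
  proof -
    have "cos (w1 l + 2 * of_int n * of_real pi) = cos (w1 l)"
      unfolding complex_cos_eq by (intro bexI[of _ "of_int n"]) auto
    thus ?thesis by (simp add: w_def mult_ac)
  qed
  have "\<exists>M'. \<forall>l. Im l > 0 \<and> M' \<le> Im (csqrt l) \<longrightarrow> norm (w l - 2 * csqrt l) \<le> \<epsilon>" if eps: "\<epsilon> > 0" for \<epsilon> :: real
  proof -
    have "\<epsilon> / 2 > 0" using eps by simp
    from branch_asymptotics[OF this] obtain M' where M': "\<And>l. Im l > 0 \<Longrightarrow> M' \<le> Im (csqrt l) \<Longrightarrow> norm (E l - 1) < \<epsilon> / 2"
      using w1 unfolding E_def by blast
    have "norm (w l - 2 * csqrt l) \<le> \<epsilon>" if l: "Im l > 0" "max M M' \<le> Im (csqrt l)" for l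
    proof -
      have lU: "l \<in> U" using l by (simp add: U_def)
      have "w l - 2 * csqrt l = \<i> * Ln (E l)" using n[OF lU] by (simp add: w_def algebra_simps)
      hence "norm (w l - 2 * csqrt l) = norm (Ln (1 + (E l - 1)))" by (simp add: norm_mult)
      also have "\<dots> \<le> 2 * norm (E l - 1)" by (rule norm_Ln_le) (use Ecl[OF lU] in simp)
      also have "\<dots> \<le> \<epsilon>" using M'[of l] l by simp
      finally show ?thesis .
    qed
    thus ?thesis by blast
  qed
  moreover have "w holomorphic_on \<H>" unfolding w_def by (intro holomorphic_intros w1)
  moreover have "Im (w l) = Im (w1 l)" for l by (simp add: w_def)
  ultimately have "is_branch w" unfolding is_branch_def using w1 wc by simp
  thus ?thesis by blast
qed

context
  fixes w :: "complex \<Rightarrow> complex"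
  assumes w: "is_branch w"
begin

lemma branch: "w holomorphic_on \<H>" "Im l > 0 \<Longrightarrow> cos (w l) = G l" "Im l > 0 \<Longrightarrow> Im (w l) > 0"
  using w unfolding is_branch_def by blast+

lemma branch_limit: "\<epsilon> > 0 \<Longrightarrow> \<exists>M. \<forall>l. Im l > 0 \<and> M \<le> Im (csqrt l) \<longrightarrow> norm (w l - 2 * csqrt l) \<le> \<epsilon>"
  using w unfolding is_branch_def by blast

lemma branch_deriv: "Im l > 0 \<Longrightarrow> (w has_field_derivative deriv w l) (at l)"
  using holomorphic_derivI[OF branch(1) convex_upper(2)] by simp

text \<open>
  The functions $T_n(G) = \cos (n w)$ have only real zeros, so that $\Im (- n w' \tan (n w)) \le 0$; and
  $\tan (n w) \to i$ as $n \to \infty$.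
\<close>

lemma Re_deriv_branch_nonneg:
  assumes l: "Im l > 0"
  shows "0 \<le> Re (deriv w l)"
proof -
  \<comment> \<open>In terms of E, -tan (n w) is i (E^n - 1)/(E^n + 1), and |E| < 1 lets E^n tend to
    0.\<close>
  define E where "E = exp (2 * \<i> * w l)"
  have nE: "norm E < 1" using branch(3)[OF l] by (simp add: E_def)
  have ineq: "Im (deriv w l * (\<i> * (E ^ n - 1) / (E ^ n + 1))) \<le> 0" if n: "n > 0" for n
  proof -
    let ?g = "\<lambda>l. chebyshev n (G l)"
    obtain C where C: "\<And>l. norm (?g l) \<le> C * exp (C * sqrt (norm l))" using chebyshev_G_growth by blast
    have hol: "?g holomorphic_on UNIV"
      using holomorphic_on_compose_gen[OF G_hol chebyshev_holomorphic[of n UNIV]] by (simp add: o_def)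
    have rz: "Im l = 0" if "?g l = 0" for l
      using chebyshev_zero[OF that] G_nonreal by blast
    have "Im (logderiv ?g l) \<le> 0" by (rule Im_logderiv_le(1)[OF hol C rz l])
    moreover have "logderiv ?g l = of_nat n * (deriv w l * (\<i> * (E ^ n - 1) / (E ^ n + 1)))"
    proof -
      have eq: "?g v = cos (of_nat n * w v)" if "Im v > 0" for v
        using branch(2)[OF that] chebyshev_cos[of n "w v"] by simp
      have "((\<lambda>v. cos (of_nat n * w v)) has_field_derivative - sin (of_nat n * w l) * (of_nat n * deriv w l)) (at l)"
        by (auto intro!: derivative_eq_intros branch_deriv l)
      hence "(?g has_field_derivative - sin (of_nat n * w l) * (of_nat n * deriv w l)) (at l)"
        by (rule has_field_derivative_transform_within_open[OF _ convex_upper(2)]) (use l eq in auto)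
      hence "deriv ?g l = - sin (of_nat n * w l) * (of_nat n * deriv w l)" by (rule DERIV_imp_deriv)
      hence "logderiv ?g l = - (of_nat n * deriv w l) * (sin (of_nat n * w l) / cos (of_nat n * w l))"
        by (simp add: logderiv_def eq[OF l])
      also have "sin (of_nat n * w l) / cos (of_nat n * w l) = - (\<i> * (E ^ n - 1) / (E ^ n + 1))"
      proof -
        let ?x = "of_nat n * w l"
        have En: "E ^ n = exp (\<i> * ?x) * exp (\<i> * ?x)"
          by (simp add: E_def exp_of_nat_mult[symmetric] exp_add[symmetric] algebra_simps)
        have "sin ?x = (E ^ n - 1) / (2 * \<i> * exp (\<i> * ?x))" "cos ?x = (E ^ n + 1) / (2 * exp (\<i> * ?x))"
          by (simp_all add: sin_exp_eq cos_exp_eq En exp_minus field_simps)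
        moreover have "(P / (2 * \<i> * x)) / (Q / (2 * x)) = - (\<i> * P / Q)" if "x \<noteq> 0" for P Q x :: complex
          using that by (cases "Q = 0") (auto simp: field_simps)
        ultimately show ?thesis by (metis exp_not_eq_zero)
      qed
      finally show ?thesis by simp
    qed
    moreover have "Im (of_nat n * X) = of_nat n * Im X" for X by simp
    ultimately have "of_nat n * Im (deriv w l * (\<i> * (E ^ n - 1) / (E ^ n + 1))) \<le> 0" by metis
    thus ?thesis using n by (simp add: mult_le_0_iff)
  qed
  have "(\<lambda>n. Im (deriv w l * (\<i> * (E ^ n - 1) / (E ^ n + 1)))) \<longlonglongrightarrow> Im (deriv w l * (\<i> * (0 - 1) / (0 + 1)))"
    by (intro tendsto_intros LIMSEQ_power_zero nE) simp
  hence "Im (deriv w l * (\<i> * (0 - 1) / (0 + 1))) \<le> 0"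
    by (rule LIMSEQ_le_const2) (use ineq in \<open>auto intro!: exI[of _ 1]\<close>)
  thus ?thesis by simp
qed

lemma Re_branch_mono:
  assumes y: "y > 0" and x: "x \<le> x'"
  shows "Re (w (Complex x y)) \<le> Re (w (Complex x' y))"
proof (rule DERIV_nonneg_imp_nondecreasing[OF x])
  fix t assume "x \<le> t" "t \<le> x'"
  have "((\<lambda>u. w (u + \<i> * of_real y)) has_field_derivative deriv w (of_real t + \<i> * of_real y)) (at (of_real t))"
    by (rule DERIV_chain2[OF branch_deriv, of _ _ 1, simplified]) (use y in \<open>auto intro!: derivative_eq_intros\<close>)
  from Re_has_real_derivative[OF this]
  have "((\<lambda>t. Re (w (Complex t y))) has_real_derivative Re (deriv w (Complex t y))) (at t)"
    by (simp add: Complex_eq)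
  moreover have "Re (deriv w (Complex t y)) \<ge> 0" by (rule Re_deriv_branch_nonneg) (use y in simp)
  ultimately show "\<exists>d. ((\<lambda>t. Re (w (Complex t y))) has_real_derivative d) (at t) \<and> 0 \<le> d" by blast
qed

lemma Im_csqrt_large:
  assumes "Im l > 0" "Re l \<le> - (max M 0)\<^sup>2"
  shows "M \<le> Im (csqrt l)"
proof -
  have "(max M 0)\<^sup>2 \<le> (Im (csqrt l))\<^sup>2" using csqrt_upper(3)[OF assms(1)] assms(2) by linarith
  hence "max M 0 \<le> Im (csqrt l)" by (rule power2_le_imp_le) (use csqrt_upper(2)[OF assms(1)] in linarith)
  thus ?thesis by simp
qed

text \<open>Re w is nondecreasing along horizontal lines, and far to the left w is close to 2 sqrt
  \<lambda>, whose real part is positive.\<close>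

lemma Re_branch_nonneg:
  assumes l: "Im l > 0"
  shows "0 \<le> Re (w l)"
proof (rule field_le_epsilon)
  fix \<epsilon> :: real assume "\<epsilon> > 0"
  from branch_limit[OF this] obtain M where M: "\<And>l. Im l > 0 \<Longrightarrow> M \<le> Im (csqrt l) \<Longrightarrow> norm (w l - 2 * csqrt l) \<le> \<epsilon>"
    by blast
  define x where "x = min (Re l) (- (max M 0)\<^sup>2)"
  let ?v = "Complex x (Im l)"
  have v: "Im ?v > 0" using l by simp
  have "norm (w ?v - 2 * csqrt ?v) \<le> \<epsilon>" by (rule M[OF v Im_csqrt_large[OF v]]) (simp add: x_def)
  hence "\<bar>Re (w ?v - 2 * csqrt ?v)\<bar> \<le> \<epsilon>" using abs_Re_le_cmod order_trans by blast
  moreover have "Re (w ?v - 2 * csqrt ?v) = Re (w ?v) - 2 * Re (csqrt ?v)" by simp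
  ultimately have "- \<epsilon> \<le> Re (w ?v)" using csqrt_upper(1)[OF v] by linarith
  also have "\<dots> \<le> Re (w (Complex (Re l) (Im l)))" by (rule Re_branch_mono[OF l]) (simp add: x_def)
  finally show "0 \<le> Re (w l) + \<epsilon>" by simp
qed

text \<open>The Julia--Wolff argument: the angular derivative of $w^2/4$ at infinity equals one.\<close>

lemma Im_branch_square_ge:
  assumes l: "Im l > 0"
  shows "Im l \<le> Im ((w l)\<^sup>2 / 4)"
proof (rule field_le_epsilon)
  fix \<delta> :: real assume \<delta>: "\<delta> > 0"
  \<comment> \<open>Re w is only known to be nonnegative; adding i \<delta> places the values in the
    open half-plane, as Schwarz-Pick requires.\<close>
  define f where "f = (\<lambda>l. (w l)\<^sup>2 / 4 + \<i> * of_real \<delta>)"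
  have fh: "f holomorphic_on \<H>" unfolding f_def by (intro holomorphic_intros branch(1)) auto
  have Im_sq: "Im ((w l)\<^sup>2 / 4) = Re (w l) * Im (w l) / 2" for l by (simp add: power2_eq_square)
  have fi: "Im (f l) > 0" if "Im l > 0" for l
  proof -
    have "0 \<le> Re (w l) * Im (w l)" using Re_branch_nonneg[OF that] branch(3)[OF that] by simp
    thus ?thesis using \<delta> by (simp add: f_def Im_sq del: Im_divide_numeral)
  qed
  define z where "z = (\<lambda>t::real. \<i> * of_real t)"
  have SP: "(norm (f l - f (z t)))\<^sup>2 * (Im l * t) \<le> (norm (l - z t))\<^sup>2 * (Im (f l) * Im (f (z t)))" if "t > 0" for t
    using Schwarz_Pick_upper[OF fh fi _ l, of "z t"] that by (simp add: z_def)
  have csq: "csqrt (z t) = of_real (sqrt (t / 2)) * (1 + \<i>)" if t: "t > 0" for t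
  proof (rule csqrt_unique)
    have "(complex_of_real (sqrt (t / 2)))\<^sup>2 = of_real (t / 2)" using t by (metis of_real_power real_sqrt_pow2 less_imp_le half_gt_zero)
    thus "(of_real (sqrt (t / 2)) * (1 + \<i>))\<^sup>2 = z t" by (simp add: power_mult_distrib z_def power2_eq_square algebra_simps)
  qed (use t in simp)
  have wl: "((\<lambda>t. w (z t) - 2 * csqrt (z t)) \<longlongrightarrow> 0) at_top"
  proof (rule tendstoI)
    fix e :: real assume e: "e > 0"
    hence "e / 2 > 0" by simp
    from branch_limit[OF this] obtain M where M: "\<And>l. Im l > 0 \<Longrightarrow> M \<le> Im (csqrt l) \<Longrightarrow> norm (w l - 2 * csqrt l) \<le> e / 2"
      by blast
    have "eventually (\<lambda>t::real. sqrt (t / 2) \<ge> M) at_top" by real_asymp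
    thus "eventually (\<lambda>t. dist (w (z t) - 2 * csqrt (z t)) 0 < e) at_top"
      using eventually_gt_at_top[of 0]
    proof eventually_elim
      case (elim t)
      have "M \<le> Im (csqrt (z t))" using elim csq[of t] by simp
      hence "norm (w (z t) - 2 * csqrt (z t)) \<le> e / 2" using elim by (intro M) (auto simp: z_def)
      thus ?case using e by simp
    qed
  qed
  have isq: "((\<lambda>t::real. complex_of_real (1 / sqrt t)) \<longlongrightarrow> of_real 0) at_top"
    by (intro tendsto_of_real) real_asymp
  have lim_w: "((\<lambda>t. w (z t) * of_real (1 / sqrt t)) \<longlongrightarrow> of_real (2 / sqrt 2) * (1 + \<i>)) at_top"
  proof -
    have "((\<lambda>t. (w (z t) - 2 * csqrt (z t)) * of_real (1 / sqrt t) + of_real (2 / sqrt 2) * (1 + \<i>)) \<longlongrightarrow>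
       0 * of_real 0 + of_real (2 / sqrt 2) * (1 + \<i>)) at_top"
      by (intro tendsto_intros wl isq)
    moreover have "eventually (\<lambda>t. (w (z t) - 2 * csqrt (z t)) * of_real (1 / sqrt t) + of_real (2 / sqrt 2) * (1 + \<i>)
        = w (z t) * of_real (1 / sqrt t)) at_top"
      using eventually_gt_at_top[of 0]
    proof eventually_elim
      case (elim t)
      have "sqrt (t / 2) * (1 / sqrt t) = 1 / sqrt 2" using elim by (simp add: real_sqrt_divide)
      hence "complex_of_real (sqrt (t / 2)) * of_real (1 / sqrt t) = of_real (1 / sqrt 2)"
        by (metis of_real_mult)
      hence "2 * csqrt (z t) * of_real (1 / sqrt t) = of_real (2 / sqrt 2) * (1 + \<i>)"
        unfolding csq[OF elim] by (simp add: mult_ac)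
      thus ?case by (simp add: algebra_simps)
    qed
    ultimately have "((\<lambda>t. w (z t) * of_real (1 / sqrt t)) \<longlongrightarrow> 0 * of_real 0 + of_real (2 / sqrt 2) * (1 + \<i>)) at_top"
      by (rule Lim_transform_eventually)
    thus ?thesis by (simp only: mult_zero_left add_0)
  qed
  have lim_f: "((\<lambda>t. f (z t) * of_real (1 / t)) \<longlongrightarrow> \<i>) at_top"
  proof -
    have it: "((\<lambda>t::real. complex_of_real (1 / t)) \<longlongrightarrow> of_real 0) at_top"
      by (intro tendsto_of_real) real_asymp
    have lim1: "((\<lambda>t. (w (z t) * of_real (1 / sqrt t))\<^sup>2 / 4 + \<i> * of_real \<delta> * of_real (1 / t)) \<longlongrightarrow>
       (of_real (2 / sqrt 2) * (1 + \<i>))\<^sup>2 / 4 + \<i> * of_real \<delta> * of_real 0) at_top"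
      by (intro tendsto_intros lim_w it) auto
    have X: "(of_real (2 / sqrt 2) * (1 + \<i>))\<^sup>2 / 4 + \<i> * of_real \<delta> * of_real 0 = \<i>"
    proof -
      have "(complex_of_real (2 / sqrt 2))\<^sup>2 = of_real ((2 / sqrt 2)\<^sup>2)" by (simp only: of_real_power)
      also have "(2 / sqrt 2)\<^sup>2 = 2" by (simp add: power_divide)
      finally have sq2: "(complex_of_real (2 / sqrt 2))\<^sup>2 = 2" by simp
      have i2: "(1 + \<i>)\<^sup>2 = 2 * \<i>" by (simp add: complex_eq_iff power2_eq_square)
      have "(K * (1 + \<i>))\<^sup>2 / 4 + \<i> * of_real \<delta> * of_real 0 = \<i>" if "K\<^sup>2 = 2" for K :: complex
        by (simp add: power_mult_distrib i2 that)
      from this[OF sq2] show ?thesis .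
    qed
    have ev: "eventually (\<lambda>t. (w (z t) * of_real (1 / sqrt t))\<^sup>2 / 4 + \<i> * of_real \<delta> * of_real (1 / t) = f (z t) * of_real (1 / t)) at_top"
      using eventually_gt_at_top[of 0]
    proof eventually_elim
      case (elim t)
      have "(complex_of_real (1 / sqrt t))\<^sup>2 = of_real ((1 / sqrt t)\<^sup>2)" by simp
      also have "(1 / sqrt t)\<^sup>2 = 1 / t" using elim by (simp add: power_divide)
      finally show ?case by (simp only: power_mult_distrib f_def) (simp add: algebra_simps)
    qed
    from Lim_transform_eventually[OF lim1 ev] show ?thesis unfolding X .
  qed
  have it: "((\<lambda>t::real. complex_of_real (1 / t)) \<longlongrightarrow> 0) at_top"
  proof -
    have ir: "((\<lambda>t::real. 1 / t) \<longlongrightarrow> 0) at_top" by real_asymp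
    from tendsto_of_real[OF ir] show ?thesis by (simp only: of_real_0)
  qed
  have A: "((\<lambda>t. (norm (f l * of_real (1 / t) - f (z t) * of_real (1 / t)))\<^sup>2 * Im l) \<longlongrightarrow> (norm (f l * 0 - \<i>))\<^sup>2 * Im l) at_top"
    by (intro tendsto_intros lim_f it)
  have B: "((\<lambda>t. (norm (l * of_real (1 / t) - \<i>))\<^sup>2 * (Im (f l) * Im (f (z t) * of_real (1 / t)))) \<longlongrightarrow>
      (norm (l * 0 - \<i>))\<^sup>2 * (Im (f l) * Im \<i>)) at_top"
    by (intro tendsto_intros lim_f it)
  have "(norm (f l * 0 - \<i>))\<^sup>2 * Im l \<le> (norm (l * 0 - \<i>))\<^sup>2 * (Im (f l) * Im \<i>)"
  proof (rule tendsto_le[OF _ B A])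
    show "eventually (\<lambda>t. (norm (f l * of_real (1 / t) - f (z t) * of_real (1 / t)))\<^sup>2 * Im l \<le>
       (norm (l * of_real (1 / t) - \<i>))\<^sup>2 * (Im (f l) * Im (f (z t) * of_real (1 / t)))) at_top"
      using eventually_gt_at_top[of 0]
    proof eventually_elim
      case (elim t)
      have 1: "f l * of_real (1 / t) - f (z t) * of_real (1 / t) = (f l - f (z t)) * of_real (1 / t)"
        by (rule left_diff_distrib[symmetric])
      have 2: "l * of_real (1 / t) - \<i> = (l - z t) * of_real (1 / t)" using elim by (simp add: z_def field_simps)
      have 3: "Im (f (z t) * of_real (1 / t)) = Im (f (z t)) * (1 / t)" by simp
      have 4: "(norm (u * complex_of_real (1 / t)))\<^sup>2 = (norm u)\<^sup>2 * (1 / t)\<^sup>2" for u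
        by (simp only: norm_mult norm_of_real power_mult_distrib power2_abs)
      \<comment> \<open>Division by t^3 leaves an inequality in f l/t and l/t, which tend to 0, and
        f (i t)/t, which tends to i.\<close>
      have "(norm (f l - f (z t)))\<^sup>2 * (Im l * t) * (1 / t) ^ 3 \<le> (norm (l - z t))\<^sup>2 * (Im (f l) * Im (f (z t))) * (1 / t) ^ 3"
        by (rule mult_right_mono[OF SP[OF elim]]) (use elim in simp)
      thus ?case unfolding 1 2 3 4 using elim by (simp add: power2_eq_square power3_eq_cube field_simps)
    qed
  qed simp
  thus "Im l \<le> Im ((w l)\<^sup>2 / 4) + \<delta>" by (simp add: f_def)
qed

end

end

section \<open>Boundary values on the bands\<close>

lemma real_islimpt_upper: "complex_of_real x islimpt \<H>"
proof -
  have "\<exists>y\<in>\<H>. y \<noteq> of_real x \<and> dist y (of_real x) < e" if "e > 0" for e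
    by (rule bexI[of _ "Complex x (e / 2)"]) (use that in \<open>auto simp: dist_norm complex_eq_iff cmod_def\<close>)
  thus ?thesis by (simp add: islimpt_approachable)
qed

context band_function
begin

lemma g_continuous: "continuous_on S g"
  unfolding g_def by (intro continuous_intros \<phi>_continuous) auto

text \<open>The limit is shown to exist at points with |g| < 1, and only there is \<open>bv\<close>
  used.\<close>

definition "bv w x = Re (Lim (at (complex_of_real x) within \<H>) w)" for w :: "complex \<Rightarrow> complex"

context
  fixes w :: "complex \<Rightarrow> complex"
  assumes w: "is_branch w"
begin

text \<open>Where |Re G| < 1 the principal Arccos is holomorphic. On the upper half of a small disc
  w is Arccos G up to sign and a multiple of 2 \<pi>, so it continues across the real line, with
  real values on it.\<close>

lemma local_extension:
  assumes x0: "\<bar>g x0\<bar> < 1"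
  obtains r W where "r > 0" "W holomorphic_on ball (complex_of_real x0) r"
    "\<And>l. l \<in> ball (complex_of_real x0) r \<Longrightarrow> Im l > 0 \<Longrightarrow> W l = w l"
    "\<And>x. complex_of_real x \<in> ball (complex_of_real x0) r \<Longrightarrow> Im (W (of_real x)) = 0 \<and> cos (Re (W (of_real x))) = g x"
proof -
  have Gc: "continuous_on UNIV G" by (rule holomorphic_on_imp_continuous_on[OF G_hol])
  have "open {l. \<bar>Re (G l)\<bar> < 1}"
    by (intro open_Collect_less continuous_intros Gc)
  moreover have "complex_of_real x0 \<in> {l. \<bar>Re (G l)\<bar> < 1}" using x0 by (simp add: G_of_real)
  ultimately obtain r where r: "r > 0" "ball (complex_of_real x0) r \<subseteq> {l. \<bar>Re (G l)\<bar> < 1}"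
    by (meson openE)
  let ?B = "ball (complex_of_real x0) r"
  have Ah: "(\<lambda>l. Arccos (G l)) holomorphic_on ?B"
  proof -
    have "Arccos holomorphic_on {z. \<bar>Re z\<bar> < 1}" by (rule holomorphic_on_Arccos) simp
    moreover have "G holomorphic_on ?B" by (rule holomorphic_on_subset[OF G_hol]) simp
    ultimately have "Arccos \<circ> G holomorphic_on ?B" using holomorphic_on_compose_gen r(2) by blast
    thus ?thesis by (simp add: o_def)
  qed
  have conn: "connected (?B \<inter> \<H>)" by (intro convex_connected convex_Int convex_ball convex_upper)
  have cw: "continuous_on (?B \<inter> \<H>) w"
    by (rule continuous_on_subset[OF holomorphic_on_imp_continuous_on[OF branch(1)[OF w]]]) simp
  have cA: "continuous_on (?B \<inter> \<H>) (\<lambda>l. Arccos (G l))"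
    by (rule continuous_on_subset[OF holomorphic_on_imp_continuous_on[OF Ah]]) simp
  obtain \<sigma> :: complex and n :: int where \<sigma>: "\<sigma> = 1 \<or> \<sigma> = -1"
    and wA: "\<And>l. l \<in> ?B \<inter> \<H> \<Longrightarrow> w l = \<sigma> * Arccos (G l) + of_real (2 * pi * n)"
  proof (rule cos_branch_unique[OF conn cw cA])
    show "cos (w l) = cos (Arccos (G l))" if "l \<in> ?B \<inter> \<H>" for l
      using branch(2)[OF w, of l] that by simp
    show "cos (Arccos (G l)) \<noteq> 1 \<and> cos (Arccos (G l)) \<noteq> - 1" if "l \<in> ?B \<inter> \<H>" for l
      using G_ne_pm1[of l] that by simp
  qed blast
  define W where "W = (\<lambda>l. \<sigma> * Arccos (G l) + of_real (2 * pi * n))"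
  show ?thesis
  proof (rule that[of r W])
    show "W holomorphic_on ?B" unfolding W_def by (intro holomorphic_intros Ah)
    show "W l = w l" if "l \<in> ?B" "Im l > 0" for l using wA[of l] that by (simp add: W_def)
    fix x assume "complex_of_real x \<in> ?B"
    hence "complex_of_real x \<in> {l. \<bar>Re (G l)\<bar> < 1}" using r(2) by (rule subsetD[rotated])
    hence gx: "\<bar>g x\<bar> < 1" by (simp add: G_of_real)
    have A: "Arccos (G (of_real x)) = of_real (arccos (g x))"
      unfolding G_of_real using of_real_arccos[of "g x"] gx by simp
    obtain s :: real where s: "s = 1 \<or> s = -1" "\<sigma> = of_real s"
      using \<sigma> by (metis of_real_1 of_real_minus)
    have W: "W (of_real x) = of_real (s * arccos (g x) + 2 * pi * n)"
      unfolding W_def A s(2) by simp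
    have "cos (s * arccos (g x) + 2 * pi * n) = cos (s * arccos (g x))"
    proof -
      have "cos (y + 2 * pi * of_int n) = cos y" for y :: real
        using cos_int_2pin[of n] sin_int_2pin[of n] by (simp add: cos_add mult_ac)
      thus ?thesis by simp
    qed
    also have "\<dots> = cos (arccos (g x))" using s(1) by auto
    also have "\<dots> = g x" using gx by (intro cos_arccos) auto
    finally show "Im (W (of_real x)) = 0 \<and> cos (Re (W (of_real x))) = g x" unfolding W by simp
  qed (rule r(1))
qed

text \<open>On the band w^2/4 is real, and above it its imaginary part is at least Im \<lambda>. By
  the Cauchy-Riemann equations its derivative along the line, bv D/2, equals the vertical derivative
  of the imaginary part, hence is at least 1.\<close>

lemma band_point:
  assumes x0: "\<bar>g x0\<bar> < 1"
  shows "cos (bv w x0) = g x0"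
    and "((\<lambda>t. Re (w (Complex x0 t))) \<longlongrightarrow> bv w x0) (at_right 0)"
    and "0 \<le> bv w x0"
    and "\<exists>D. (bv w has_real_derivative D) (at x0) \<and> 1 \<le> bv w x0 * D / 2"
proof -
  obtain r W where r: "r > 0" and Wh: "W holomorphic_on ball (complex_of_real x0) r"
    and Ww: "\<And>l. l \<in> ball (complex_of_real x0) r \<Longrightarrow> Im l > 0 \<Longrightarrow> W l = w l"
    and Wr: "\<And>x. complex_of_real x \<in> ball (complex_of_real x0) r \<Longrightarrow> Im (W (of_real x)) = 0 \<and> cos (Re (W (of_real x))) = g x"
    using local_extension[OF x0] by blast
  let ?B = "ball (complex_of_real x0) r"
  have Wc: "isCont W l" if "l \<in> ?B" for l
    using holomorphic_on_imp_continuous_on[OF Wh] that continuous_on_eq_continuous_at open_ball by blast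
  have lim: "(w \<longlongrightarrow> W (of_real x)) (at (of_real x) within \<H>)" if x: "complex_of_real x \<in> ?B" for x
  proof -
    have "(W \<longlongrightarrow> W (of_real x)) (at (of_real x) within \<H>)"
      using Wc[OF x] by (intro tendsto_within_subset[where T = \<H> and S = UNIV]) (auto simp: isCont_def)
    moreover have "eventually (\<lambda>l. W l = w l) (at (of_real x) within \<H>)"
      unfolding eventually_at_topological using x Ww by (intro exI[of _ ?B]) auto
    ultimately show ?thesis by (rule Lim_transform_eventually)
  qed
  have bv_eq: "bv w x = Re (W (of_real x))" if x: "complex_of_real x \<in> ?B" for x
    unfolding bv_def using tendsto_Lim[OF _ lim[OF x]] real_islimpt_upper[of x] trivial_limit_within by metis
  have x0B: "complex_of_real x0 \<in> ?B" using r by simp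
  have W0: "W (of_real x0) = of_real (bv w x0)" using Wr[OF x0B] bv_eq[OF x0B] by (simp add: complex_eq_iff)
  show "cos (bv w x0) = g x0" using Wr[OF x0B] bv_eq[OF x0B] by simp
  have path: "filterlim (\<lambda>t. Complex x0 t) (at (of_real x0) within \<H>) (at_right 0)"
    unfolding filterlim_at
  proof
    show "eventually (\<lambda>t. Complex x0 t \<in> \<H> \<and> Complex x0 t \<noteq> of_real x0) (at_right 0)"
      using eventually_at_right_less[of "0::real"] by eventually_elim (auto simp: complex_eq_iff)
    have "((\<lambda>t. Complex x0 t) \<longlongrightarrow> Complex x0 0) (at_right 0)" by (intro tendsto_intros)
    thus "((\<lambda>t. Complex x0 t) \<longlongrightarrow> of_real x0) (at_right 0)" by (simp add: complex_of_real_def)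
  qed
  show lim_right: "((\<lambda>t. Re (w (Complex x0 t))) \<longlongrightarrow> bv w x0) (at_right 0)"
    unfolding bv_eq[OF x0B] by (intro tendsto_intros filterlim_compose[OF lim[OF x0B] path])
  show "0 \<le> bv w x0"
  proof (rule tendsto_lowerbound[OF lim_right])
    show "eventually (\<lambda>t. 0 \<le> Re (w (Complex x0 t))) (at_right 0)"
      using eventually_at_right_less[of "0::real"] by eventually_elim (simp add: Re_branch_nonneg[OF w])
  qed simp
  have dW: "(W has_field_derivative deriv W (of_real x0)) (at (of_real x0))"
    using holomorphic_derivI[OF Wh open_ball x0B] .
  define D where "D = Re (deriv W (of_real x0))"
  have "((\<lambda>x. Re (W (complex_of_real x))) has_real_derivative D) (at x0)"
    unfolding D_def by (rule Re_has_real_derivative[OF dW])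
  hence dbv: "(bv w has_real_derivative D) (at x0)"
  proof (rule has_field_derivative_transform_within_open[where S = "ball x0 r"])
    show "Re (W (of_real x)) = bv w x" if "x \<in> ball x0 r" for x
    proof -
      have "complex_of_real x \<in> ?B" using that by (simp add: dist_real_def dist_norm) (metis norm_of_real of_real_diff real_norm_def)
      thus ?thesis using bv_eq by simp
    qed
  qed (use r in auto)
  have "((\<lambda>l. (W l)\<^sup>2 / 4) has_field_derivative (of_real (bv w x0) * deriv W (of_real x0) / 2)) (at (of_real x0))"
    using W0 by (auto intro!: derivative_eq_intros dW)
  hence "((\<lambda>l. (W l)\<^sup>2 / 4) has_field_derivative (of_real (bv w x0) * deriv W (of_real x0) / 2)) (at (of_real x0 + \<i> * of_real 0))"
    by simp
  hence "((\<lambda>u. (W (of_real x0 + \<i> * u))\<^sup>2 / 4) has_field_derivative (of_real (bv w x0) * deriv W (of_real x0) / 2 * \<i>)) (at (of_real 0))"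
    by (rule DERIV_chain2[where f = "\<lambda>l. (W l)\<^sup>2 / 4" and g = "\<lambda>u. of_real x0 + \<i> * u"]) (auto intro!: derivative_eq_intros)
  \<comment> \<open>The factor -i turns the imaginary part into a real part, so that the vertical
    derivative becomes a derivative of a real function.\<close>
  hence "((\<lambda>u. - \<i> * ((W (of_real x0 + \<i> * u))\<^sup>2 / 4)) has_field_derivative (- \<i> * (of_real (bv w x0) * deriv W (of_real x0) / 2 * \<i>))) (at (of_real 0))"
    by (rule DERIV_cmult)
  from Re_has_real_derivative[OF this]
  have "((\<lambda>t. Im ((W (of_real x0 + \<i> * of_real t))\<^sup>2 / 4)) has_real_derivative (bv w x0 * D / 2)) (at 0)"
    by (simp add: D_def)
  hence "((\<lambda>t. (Im ((W (of_real x0 + \<i> * of_real t))\<^sup>2 / 4) - Im ((W (of_real x0))\<^sup>2 / 4)) / t) \<longlongrightarrow> bv w x0 * D / 2) (at 0)"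
    by (simp add: DERIV_def)
  moreover have "Im ((W (of_real x0))\<^sup>2 / 4) = 0" unfolding W0 by (simp add: power2_eq_square)
  ultimately have "((\<lambda>t. Im ((W (of_real x0 + \<i> * of_real t))\<^sup>2 / 4) / t) \<longlongrightarrow> bv w x0 * D / 2) (at 0)" by (simp only: diff_zero)
  hence "((\<lambda>t. Im ((W (of_real x0 + \<i> * of_real t))\<^sup>2 / 4) / t) \<longlongrightarrow> bv w x0 * D / 2) (at_right 0)"
    by (rule tendsto_within_subset) simp
  hence "1 \<le> bv w x0 * D / 2"
  proof (rule tendsto_lowerbound)
    have "eventually (\<lambda>t::real. t < r) (at_right 0)" using r eventually_at_right[of 0 r "\<lambda>t. t < r"] by (auto intro!: exI[of _ r])
    thus "eventually (\<lambda>t. 1 \<le> Im ((W (of_real x0 + \<i> * of_real t))\<^sup>2 / 4) / t) (at_right 0)"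
      using eventually_at_right_less[of "0::real"]
    proof eventually_elim
      case (elim t)
      let ?l = "of_real x0 + \<i> * of_real t"
      have "?l \<in> ?B" using elim by (simp add: dist_norm norm_mult)
      hence "W ?l = w ?l" using Ww[of ?l] elim by simp
      moreover have "Im ?l \<le> Im ((w ?l)\<^sup>2 / 4)" by (rule Im_branch_square_ge[OF w]) (use elim in simp)
      ultimately have "t \<le> Im ((W ?l)\<^sup>2 / 4)" by simp
      thus ?case using elim by (simp add: field_simps del: Im_divide_numeral)
    qed
  qed simp
  with dbv show "\<exists>D. (bv w has_real_derivative D) (at x0) \<and> 1 \<le> bv w x0 * D / 2" by blast
qed

text \<open>
  Where $\cos \kappa \cdot \Re G > 0$ just above a real interval, $\Re w$ cannot leave
  $(\kappa - \pi/2, \kappa + \pi/2)$, because $\Re \cos w = \cos (\Re w) \cosh (\Im w)$.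
\<close>

lemma Re_branch_trapped:
  assumes xx: "x \<le> x'" and \<kappa>: "sin \<kappa> = 0" and pos: "\<And>t. x \<le> t \<Longrightarrow> t \<le> x' \<Longrightarrow> cos \<kappa> * g t > 0"
    and start: "eventually (\<lambda>t. \<bar>Re (w (Complex x t)) - \<kappa>\<bar> < pi / 2) (at_right 0)"
  shows "eventually (\<lambda>t. \<bar>Re (w (Complex x' t)) - \<kappa>\<bar> < pi / 2) (at_right 0)"
proof -
  have ck: "cos \<kappa> = 1 \<or> cos \<kappa> = -1" using \<kappa> by (metis sin_zero_abs_cos_one abs_1 abs_eq_iff)
  have "continuous_on {x..x'} (\<lambda>t. cos \<kappa> * g t)" by (intro continuous_intros g_continuous)
  then obtain t0 where t0: "t0 \<in> {x..x'}" "\<And>t. t \<in> {x..x'} \<Longrightarrow> cos \<kappa> * g t0 \<le> cos \<kappa> * g t"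
    using continuous_attains_inf[of "{x..x'}" "\<lambda>t. cos \<kappa> * g t"] xx by auto
  define m where "m = cos \<kappa> * g t0"
  have m: "m > 0" unfolding m_def by (rule pos) (use t0 in auto)
  let ?K = "cbox (Complex x 0) (Complex x' 1)"
  have "uniformly_continuous_on ?K G"
    by (intro compact_uniformly_continuous compact_cbox continuous_on_subset[OF holomorphic_on_imp_continuous_on[OF G_hol]]) simp
  then obtain \<delta> where \<delta>: "\<delta> > 0" "\<And>l l'. l \<in> ?K \<Longrightarrow> l' \<in> ?K \<Longrightarrow> dist l' l < \<delta> \<Longrightarrow> dist (G l') (G l) < m"
    using m unfolding uniformly_continuous_on_def by metis
  \<comment> \<open>Uniform continuity of G on a compact rectangle preserves the sign of cos
    \<kappa> Re G up to a height that does not depend on t.\<close>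
  have ReG: "cos \<kappa> * Re (G (Complex t y)) > 0" if t: "x \<le> t" "t \<le> x'" and y: "0 < y" "y < min \<delta> 1" for t y
  proof -
    have K: "Complex t y \<in> ?K" "Complex t 0 \<in> ?K" using t y by (auto simp: in_cbox_complex_iff)
    have "dist (Complex t y) (Complex t 0) = y" using y by (simp add: dist_norm cmod_def)
    hence "dist (G (Complex t y)) (G (Complex t 0)) < m" using \<delta>(2)[OF K(2) K(1)] y by simp
    moreover have "G (Complex t 0) = of_real (g t)" using G_of_real[of t] by (simp add: complex_of_real_def)
    ultimately have "\<bar>Re (G (Complex t y)) - g t\<bar> < m"
      using abs_Re_le_cmod[of "G (Complex t y) - of_real (g t)"] by (simp add: dist_norm)
    moreover have "m \<le> cos \<kappa> * g t" unfolding m_def by (rule t0) (use t in simp)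
    ultimately show ?thesis using ck by (auto simp: abs_less_iff)
  qed
  have "eventually (\<lambda>y::real. y < min \<delta> 1) (at_right 0)"
    using \<delta>(1) eventually_at_right[of 0 "min \<delta> 1" "\<lambda>t. t < min \<delta> 1"] by (auto intro!: exI[of _ "min \<delta> 1"])
  thus ?thesis using start eventually_at_right_less[of "0::real"]
  proof eventually_elim
    case (elim y)
    define p where "p = (\<lambda>t. Re (w (Complex t y)))"
    have pos': "cos (p t - \<kappa>) > 0" if t: "x \<le> t" "t \<le> x'" for t
    proof -
      have l: "Im (Complex t y) > 0" using elim by simp
      have "Re (G (Complex t y)) = cos (p t) * cosh (Im (w (Complex t y)))"
        using branch(2)[OF w l, symmetric] by (simp add: p_def Re_cos cosh_field_def)
      hence "cos \<kappa> * cos (p t) * cosh (Im (w (Complex t y))) > 0" using ReG[OF t, of y] elim by simp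
      hence "cos \<kappa> * cos (p t) > 0" using cosh_real_pos[of "Im (w (Complex t y))"] by (simp add: zero_less_mult_iff)
      thus ?thesis using \<kappa> by (simp add: cos_diff mult.commute)
    qed
    have pc: "continuous_on {x..x'} (\<lambda>t. \<bar>p t - \<kappa>\<bar>)"
    proof -
      have "continuous_on {x..x'} (\<lambda>t. w (Complex t y))"
      proof (rule continuous_on_compose2[OF holomorphic_on_imp_continuous_on[OF branch(1)[OF w]]])
        show "continuous_on {x..x'} (\<lambda>t. Complex t y)" by (intro continuous_intros)
      qed (use elim in auto)
      thus ?thesis unfolding p_def by (intro continuous_intros)
    qed
    show ?case
    proof (rule ccontr)
      assume "\<not> \<bar>Re (w (Complex x' y)) - \<kappa>\<bar> < pi / 2"
      hence "\<exists>t\<ge>x. t \<le> x' \<and> \<bar>p t - \<kappa>\<bar> = pi / 2"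
        using elim by (intro IVT' xx pc) (auto simp: p_def)
      then obtain t where t: "x \<le> t" "t \<le> x'" "\<bar>p t - \<kappa>\<bar> = pi / 2" by blast
      have "cos (p t - \<kappa>) = cos \<bar>p t - \<kappa>\<bar>" by simp
      also have "\<dots> = 0" unfolding t(3) by simp
      finally show False using pos'[OF t(1,2)] by simp
    qed
  qed
qed

lemma trapped_start:
  assumes "\<bar>g x\<bar> < 1" "\<bar>bv w x - \<kappa>\<bar> < pi / 2"
  shows "eventually (\<lambda>t. \<bar>Re (w (Complex x t)) - \<kappa>\<bar> < pi / 2) (at_right 0)"
proof -
  have "((\<lambda>t. \<bar>Re (w (Complex x t)) - \<kappa>\<bar>) \<longlongrightarrow> \<bar>bv w x - \<kappa>\<bar>) (at_right 0)"
    by (intro tendsto_intros band_point(2) assms)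
  thus ?thesis by (rule order_tendstoD) (rule assms)
qed

text \<open>The limit preserves only the weak inequality; equality would give cos (bv - \<kappa>) =
  0 and hence g x = 0.\<close>

lemma trapped_end:
  assumes "\<bar>g x\<bar> < 1" "sin \<kappa> = 0" "cos \<kappa> * g x > 0"
    and ev: "eventually (\<lambda>t. \<bar>Re (w (Complex x t)) - \<kappa>\<bar> < pi / 2) (at_right 0)"
  shows "\<bar>bv w x - \<kappa>\<bar> < pi / 2"
proof -
  have lim: "((\<lambda>t. \<bar>Re (w (Complex x t)) - \<kappa>\<bar>) \<longlongrightarrow> \<bar>bv w x - \<kappa>\<bar>) (at_right 0)"
    by (intro tendsto_intros band_point(2) assms)
  have "\<bar>bv w x - \<kappa>\<bar> \<le> pi / 2"
    by (rule tendsto_upperbound[OF lim]) (use ev in \<open>auto elim!: eventually_mono\<close>)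
  moreover have "\<bar>bv w x - \<kappa>\<bar> \<noteq> pi / 2"
  proof
    assume "\<bar>bv w x - \<kappa>\<bar> = pi / 2"
    hence "cos \<bar>bv w x - \<kappa>\<bar> = 0" by (simp only: cos_pi_half)
    moreover have "cos \<bar>bv w x - \<kappa>\<bar> = cos (bv w x - \<kappa>)" by (simp add: abs_if cos_diff)
    ultimately have "cos (bv w x - \<kappa>) = 0" by simp
    hence "cos \<kappa> * g x = 0" using band_point(1)[OF assms(1)] assms(2) by (simp only: cos_diff) auto
    thus False using assms(3) by linarith
  qed
  ultimately show ?thesis by simp
qed

text \<open>At \<lambda> = x + i t with x very negative, Im sqrt \<lambda> >= 1 and 2 Re sqrt
  \<lambda> Im sqrt \<lambda> = t make Re sqrt \<lambda> small, and w is within 1/2 of 2 sqrt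
  \<lambda>.\<close>

lemma trapped_far_left: "\<exists>R. \<forall>x\<le>R. eventually (\<lambda>t. \<bar>Re (w (Complex x t)) - 0\<bar> < pi / 2) (at_right 0)"
proof -
  have "(1 / 2 :: real) > 0" by simp
  from branch_limit[OF w this] obtain M where
    M: "\<And>l. Im l > 0 \<Longrightarrow> M \<le> Im (csqrt l) \<Longrightarrow> norm (w l - 2 * csqrt l) \<le> 1 / 2" by blast
  have "eventually (\<lambda>t. \<bar>Re (w (Complex x t)) - 0\<bar> < pi / 2) (at_right 0)" if x: "x \<le> - (max (max M 1) 0)\<^sup>2" for x
  proof -
    have "eventually (\<lambda>t::real. t < 1 / 2) (at_right 0)"
      using eventually_at_right[of 0 "1/2::real" "\<lambda>t. t < 1/2"] by (auto intro!: exI[of _ "1/2"])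
    thus ?thesis using eventually_at_right_less[of "0::real"]
    proof eventually_elim
      case (elim t)
      let ?l = "Complex x t"
      have l: "Im ?l > 0" using elim by simp
      have s: "max M 1 \<le> Im (csqrt ?l)" by (rule Im_csqrt_large[OF w l]) (use x in simp)
      have "norm (w ?l - 2 * csqrt ?l) \<le> 1 / 2" using s by (intro M l) simp
      hence "\<bar>Re (w ?l - 2 * csqrt ?l)\<bar> \<le> 1 / 2" using abs_Re_le_cmod order_trans by blast
      hence 1: "\<bar>Re (w ?l) - 2 * Re (csqrt ?l)\<bar> \<le> 1 / 2" by simp
      have "2 * Re (csqrt ?l) * 1 \<le> 2 * Re (csqrt ?l) * Im (csqrt ?l)"
        using s csqrt_upper(1)[OF l] by (intro mult_left_mono) auto
      hence 2: "2 * Re (csqrt ?l) \<le> t" using csqrt_upper(4)[OF l] by simp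
      have "\<bar>Re (w ?l)\<bar> < 3 / 2" using 1 2 csqrt_upper(1)[OF l] elim by linarith
      thus ?case using pi_gt3 by simp
    qed
  qed
  thus ?thesis by blast
qed

end

end

section \<open>Labelling of the bands\<close>

context band_function
begin

lemma g_deriv: "(g has_real_derivative 8 / 9 * d\<phi> x) (at x)"
  unfolding g_def[abs_def] by (auto intro!: derivative_eq_intros \<phi>_deriv)

lemma slope_nonpos:
  assumes "x \<in> seg n"
  shows "(-1) ^ n * d\<phi> x \<le> 0"
proof (cases "x = cs n")
  case True
  thus ?thesis by (simp add: cs_crit)
next
  case False
  hence lt: "x < cs n" using seg_le[OF assms] by simp
  show ?thesis
  proof (rule ccontr)
    assume "\<not> ?thesis"
    hence pos: "0 < (-1) ^ n * d\<phi> x" by simp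
    obtain d where d: "d > 0" "\<And>h. h > 0 \<Longrightarrow> h < d \<Longrightarrow> (-1) ^ n * \<phi> x < (-1) ^ n * \<phi> (x + h)"
      using DERIV_pos_inc_right[OF DERIV_cmult[OF \<phi>_deriv(1)] pos] by blast
    define h where "h = min (d / 2) (cs n - x)"
    have h: "h > 0" "h < d" "x + h \<le> cs n" using d lt by (auto simp: h_def)
    have "x + h \<in> seg n" by (rule seg_convex[OF assms cs_in_seg(1)]) (use h in auto)
    from seg_strict[OF assms this] d(2)[OF h(1,2)] h(1) show False by simp
  qed
qed

lemma slope_neg:
  assumes x: "x \<in> seg n" and gx: "\<bar>g x\<bar> < 1"
  shows "(-1) ^ n * d\<phi> x < 0"
proof -
  have "d\<phi> x \<noteq> 0"
  proof
    assume "d\<phi> x = 0"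
    from crit_value(1)[OF this] gx show False by (auto simp: g_def abs_less_iff)
  qed
  hence "(-1) ^ n * d\<phi> x \<noteq> 0" by simp
  thus ?thesis using slope_nonpos[OF x] by linarith
qed

lemma seg_strict_g: "x \<in> seg n \<Longrightarrow> y \<in> seg n \<Longrightarrow> x < y \<Longrightarrow> (-1) ^ n * g y < (-1) ^ n * g x"
  using seg_strict[of x n y] by (cases "even n") (auto simp: g_def field_simps)

text \<open>The sign is put into the parameter: s decreases from 1 to -1 along every band, whether
  \<phi> rises or falls there.\<close>

definition "bp n s = pt n ((9 * ((-1) ^ n * s) - 1) / 8)"

lemma bp:
  assumes "s \<in> {-1..1}"
  shows "bp n s \<in> seg n" "(-1) ^ n * g (bp n s) = s"
proof -
  have "(9 * ((-1) ^ n * s) - 1) / 8 \<in> {-5/4..1}" using assms by (cases "even n") auto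
  note p = pt[OF this, of n, folded bp_def]
  show "bp n s \<in> seg n" by (rule p)
  show "(-1) ^ n * g (bp n s) = s" unfolding g_def p(2) by (cases "even n") (simp_all add: field_simps)
qed

lemma bp_eq: "x \<in> seg n \<Longrightarrow> bp n ((-1) ^ n * g x) = x"
proof -
  assume x: "x \<in> seg n"
  have "(-1) ^ n * ((-1) ^ n * g x) = g x" by (cases "even n") simp_all
  hence "\<phi> x = (9 * ((-1) ^ n * ((-1) ^ n * g x)) - 1) / 8" by (simp add: g_def field_simps)
  from pt_eq[OF x this] show ?thesis unfolding bp_def .
qed

lemma bp_le_iff:
  assumes x: "x \<in> seg n" and s: "s \<in> {-1..1}"
  shows "x \<le> bp n s \<longleftrightarrow> s \<le> (-1) ^ n * g x" "bp n s \<le> x \<longleftrightarrow> (-1) ^ n * g x \<le> s"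
proof -
  note m = seg_strict_g[OF x bp(1)[OF s], unfolded bp(2)[OF s]] seg_strict_g[OF bp(1)[OF s] x, unfolded bp(2)[OF s]]
  have e: "(-1) ^ n * g x = s" if "x = bp n s" using bp(2)[OF s, of n] by (simp only: that)
  consider "x < bp n s" | "x = bp n s" | "bp n s < x" by linarith
  hence "(x \<le> bp n s \<longleftrightarrow> s \<le> (-1) ^ n * g x) \<and> (bp n s \<le> x \<longleftrightarrow> (-1) ^ n * g x \<le> s)"
  proof cases
    case 1
    from m(1)[OF this] 1 show ?thesis by linarith
  next
    case 2
    from e[OF this] 2 show ?thesis by linarith
  next
    case 3
    from m(2)[OF this] 3 show ?thesis by linarith
  qed
  thus "x \<le> bp n s \<longleftrightarrow> s \<le> (-1) ^ n * g x" "bp n s \<le> x \<longleftrightarrow> (-1) ^ n * g x \<le> s" by blast+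
qed

lemma bp_less:
  assumes "s \<in> {-1..1}" "t \<in> {-1..1}" "s < t"
  shows "bp n t < bp n s"
proof -
  have "\<not> bp n s \<le> bp n t" unfolding bp_le_iff(1)[OF bp(1)[OF assms(1)] assms(2)] bp(2)[OF assms(1)] bp_le_iff(2)[OF bp(1)[OF assms(2)] assms(1)] bp(2)[OF assms(2)]
    using assms(3) by simp
  thus ?thesis by simp
qed

lemma g_abs: "\<bar>g x\<bar> = \<bar>(-1) ^ n * g x\<bar>"
  by (simp add: abs_mult power_abs)

lemma seg_between: "x \<in> seg n \<Longrightarrow> x' \<in> seg (Suc n) \<Longrightarrow> x \<le> t \<Longrightarrow> t \<le> x' \<Longrightarrow> t \<in> seg n \<or> t \<in> seg (Suc n)"
  using seg_convex[OF _ cs_in_seg(1), of x n t] seg_convex[OF cs_in_seg(2), of x' n t] by linarith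

definition "band n = {x \<in> seg n. \<bar>g x\<bar> < 1}"

lemma band_eq: "band n = {bp n 1<..<bp n (-1)}"
proof (rule set_eqI)
  fix x
  have 1: "(1::real) \<in> {-1..1}" "(-1::real) \<in> {-1..1}" by auto
  show "x \<in> band n \<longleftrightarrow> x \<in> {bp n 1<..<bp n (-1)}"
  proof
    assume "x \<in> band n"
    hence x: "x \<in> seg n" "\<bar>(-1) ^ n * g x\<bar> < 1" by (auto simp: band_def g_abs[of x n])
    have "\<not> x \<le> bp n 1" "\<not> bp n (-1) \<le> x" unfolding bp_le_iff[OF x(1) 1(1)] bp_le_iff[OF x(1) 1(2)] using x(2) by auto
    thus "x \<in> {bp n 1<..<bp n (-1)}" by simp
  next
    assume h: "x \<in> {bp n 1<..<bp n (-1)}"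
    hence x: "x \<in> seg n" by (intro seg_convex[OF bp(1)[OF 1(1)] bp(1)[OF 1(2)]]) auto
    have "\<not> x \<le> bp n 1" "\<not> bp n (-1) \<le> x" using h by auto
    hence "\<bar>(-1) ^ n * g x\<bar> < 1" unfolding bp_le_iff[OF x(1) 1(1)] bp_le_iff[OF x(1) 1(2)] by auto
    thus "x \<in> band n" using x by (simp add: band_def g_abs[of x n])
  qed
qed

text \<open>For q = 0 this is the point at level s in the n-th interval: 2 sqrt \<lambda> = \<pi> n
  + arccos s solves (-1)^n cos (2 sqrt \<lambda>) = s.\<close>

definition "level_of n s = (pi * real n + arccos s)\<^sup>2 / 4"

context
  fixes w :: "complex \<Rightarrow> complex"
  assumes w: "is_branch w"
begin

text \<open>Differentiating cos bv = g gives -D sin bv = g', where D > 0 and the sign of g' is known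
  on each interval.\<close>

lemma sin_bv_pos:
  assumes x: "x \<in> band n"
  shows "0 < (-1) ^ n * sin (bv w x)"
proof -
  have gx: "\<bar>g x\<bar> < 1" and xs: "x \<in> seg n" using x by (auto simp: band_def)
  obtain D where D: "(bv w has_real_derivative D) (at x)" "1 \<le> bv w x * D / 2"
    using band_point(4)[OF w gx] by blast
  have "((\<lambda>x. cos (bv w x)) has_real_derivative - sin (bv w x) * D) (at x)"
    by (rule DERIV_fun_cos[OF D(1)])
  moreover have "((\<lambda>x. cos (bv w x)) has_real_derivative 8 / 9 * d\<phi> x) (at x)"
  proof (rule has_field_derivative_transform_within_open[OF g_deriv, where S = "band n"])
    show "open (band n)" unfolding band_eq by simp
    show "g y = cos (bv w y)" if "y \<in> band n" for y
      using band_point(1)[OF w] that by (simp add: band_def)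
  qed (rule x)
  ultimately have e: "- sin (bv w x) * D = 8 / 9 * d\<phi> x" by (rule DERIV_unique)
  have "((-1) ^ n * sin (bv w x)) * D = - ((-1) ^ n * (- sin (bv w x) * D))" by simp
  also have "\<dots> = - 8 / 9 * ((-1) ^ n * d\<phi> x)" unfolding e by simp
  finally have "((-1) ^ n * sin (bv w x)) * D = - 8 / 9 * ((-1) ^ n * d\<phi> x)" .
  moreover have "\<dots> > 0" using slope_neg[OF xs gx] by (simp add: mult.commute)
  moreover have "D > 0"
    using D(2) band_point(3)[OF w gx] by (smt (verit) divide_nonpos_pos mult_nonneg_nonpos)
  ultimately show ?thesis by (metis zero_less_mult_pos2)
qed

text \<open>sin bv has no zero on the band, so by continuity bv cannot cross a multiple of
  \<pi>.\<close>

lemma bv_in_band: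
  assumes x0: "x0 \<in> band n" "bv w x0 \<in> {pi * n<..<pi * (real n + 1)}" and x: "x \<in> band n"
  shows "bv w x \<in> {pi * n<..<pi * (real n + 1)}"
proof -
  have cont: "continuous_on (band n) (bv w)"
  proof (rule continuous_at_imp_continuous_on, rule ballI)
    fix y assume "y \<in> band n"
    then obtain D where "(bv w has_real_derivative D) (at y)" using band_point(4)[OF w, of y] by (auto simp: band_def)
    thus "isCont (bv w) y" by (rule DERIV_isCont)
  qed
  have conn: "connected (bv w ` band n)"
    by (rule connected_continuous_image[OF cont]) (simp add: band_eq)
  have no: "pi * real m \<notin> bv w ` band n" for m
  proof
    assume "pi * real m \<in> bv w ` band n"
    then obtain y where y: "y \<in> band n" "bv w y = pi * real m" by auto
    hence "sin (bv w y) = 0" by (simp add: mult.commute[of pi])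
    thus False using sin_bv_pos[OF y(1)] by simp
  qed
  have m: "bv w x \<in> bv w ` band n" "bv w x0 \<in> bv w ` band n" using x x0 by auto
  have "\<not> bv w x \<le> pi * n"
  proof
    assume "bv w x \<le> pi * n"
    from connectedD_interval[OF conn m this] no[of n] x0(2) show False by auto
  qed
  moreover have "\<not> pi * (real n + 1) \<le> bv w x"
  proof
    assume "pi * (real n + 1) \<le> bv w x"
    from connectedD_interval[OF conn m(2,1) _ this] no[of "Suc n"] x0(2) show False by (auto simp: add.commute)
  qed
  ultimately show ?thesis by simp
qed

lemma bv_eq_arccos:
  assumes x: "x \<in> band n" and r: "bv w x \<in> {pi * n<..<pi * (real n + 1)}"
  shows "bv w x = pi * n + arccos ((-1) ^ n * g x)"
proof -
  have "cos (bv w x - pi * n) = (-1) ^ n * g x"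
    using band_point(1)[OF w] x by (simp add: cos_diff band_def mult.commute[of pi])
  moreover have "arccos (cos (bv w x - pi * n)) = bv w x - pi * n"
    using r by (intro arccos_cos) (auto simp: algebra_simps)
  ultimately show ?thesis by simp
qed

lemma bv_trapped_band:
  assumes x: "x \<in> band n" and t: "\<bar>bv w x - pi * n\<bar> < pi / 2"
  shows "bv w x \<in> {pi * n<..<pi * (real n + 1)}"
proof -
  define y where "y = bv w x - pi * n"
  have "sin y = (-1) ^ n * sin (bv w x)"
    unfolding y_def sin_diff mult.commute[of pi] cos_npi sin_npi by (simp add: mult.commute)
  hence s: "sin y > 0" using sin_bv_pos[OF x] by simp
  have t': "\<bar>y\<bar> < pi / 2" using t by (simp only: y_def)
  have "y > 0"
  proof (rule ccontr)
    assume "\<not> y > 0"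
    hence "sin (- y) \<ge> 0" using t' pi_gt_zero by (intro sin_ge_zero; linarith)
    thus False using s by simp
  qed
  moreover have "y < pi" using t' pi_gt_zero by linarith
  moreover have "bv w x = pi * n + y" "pi * (real n + 1) = pi * n + pi" by (simp_all only: y_def distrib_left)
  ultimately show ?thesis by simp
qed

lemma half_levels:
  "bp n (1/2) \<in> band n" "bp n (-(1/2)) \<in> band n"
  unfolding band_eq using bp_less[of "-1" "1/2" n] bp_less[of "1/2" 1 n] bp_less[of "-1" "-(1/2)" n] bp_less[of "-(1/2)" 1 n]
  by auto

text \<open>Between level -1/2 of band n and level 1/2 of the next, (-1)^(n+1) g is at least 1/2, so
  Re w stays within \<pi>/2 of \<pi> (n + 1) while the gap is passed. The induction starts far to
  the left, where Re w is near 0; the levels 1/2 and -1/2 are a convenient choice inside (-1,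
  1).\<close>

lemma bv_band: "x \<in> band n \<Longrightarrow> bv w x \<in> {pi * n<..<pi * (real n + 1)}"
proof (induction n arbitrary: x)
  case 0
  obtain R where R: "\<And>x. x \<le> R \<Longrightarrow> eventually (\<lambda>t. \<bar>Re (w (Complex x t)) - 0\<bar> < pi / 2) (at_right 0)"
    using trapped_far_left[OF w] by blast
  let ?y = "bp 0 (1/2)"
  have y: "?y \<in> seg 0" "g ?y = 1 / 2" using bp[of "1/2" 0] by auto
  have "eventually (\<lambda>t. \<bar>Re (w (Complex ?y t)) - 0\<bar> < pi / 2) (at_right 0)"
  proof (rule Re_branch_trapped[OF w _ _ _ R])
    fix t assume t: "min R ?y \<le> t" "t \<le> ?y"
    have ts: "t \<in> seg 0" using seg_le[OF y(1)] t by (simp add: seg_simps)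
    have "1 / 2 \<le> g t" using bp_le_iff(1)[OF ts, of "1/2"] t by simp
    thus "0 < cos 0 * g t" by simp
  qed auto
  hence "\<bar>bv w ?y - 0\<bar> < pi / 2" by (rule trapped_end[OF w, rotated -1]) (simp_all add: y)
  hence "bv w ?y \<in> {pi * real 0<..<pi * (real 0 + 1)}" by (intro bv_trapped_band[OF half_levels(1)]) simp
  from bv_in_band[OF half_levels(1) this 0] show ?case .
next
  case (Suc n)
  let ?x = "bp n (-(1/2))" and ?y = "bp (Suc n) (1/2)" and ?k = "pi * real (Suc n)"
  have x: "?x \<in> seg n" "(-1) ^ n * g ?x = -(1/2)" using bp[of "-(1/2)" n] by auto
  have y: "?y \<in> seg (Suc n)" "(-1) ^ Suc n * g ?y = 1/2" using bp[of "1/2" "Suc n"] by (simp_all del: power_Suc)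
  have xb: "\<bar>g ?x\<bar> < 1" "\<bar>g ?y\<bar> < 1" using half_levels(2)[of n] half_levels(1)[of "Suc n"] by (auto simp: band_def)
  have ck: "cos ?k = (-1) ^ Suc n" "sin ?k = 0"
    by (simp_all only: mult.commute[of pi] cos_npi sin_npi)
  have "bv w ?x = pi * n + arccos (-(1/2))"
    using bv_eq_arccos[OF half_levels(2) Suc.IH[OF half_levels(2)]] x(2) by simp
  moreover have "arccos (-(1/2)) > arccos 0" by (rule arccos_less_arccos) auto
  moreover have "arccos (-(1/2)) \<le> pi" by (rule arccos_ubound) auto
  ultimately have "\<bar>bv w ?x - ?k\<bar> < pi / 2" by (simp add: algebra_simps)
  from trapped_start[OF w xb(1) this]
  have start: "eventually (\<lambda>t. \<bar>Re (w (Complex ?x t)) - ?k\<bar> < pi / 2) (at_right 0)" .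
  have "eventually (\<lambda>t. \<bar>Re (w (Complex ?y t)) - ?k\<bar> < pi / 2) (at_right 0)"
  proof (rule Re_branch_trapped[OF w _ ck(2) _ start])
    show "?x \<le> ?y" using seg_le[OF x(1)] seg_ge[OF y(1)] by simp
    fix t assume t: "?x \<le> t" "t \<le> ?y"
    from seg_between[OF x(1) y(1) t] show "0 < cos ?k * g t"
    proof
      assume "t \<in> seg n"
      from bp_le_iff(2)[OF this, of "-(1/2)"] t show ?thesis unfolding ck(1) by simp
    next
      assume "t \<in> seg (Suc n)"
      from bp_le_iff(1)[OF this, of "1/2"] t show ?thesis unfolding ck(1) by simp
    qed
  qed
  moreover have "0 < cos ?k * g ?y" unfolding ck(1) y(2) by simp
  ultimately have "\<bar>bv w ?y - ?k\<bar> < pi / 2" by (intro trapped_end[OF w xb(2) ck(2)])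
  hence "bv w ?y \<in> {pi * real (Suc n)<..<pi * (real (Suc n) + 1)}" by (rule bv_trapped_band[OF half_levels(1)])
  from bv_in_band[OF half_levels(1) this Suc.prems] show ?case .
qed

lemma level_of_deriv:
  assumes x: "x \<in> band n"
  shows "\<exists>D\<ge>1. ((\<lambda>x. level_of n ((-1) ^ n * g x)) has_real_derivative D) (at x)"
proof -
  obtain D where D: "(bv w has_real_derivative D) (at x)" "1 \<le> bv w x * D / 2"
    using band_point(4)[OF w, of x] x by (auto simp: band_def)
  have "((\<lambda>x. (bv w x)\<^sup>2 / 4) has_real_derivative bv w x * D / 2) (at x)"
    by (auto intro!: derivative_eq_intros D)
  hence "((\<lambda>x. level_of n ((-1) ^ n * g x)) has_real_derivative bv w x * D / 2) (at x)"
  proof (rule has_field_derivative_transform_within_open[where S = "band n"])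
    show "open (band n)" unfolding band_eq by simp
    show "(bv w y)\<^sup>2 / 4 = level_of n ((-1) ^ n * g y)" if "y \<in> band n" for y
      unfolding level_of_def using bv_eq_arccos[OF that bv_band[OF that]] by simp
  qed (rule x)
  with D(2) show ?thesis by blast
qed

end

lemma bp_range:
  assumes "s \<in> {-1..1}" "t \<in> {-1..1}" "bp n t \<le> x" "x \<le> bp n s"
  shows "x \<in> seg n" "s \<le> (-1) ^ n * g x" "(-1) ^ n * g x \<le> t"
proof -
  show x: "x \<in> seg n" by (rule seg_convex[OF bp(1)[OF assms(2)] bp(1)[OF assms(1)] assms(3,4)])
  show "s \<le> (-1) ^ n * g x" "(-1) ^ n * g x \<le> t"
    using bp_le_iff(1)[OF x assms(1)] bp_le_iff(2)[OF x assms(2)] assms(3,4) by auto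
qed

lemma level_of_continuous:
  assumes "s \<in> {-1..1}" "t \<in> {-1..1}"
  shows "continuous_on {bp n t..bp n s} (\<lambda>x. level_of n ((-1) ^ n * g x))"
proof -
  have b: "\<forall>x\<in>{bp n t..bp n s}. -1 \<le> (-1) ^ n * g x \<and> (-1) ^ n * g x \<le> 1"
  proof
    fix x assume x: "x \<in> {bp n t..bp n s}"
    show "-1 \<le> (-1) ^ n * g x \<and> (-1) ^ n * g x \<le> 1" using bp_range(2,3)[OF assms, of n x] assms x by simp
  qed
  have "continuous_on {bp n t..bp n s} (\<lambda>x. (-1) ^ n * g x)" by (rule continuous_on_mult_left[OF g_continuous])
  from continuous_on_arccos[OF this b]
  have A: "continuous_on {bp n t..bp n s} (\<lambda>x. arccos ((-1) ^ n * g x))" .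
  have "continuous_on {bp n t..bp n s} (\<lambda>x. (pi * real n + arccos ((-1) ^ n * g x))\<^sup>2 * (1 / 4))"
    by (intro continuous_on_mult_right continuous_on_power continuous_on_add continuous_on_const A)
  thus ?thesis by (simp add: level_of_def)
qed

text \<open>The mean value theorem for the map taking x to the free point of the same level: its
  derivative is at least 1 inside the band, and continuity takes in the ends, where arccos is not
  differentiable.\<close>

lemma bp_diff_le:
  assumes s: "s \<in> {-1..1}" and t: "t \<in> {-1..1}" and st: "s < t"
  shows "bp n s - bp n t \<le> level_of n s - level_of n t"
proof -
  obtain w where w: "is_branch w" using branch_exists by blast
  have "\<exists>D. (\<forall>x. bp n t < x \<longrightarrow> x < bp n s \<longrightarrow> 1 \<le> D x \<and> ((\<lambda>x. level_of n ((-1) ^ n * g x)) has_real_derivative D x) (at x))"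
  proof (intro choice allI)
    fix x
    show "\<exists>D. bp n t < x \<longrightarrow> x < bp n s \<longrightarrow> 1 \<le> D \<and> ((\<lambda>x. level_of n ((-1) ^ n * g x)) has_real_derivative D) (at x)"
    proof (cases "bp n t < x \<and> x < bp n s")
      case True
      have 1: "(1::real) \<in> {-1..1}" "(-1::real) \<in> {-1..1}" by auto
      have "bp n 1 \<le> bp n t" unfolding bp_le_iff(2)[OF bp(1)[OF t] 1(1)] bp(2)[OF t] using t by simp
      moreover have "bp n s \<le> bp n (-1)" unfolding bp_le_iff(1)[OF bp(1)[OF s] 1(2)] bp(2)[OF s] using s by simp
      ultimately have "x \<in> {bp n 1<..<bp n (-1)}" using True by simp
      hence "x \<in> band n" by (simp only: band_eq)
      from level_of_deriv[OF w this] show ?thesis by blast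
    qed auto
  qed
  then obtain D where D: "\<And>x. bp n t < x \<Longrightarrow> x < bp n s \<Longrightarrow> 1 \<le> D x"
    "\<And>x. bp n t < x \<Longrightarrow> x < bp n s \<Longrightarrow> ((\<lambda>x. level_of n ((-1) ^ n * g x)) has_real_derivative D x) (at x)" by blast
  have lt: "bp n t < bp n s" by (rule bp_less[OF s t st])
  have der: "((\<lambda>x. level_of n ((-1) ^ n * g x)) has_derivative times (D x)) (at x)" if "bp n t < x" "x < bp n s" for x
    using D(2)[OF that] by (simp only: has_field_derivative_def)
  obtain z where z: "bp n t < z" "z < bp n s"
    "level_of n ((-1) ^ n * g (bp n s)) - level_of n ((-1) ^ n * g (bp n t)) = D z * (bp n s - bp n t)"
    by (rule mvt[OF lt level_of_continuous[OF s t] der])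
  have "bp n s - bp n t = 1 * (bp n s - bp n t)" by (rule mult_1[symmetric])
  also have "\<dots> \<le> D z * (bp n s - bp n t)" using D(1)[OF z(1,2)] lt by (intro mult_right_mono) auto
  also have "\<dots> = level_of n s - level_of n t" using z(3) unfolding bp(2)[OF s] bp(2)[OF t] by (rule sym)
  finally show ?thesis .
qed

end

section \<open>Comparison with the free case and monotonicity in $a$\<close>

context band_function
begin

text \<open>For z = sqrt (x + i t), (Re z)^2 - (Im z)^2 = x and Im z = t/(2 Re z). The boundary
  value of Re z is positive, so Im z tends to 0 and x is the square of half the boundary value of
  2z.\<close>

lemma band_free_level:
  assumes w: "is_branch (\<lambda>l. 2 * csqrt l)" and x: "x \<in> band n"
  shows "level_of n ((-1) ^ n * g x) = x"
proof -
  let ?w = "\<lambda>l. 2 * csqrt l"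
  let ?b = "bv ?w x / 2"
  have gx: "\<bar>g x\<bar> < 1" using x by (simp add: band_def)
  have b: "bv ?w x = pi * n + arccos ((-1) ^ n * g x)" by (rule bv_eq_arccos[OF w x bv_band[OF w x]])
  have "0 \<le> pi * real n" by simp
  moreover have "pi * real n < bv ?w x" using bv_band[OF w x] by simp
  ultimately have pos: "0 < ?b" by linarith
  have "((\<lambda>t. Re (2 * csqrt (Complex x t))) \<longlongrightarrow> bv ?w x) (at_right 0)" by (rule band_point(2)[OF w gx])
  from tendsto_divide[OF this tendsto_const[of 2]]
  have R: "((\<lambda>t. Re (csqrt (Complex x t))) \<longlongrightarrow> ?b) (at_right 0)" by simp
  have lim: "((\<lambda>t. (Re (csqrt (Complex x t)))\<^sup>2 - (t / (2 * Re (csqrt (Complex x t))))\<^sup>2) \<longlongrightarrow> ?b\<^sup>2 - (0 / (2 * ?b))\<^sup>2) (at_right 0)"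
    using pos by (intro tendsto_intros R) auto
  have ev: "eventually (\<lambda>t. (Re (csqrt (Complex x t)))\<^sup>2 - (t / (2 * Re (csqrt (Complex x t))))\<^sup>2 = x) (at_right 0)"
    using eventually_at_right_less[of "0::real"]
  proof eventually_elim
    case (elim t)
    let ?z = "csqrt (Complex x t)"
    have ne: "2 * Re ?z \<noteq> 0" using csqrt_upper(1)[of "Complex x t"] elim by simp
    have "Re (?z * ?z) = x" "Im (?z * ?z) = t" by (simp_all flip: power2_eq_square)
    hence z: "(Re ?z)\<^sup>2 - (Im ?z)\<^sup>2 = x" "t = Im ?z * (2 * Re ?z)"
      by (simp_all add: power2_eq_square mult_ac)
    have "t / (2 * Re ?z) = Im ?z" by (rule iffD2[OF nonzero_divide_eq_eq[OF ne] z(2)])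
    thus ?case using z(1) by presburger
  qed
  have "((\<lambda>t. x) \<longlongrightarrow> ?b\<^sup>2 - (0 / (2 * ?b))\<^sup>2) (at_right (0::real))" by (rule Lim_transform_eventually[OF lim ev])
  hence "x = ?b\<^sup>2 - (0 / (2 * ?b))\<^sup>2" by (intro tendsto_unique[OF _ tendsto_const]) simp_all
  thus ?thesis by (simp add: level_of_def b[symmetric] power_divide)
qed

lemma bp_free:
  assumes w: "is_branch (\<lambda>l. 2 * csqrt l)" and s: "s \<in> {-1..1}"
  shows "bp n s = level_of n s"
proof -
  have 1: "(1::real) \<in> {-1..1}" "(-1::real) \<in> {-1..1}" by auto
  have lt: "bp n 1 < bp n (-1)" by (rule bp_less[OF 1(2,1)]) simp
  have cl: "closure (band n) = {bp n 1..bp n (-1)}" unfolding band_eq by (rule closure_greaterThanLessThan[OF lt])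
  have "bp n 1 \<le> bp n s" "bp n s \<le> bp n (-1)"
    unfolding bp_le_iff(2)[OF bp(1)[OF s] 1(1)] bp_le_iff(1)[OF bp(1)[OF s] 1(2)] bp(2)[OF s] using s by auto
  hence "bp n s \<in> closure (band n)" unfolding cl by simp
  hence "level_of n ((-1) ^ n * g (bp n s)) = bp n s"
    using continuous_constant_on_closure[of "band n" "\<lambda>x. level_of n ((-1) ^ n * g x) - x" 0 "bp n s"]
      continuous_on_diff[OF level_of_continuous[OF 1(2,1), of n, folded cl] continuous_on_id] band_free_level[OF w]
    by simp
  thus ?thesis unfolding bp(2)[OF s] by (rule sym)
qed

text \<open>All gaps are closed: (\<pi> n + \<pi>)^2/4 is the right end of one band and the left end
  of the next, and the critical point is squeezed between them.\<close>

lemma cs_free: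
  assumes w: "is_branch (\<lambda>l. 2 * csqrt l)"
  shows "cs n = bp n (-1)" "\<phi> (cs n) = (if even n then -5/4 else 1)"
proof -
  have "level_of (Suc n) 1 = level_of n (-1)"
    by (simp add: level_of_def distrib_left add.commute)
  hence "bp (Suc n) 1 = bp n (-1)" using bp_free[OF w, of 1 "Suc n"] bp_free[OF w, of "-1" n] by simp
  moreover have "bp n (-1) \<le> cs n" by (rule seg_le[OF bp(1)]) simp
  moreover have "cs n \<le> bp (Suc n) 1" by (rule seg_ge[OF bp(1)]) simp
  ultimately show c: "cs n = bp n (-1)" by simp
  have "(-1) ^ n * g (cs n) = -1" unfolding c by (rule bp(2)) simp
  thus "\<phi> (cs n) = (if even n then -5/4 else 1)" by (cases "even n") (simp_all add: g_def)
qed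

text \<open>The parameter of the k-th edge in the scale of \<open>bp\<close>. It depends on a and k
  alone, so corresponding edges for q and for 0 share it.\<close>

definition edge_level :: "real \<Rightarrow> nat \<Rightarrow> real" where
  "edge_level a k = (-1) ^ (k div 2) * ((8 * edge_value a k + 1) / 9)"

lemma edge_bp:
  assumes c: "0 < cos a"
  shows "edge a k = bp (k div 2) (edge_level a k)" "edge_level a k \<in> {-1..1}"
proof -
  have "edge_level a k = (-1) ^ (k div 2) * g (edge a k)" by (simp add: edge_level_def g_def edge[OF c])
  thus "edge a k = bp (k div 2) (edge_level a k)" using bp_eq[OF edge(1)[OF c]] by simp
  have "edge_value a k \<in> {-5/4..1}" using edge_value_range[OF c edge_sign_cases[of k]] by (simp add: edge_value_def)
  thus "edge_level a k \<in> {-1..1}" by (cases "even (k div 2)") (auto simp: edge_level_def)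
qed

text \<open>The weak Laguerre inequality includes the end level -5/4, one of the two levels from
  which the slopes at the edges are measured.\<close>

lemma logslope_nonincreasing:
  assumes f: "f \<in> {-5/4..1}" and uv: "u \<le> v" and ne: "\<And>t. u \<le> t \<Longrightarrow> t \<le> v \<Longrightarrow> \<phi> t \<noteq> f"
  shows "d\<phi> v / (\<phi> v - f) \<le> d\<phi> u / (\<phi> u - f)"
proof (rule DERIV_nonpos_imp_nonincreasing[OF uv])
  fix t assume t: "u \<le> t" "t \<le> v"
  have nz: "\<phi> t - f \<noteq> 0" using ne[OF t] by simp
  have d: "((\<lambda>t. \<phi> t - f) has_real_derivative d\<phi> t) (at t)" by (auto intro!: derivative_eq_intros \<phi>_deriv)
  have "((\<lambda>t. d\<phi> t / (\<phi> t - f)) has_real_derivative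
      (dd\<phi> t * (\<phi> t - f) - d\<phi> t * d\<phi> t) / ((\<phi> t - f) * (\<phi> t - f))) (at t)"
    by (rule DERIV_divide[OF \<phi>_deriv(2) d nz])
  moreover have "(dd\<phi> t * (\<phi> t - f) - d\<phi> t * d\<phi> t) / ((\<phi> t - f) * (\<phi> t - f)) \<le> 0"
    using laguerre(1)[OF f ne[OF t]] by (intro divide_nonpos_nonneg) (auto simp: power2_eq_square)
  ultimately show "\<exists>y. ((\<lambda>t. d\<phi> t / (\<phi> t - f)) has_real_derivative y) (at t) \<and> y \<le> 0" by blast
qed

section \<open>Monotonicity in a\<close>

context
  fixes a b :: real
  assumes cb: "0 < cos b" and cab: "cos b \<le> cos a" and ca: "cos a \<le> 1 / 2"
begin

text \<open>As c = cos a decreases below 1/2, c^2 + c - 1 falls and c^2 - c - 1 rises; the range of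
  values on a band shrinks from both sides, and by monotonicity of \<phi> so does the band.\<close>

lemma edge_nested: "edge a (2 * n) \<le> edge b (2 * n)" "edge b (2 * n + 1) \<le> edge a (2 * n + 1)"
proof -
  have c: "0 < cos a" using cb cab by simp
  have sq: "(cos b)\<^sup>2 \<le> (cos a)\<^sup>2" using cb cab by (intro power_mono) auto
  have "(cos a - cos b) * (cos a + cos b) \<le> (cos a - cos b) * 1" using cab ca by (intro mult_left_mono) auto
  hence l: "(cos a)\<^sup>2 - (cos b)\<^sup>2 \<le> cos a - cos b" by (simp add: power2_eq_square algebra_simps)
  have v: "edge_value x k = edge_sign k * cos x + (cos x)\<^sup>2 - 1" for x k by (simp add: edge_value_def sin_squared_eq)
  have "(-1) ^ n * \<phi> (edge b (2 * n)) \<le> (-1) ^ n * \<phi> (edge a (2 * n))"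
    unfolding edge(2)[OF c] edge(2)[OF cb] v edge_sign_simps by (cases "even n") (use sq l cab in simp_all)
  thus "edge a (2 * n) \<le> edge b (2 * n)"
    using seg_strict[of "edge b (2 * n)" n "edge a (2 * n)"] edge(1)[OF c, of "2 * n"] edge(1)[OF cb, of "2 * n"] by fastforce
  have "(-1) ^ n * \<phi> (edge a (2 * n + 1)) \<le> (-1) ^ n * \<phi> (edge b (2 * n + 1))"
    unfolding edge(2)[OF c] edge(2)[OF cb] v edge_sign_simps by (cases "even n") (use sq l cab in simp_all)
  thus "edge b (2 * n + 1) \<le> edge a (2 * n + 1)"
    using seg_strict[of "edge a (2 * n + 1)" n "edge b (2 * n + 1)"] edge(1)[OF c, of "2 * n + 1"] edge(1)[OF cb, of "2 * n + 1"] by fastforce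
qed

text \<open>For even n the argument is T/c + c with T >= 1/4, which decreases in c as long as c <=
  1/2; for odd n the numerator grows and the denominator falls as c falls.\<close>

lemma crit_height_arg_mono:
  "(-1) ^ Suc n * (\<phi> (cs n) + (sin a)\<^sup>2) / cos a \<le> (-1) ^ Suc n * (\<phi> (cs n) + (sin b)\<^sup>2) / cos b"
proof -
  have c: "0 < cos a" using cb cab by simp
  have s: "(sin x)\<^sup>2 = 1 - (cos x)\<^sup>2" for x :: real by (simp add: sin_squared_eq)
  show ?thesis
  proof (cases "even n")
    case True
    hence v: "\<phi> (cs n) \<le> -5/4" using cs_value[of n] by simp
    define T where "T = - \<phi> (cs n) - 1"
    have "cos a * cos b \<le> 1/2 * (1/2)" using cb cab ca c by (intro mult_mono) auto
    hence T: "cos a * cos b \<le> T" using v by (simp add: T_def)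
    have "(cos a - cos b) * (cos a * cos b) \<le> (cos a - cos b) * T" using cab by (intro mult_left_mono T) auto
    hence "(T + (cos a)\<^sup>2) * cos b \<le> (T + (cos b)\<^sup>2) * cos a" by (simp add: power2_eq_square algebra_simps)
    hence "(T + (cos a)\<^sup>2) / cos a \<le> (T + (cos b)\<^sup>2) / cos b" using c cb by (simp add: field_simps)
    moreover have "(-1) ^ Suc n * (\<phi> (cs n) + (sin x)\<^sup>2) = T + (cos x)\<^sup>2" for x
      using True by (simp add: T_def s)
    ultimately show ?thesis by simp
  next
    case False
    hence v: "1 \<le> \<phi> (cs n)" using cs_value[of n] by simp
    have "(cos b)\<^sup>2 \<le> (cos a)\<^sup>2" using cb cab by (intro power_mono) auto
    moreover have "(cos a)\<^sup>2 \<le> 1" "(cos b)\<^sup>2 \<le> 1" by (simp_all add: abs_square_le_1)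
    ultimately have "(\<phi> (cs n) + (sin a)\<^sup>2) / cos a \<le> (\<phi> (cs n) + (sin b)\<^sup>2) / cos b"
      using v cb cab c unfolding s by (intro frac_le) auto
    thus ?thesis using False by simp
  qed
qed

text \<open>The slope is |\<phi>'/(\<phi> - f)| times |\<phi> - f|. The first factor is monotone in
  the position of the edge, the second is a polynomial P in c = cos a, and P/c decreases on 0 < c <=
  1/2.\<close>

lemma edge_slope_mono: "\<bar>d\<phi> (edge a k)\<bar> / cos a \<le> \<bar>d\<phi> (edge b k)\<bar> / cos b"
proof -
  have c: "0 < cos a" using cb cab by simp
  let ?x = "edge a k" and ?y = "edge b k" and ?n = "k div 2"
  \<comment> \<open>The level beyond the opposite edge of the band: with it h is nonpositive at left
    edges and nonnegative at right ones, so that moving an edge into the band increases |h|. The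
    other level would reverse the signs.\<close>
  define f where "f = (if edge_sign k = 1 then -5/4 else 1 :: real)"
  define h where "h = (\<lambda>t. d\<phi> t / (\<phi> t - f))"
  have fr: "f \<in> {-5/4..1}" by (simp add: f_def)
  have xs: "?x \<in> seg ?n" "?y \<in> seg ?n" by (rule edge(1)[OF c] edge(1)[OF cb])+
  have v: "edge_value x k = edge_sign k * cos x + (cos x)\<^sup>2 - 1" for x by (simp add: edge_value_def sin_squared_eq)
  have p: "(if edge_sign k = 1 then \<phi> (edge x k) - f else f - \<phi> (edge x k)) =
      (if edge_sign k = 1 then (cos x + 1/2)\<^sup>2 else (2 - cos x) * (1 + cos x))" if "0 < cos x" for x :: real
    using edge_sign_cases[of k] unfolding edge(2)[OF that] v f_def
    by (auto simp: power2_eq_square algebra_simps)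
  define P where "P x = (if edge_sign k = 1 then (cos x + 1/2)\<^sup>2 else (2 - cos x) * (1 + cos x))" for x :: real
  have Ppos: "0 < P x" if "0 < cos x" for x
  proof -
    have "0 < (2 - cos x) * (1 + cos x)" using that cos_le_one[of x] by (intro mult_pos_pos; linarith)
    moreover have "0 < (cos x + 1/2)\<^sup>2" using that by (intro zero_less_power) auto
    ultimately show ?thesis by (simp add: P_def)
  qed
  have "0 < (if edge_sign k = 1 then \<phi> (edge x k) - f else f - \<phi> (edge x k))" if "0 < cos x" for x
    unfolding p[OF that] using Ppos[OF that] unfolding P_def .
  hence sP: "edge_sign k = 1 \<Longrightarrow> f < \<phi> (edge x k)" "edge_sign k \<noteq> 1 \<Longrightarrow> \<phi> (edge x k) < f" if "0 < cos x" for x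
    using that by force+
  have absP: "\<bar>\<phi> (edge x k) - f\<bar> = P x" if "0 < cos x" for x
    using p[OF that, folded P_def] sP[OF that] by (cases "edge_sign k = 1") simp_all
  have ne: "\<phi> t \<noteq> f" if t: "min ?x ?y \<le> t" "t \<le> max ?x ?y" for t
  proof -
    have "t \<in> seg ?n" using seg_convex[OF xs(1) xs(2), of t] seg_convex[OF xs(2) xs(1), of t] t by (auto simp: min_def max_def split: if_splits)
    hence mono: "u \<in> seg ?n \<Longrightarrow> t \<le> u \<Longrightarrow> (-1) ^ ?n * \<phi> u \<le> (-1) ^ ?n * \<phi> t"
      "u \<in> seg ?n \<Longrightarrow> u \<le> t \<Longrightarrow> (-1) ^ ?n * \<phi> t \<le> (-1) ^ ?n * \<phi> u" for u
      using seg_strict[of t ?n u] seg_strict[of u ?n t] by (cases "t = u"; simp)+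
    have "(\<phi> ?x \<le> \<phi> t \<or> \<phi> ?y \<le> \<phi> t) \<and> (\<phi> t \<le> \<phi> ?x \<or> \<phi> t \<le> \<phi> ?y)"
      using mono[OF xs(1)] mono[OF xs(2)] t by (cases "even ?n") (auto simp: min_def max_def split: if_splits)
    thus ?thesis using sP[OF c] sP[OF cb] by (cases "edge_sign k = 1") auto
  qed
  have "\<bar>h ?x\<bar> \<le> \<bar>h ?y\<bar>"
  proof (cases "even k")
    case True
    then obtain m where m: "k = 2 * m" by blast
    have le: "?x \<le> ?y" using edge_nested(1)[of m] m by simp
    have "h ?y \<le> h ?x" unfolding h_def
      by (rule logslope_nonincreasing[OF fr le]) (rule ne, use le in auto)
    moreover have "h ?x \<le> 0"
      using slope_nonpos[OF xs(1)] sP[OF c] edge_sign_simps(1)[of m] m unfolding h_def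
      by (cases "even m") (auto simp: divide_le_0_iff split: if_splits)
    ultimately show ?thesis by simp
  next
    case False
    then obtain m where m: "k = 2 * m + 1" by (elim oddE)
    have le: "?y \<le> ?x" using edge_nested(2)[of m] m by simp
    have "h ?x \<le> h ?y" unfolding h_def
      by (rule logslope_nonincreasing[OF fr le]) (rule ne, use le in auto)
    moreover have "0 \<le> h ?x"
      using slope_nonpos[OF xs(1)] sP[OF c] edge_sign_simps(2)[of m] m unfolding h_def
      by (cases "even m") (auto simp: zero_le_divide_iff split: if_splits)
    ultimately show ?thesis by simp
  qed
  hence A: "\<bar>d\<phi> ?x\<bar> / P a \<le> \<bar>d\<phi> ?y\<bar> / P b" by (simp add: h_def absP[OF c] absP[OF cb])
  \<comment> \<open>The two quotients are (c + 1/2)^2/c = c + 1 + 1/(4c) and (2 - c)(1 + c)/c = 2/c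
    + 1 - c.\<close>
  have B: "P a / cos a \<le> P b / cos b"
  proof -
    have q: "cos a * cos b \<le> 1/2 * (1/2)" using cb cab ca c by (intro mult_mono) auto
    have "(cos a - cos b) * (cos a * cos b) \<le> (cos a - cos b) * (1/4)" using cab q by (intro mult_left_mono) auto
    hence "(cos a + 1/2)\<^sup>2 * cos b \<le> (cos b + 1/2)\<^sup>2 * cos a" by (simp add: power2_eq_square algebra_simps)
    moreover have "0 \<le> (cos a - cos b) * (2 + cos a * cos b)" using cab c cb by (intro mult_nonneg_nonneg) auto
    hence "(2 - cos a) * (1 + cos a) * cos b \<le> (2 - cos b) * (1 + cos b) * cos a" by (simp add: algebra_simps)
    ultimately have "P a * cos b \<le> P b * cos a" by (simp add: P_def)
    thus ?thesis using c cb by (simp add: field_simps)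
  qed
  have "\<bar>d\<phi> ?x\<bar> / cos a = \<bar>d\<phi> ?x\<bar> / P a * (P a / cos a)" using Ppos[OF c] by simp
  also have "\<dots> \<le> \<bar>d\<phi> ?y\<bar> / P b * (P b / cos b)"
    using A B Ppos[OF c] Ppos[OF cb] c cb by (intro mult_mono) auto
  also have "\<dots> = \<bar>d\<phi> ?y\<bar> / cos b" using Ppos[OF cb] by simp
  finally show ?thesis .
qed

end

end

section \<open>Comparison with the free instance\<close>

text \<open>The assumption amounts to G = cos (2 sqrt \<lambda>) for \<Phi>0, which describes q = 0
  without mentioning a differential equation.\<close>

locale band_comparison = band_function \<Phi> + free: band_function \<Phi>0 for \<Phi> \<Phi>0 +
  assumes free_branch: "free.is_branch (\<lambda>l. 2 * csqrt l)"
begin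

lemma bp_diff_le_free:
  assumes "s \<in> {-1..1}" "t \<in> {-1..1}" "s < t"
  shows "bp n s - bp n t \<le> free.bp n s - free.bp n t"
  using bp_diff_le[OF assms] unfolding free.bp_free[OF free_branch assms(1)] free.bp_free[OF free_branch assms(2)]
    level_of_def free.level_of_def .

text \<open>A given drop of level takes at most the distance it takes in the free case. From points
  of equal level, a step h to the right therefore leads \<Phi> at least as far down as \<Phi>0, and
  the one-sided difference quotients compare the slopes.\<close>

lemma slope_le_free:
  assumes s: "s \<in> {-1..1}"
  shows "(-1) ^ n * d\<phi> (bp n s) \<le> (-1) ^ n * free.d\<phi> (free.bp n s)"
proof (cases "s = -1")
  case True
  \<comment> \<open>At the right end of the band no step to the right is available; the free slope
    is 0 there because the free gap is closed.\<close>
  have "free.d\<phi> (free.bp n s) = 0"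
    unfolding True free.cs_free(1)[OF free_branch, symmetric] by (rule free.cs_crit)
  thus ?thesis using slope_nonpos[OF bp(1)[OF s]] by simp
next
  case False
  let ?p = "bp n s" and ?fp = "free.bp n s" and ?e = "bp n (-1)"
  have m1: "(-1::real) \<in> {-1..1}" by simp
  have lt: "?p < ?e" by (rule bp_less[OF m1 s]) (use s False in auto)
  have le: "0 \<le> (-1) ^ n * (free.\<phi> (?fp + h) - \<phi> (?p + h))" if h: "0 < h" "h < ?e - ?p" for h
  proof -
    define t where "t = (-1) ^ n * g (?p + h)"
    have x: "?p + h \<in> seg n" by (rule seg_convex[OF bp(1)[OF s] bp(1)[OF m1]]) (use h in auto)
    have xt: "bp n t = ?p + h" unfolding t_def by (rule bp_eq[OF x])
    have "\<not> ?p + h \<le> ?p" "?p + h \<le> ?e" using h by auto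
    hence t: "t < s" "-1 \<le> t" unfolding bp_le_iff(1)[OF x s] bp_le_iff(1)[OF x m1] t_def by auto
    hence tr: "t \<in> {-1..1}" using s by auto
    have "?p + h - ?p \<le> free.bp n t - ?fp" using bp_diff_le_free[OF tr s t(1), of n] by (simp only: xt)
    hence h0: "?fp + h \<le> free.bp n t" by simp
    have x0: "?fp + h \<in> free.seg n" by (rule free.seg_convex[OF free.bp(1)[OF s] free.bp(1)[OF tr]]) (use h h0 in auto)
    have "(-1) ^ n * free.g (free.bp n t) \<le> (-1) ^ n * free.g (?fp + h)"
      using free.seg_strict_g[OF x0 free.bp(1)[OF tr]] h0 by (cases "?fp + h = free.bp n t") auto
    hence "t \<le> (-1) ^ n * free.g (?fp + h)" by (simp only: free.bp(2)[OF tr])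
    hence "(-1) ^ n * g (?p + h) \<le> (-1) ^ n * free.g (?fp + h)" by (simp only: t_def)
    thus ?thesis by (cases "even n") (simp_all add: g_def free.g_def)
  qed
  let ?f = "\<lambda>h. (-1) ^ n * (free.\<phi> (?fp + h) - \<phi> (?p + h))"
  have "((\<lambda>h. free.\<phi> (?fp + h)) has_real_derivative free.d\<phi> ?fp) (at 0)" "((\<lambda>h. \<phi> (?p + h)) has_real_derivative d\<phi> ?p) (at 0)"
    using free.\<phi>_deriv(1)[of ?fp] \<phi>_deriv(1)[of ?p] by (simp_all only: DERIV_shift add.commute) (simp_all add: DERIV_shift[of _ _ 0, simplified, symmetric] add.commute)
  hence d: "(?f has_real_derivative (-1) ^ n * (free.d\<phi> ?fp - d\<phi> ?p)) (at 0)"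
    by (intro DERIV_cmult DERIV_diff)
  have f0: "?f 0 = 0"
  proof -
    have "(-1) ^ n * free.g ?fp = (-1) ^ n * g ?p" unfolding bp(2)[OF s] free.bp(2)[OF s] by (rule refl)
    thus ?thesis by (cases "even n") (simp_all add: g_def free.g_def)
  qed
  have "0 \<le> (-1) ^ n * (free.d\<phi> ?fp - d\<phi> ?p)"
  proof (rule ccontr)
    assume "\<not> 0 \<le> (-1) ^ n * (free.d\<phi> ?fp - d\<phi> ?p)"
    hence "(-1) ^ n * (free.d\<phi> ?fp - d\<phi> ?p) < 0" by simp
    from DERIV_neg_dec_right[OF d this] obtain e where e: "e > 0" "\<And>h. 0 < h \<Longrightarrow> h < e \<Longrightarrow> ?f (0 + h) < ?f 0" by blast
    define h where "h = min e (?e - ?p) / 2"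
    have h: "0 < h" "h < e" "h < ?e - ?p" using e(1) lt by (auto simp: h_def)
    have "?f (0 + h) < 0" using e(2)[OF h(1,2)] unfolding f0 .
    thus False using le[OF h(1,3)] by simp
  qed
  thus ?thesis by (simp add: right_diff_distrib)
qed

lemma edge_slope_ge_free:
  assumes c: "0 < cos a"
  shows "\<bar>free.d\<phi> (free.edge a k)\<bar> \<le> \<bar>d\<phi> (edge a k)\<bar>"
proof -
  let ?n = "k div 2"
  have "(-1) ^ ?n * d\<phi> (edge a k) \<le> (-1) ^ ?n * free.d\<phi> (free.edge a k)"
    using slope_le_free[OF edge_bp(2)[OF c], of ?n k] by (simp only: edge_bp(1)[OF c] free.edge_bp(1)[OF c])
  moreover have "(-1) ^ ?n * free.d\<phi> (free.edge a k) \<le> 0" by (rule free.slope_nonpos[OF free.edge(1)[OF c]])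
  ultimately show ?thesis by (cases "even ?n") auto
qed

lemma edge_diff_le_free:
  assumes c: "0 < cos a"
  shows "edge a (2 * n + 1) - edge a (2 * n) \<le> free.edge a (2 * n + 1) - free.edge a (2 * n)"
proof -
  have "edge_level a (2 * n + 1) < edge_level a (2 * n)"
    using c by (cases "even n") (simp_all add: edge_level_def edge_value_def edge_sign_simps)
  from bp_diff_le_free[OF edge_bp(2)[OF c] edge_bp(2)[OF c] this, of n]
  show ?thesis by (simp add: edge_bp(1)[OF c] free.edge_bp(1)[OF c])
qed

lemma crit_height_arg_ge_free:
  assumes c: "0 < cos a"
  shows "(-1) ^ Suc n * (free.\<phi> (free.cs n) + (sin a)\<^sup>2) / cos a \<le> (-1) ^ Suc n * (\<phi> (cs n) + (sin a)\<^sup>2) / cos a"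
  using cs_value[of n] c unfolding free.cs_free(2)[OF free_branch]
  by (intro divide_right_mono) (auto split: if_splits)

end

section \<open>Effective masses\<close>

lemma upper_at_real_nontrivial: "at (complex_of_real x) within \<H> \<noteq> bot"
  using real_islimpt_upper[of x] by (simp only: trivial_limit_within not_False_eq_True) simp

text \<open>A global arccos k0 of \<xi> need not tend to \<pi> n at e. But sin ((k0 - \<pi> n)/2)
  tends to 0, its square being (1 - (-1)^n \<xi>)/2, and its Arcsin yields a local branch with the
  right limit. k0 differs from it by a sign and a multiple of 2 \<pi>, which are corrected
  globally.\<close>

lemma quasimomentum_exists:
  assumes hol: "xi q a holomorphic_on UNIV"
    and ne: "\<And>z. Im z > 0 \<Longrightarrow> xi q a z \<noteq> 1 \<and> xi q a z \<noteq> -1"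
    and val: "xi q a (of_real e) = (-1) ^ n"
  shows "\<exists>k. is_quasimomentum q a k \<and> (k \<longlongrightarrow> complex_of_real (pi * n)) (at (of_real e) within \<H>)"
proof -
  have contr: "contractible \<H>" by (rule convex_imp_contractible[OF convex_upper(1)])
  obtain k0 where k0: "k0 holomorphic_on \<H>" "\<And>z. Im z > 0 \<Longrightarrow> xi q a z = cos (k0 z)"
  proof (rule contractible_imp_holomorphic_arccos[OF holomorphic_on_subset[OF hol] contr])
    show "xi q a z \<noteq> 1 \<and> xi q a z \<noteq> -1" if "z \<in> \<H>" for z using ne[of z] that by simp
  qed auto
  define s where "s = (\<lambda>z. sin ((k0 z - of_real (pi * n)) / 2))"
  have cosn: "cos (of_real (pi * n)) = (-1 :: complex) ^ n" "sin (of_real (pi * n)) = (0 :: complex)"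
    by (simp_all only: cos_of_real sin_of_real mult.commute[of pi] cos_npi sin_npi) simp_all
  have sq: "(s z)\<^sup>2 = (1 - (-1) ^ n * xi q a z) / 2" if z: "Im z > 0" for z
  proof -
    have "cos (k0 z - of_real (pi * n)) = (-1) ^ n * xi q a z"
      unfolding cos_diff cosn k0(2)[OF z] by simp
    moreover have "cos (k0 z - of_real (pi * n)) = 1 - 2 * (s z)\<^sup>2"
    proof -
      have h: "2 * (u / 2) = u" for u :: complex by simp
      show ?thesis using cos_double_sin[of "(k0 z - of_real (pi * n)) / 2"] unfolding s_def h .
    qed
    ultimately show ?thesis by (simp add: field_simps)
  qed
  have xc: "(xi q a \<longlongrightarrow> (-1) ^ n) (at (of_real e) within \<H>)"
  proof -
    have "isCont (xi q a) (of_real e)"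
      using holomorphic_on_imp_continuous_on[OF hol] by (simp add: continuous_on_eq_continuous_at)
    hence "(xi q a \<longlongrightarrow> xi q a (of_real e)) (at (of_real e) within \<H>)"
      unfolding isCont_def by (rule tendsto_within_subset) simp
    thus ?thesis unfolding val .
  qed
  have sgn: "(-1::complex) ^ n * (-1) ^ n = 1" by (cases "even n") simp_all
  have "((\<lambda>z. (1 - (-1) ^ n * xi q a z) / 2) \<longlongrightarrow> (1 - (-1) ^ n * (-1) ^ n) / 2) (at (of_real e) within \<H>)"
    by (intro tendsto_intros xc) simp
  hence l2: "((\<lambda>z. (1 - (-1) ^ n * xi q a z) / 2) \<longlongrightarrow> 0) (at (of_real e) within \<H>)" unfolding sgn by simp
  have up: "eventually (\<lambda>z. Im z > 0) (at (complex_of_real e) within \<H>)"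
    unfolding eventually_at_filter by simp
  have "((\<lambda>z. (s z)\<^sup>2) \<longlongrightarrow> 0) (at (of_real e) within \<H>)"
    by (rule Lim_transform_eventually[OF l2]) (use up sq in \<open>auto elim!: eventually_mono\<close>)
  hence "((\<lambda>z. sqrt (norm ((s z)\<^sup>2))) \<longlongrightarrow> sqrt (norm (0::complex))) (at (of_real e) within \<H>)"
    by (intro tendsto_intros)
  hence "((\<lambda>z. norm (s z)) \<longlongrightarrow> 0) (at (of_real e) within \<H>)" by (simp add: norm_power)
  hence s0: "(s \<longlongrightarrow> 0) (at (of_real e) within \<H>)" by (rule tendsto_norm_zero_cancel)
  have "eventually (\<lambda>z. dist (s z) 0 < 1) (at (of_real e) within \<H>)" by (rule tendstoD[OF s0]) simp
  then obtain r where r: "r > 0" "\<And>z. Im z > 0 \<Longrightarrow> dist z (of_real e) < r \<Longrightarrow> norm (s z) < 1"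
    unfolding eventually_at by force
  let ?D = "ball (complex_of_real e) r \<inter> \<H>"
  define A where "A = (\<lambda>z. of_real (pi * n) + 2 * Arcsin (s z))"
  have D: "Im z > 0" "norm (s z) < 1" if "z \<in> ?D" for z
    using that r(2)[of z] by (auto simp: dist_commute)
  have Ac: "isCont Arcsin (s z)" if "z \<in> ?D" for z
  proof (rule isCont_Arcsin)
    have "\<bar>Re (s z)\<bar> < 1" using D(2)[OF that] abs_Re_le_cmod[of "s z"] by simp
    thus "Im (s z) = 0 \<Longrightarrow> \<bar>Re (s z)\<bar> < 1" .
  qed
  have kc: "continuous_on ?D k0" by (rule continuous_on_subset[OF holomorphic_on_imp_continuous_on[OF k0(1)]]) simp
  have sc: "continuous_on ?D s" unfolding s_def by (intro continuous_intros kc) simp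
  have AA: "continuous_on ?D A"
  proof -
    have "continuous_on ?D (\<lambda>z. Arcsin (s z))"
      by (rule continuous_on_compose2[where t = "s ` ?D", OF _ sc])
         (use Ac in \<open>auto intro!: continuous_at_imp_continuous_on\<close>)
    thus ?thesis unfolding A_def by (intro continuous_intros)
  qed
  have conn: "connected ?D" by (intro convex_connected convex_Int convex_ball convex_upper)
  have cosA: "cos (A z) = xi q a z" if z: "z \<in> ?D" for z
  proof -
    have "cos (2 * Arcsin (s z)) = 1 - 2 * (s z)\<^sup>2" by (simp add: cos_double_sin)
    also have "\<dots> = (-1) ^ n * xi q a z" by (simp add: sq D[OF z] field_simps)
    finally have "cos (A z) = ((-1) ^ n * (-1) ^ n) * xi q a z" unfolding A_def cos_add cosn by simp
    thus ?thesis unfolding sgn by simp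
  qed
  obtain \<sigma> :: complex and m :: int where \<sigma>: "\<sigma> = 1 \<or> \<sigma> = -1"
    and kA: "\<And>z. z \<in> ?D \<Longrightarrow> k0 z = \<sigma> * A z + of_real (2 * pi * m)"
  proof (rule cos_branch_unique[OF conn kc AA])
    show "cos (k0 z) = cos (A z)" if "z \<in> ?D" for z using k0(2)[OF D(1)[OF that]] cosA[OF that] by simp
    show "cos (A z) \<noteq> 1 \<and> cos (A z) \<noteq> -1" if "z \<in> ?D" for z using ne[OF D(1)[OF that]] cosA[OF that] by simp
  qed blast
  define k where "k = (\<lambda>z. \<sigma> * (k0 z - of_real (2 * pi * m)))"
  have \<sigma>2: "\<sigma> * \<sigma> = 1" using \<sigma> by auto
  have ss: "cos (\<sigma> * u) = cos u" for u using \<sigma> by auto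
  have cm: "cos (u - of_real (2 * pi * m)) = cos u" for u :: complex
  proof -
    have "cos (of_real (2 * pi * m)) = (1::complex)" "sin (of_real (2 * pi * m)) = (0::complex)"
      using cos_int_2pin[of m] sin_int_2pin[of m] by (simp_all only: cos_of_real sin_of_real) simp_all
    thus ?thesis by (simp add: cos_diff)
  qed
  have "is_quasimomentum q a k"
    unfolding is_quasimomentum_def k_def
  proof (intro conjI ballI)
    show "(\<lambda>z. \<sigma> * (k0 z - of_real (2 * pi * m))) holomorphic_on \<H>" by (intro holomorphic_intros k0(1))
    show "xi q a z = cos (\<sigma> * (k0 z - of_real (2 * pi * m)))" if "z \<in> \<H>" for z
      unfolding ss cm using k0(2)[of z] that by simp
  qed
  moreover have "(k \<longlongrightarrow> of_real (pi * n)) (at (of_real e) within \<H>)"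
  proof -
    have "isCont Arcsin 0" by (rule isCont_Arcsin) simp
    from isCont_tendsto_compose[OF this s0]
    have "(A \<longlongrightarrow> of_real (pi * n) + 2 * Arcsin 0) (at (of_real e) within \<H>)"
      unfolding A_def by (intro tendsto_intros)
    hence lim: "(A \<longlongrightarrow> of_real (pi * n)) (at (of_real e) within \<H>)" by simp
    have "eventually (\<lambda>z. A z = k z) (at (of_real e) within \<H>)"
      unfolding eventually_at
    proof (intro exI conjI ballI impI)
      fix z assume z: "z \<in> \<H>" "z \<noteq> of_real e \<and> dist z (of_real e) < r"
      hence "z \<in> ?D" by (simp add: dist_commute)
      from kA[OF this] have "k z = \<sigma> * \<sigma> * A z" by (simp add: k_def)
      thus "A z = k z" by (simp add: \<sigma>2)
    qed (rule r(1))
    from Lim_transform_eventually[OF lim this] show ?thesis .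
  qed
  ultimately show ?thesis by blast
qed

lemma cos_quotient_limit: "((\<lambda>v::complex. (cos v - 1) / v\<^sup>2) \<longlongrightarrow> - 1 / 2) (at 0)"
proof -
  have d: "(sin has_field_derivative 1) (at (0::complex))" using DERIV_sin[of "0::complex"] by simp
  hence s: "((\<lambda>v::complex. sin v / v) \<longlongrightarrow> 1) (at 0)" by (simp add: has_field_derivative_iff)
  have "filterlim (\<lambda>v::complex. v / 2) (at 0) (at 0)"
    unfolding filterlim_at
  proof
    show "eventually (\<lambda>v::complex. v / 2 \<in> UNIV \<and> v / 2 \<noteq> 0) (at 0)" by (simp add: eventually_at_filter)
    have "((\<lambda>v::complex. v / 2) \<longlongrightarrow> 0 / 2) (at 0)" by (intro tendsto_intros) simp
    thus "((\<lambda>v::complex. v / 2) \<longlongrightarrow> 0) (at 0)" by simp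
  qed
  from filterlim_compose[OF s this] have "((\<lambda>v::complex. sin (v / 2) / (v / 2)) \<longlongrightarrow> 1) (at 0)" .
  hence "((\<lambda>v::complex. - (1/2) * (sin (v / 2) / (v / 2))\<^sup>2) \<longlongrightarrow> - (1/2) * 1\<^sup>2) (at 0)" by (intro tendsto_intros)
  hence l: "((\<lambda>v::complex. - (1/2) * (sin (v / 2) / (v / 2))\<^sup>2) \<longlongrightarrow> - 1 / 2) (at 0)" by simp
  have "- (1/2) * (sin (v / 2) / (v / 2))\<^sup>2 = (cos v - 1) / v\<^sup>2" for v :: complex
    using cos_double_sin[of "v / 2"] by (simp add: power_divide)
  with l show ?thesis by simp
qed

text \<open>With v = k - \<pi> n, (-1)^n \<xi> = cos v is 1 - v^2/2 to second order, while \<xi> has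
  slope d at e. So v^2/(\<lambda> - e) tends to -2 (-1)^n d for every admissible branch, which
  determines the mass.\<close>

lemma is_effective_mass_iff:
  assumes hol: "xi q a holomorphic_on UNIV"
    and ne: "\<And>z. Im z > 0 \<Longrightarrow> xi q a z \<noteq> 1 \<and> xi q a z \<noteq> -1"
    and val: "xi q a (of_real e) = (-1) ^ n"
    and der: "(xi q a has_field_derivative complex_of_real d) (at (of_real e))" and d: "d \<noteq> 0"
  shows "is_effective_mass q a n e \<mu> \<longleftrightarrow> \<mu> = - ((-1) ^ n * d)"
proof -
  let ?U = "at (complex_of_real e) within \<H>"
  define M where "M = - ((-1) ^ n * d)"
  have M: "M \<noteq> 0" using d by (simp add: M_def)
  have sgn: "(-1::complex) ^ n * (-1) ^ n = 1" by (cases "even n") simp_all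
  have cosn: "cos (of_real (pi * n)) = (-1 :: complex) ^ n" "sin (of_real (pi * n)) = (0 :: complex)"
    by (simp_all only: cos_of_real sin_of_real mult.commute[of pi] cos_npi sin_npi) simp_all
  have up: "eventually (\<lambda>z. Im z > 0) ?U" unfolding eventually_at_filter by simp
  have ne': "(-1) ^ n * xi q a z \<noteq> 1" if "Im z > 0" for z
  proof
    assume h: "(-1) ^ n * xi q a z = 1"
    have "xi q a z = (-1) ^ n * ((-1) ^ n * xi q a z)" by (simp only: mult.assoc[symmetric] sgn mult_1)
    hence "xi q a z = (-1) ^ n" by (simp only: h mult_1_right)
    thus False using ne[OF that] by (cases "even n") simp_all
  qed
  have main: "(\<lambda>l. l - of_real e) \<sim>[?U] (\<lambda>l. (k l - of_real (pi * n))\<^sup>2 / of_real (2 * \<mu>)) \<longleftrightarrow> \<mu> = M"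
    if k: "is_quasimomentum q a k" and lim: "(k \<longlongrightarrow> of_real (pi * n)) ?U" for k
  proof -
    define v where "v = (\<lambda>z. k z - of_real (pi * n))"
    have cosv: "cos (v z) = (-1) ^ n * xi q a z" if "Im z > 0" for z
      using k that unfolding is_quasimomentum_def v_def cos_diff cosn by simp
    have v0: "(v \<longlongrightarrow> 0) ?U" using tendsto_diff[OF lim tendsto_const[of "of_real (pi * n)"]] by (simp add: v_def)
    have vn: "v z \<noteq> 0" if "Im z > 0" for z
    proof
      assume "v z = 0"
      hence "(-1) ^ n * xi q a z = 1" using cosv[OF that] by simp
      thus False using ne'[OF that] by simp
    qed
    have "filterlim v (at 0) ?U"
      unfolding filterlim_at using v0 up vn by (auto elim!: eventually_mono)
    from filterlim_compose[OF cos_quotient_limit this]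
    have q1: "((\<lambda>z. (cos (v z) - 1) / (v z)\<^sup>2) \<longlongrightarrow> - 1 / 2) ?U" .
    have "((\<lambda>z. (xi q a z - xi q a (of_real e)) / (z - of_real e)) \<longlongrightarrow> of_real d) (at (of_real e))"
      using der by (simp add: has_field_derivative_iff)
    hence q2: "((\<lambda>z. (xi q a z - xi q a (of_real e)) / (z - of_real e)) \<longlongrightarrow> of_real d) ?U"
      by (rule tendsto_within_subset) simp
    have lim1: "((\<lambda>z. (-1) ^ n * ((xi q a z - xi q a (of_real e)) / (z - of_real e)) / ((cos (v z) - 1) / (v z)\<^sup>2))
        \<longlongrightarrow> (-1) ^ n * of_real d / (- 1 / 2)) ?U"
      by (intro tendsto_intros q1 q2) simp
    have ev: "eventually (\<lambda>z. (-1) ^ n * ((xi q a z - xi q a (of_real e)) / (z - of_real e)) / ((cos (v z) - 1) / (v z)\<^sup>2)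
        = (v z)\<^sup>2 / (z - of_real e)) ?U"
      using up
    proof eventually_elim
      case (elim z)
      have "(-1) ^ n * (xi q a z - xi q a (of_real e)) = cos (v z) - 1"
        unfolding cosv[OF elim] val right_diff_distrib sgn by simp
      moreover have "cos (v z) - 1 \<noteq> 0"
        unfolding cosv[OF elim] using ne'[OF elim] by simp
      ultimately show ?case by (simp add: divide_simps)
    qed
    have 2: "((\<lambda>z. (v z)\<^sup>2 / (z - of_real e)) \<longlongrightarrow> of_real (2 * M)) ?U"
      using Lim_transform_eventually[OF lim1 ev] by (simp add: M_def mult_ac)
    have 3: "((\<lambda>z. ((v z)\<^sup>2 / of_real (2 * \<mu>)) / (z - of_real e)) \<longlongrightarrow> of_real (M / \<mu>)) ?U"
    proof -
      have "((\<lambda>z. (v z)\<^sup>2 / (z - of_real e) * inverse (of_real (2 * \<mu>))) \<longlongrightarrow>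
          of_real (2 * M) * inverse (of_real (2 * \<mu>))) ?U" by (intro tendsto_mult 2 tendsto_const)
      moreover have "w / x * inverse c = w / c / x" for w x c :: complex by (simp add: divide_inverse)
      moreover have "complex_of_real (2 * M) * inverse (of_real (2 * \<mu>)) = of_real (2 * M * inverse (2 * \<mu>))"
        by (simp only: of_real_mult of_real_inverse)
      \<comment> \<open>For \<mu> = 0 both sides are 0 by the convention for division by zero; the
        limit is then 0 and not 1, so this value is ruled out.\<close>
      moreover have "2 * M * inverse (2 * \<mu>) = M / \<mu>" by (cases "\<mu> = 0") (simp_all add: field_simps)
      ultimately show ?thesis by (simp only:)
    qed
    have nz: "eventually (\<lambda>z. z - of_real e \<noteq> 0) ?U" by (simp add: eventually_at_filter)
    have "(\<lambda>l. l - of_real e) \<sim>[?U] (\<lambda>l. (v l)\<^sup>2 / of_real (2 * \<mu>)) \<longleftrightarrow>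
        ((\<lambda>z. ((v z)\<^sup>2 / of_real (2 * \<mu>)) / (z - of_real e)) \<longlongrightarrow> 1) ?U"
    proof -
      have "(\<lambda>l. l - of_real e) \<sim>[?U] (\<lambda>l. (v l)\<^sup>2 / of_real (2 * \<mu>)) \<longleftrightarrow>
         (\<lambda>l. (v l)\<^sup>2 / of_real (2 * \<mu>)) \<sim>[?U] (\<lambda>l. l - of_real e)" by (rule asymp_equiv_sym)
      also have "\<dots> \<longleftrightarrow> ((\<lambda>z. ((v z)\<^sup>2 / of_real (2 * \<mu>)) / (z - of_real e)) \<longlongrightarrow> 1) ?U"
        unfolding asymp_equiv_def by (rule tendsto_cong) (use nz in \<open>auto elim!: eventually_mono\<close>)
      finally show ?thesis .
    qed
    also have "\<dots> \<longleftrightarrow> \<mu> = M"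
    proof
      assume "((\<lambda>z. ((v z)\<^sup>2 / of_real (2 * \<mu>)) / (z - of_real e)) \<longlongrightarrow> 1) ?U"
      from tendsto_unique[OF upper_at_real_nontrivial 3 this] have "complex_of_real (M / \<mu>) = of_real 1" by simp
      hence "M / \<mu> = 1" by (simp only: of_real_eq_iff)
      thus "\<mu> = M" by (cases "\<mu> = 0") simp_all
    next
      assume "\<mu> = M"
      thus "((\<lambda>z. ((v z)\<^sup>2 / of_real (2 * \<mu>)) / (z - of_real e)) \<longlongrightarrow> 1) ?U" using 3 M by simp
    qed
    finally show ?thesis by (simp only: v_def)
  qed
  obtain k where "is_quasimomentum q a k" "(k \<longlongrightarrow> of_real (pi * n)) ?U"
    using quasimomentum_exists[OF hol ne val] by blast
  thus ?thesis unfolding is_effective_mass_def M_def[symmetric] using main by blast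
qed

section \<open>The functions of a potential\<close>

lemma band_function_F:
  assumes "potential q"
  shows "band_function (F q)"
proof -
  interpret potential q by fact
  show ?thesis
  proof
    show "\<exists>C R. \<forall>z. R \<le> norm z \<longrightarrow> norm ((8 * F q (z\<^sup>2) + 1) / 9 - cos (2 * z)) \<le> C * exp (2 * \<bar>Im z\<bar>) / norm z"
      by (rule exI[of _ "12 * q_norm"], rule exI[of _ "2 * q_norm + 1"]) (use F_asymptotics in blast)
  qed (fact F_holomorphic F_cnj F_nonreal)+
qed

locale band_potential = band_function "F q" for q
begin

lemma xi_eq: "xi q a = \<xi> a"
  by (simp add: fun_eq_iff xi_def \<xi>_def)

text \<open>All complex zeros of F' are real, so the enumeration on the real line meets the
  requirement stated in the complex plane, and a strictly increasing enumeration is unique.\<close>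

lemma crit_eq: "crit q n = cs (n - 1)"
proof -
  have r: "range (\<lambda>k. complex_of_real (cs k)) = {z. deriv (F q) z = 0}"
  proof
    show "range (\<lambda>k. complex_of_real (cs k)) \<subseteq> {z. deriv (F q) z = 0}"
      by (auto simp: on_reals cs_crit)
    show "{z. deriv (F q) z = 0} \<subseteq> range (\<lambda>k. complex_of_real (cs k))"
    proof
      fix z assume "z \<in> {z. deriv (F q) z = 0}"
      hence z: "deriv (F q) z = 0" by simp
      hence zr: "z = of_real (Re z)" using crit_real[OF z] by (simp add: complex_eq_iff)
      have "deriv (F q) (of_real (Re z)) = 0" using z zr by simp
      hence "d\<phi> (Re z) = 0" by (simp add: on_reals)
      then obtain k where "Re z = cs k" by (rule crit_cases)
      thus "z \<in> range (\<lambda>k. complex_of_real (cs k))" using zr by (metis rangeI)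
    qed
  qed
  have "(THE c :: nat \<Rightarrow> real. strict_mono c \<and> range (\<lambda>k. complex_of_real (c k)) = {z. deriv (F q) z = 0}) = cs"
  proof (rule the_equality)
    show "strict_mono cs \<and> range (\<lambda>k. complex_of_real (cs k)) = {z. deriv (F q) z = 0}" using cs(1) r by simp
    fix c :: "nat \<Rightarrow> real"
    assume h: "strict_mono c \<and> range (\<lambda>k. complex_of_real (c k)) = {z. deriv (F q) z = 0}"
    hence "Re ` range (\<lambda>k. complex_of_real (c k)) = Re ` range (\<lambda>k. complex_of_real (cs k))" by (simp only: r)
    hence "range c = range cs" by (simp add: image_image)
    thus "c = cs" using h cs(1) by (intro strict_mono_nat_range_unique) auto
  qed
  thus ?thesis unfolding crit_def by simp
qed

context
  fixes a :: real
  assumes c: "0 < cos a"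
begin

lemma edge_sequence_eq: "edge_sequence q a = edge a"
  unfolding edge_sequence_def
proof (rule the_equality)
  show "is_edge_sequence q a (edge a)"
    unfolding is_edge_sequence_def xi_eq using edge_order[OF c] zorder_edge[OF c] by blast
  fix e assume "is_edge_sequence q a e"
  thus "e = edge a" unfolding is_edge_sequence_def xi_eq by (intro edge_sequence_unique[OF c]) auto
qed

lemma lam_plus_eq: "lam_plus q a n = edge a (2 * n)"
  by (simp add: lam_plus_def edge_sequence_eq)

lemma lam_minus_eq: "lam_minus q a (Suc n) = edge a (2 * n + 1)"
  by (simp add: lam_minus_def edge_sequence_eq)

lemma band_length_eq: "band_length q a (Suc n) = edge a (2 * n + 1) - edge a (2 * n)"
  by (simp only: band_length_def lam_plus_eq lam_minus_eq diff_Suc_1)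

lemma height_eq: "height q a (Suc n) = arcosh ((-1) ^ Suc n * (\<phi> (cs n) + (sin a)\<^sup>2) / cos a)"
  unfolding height_def crit_eq xi_eq diff_Suc_1 crit_height_unique[OF c] crit_height_def[OF c] ..

lemma xi_deriv: "(xi q a has_field_derivative of_real (d\<phi> x / cos a)) (at (of_real x))"
  using \<xi>_deriv[of a "of_real x"] by (simp add: xi_eq on_reals)

lemma xi_ne_pm1:
  assumes "Im z > 0"
  shows "xi q a z \<noteq> 1 \<and> xi q a z \<noteq> -1"
proof -
  have "xi q a z \<noteq> of_real \<sigma>" if \<sigma>: "\<sigma> = 1 \<or> \<sigma> = -1" for \<sigma> :: real
  proof
    assume "xi q a z = of_real \<sigma>"
    hence "F q z = of_real (\<sigma> * cos a - (sin a)\<^sup>2)" using c by (simp add: xi_def field_simps)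
    thus False using nonreal[OF _ edge_value_range[OF c \<sigma>]] assms by auto
  qed
  from this[of 1] this[of "-1"] show ?thesis by simp
qed

lemma the_effective_mass:
  assumes k: "edge_sign k = (-1) ^ n" and d: "d\<phi> (edge a k) \<noteq> 0"
  shows "\<bar>THE \<mu>. is_effective_mass q a n (edge a k) \<mu>\<bar> = \<bar>d\<phi> (edge a k)\<bar> / cos a"
proof -
  have "is_effective_mass q a n (edge a k) \<mu> \<longleftrightarrow> \<mu> = - ((-1) ^ n * (d\<phi> (edge a k) / cos a))" for \<mu>
  proof (rule is_effective_mass_iff[OF _ xi_ne_pm1 _ xi_deriv])
    show "xi q a holomorphic_on UNIV" unfolding xi_eq by (rule \<xi>_hol)
    show "xi q a (of_real (edge a k)) = (-1) ^ n" unfolding xi_eq \<xi>_edge[OF c] k by simp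
  qed (use c d in auto)
  thus ?thesis using c by (simp add: abs_mult)
qed

text \<open>An edge with zero slope is a critical point and hence occurs twice in the sequence of
  edges: the adjacent gap is closed.\<close>

lemma crit_edge:
  assumes "d\<phi> (edge a k) = 0"
  obtains m where "k = 2 * m + 1 \<or> k = 2 * m + 2" "edge a (2 * m + 1) = edge a (2 * m + 2)"
proof -
  obtain m where m: "edge a k = cs m" using assms by (rule crit_cases)
  have "\<phi> (cs m) = edge_sign k * cos a - (sin a)\<^sup>2"
    using edge(2)[OF c, of k] by (simp add: m edge_value_def)
  from edge_set_crit[OF c this edge_sign_cases]
  have s: "{k. edge a k = cs m} = {2 * m + 1, 2 * m + 2}" .
  have "k \<in> {k. edge a k = cs m}" using m by simp
  hence 1: "k = 2 * m + 1 \<or> k = 2 * m + 2" unfolding s by simp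
  have "2 * m + 1 \<in> {k. edge a k = cs m}" "2 * m + 2 \<in> {k. edge a k = cs m}" unfolding s by simp_all
  hence "edge a (2 * m + 1) = edge a (2 * m + 2)" by simp
  with 1 show thesis by (rule that)
qed

lemma edge_eq_imp_crit: "edge a (2 * m + 1) = edge a (2 * m + 2) \<Longrightarrow> d\<phi> (edge a (2 * m + 1)) = 0 \<and> d\<phi> (edge a (2 * m + 2)) = 0"
  using edge_le_crit[OF c, of m] cs_crit[of m] by (metis order_antisym)

lemma gap_empty_iff: "gap q a (Suc m) = {} \<longleftrightarrow> edge a (2 * m + 1) = edge a (2 * m + 2)"
proof -
  have "gap q a (Suc m) = {edge a (2 * m + 1)<..<edge a (2 * m + 2)}"
    by (simp add: gap_def lam_plus_eq lam_minus_eq)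
  thus ?thesis using edge_order[OF c, of m] by auto
qed

text \<open>Closed gaps are covered as well: there the mass is 0 by definition and the slope
  vanishes.\<close>

lemma mass_minus_abs: "\<bar>mass_minus q a (Suc m)\<bar> = \<bar>d\<phi> (edge a (2 * m + 1))\<bar> / cos a"
proof (cases "gap q a (Suc m) = {}")
  case True
  thus ?thesis using edge_eq_imp_crit[of m] by (simp add: mass_minus_def gap_empty_iff)
next
  case False
  have "d\<phi> (edge a (2 * m + 1)) \<noteq> 0"
  proof
    assume "d\<phi> (edge a (2 * m + 1)) = 0"
    then obtain m' where "2 * m + 1 = 2 * m' + 1 \<or> 2 * m + 1 = 2 * m' + 2" "edge a (2 * m' + 1) = edge a (2 * m' + 2)"
      by (rule crit_edge)
    moreover from this(1) have "m' = m" by presburger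
    ultimately show False using False by (simp add: gap_empty_iff)
  qed
  from the_effective_mass[OF _ this, of "Suc m"] False show ?thesis
    by (simp add: mass_minus_def lam_minus_eq edge_sign_simps)
qed

text \<open>For n = 0 no gap is involved; the slope at \<lambda>_0^+ cannot vanish, since edges with
  zero slope have positive index.\<close>

lemma mass_plus_abs: "\<bar>mass_plus q a n\<bar> = \<bar>d\<phi> (edge a (2 * n))\<bar> / cos a"
proof (cases "n \<ge> 1 \<and> gap q a n = {}")
  case True
  then obtain m where m: "n = Suc m" by (cases n) auto
  thus ?thesis using True edge_eq_imp_crit[of m] by (simp add: mass_plus_def gap_empty_iff)
next
  case False
  have "d\<phi> (edge a (2 * n)) \<noteq> 0"
  proof
    assume "d\<phi> (edge a (2 * n)) = 0"
    then obtain m where k: "2 * n = 2 * m + 1 \<or> 2 * n = 2 * m + 2" and e: "edge a (2 * m + 1) = edge a (2 * m + 2)"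
      by (rule crit_edge)
    from k have "n = Suc m" by presburger
    thus False using False e by (simp add: gap_empty_iff)
  qed
  from the_effective_mass[OF _ this, of n] False show ?thesis
    by (auto simp: mass_plus_def lam_plus_eq edge_sign_simps)
qed

end

end

lemma free_branch: "band_function.is_branch (F (\<lambda>_. 0)) (\<lambda>l. 2 * csqrt l)"
proof -
  interpret free: band_function "F (\<lambda>_. 0)" by (rule band_function_F[OF potential_zero])
  show ?thesis
    unfolding free.is_branch_def
  proof (intro conjI allI impI)
    show "(\<lambda>l. 2 * csqrt l) holomorphic_on \<H>" by (intro holomorphic_intros csqrt_holomorphic_upper)
    fix l :: complex assume l: "Im l > 0"
    show "Im (2 * csqrt l) > 0" using csqrt_upper(2)[OF l] by simp
    have "F (\<lambda>_. 0) ((csqrt l)\<^sup>2) = (9 * cos (2 * csqrt l) - 1) / 8" by (rule F_zero_potential)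
    thus "cos (2 * csqrt l) = free.G l" by (simp add: free.G_def field_simps)
  next
    fix \<epsilon> :: real assume "\<epsilon> > 0"
    thus "\<exists>M. \<forall>l. Im l > 0 \<and> M \<le> Im (csqrt l) \<longrightarrow> norm (2 * csqrt l - 2 * csqrt l) \<le> \<epsilon>" by auto
  qed
qed

theorem theorem1p3:
  fixes q :: "real \<Rightarrow> real" and a :: real and n :: nat
  assumes "L2_potential q" and "0 \<le> a" and "a < pi / 2"
  shows
    "\<bar>mass_plus (\<lambda>_. 0) a n\<bar> \<le> \<bar>mass_plus q a n\<bar> \<and>
     (n \<ge> 1 \<longrightarrow>
        height (\<lambda>_. 0) a n \<le> height q a n \<and>
        \<bar>mass_minus (\<lambda>_. 0) a n\<bar> \<le> \<bar>mass_minus q a n\<bar> \<and>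
        band_length (\<lambda>_. 0) a n \<ge> band_length q a n) \<and>
     (\<forall>a1. pi / 3 \<le> a \<and> a \<le> a1 \<and> a1 < pi / 2 \<longrightarrow>
        \<bar>mass_plus q a n\<bar> \<le> \<bar>mass_plus q a1 n\<bar> \<and>
        (n \<ge> 1 \<longrightarrow>
           height q a n \<le> height q a1 n \<and>
           \<bar>mass_minus q a n\<bar> \<le> \<bar>mass_minus q a1 n\<bar> \<and>
           band_length (\<lambda>_. 0) a n \<ge> band_length q a1 n))"
proof -
  have q: "band_function (F q)"
    by (intro band_function_F potential.intro L2_potential_absolutely_integrable assms)
  interpret b: band_potential q by (rule band_potential.intro[OF q])
  interpret z: band_potential "\<lambda>_. 0" by (rule band_potential.intro[OF band_function_F[OF potential_zero]])
  interpret cmp: band_comparison "F q" "F (\<lambda>_. 0)"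
    by unfold_locales (rule free_branch)
  have c: "0 < cos a" using assms(2,3) by (intro cos_gt_zero_pi) auto
  have am: "arcosh x \<le> arcosh y" if "1 \<le> x" "x \<le> y" for x y :: real
    using that arcosh_less_iff_real[of x y] by (cases "x = y") (auto intro: less_imp_le)
  have 1: "\<bar>mass_plus (\<lambda>_. 0) a n\<bar> \<le> \<bar>mass_plus q a n\<bar>"
    unfolding b.mass_plus_abs[OF c] z.mass_plus_abs[OF c]
    using cmp.edge_slope_ge_free[OF c] c by (intro divide_right_mono) auto
  have 2: "height (\<lambda>_. 0) a n \<le> height q a n \<and> \<bar>mass_minus (\<lambda>_. 0) a n\<bar> \<le> \<bar>mass_minus q a n\<bar> \<and>
      band_length q a n \<le> band_length (\<lambda>_. 0) a n" if "n \<ge> 1"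
  proof -
    obtain m where m: "n = Suc m" using \<open>n \<ge> 1\<close> by (cases n) auto
    have "height (\<lambda>_. 0) a n \<le> height q a n"
      unfolding m b.height_eq[OF c] z.height_eq[OF c]
      by (rule am[OF z.crit_height_arg[OF c] cmp.crit_height_arg_ge_free[OF c]])
    moreover have "\<bar>mass_minus (\<lambda>_. 0) a n\<bar> \<le> \<bar>mass_minus q a n\<bar>"
      unfolding m b.mass_minus_abs[OF c] z.mass_minus_abs[OF c]
      using cmp.edge_slope_ge_free[OF c] c by (intro divide_right_mono) auto
    moreover have "band_length q a n \<le> band_length (\<lambda>_. 0) a n"
      unfolding m b.band_length_eq[OF c] z.band_length_eq[OF c] by (rule cmp.edge_diff_le_free[OF c])
    ultimately show ?thesis by blast
  qed
  have 3: "\<bar>mass_plus q a n\<bar> \<le> \<bar>mass_plus q a1 n\<bar> \<and>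
      (n \<ge> 1 \<longrightarrow> height q a n \<le> height q a1 n \<and> \<bar>mass_minus q a n\<bar> \<le> \<bar>mass_minus q a1 n\<bar> \<and>
         band_length q a1 n \<le> band_length (\<lambda>_. 0) a n)"
    if a1: "pi / 3 \<le> a" "a \<le> a1" "a1 < pi / 2" for a1
  proof -
    have c1: "0 < cos a1" using a1 assms(2) by (intro cos_gt_zero_pi) auto
    have le: "cos a1 \<le> cos a" using a1 assms(2) by (intro cos_monotone_0_pi_le) auto
    have "cos a \<le> cos (pi / 3)" using a1 by (intro cos_monotone_0_pi_le) auto
    hence half: "cos a \<le> 1 / 2" by (simp add: cos_60)
    note h = c1 le half
    have "\<bar>mass_plus q a n\<bar> \<le> \<bar>mass_plus q a1 n\<bar>"
      unfolding b.mass_plus_abs[OF c] b.mass_plus_abs[OF c1] by (rule b.edge_slope_mono[OF h])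
    moreover have "height q a n \<le> height q a1 n \<and> \<bar>mass_minus q a n\<bar> \<le> \<bar>mass_minus q a1 n\<bar> \<and>
         band_length q a1 n \<le> band_length (\<lambda>_. 0) a n" if n1: "n \<ge> 1"
    proof -
      obtain m where m: "n = Suc m" using n1 by (cases n) auto
      have "height q a n \<le> height q a1 n"
        unfolding m b.height_eq[OF c] b.height_eq[OF c1]
        by (rule am[OF b.crit_height_arg[OF c] b.crit_height_arg_mono[OF h]])
      moreover have "\<bar>mass_minus q a n\<bar> \<le> \<bar>mass_minus q a1 n\<bar>"
        unfolding m b.mass_minus_abs[OF c] b.mass_minus_abs[OF c1] by (rule b.edge_slope_mono[OF h])
      moreover have "band_length q a1 n \<le> band_length q a n"
        unfolding m b.band_length_eq[OF c] b.band_length_eq[OF c1] using b.edge_nested[OF h, of m] by linarith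
      \<comment> \<open>The band for \<open>a1\<close> is compared with the free band for
        \<open>a\<close> through the band of \<open>q\<close> for the same \<open>a\<close>.\<close>
      moreover have "band_length q a n \<le> band_length (\<lambda>_. 0) a n" using 2[OF n1] by blast
      ultimately show ?thesis by linarith
    qed
    ultimately show ?thesis by blast
  qed
  from 1 2 3 show ?thesis by blast
qed

end
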